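(* Let $n\geq 2$ be an integer and fix $\lambda\in\mathbb{C}^n$. Let $\mathcal{C}_{\lambda,n}$ be the category of Harish-Chandra $U(\mathfrak{s}_n)_{X_n}$-modules $M$ such that $M=0$ or $\mathrm{Supp}(M)=\lambda+\mathbb{Z}^n$. Then $\mathcal{C}_{\lambda,n}$ is equivalent to the category $\mathcal{A}_{n-1}$ of finite dimensional $\mathfrak{s}_{n-1}$-modules.
   Context: All vector spaces and algebras are over $\mathbb{C}$; $\mathbb{Z}_+$ is the set of nonnegative integers; $U(\mathfrak{g})$ is the universal enveloping algebra of a Lie algebra $\mathfrak{g}$. For $n\ge 1$, $\mathfrak{s}_n=\mathfrak{gl}_n\ltimes\mathbb{C}^n$ is the semidirect product of $\mathfrak{gl}_n$ (with basis the matrix units $e_{ij}$, $1\le i,j\le n$) and its natural representation $\mathbb{C}^n$ (with standard basis $e_1,\dots,e_n$), so that $[e_{ij},e_{kl}]=\delta_{jk}e_{il}-\delta_{li}e_{kj}$, $[e_{ij},e_k]=\delta_{jk}e_i$, $[e_i,e_j]=0$. The set $X_n=\{e_1^{i_1}\cdots e_n^{i_n}\mid i_1,\dots,i_n\in\mathbb{Z}_+\}$ is an Ore subset of $U(\mathfrak{s}_n)$, and $U(\mathfrak{s}_n)_{X_n}$ is the localization of $U(\mathfrak{s}_n)$ with respect to $X_n$. Let $\mathfrak{h}_n=\bigoplus_{i=1}^n\mathbb{C}e_{ii}$; a weight $\lambda\in\mathfrak{h}_n^*$ is identified with the $n$-tuple $(\lambda(e_{11}),\dots,\lambda(e_{nn}))\in\mathbb{C}^n$.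 An $\mathfrak{s}_n$-module $M$ is a weight module if $M=\bigoplus_{\lambda\in\mathfrak{h}_n^*}M_\lambda$, where $M_\lambda=\{v\in M\mid hv=\lambda(h)v\ \forall h\in\mathfrak{h}_n\}$, and $\mathrm{Supp}(M)=\{\lambda\in\mathfrak{h}_n^*\mid M_\lambda\ne 0\}$. A weight module is a Harish-Chandra module if all its weight spaces $M_\lambda$ are finite dimensional. A $U(\mathfrak{s}_n)_{X_n}$-module is called Harish-Chandra if it is so as an $\mathfrak{s}_n$-module. Morphisms in each category are all module homomorphisms. *)

theory Defs
  imports
    "HOL-Library.FuncSet"
    "HOL-Library.Equipollence"
    "HOL-Algebra.QuotRing"
    "Jordan_Normal_Form.VS_Connect"
begin

section \<open>Lie algebras and their universal enveloping algebras\<close>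

text \<open>As in \<^const>\<open>module_vec\<close>, the fields \<^const>\<open>mult\<close> and \<^const>\<open>one\<close> which a
  \<^typ>\<open>('k, 'g) module\<close> inherits from rings carry no meaning.\<close>

record ('k, 'g) lie_algebra = "('k, 'g) module" +
  bracket :: "'g \<Rightarrow> 'g \<Rightarrow> 'g"

text \<open>The free associative unital complex algebra on a set: finitely supported functions on
  words, with convolution along concatenation.\<close>

definition free_algebra :: "'x set \<Rightarrow> ('x list \<Rightarrow> complex) ring" where
  "free_algebra X = \<lparr>
     carrier = {f. finite {w. f w \<noteq> 0} \<and> {w. f w \<noteq> 0} \<subseteq> lists X},
     mult = (\<lambda>f g w. \<Sum>k\<le>length w. f (take k w) * g (drop k w)),
     one = (\<lambda>w. if w = [] then 1 else 0),
     zero = (\<lambda>w. 0),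
     add = (\<lambda>f g w. f w + g w)\<rparr>"

definition free_gen :: "'x \<Rightarrow> 'x list \<Rightarrow> complex" where
  "free_gen x = (\<lambda>w. if w = [x] then 1 else 0)"

definition free_scalar :: "complex \<Rightarrow> 'x list \<Rightarrow> complex" where
  "free_scalar c = (\<lambda>w. if w = [] then c else 0)"

text \<open>The first two families of relations turn the free algebra on the underlying set of
  \<open>L\<close> into the tensor algebra of the vector space \<open>L\<close>; the third one is
  \<open>x \<otimes> y - y \<otimes> x - [x, y]\<close>.\<close>

definition uea_relations :: "(complex, 'g, 'z) lie_algebra_scheme \<Rightarrow> ('g list \<Rightarrow> complex) set" where
  "uea_relations L = (let F = free_algebra (carrier L) in
     {free_gen (x \<oplus>\<^bsub>L\<^esub> y) \<ominus>\<^bsub>F\<^esub> (free_gen x \<oplus>\<^bsub>F\<^esub> free_gen y) | x y.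
        x \<in> carrier L \<and> y \<in> carrier L} \<union>
     {free_gen (c \<odot>\<^bsub>L\<^esub> x) \<ominus>\<^bsub>F\<^esub> (free_scalar c \<otimes>\<^bsub>F\<^esub> free_gen x) | c x.
        x \<in> carrier L} \<union>
     {(free_gen x \<otimes>\<^bsub>F\<^esub> free_gen y \<ominus>\<^bsub>F\<^esub> free_gen y \<otimes>\<^bsub>F\<^esub> free_gen x) \<ominus>\<^bsub>F\<^esub> free_gen (bracket L x y) | x y.
        x \<in> carrier L \<and> y \<in> carrier L})"

definition uea_ideal :: "(complex, 'g, 'z) lie_algebra_scheme \<Rightarrow> ('g list \<Rightarrow> complex) set" where
  "uea_ideal L = Idl\<^bsub>free_algebra (carrier L)\<^esub> (uea_relations L)"

definition uea :: "(complex, 'g, 'z) lie_algebra_scheme \<Rightarrow> ('g list \<Rightarrow> complex) set ring" where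
  "uea L = free_algebra (carrier L) Quot uea_ideal L"

definition uea_gen :: "(complex, 'g, 'z) lie_algebra_scheme \<Rightarrow> 'g \<Rightarrow> ('g list \<Rightarrow> complex) set" where
  "uea_gen L x = uea_ideal L +>\<^bsub>free_algebra (carrier L)\<^esub> free_gen x"

definition uea_scalar :: "(complex, 'g, 'z) lie_algebra_scheme \<Rightarrow> complex \<Rightarrow> ('g list \<Rightarrow> complex) set" where
  "uea_scalar L c = uea_ideal L +>\<^bsub>free_algebra (carrier L)\<^esub> free_scalar c"


section \<open>Ore localization\<close>

text \<open>For a (left) Ore subset \<open>S\<close> of a ring \<open>R\<close>, elements of the localization are classes
  of pairs \<open>(s, r)\<close>, to be read as left fractions \<open>s\<^sup>-\<^sup>1 r\<close>.\<close>

definition ore_rel :: "('r, 'z) ring_scheme \<Rightarrow> 'r set \<Rightarrow> (('r \<times> 'r) \<times> ('r \<times> 'r)) set" where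
  "ore_rel R S = {((s, r), (t, q)).
     s \<in> S \<and> r \<in> carrier R \<and> t \<in> S \<and> q \<in> carrier R \<and>
     (\<exists>a\<in>carrier R. \<exists>b\<in>carrier R.
        a \<otimes>\<^bsub>R\<^esub> s = b \<otimes>\<^bsub>R\<^esub> t \<and> a \<otimes>\<^bsub>R\<^esub> s \<in> S \<and> a \<otimes>\<^bsub>R\<^esub> r = b \<otimes>\<^bsub>R\<^esub> q)}"

text \<open>Sums are formed over a common denominator. Products use
  \<open>(s\<^sup>-\<^sup>1 r) (t\<^sup>-\<^sup>1 q) = (u s)\<^sup>-\<^sup>1 (p q)\<close> for any \<open>u \<in> S\<close> and \<open>p \<in> R\<close> with \<open>u r = p t\<close>,
  i.e. \<open>r t\<^sup>-\<^sup>1 = u\<^sup>-\<^sup>1 p\<close>. Under the Ore conditions all the fractions collected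
  on the right hand sides are equal, so that their image under \<^const>\<open>ore_rel\<close> is a single
  class.\<close>

definition ore_localization :: "('r, 'z) ring_scheme \<Rightarrow> 'r set \<Rightarrow> ('r \<times> 'r) set ring" where
  "ore_localization R S = \<lparr>
     carrier = (S \<times> carrier R) // ore_rel R S,
     mult = (\<lambda>A B. ore_rel R S `` {(u \<otimes>\<^bsub>R\<^esub> s, p \<otimes>\<^bsub>R\<^esub> q) | u s p q.
        u \<in> S \<and> p \<in> carrier R \<and>
        (\<exists>r t. (s, r) \<in> A \<and> (t, q) \<in> B \<and> u \<otimes>\<^bsub>R\<^esub> r = p \<otimes>\<^bsub>R\<^esub> t)}),
     one = ore_rel R S `` {(\<one>\<^bsub>R\<^esub>, \<one>\<^bsub>R\<^esub>)},
     zero = ore_rel R S `` {(\<one>\<^bsub>R\<^esub>, \<zero>\<^bsub>R\<^esub>)},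
     add = (\<lambda>A B. ore_rel R S `` {(s, r \<oplus>\<^bsub>R\<^esub> q) | s r q. (s, r) \<in> A \<and> (s, q) \<in> B})\<rparr>"

definition ore_map :: "('r, 'z) ring_scheme \<Rightarrow> 'r set \<Rightarrow> 'r \<Rightarrow> ('r \<times> 'r) set" where
  "ore_map R S r = ore_rel R S `` {(\<one>\<^bsub>R\<^esub>, r)}"


section \<open>Modules over rings and over Lie algebras\<close>

text \<open>Unlike \<^locale>\<open>module\<close>, the ring need not be commutative.\<close>

locale left_module = R?: ring R + M?: abelian_group M
  for R :: "('r, 'z) ring_scheme" (structure) and M :: "('r, 'a, 'y) module_scheme" (structure) +
  assumes smult_closed: "\<lbrakk>a \<in> carrier R; x \<in> carrier M\<rbrakk> \<Longrightarrow> a \<odot>\<^bsub>M\<^esub> x \<in> carrier M"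
    and smult_l_distr: "\<lbrakk>a \<in> carrier R; b \<in> carrier R; x \<in> carrier M\<rbrakk> \<Longrightarrow>
      (a \<oplus>\<^bsub>R\<^esub> b) \<odot>\<^bsub>M\<^esub> x = a \<odot>\<^bsub>M\<^esub> x \<oplus>\<^bsub>M\<^esub> b \<odot>\<^bsub>M\<^esub> x"
    and smult_r_distr: "\<lbrakk>a \<in> carrier R; x \<in> carrier M; y \<in> carrier M\<rbrakk> \<Longrightarrow>
      a \<odot>\<^bsub>M\<^esub> (x \<oplus>\<^bsub>M\<^esub> y) = a \<odot>\<^bsub>M\<^esub> x \<oplus>\<^bsub>M\<^esub> a \<odot>\<^bsub>M\<^esub> y"
    and smult_assoc: "\<lbrakk>a \<in> carrier R; b \<in> carrier R; x \<in> carrier M\<rbrakk> \<Longrightarrow>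
      (a \<otimes>\<^bsub>R\<^esub> b) \<odot>\<^bsub>M\<^esub> x = a \<odot>\<^bsub>M\<^esub> (b \<odot>\<^bsub>M\<^esub> x)"
    and smult_one: "x \<in> carrier M \<Longrightarrow> \<one>\<^bsub>R\<^esub> \<odot>\<^bsub>M\<^esub> x = x"

text \<open>Homomorphisms are extensional, so that equality of morphisms is equality on the carrier.\<close>

definition left_module_hom ::
  "('r, 'z) ring_scheme \<Rightarrow> ('r, 'a, 'y) module_scheme \<Rightarrow> ('r, 'b, 'x) module_scheme \<Rightarrow> ('a \<Rightarrow> 'b) set" where
  "left_module_hom R M N = {f \<in> carrier M \<rightarrow>\<^sub>E carrier N.
     (\<forall>x\<in>carrier M. \<forall>y\<in>carrier M. f (x \<oplus>\<^bsub>M\<^esub> y) = f x \<oplus>\<^bsub>N\<^esub> f y) \<and>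
     (\<forall>a\<in>carrier R. \<forall>x\<in>carrier M. f (a \<odot>\<^bsub>M\<^esub> x) = a \<odot>\<^bsub>N\<^esub> f x)}"

record ('g, 'v) lie_rep = "(complex, 'v) module" +
  act :: "'g \<Rightarrow> 'v \<Rightarrow> 'v"

locale lie_module = vectorspace "class_ring :: complex ring" V
  for L :: "(complex, 'g, 'z) lie_algebra_scheme"
    and V :: "('g, 'v, 'y) lie_rep_scheme" +
  assumes act_closed: "\<lbrakk>x \<in> carrier L; v \<in> carrier V\<rbrakk> \<Longrightarrow> act V x v \<in> carrier V"
    and act_add_left: "\<lbrakk>x \<in> carrier L; y \<in> carrier L; v \<in> carrier V\<rbrakk> \<Longrightarrow>
      act V (x \<oplus>\<^bsub>L\<^esub> y) v = act V x v \<oplus>\<^bsub>V\<^esub> act V y v"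
    and act_smult_left: "\<lbrakk>x \<in> carrier L; v \<in> carrier V\<rbrakk> \<Longrightarrow>
      act V (c \<odot>\<^bsub>L\<^esub> x) v = c \<odot>\<^bsub>V\<^esub> act V x v"
    and act_add_right: "\<lbrakk>x \<in> carrier L; v \<in> carrier V; w \<in> carrier V\<rbrakk> \<Longrightarrow>
      act V x (v \<oplus>\<^bsub>V\<^esub> w) = act V x v \<oplus>\<^bsub>V\<^esub> act V x w"
    and act_smult_right: "\<lbrakk>x \<in> carrier L; v \<in> carrier V\<rbrakk> \<Longrightarrow>
      act V x (c \<odot>\<^bsub>V\<^esub> v) = c \<odot>\<^bsub>V\<^esub> act V x v"
    and act_bracket: "\<lbrakk>x \<in> carrier L; y \<in> carrier L; v \<in> carrier V\<rbrakk> \<Longrightarrow>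
      act V (bracket L x y) v = act V x (act V y v) \<ominus>\<^bsub>V\<^esub> act V y (act V x v)"

definition lie_module_hom ::
  "(complex, 'g, 'z) lie_algebra_scheme \<Rightarrow> ('g, 'v, 'y) lie_rep_scheme \<Rightarrow> ('g, 'w, 'x) lie_rep_scheme
     \<Rightarrow> ('v \<Rightarrow> 'w) set" where
  "lie_module_hom L V W = {f \<in> carrier V \<rightarrow>\<^sub>E carrier W.
     (\<forall>v\<in>carrier V. \<forall>w\<in>carrier V. f (v \<oplus>\<^bsub>V\<^esub> w) = f v \<oplus>\<^bsub>W\<^esub> f w) \<and>
     (\<forall>c. \<forall>v\<in>carrier V. f (c \<odot>\<^bsub>V\<^esub> v) = c \<odot>\<^bsub>W\<^esub> f v) \<and>
     (\<forall>x\<in>carrier L. \<forall>v\<in>carrier V. f (act V x v) = act W x (f v))}"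


section \<open>The Lie algebra \<open>gl\<^sub>n \<ltimes> \<complex>\<^sup>n\<close> and the localization of its enveloping algebra\<close>

text \<open>Rows, columns and coordinates are numbered from 0.\<close>

type_synonym s_elem = "complex mat \<times> complex vec"

definition s_alg :: "nat \<Rightarrow> (complex, s_elem) lie_algebra" where
  "s_alg n = \<lparr>
     carrier = carrier_mat n n \<times> carrier_vec n,
     mult = undefined,
     one = undefined,
     zero = (0\<^sub>m n n, 0\<^sub>v n),
     add = (\<lambda>(A, v) (B, w). (A + B, v + w)),
     smult = (\<lambda>c (A, v). (c \<cdot>\<^sub>m A, c \<cdot>\<^sub>v v)),
     bracket = (\<lambda>(A, v) (B, w). (A * B - B * A, A *\<^sub>v w - B *\<^sub>v v))\<rparr>"

definition e_vec :: "nat \<Rightarrow> nat \<Rightarrow> s_elem" where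
  "e_vec n i = (0\<^sub>m n n, unit_vec n i)"

definition X_set :: "nat \<Rightarrow> (s_elem list \<Rightarrow> complex) set set" where
  "X_set n = {foldr (\<lambda>i p. (uea_gen (s_alg n) (e_vec n i) [^]\<^bsub>uea (s_alg n)\<^esub> k i) \<otimes>\<^bsub>uea (s_alg n)\<^esub> p)
                [0..<n] \<one>\<^bsub>uea (s_alg n)\<^esub> | k :: nat \<Rightarrow> nat. True}"

type_synonym loc_elem =
  "((s_elem list \<Rightarrow> complex) set \<times> (s_elem list \<Rightarrow> complex) set) set"

definition U_loc :: "nat \<Rightarrow> loc_elem ring" where
  "U_loc n = ore_localization (uea (s_alg n)) (X_set n)"

definition as_s_module :: "nat \<Rightarrow> (loc_elem, 'a) module \<Rightarrow> (s_elem, 'a) lie_rep" where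
  "as_s_module n M = \<lparr>
     carrier = carrier M,
     mult = mult M,
     one = one M,
     zero = zero M,
     add = add M,
     smult = (\<lambda>c v. ore_map (uea (s_alg n)) (X_set n) (uea_scalar (s_alg n) c) \<odot>\<^bsub>M\<^esub> v),
     act = (\<lambda>x v. ore_map (uea (s_alg n)) (X_set n) (uea_gen (s_alg n) x) \<odot>\<^bsub>M\<^esub> v)\<rparr>"


section \<open>Weight modules\<close>

definition cartan :: "nat \<Rightarrow> s_elem set" where
  "cartan n = {(D, 0\<^sub>v n) | D. D \<in> carrier_mat n n \<and> diagonal_mat D}"

text \<open>A tuple \<open>\<mu>\<close> stands for the linear form on the Cartan subalgebra which maps
  \<open>(D, 0)\<close> to \<open>\<Sum>i<n. \<mu>\<^sub>i D\<^sub>i\<^sub>i\<close>.\<close>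

definition weight_eval :: "nat \<Rightarrow> complex vec \<Rightarrow> s_elem \<Rightarrow> complex" where
  "weight_eval n \<mu> h = (\<Sum>i<n. \<mu> $ i * fst h $$ (i, i))"

definition weight_space :: "nat \<Rightarrow> (s_elem, 'v, 'y) lie_rep_scheme \<Rightarrow> complex vec \<Rightarrow> 'v set" where
  "weight_space n V \<mu> =
     {v \<in> carrier V. \<forall>h\<in>cartan n. act V h v = weight_eval n \<mu> h \<odot>\<^bsub>V\<^esub> v}"

definition internal_direct_sum :: "('k, 'v, 'y) module_scheme \<Rightarrow> 'i set \<Rightarrow> ('i \<Rightarrow> 'v set) \<Rightarrow> bool" where
  "internal_direct_sum V I W \<longleftrightarrow>
     (\<forall>v\<in>carrier V. \<exists>!f. f \<in> (\<Pi>\<^sub>E i\<in>I. W i) \<and> finite {i \<in> I. f i \<noteq> \<zero>\<^bsub>V\<^esub>} \<and>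
        v = (\<Oplus>\<^bsub>V\<^esub>i\<in>{i \<in> I. f i \<noteq> \<zero>\<^bsub>V\<^esub>}. f i))"

definition weight_module :: "nat \<Rightarrow> (s_elem, 'v, 'y) lie_rep_scheme \<Rightarrow> bool" where
  "weight_module n V \<longleftrightarrow> internal_direct_sum V (carrier_vec n) (weight_space n V)"

definition weight_support :: "nat \<Rightarrow> (s_elem, 'v, 'y) lie_rep_scheme \<Rightarrow> complex vec set" where
  "weight_support n V = {\<mu> \<in> carrier_vec n. weight_space n V \<mu> \<noteq> {\<zero>\<^bsub>V\<^esub>}}"

definition harish_chandra :: "nat \<Rightarrow> (s_elem, 'v, 'y) lie_rep_scheme \<Rightarrow> bool" where
  "harish_chandra n V \<longleftrightarrow> lie_module (s_alg n) V \<and> weight_module n V \<and>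
     (\<forall>\<mu>\<in>carrier_vec n. vectorspace.fin_dim class_ring (V\<lparr>carrier := weight_space n V \<mu>\<rparr>))"


section \<open>Categories and their equivalence\<close>

text \<open>\<open>Comp C A B D g f\<close> is the composite of \<open>f : A \<rightarrow> B\<close> and \<open>g : B \<rightarrow> D\<close>.
  The hom sets need not be disjoint, hence composition and functors on morphisms take the
  objects involved as arguments.\<close>

record ('o, 'm) cat =
  Ob :: "'o set"
  Mor :: "'o \<Rightarrow> 'o \<Rightarrow> 'm set"
  Ident :: "'o \<Rightarrow> 'm"
  Comp :: "'o \<Rightarrow> 'o \<Rightarrow> 'o \<Rightarrow> 'm \<Rightarrow> 'm \<Rightarrow> 'm"

locale category =
  fixes C :: "('o, 'm) cat"
  assumes Ident_Mor: "A \<in> Ob C \<Longrightarrow> Ident C A \<in> Mor C A A"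
    and Comp_Mor: "\<lbrakk>A \<in> Ob C; B \<in> Ob C; D \<in> Ob C; f \<in> Mor C A B; g \<in> Mor C B D\<rbrakk> \<Longrightarrow>
      Comp C A B D g f \<in> Mor C A D"
    and Comp_Ident: "\<lbrakk>A \<in> Ob C; B \<in> Ob C; f \<in> Mor C A B\<rbrakk> \<Longrightarrow> Comp C A A B f (Ident C A) = f"
    and Ident_Comp: "\<lbrakk>A \<in> Ob C; B \<in> Ob C; f \<in> Mor C A B\<rbrakk> \<Longrightarrow> Comp C A B B (Ident C B) f = f"
    and Comp_assoc: "\<lbrakk>A \<in> Ob C; B \<in> Ob C; D \<in> Ob C; E \<in> Ob C;
        f \<in> Mor C A B; g \<in> Mor C B D; h \<in> Mor C D E\<rbrakk> \<Longrightarrow>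
      Comp C A D E h (Comp C A B D g f) = Comp C A B E (Comp C B D E h g) f"

definition is_functor ::
  "('o, 'm) cat \<Rightarrow> ('p, 'k) cat \<Rightarrow> ('o \<Rightarrow> 'p) \<Rightarrow> ('o \<Rightarrow> 'o \<Rightarrow> 'm \<Rightarrow> 'k) \<Rightarrow> bool" where
  "is_functor C D Fo Fm \<longleftrightarrow>
     (\<forall>A\<in>Ob C. Fo A \<in> Ob D) \<and>
     (\<forall>A\<in>Ob C. \<forall>B\<in>Ob C. \<forall>f\<in>Mor C A B. Fm A B f \<in> Mor D (Fo A) (Fo B)) \<and>
     (\<forall>A\<in>Ob C. Fm A A (Ident C A) = Ident D (Fo A)) \<and>
     (\<forall>A\<in>Ob C. \<forall>B\<in>Ob C. \<forall>E\<in>Ob C. \<forall>f\<in>Mor C A B. \<forall>g\<in>Mor C B E.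
        Fm A E (Comp C A B E g f) = Comp D (Fo A) (Fo B) (Fo E) (Fm B E g) (Fm A B f))"

definition is_iso :: "('o, 'm) cat \<Rightarrow> 'o \<Rightarrow> 'o \<Rightarrow> 'm \<Rightarrow> bool" where
  "is_iso C A B f \<longleftrightarrow> f \<in> Mor C A B \<and>
     (\<exists>g\<in>Mor C B A. Comp C A B A g f = Ident C A \<and> Comp C B A B f g = Ident C B)"

definition natural_iso ::
  "('o, 'm) cat \<Rightarrow> ('p, 'k) cat \<Rightarrow> ('o \<Rightarrow> 'p) \<Rightarrow> ('o \<Rightarrow> 'o \<Rightarrow> 'm \<Rightarrow> 'k) \<Rightarrow>
     ('o \<Rightarrow> 'p) \<Rightarrow> ('o \<Rightarrow> 'o \<Rightarrow> 'm \<Rightarrow> 'k) \<Rightarrow> ('o \<Rightarrow> 'k) \<Rightarrow> bool" where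
  "natural_iso C D Fo Fm Go Gm \<eta> \<longleftrightarrow>
     (\<forall>A\<in>Ob C. is_iso D (Fo A) (Go A) (\<eta> A)) \<and>
     (\<forall>A\<in>Ob C. \<forall>B\<in>Ob C. \<forall>f\<in>Mor C A B.
        Comp D (Fo A) (Fo B) (Go B) (\<eta> B) (Fm A B f) =
        Comp D (Fo A) (Go A) (Go B) (Gm A B f) (\<eta> A))"

definition equivalent_categories :: "('o, 'm) cat \<Rightarrow> ('p, 'k) cat \<Rightarrow> bool" where
  "equivalent_categories C D \<longleftrightarrow> category C \<and> category D \<and>
     (\<exists>Fo Fm Go Gm \<eta> \<epsilon>.
        is_functor C D Fo Fm \<and> is_functor D C Go Gm \<and>
        natural_iso C C (\<lambda>A. A) (\<lambda>A B f. f) (\<lambda>A. Go (Fo A)) (\<lambda>A B f. Gm (Fo A) (Fo B) (Fm A B f)) \<eta> \<and>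
        natural_iso D D (\<lambda>A. Fo (Go A)) (\<lambda>A B f. Fm (Go A) (Go B) (Gm A B f)) (\<lambda>A. A) (\<lambda>A B f. f) \<epsilon>)"


section \<open>The two categories\<close>

definition weight_coset :: "nat \<Rightarrow> complex vec \<Rightarrow> complex vec set" where
  "weight_coset n l = {l + z | z. z \<in> carrier_vec n \<and> (\<forall>i<n. z $ i \<in> \<int>)}"

text \<open>The carriers of the modules lie in a fixed type. All modules of either kind have dimension
  at most countable over the complex numbers, so up to isomorphism none is missed as soon as
  this type has at least the cardinality of the continuum.\<close>

definition C_cat :: "nat \<Rightarrow> complex vec \<Rightarrow> ((loc_elem, 'a) module, 'a \<Rightarrow> 'a) cat" where
  "C_cat n l = \<lparr>
     Ob = {M. left_module (U_loc n) M \<and> harish_chandra n (as_s_module n M) \<and>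
              (carrier M = {\<zero>\<^bsub>M\<^esub>} \<or> weight_support n (as_s_module n M) = weight_coset n l)},
     Mor = left_module_hom (U_loc n),
     Ident = (\<lambda>M. \<lambda>v\<in>carrier M. v),
     Comp = (\<lambda>M N P g f. compose (carrier M) g f)\<rparr>"

definition A_cat :: "nat \<Rightarrow> ((s_elem, 'b) lie_rep, 'b \<Rightarrow> 'b) cat" where
  "A_cat m = \<lparr>
     Ob = {V. lie_module (s_alg m) V \<and> vectorspace.fin_dim class_ring V},
     Mor = lie_module_hom (s_alg m),
     Ident = (\<lambda>V. \<lambda>v\<in>carrier V. v),
     Comp = (\<lambda>V W Z g f. compose (carrier V) g f)\<rparr>"

end

theory Submission
  imports Defs "HOL-Library.Function_Algebras" "HOL-Algebra.Free_Abelian_Groups"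
begin

text \<open>Write \<open>n = m + 1\<close>. On a Harish-Chandra module \<open>M\<close> over the localization the \<open>e\<^sub>i\<close> are commuting
  bijections which permute the weight spaces over \<open>\<lambda> + \<int>\<^sup>n\<close>, so \<open>M\<close> is the tensor product of the
  finite dimensional weight space \<open>W = M\<^sub>\<lambda>\<close> and the Laurent polynomials in the \<open>e\<^sub>i\<close>. The fibre of \<open>M\<close>
  at the point \<open>e\<^sub>1 = \<dots> = e\<^sub>n = 1\<close> is a copy of \<open>W\<close>. The matrices with vanishing column sums act on
  it, and they form a Lie algebra isomorphic to \<open>s\<^sub>m\<close>. As the diagonal matrices act by the weights,
  this action on the fibre determines the module, and every finite dimensional \<open>s\<^sub>m\<close>-module arises.
  A morphism commutes with the \<open>e\<^sub>i\<close> and preserves weights, so it is given by its effect on \<open>W\<close>.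

  Both categories are compared with the one of representations of \<open>s\<^sub>m\<close> on the spaces \<open>\<complex>\<^sup>d\<close>; the
  cardinality assumptions serve to realize the latter's objects in the prescribed types.\<close>

text \<open>A square matrix is uniquely a diagonal one plus one with vanishing column sums; the
  second part of the matrix unit e_ij is e_ij - e_jj. Writing t^a y for the translate by e^a of a
  vector \<open>y\<close> of the weight space, the whole action becomes explicit: e_ij sends t^a y
  to t^(a + eps_i - eps_j) ((lambda_j + a_j) y + r_ij y), where r_ij is the operator of e_ij - e_jj
  on the fibre and r_jj = 0. Weights force the exponent, and evaluation at (1, ..., 1) forces the
  coefficient. Conversely, the formula defines an action for every representation of
  \<open>s_m\<close>; checking its brackets on matrix units is the computational core. Column sums
  enter because e_ij acts like the vector field t_i d/dt_j, and the field with matrix X vanishes at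
  (1, ..., 1) exactly when the columns of X sum to zero. Such an X maps into the hyperplane of
  coordinate sum zero; its restriction to the hyperplane and its value at one vector outside are the
  two components of an element of \<open>s_m\<close>.\<close>

hide_const (open) Wellorder_Constructions.zero

section \<open>Fully faithful and essentially surjective functors\<close>

text \<open>The isomorphism in the last clause leads out of the given object: in
  \<open>ffes_imp_equivalent\<close> it becomes the unit of the equivalence.\<close>

definition fully_faithful_essentially_surjective ::
  "('o, 'm) cat \<Rightarrow> ('p, 'k) cat \<Rightarrow> ('o \<Rightarrow> 'p) \<Rightarrow> ('o \<Rightarrow> 'o \<Rightarrow> 'm \<Rightarrow> 'k) \<Rightarrow> bool" where
  "fully_faithful_essentially_surjective C D Fo Fm \<longleftrightarrow> is_functor C D Fo Fm \<and>
     (\<forall>A\<in>Ob C. \<forall>B\<in>Ob C. bij_betw (Fm A B) (Mor C A B) (Mor D (Fo A) (Fo B))) \<and>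
     (\<forall>X\<in>Ob D. \<exists>A\<in>Ob C. \<exists>f. is_iso D X (Fo A) f)"

lemma functor_preserves_iso:
  assumes "is_functor C D Fo Fm" "is_iso C A B f" "A \<in> Ob C" "B \<in> Ob C"
  shows "is_iso D (Fo A) (Fo B) (Fm A B f)"
proof -
  obtain g where g: "f \<in> Mor C A B" "g \<in> Mor C B A" "Comp C A B A g f = Ident C A"
      "Comp C B A B f g = Ident C B"
    using assms(2) by (auto simp: is_iso_def)
  have "Fm A A (Comp C A B A g f) = Comp D (Fo A) (Fo B) (Fo A) (Fm B A g) (Fm A B f)"
       "Fm B B (Comp C B A B f g) = Comp D (Fo B) (Fo A) (Fo B) (Fm A B f) (Fm B A g)"
    using assms g unfolding is_functor_def by blast+
  then show ?thesis
    using assms g unfolding is_functor_def is_iso_def by metis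
qed

lemma (in category) is_iso_comp:
  assumes "is_iso C X Y f" "is_iso C Y Z g" "X \<in> Ob C" "Y \<in> Ob C" "Z \<in> Ob C"
  shows "is_iso C X Z (Comp C X Y Z g f)"
proof -
  obtain f' where f: "f \<in> Mor C X Y" "f' \<in> Mor C Y X" "Comp C X Y X f' f = Ident C X"
      "Comp C Y X Y f f' = Ident C Y"
    using assms(1) by (auto simp: is_iso_def)
  obtain g' where g: "g \<in> Mor C Y Z" "g' \<in> Mor C Z Y" "Comp C Y Z Y g' g = Ident C Y"
      "Comp C Z Y Z g g' = Ident C Z"
    using assms(2) by (auto simp: is_iso_def)
  note ob = assms(3-5)
  let ?k = "Comp C Z Y X f' g'"
  have 1: "Comp C X Y Z g f \<in> Mor C X Z" "?k \<in> Mor C Z X"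
    using f g ob by (auto intro: Comp_Mor)
  have "Comp C X Z X ?k (Comp C X Y Z g f) = Comp C X Y X (Comp C Y Z X ?k g) f"
    by (rule Comp_assoc) (use f g ob 1 in auto)
  also have "Comp C Y Z X ?k g = Comp C Y Y X f' (Comp C Y Z Y g' g)"
    by (rule Comp_assoc[symmetric]) (use f g ob 1 in auto)
  finally have 2: "Comp C X Z X ?k (Comp C X Y Z g f) = Ident C X"
    using f g ob by (simp add: Comp_Ident)
  have "Comp C Z X Z (Comp C X Y Z g f) ?k = Comp C Z Y Z (Comp C Y X Z (Comp C X Y Z g f) f') g'"
    by (rule Comp_assoc) (use f g ob 1 in auto)
  also have "Comp C Y X Z (Comp C X Y Z g f) f' = Comp C Y Y Z g (Comp C Y X Y f f')"
    by (rule Comp_assoc[symmetric]) (use f g ob 1 in auto)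
  finally have 3: "Comp C Z X Z (Comp C X Y Z g f) ?k = Ident C Z"
    using f g ob by (simp add: Comp_Ident)
  show ?thesis unfolding is_iso_def using 1 2 3 by blast
qed

lemma ffes_comp:
  assumes E: "category E"
    and F: "fully_faithful_essentially_surjective C D Fo Fm"
    and G: "fully_faithful_essentially_surjective D E Go Gm"
  shows "fully_faithful_essentially_surjective C E (\<lambda>A. Go (Fo A)) (\<lambda>A B f. Gm (Fo A) (Fo B) (Fm A B f))"
proof -
  interpret E: category E by (rule E)
  have ff: "is_functor C D Fo Fm" and gf: "is_functor D E Go Gm"
    using F G by (auto simp: fully_faithful_essentially_surjective_def)
  have esF: "\<exists>A\<in>Ob C. \<exists>f. is_iso D X (Fo A) f" if "X \<in> Ob D" for X
    using F that by (simp add: fully_faithful_essentially_surjective_def)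
  have esG: "\<exists>A\<in>Ob D. \<exists>f. is_iso E X (Go A) f" if "X \<in> Ob E" for X
    using G that by (simp add: fully_faithful_essentially_surjective_def)
  have "is_functor C E (\<lambda>A. Go (Fo A)) (\<lambda>A B f. Gm (Fo A) (Fo B) (Fm A B f))"
    using ff gf unfolding is_functor_def by simp
  moreover have "bij_betw (\<lambda>f. Gm (Fo A) (Fo B) (Fm A B f)) (Mor C A B) (Mor E (Go (Fo A)) (Go (Fo B)))"
    if "A \<in> Ob C" "B \<in> Ob C" for A B
  proof -
    have "Fo A \<in> Ob D" "Fo B \<in> Ob D" using ff that by (auto simp: is_functor_def)
    then show ?thesis
      using F G that bij_betw_trans[of "Fm A B" "Mor C A B" "Mor D (Fo A) (Fo B)" "Gm (Fo A) (Fo B)"]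
      by (simp add: fully_faithful_essentially_surjective_def comp_def)
  qed
  moreover have "\<exists>A\<in>Ob C. \<exists>f. is_iso E X (Go (Fo A)) f" if X: "X \<in> Ob E" for X
  proof -
    obtain Y f where Y: "Y \<in> Ob D" "is_iso E X (Go Y) f"
      using esG[OF X] by auto
    obtain A g where A: "A \<in> Ob C" "is_iso D Y (Fo A) g"
      using esF[OF Y(1)] by auto
    have "Fo A \<in> Ob D" using ff A by (auto simp: is_functor_def)
    then have "is_iso E (Go Y) (Go (Fo A)) (Gm Y (Fo A) g)" "Go (Fo A) \<in> Ob E" "Go Y \<in> Ob E"
      using functor_preserves_iso[OF gf] A Y gf by (auto simp: is_functor_def)
    then show ?thesis using E.is_iso_comp[OF Y(2)] X A by blast
  qed
  ultimately show ?thesis unfolding fully_faithful_essentially_surjective_def by blast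
qed

text \<open>A quasi-inverse \<open>K\<close> is chosen objectwise, together with isomorphisms \<eta>
  from \<open>X\<close> to \<open>Fo (K X)\<close>; a morphism is conjugated by them and then lifted
  along the bijection of hom sets. As \<open>K\<close> leads out of \<open>D\<close> and has \<eta>
  as unit, the conclusion names \<open>D\<close> first. Identities between lifts are checked after
  applying the injective \<open>Fm\<close>.\<close>

lemma ffes_imp_equivalent:
  assumes C: "category C" and D: "category D"
    and F: "fully_faithful_essentially_surjective C D Fo Fm"
  shows "equivalent_categories D C"
proof -
  interpret C: category C by (rule C)
  interpret D: category D by (rule D)
  have ff: "is_functor C D Fo Fm"
    using F by (auto simp: fully_faithful_essentially_surjective_def)
  have bij: "bij_betw (Fm A B) (Mor C A B) (Mor D (Fo A) (Fo B))" if "A \<in> Ob C" "B \<in> Ob C" for A B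
    using F that by (auto simp: fully_faithful_essentially_surjective_def)
  have FoOb: "Fo A \<in> Ob D" if "A \<in> Ob C" for A using ff that by (auto simp: is_functor_def)
  have FmMor: "Fm A B f \<in> Mor D (Fo A) (Fo B)" if "A \<in> Ob C" "B \<in> Ob C" "f \<in> Mor C A B" for A B f
    using ff that by (auto simp: is_functor_def)
  have FmId: "Fm A A (Ident C A) = Ident D (Fo A)" if "A \<in> Ob C" for A
    using ff that by (auto simp: is_functor_def)
  have FmComp: "Fm A E (Comp C A B E g f) = Comp D (Fo A) (Fo B) (Fo E) (Fm B E g) (Fm A B f)"
    if "A \<in> Ob C" "B \<in> Ob C" "E \<in> Ob C" "f \<in> Mor C A B" "g \<in> Mor C B E" for A B E f g
    using ff that unfolding is_functor_def by blast
  obtain K \<eta> where K: "\<And>X. X \<in> Ob D \<Longrightarrow> K X \<in> Ob C \<and> is_iso D X (Fo (K X)) (\<eta> X)"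
    using F unfolding fully_faithful_essentially_surjective_def by metis
  have KOb: "K X \<in> Ob C" "Fo (K X) \<in> Ob D" if "X \<in> Ob D" for X using K that FoOb by auto
  have "\<exists>g. \<eta> X \<in> Mor D X (Fo (K X)) \<and> g \<in> Mor D (Fo (K X)) X \<and> Comp D X (Fo (K X)) X g (\<eta> X) = Ident D X
      \<and> Comp D (Fo (K X)) X (Fo (K X)) (\<eta> X) g = Ident D (Fo (K X))" if "X \<in> Ob D" for X
    using K[OF that] by (auto simp: is_iso_def)
  then obtain \<theta> where et: "\<And>X. X \<in> Ob D \<Longrightarrow> \<eta> X \<in> Mor D X (Fo (K X))"
      "\<And>X. X \<in> Ob D \<Longrightarrow> \<theta> X \<in> Mor D (Fo (K X)) X"
      "\<And>X. X \<in> Ob D \<Longrightarrow> Comp D X (Fo (K X)) X (\<theta> X) (\<eta> X) = Ident D X"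
      "\<And>X. X \<in> Ob D \<Longrightarrow> Comp D (Fo (K X)) X (Fo (K X)) (\<eta> X) (\<theta> X) = Ident D (Fo (K X))"
    by metis
  \<comment> \<open>This is the only morphism that makes the naturality square of \<eta> commute
    (\<open>cj_unique\<close>). Functoriality of \<open>K\<close> is derived from this uniqueness
    rather than from the formula.\<close>
  define cj where "cj X Y f = Comp D (Fo (K X)) X (Fo (K Y)) (Comp D X Y (Fo (K Y)) (\<eta> Y) f) (\<theta> X)" for X Y f
  define Km where "Km X Y f = inv_into (Mor C (K X) (K Y)) (Fm (K X) (K Y)) (cj X Y f)" for X Y f
  have cjMor: "cj X Y f \<in> Mor D (Fo (K X)) (Fo (K Y))" if "X \<in> Ob D" "Y \<in> Ob D" "f \<in> Mor D X Y" for X Y f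
    unfolding cj_def using that et KOb by (intro D.Comp_Mor) auto
  have FmKm: "Fm (K X) (K Y) (Km X Y f) = cj X Y f" and KmMor: "Km X Y f \<in> Mor C (K X) (K Y)"
    if "X \<in> Ob D" "Y \<in> Ob D" "f \<in> Mor D X Y" for X Y f
  proof -
    have b: "Fm (K X) (K Y) ` Mor C (K X) (K Y) = Mor D (Fo (K X)) (Fo (K Y))"
      using bij KOb that by (auto simp: bij_betw_def)
    show "Fm (K X) (K Y) (Km X Y f) = cj X Y f"
      unfolding Km_def by (rule f_inv_into_f) (use b cjMor that in auto)
    show "Km X Y f \<in> Mor C (K X) (K Y)"
      unfolding Km_def by (rule inv_into_into) (use b cjMor that in auto)
  qed
  have inj: "f = g" if "A \<in> Ob C" "B \<in> Ob C" "f \<in> Mor C A B" "g \<in> Mor C A B" "Fm A B f = Fm A B g" for A B f g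
    using bij[OF that(1,2)] that(3-) by (auto simp: bij_betw_def inj_on_def)
  have cj_eta: "Comp D X (Fo (K X)) (Fo (K Y)) (cj X Y f) (\<eta> X) = Comp D X Y (Fo (K Y)) (\<eta> Y) f"
    if "X \<in> Ob D" "Y \<in> Ob D" "f \<in> Mor D X Y" for X Y f
  proof -
    have "Comp D X (Fo (K X)) (Fo (K Y)) (cj X Y f) (\<eta> X) =
      Comp D X X (Fo (K Y)) (Comp D X Y (Fo (K Y)) (\<eta> Y) f) (Comp D X (Fo (K X)) X (\<theta> X) (\<eta> X))"
      unfolding cj_def by (rule D.Comp_assoc[symmetric]) (use that et KOb in \<open>auto intro: D.Comp_Mor\<close>)
    also have "\<dots> = Comp D X Y (Fo (K Y)) (\<eta> Y) f"
      using D.Comp_Ident[of X "Fo (K Y)" "Comp D X Y (Fo (K Y)) (\<eta> Y) f"] that et KOb D.Comp_Mor by simp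
    finally show ?thesis .
  qed
  have cj_unique: "h = cj X Y f" if "X \<in> Ob D" "Y \<in> Ob D" "f \<in> Mor D X Y" "h \<in> Mor D (Fo (K X)) (Fo (K Y))"
    "Comp D X (Fo (K X)) (Fo (K Y)) h (\<eta> X) = Comp D X Y (Fo (K Y)) (\<eta> Y) f" for X Y f h
  proof -
    have "h = Comp D (Fo (K X)) (Fo (K X)) (Fo (K Y)) h (Comp D (Fo (K X)) X (Fo (K X)) (\<eta> X) (\<theta> X))"
      using that et KOb D.Comp_Ident by auto
    also have "\<dots> = Comp D (Fo (K X)) X (Fo (K Y)) (Comp D X (Fo (K X)) (Fo (K Y)) h (\<eta> X)) (\<theta> X)"
      by (rule D.Comp_assoc) (use that et KOb in auto)
    finally show ?thesis using that(5) by (simp add: cj_def)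
  qed
  have Kid: "Km X X (Ident D X) = Ident C (K X)" if "X \<in> Ob D" for X
  proof (rule inj[of "K X" "K X"])
    have "Ident D (Fo (K X)) = cj X X (Ident D X)"
      by (rule cj_unique) (use that et KOb D.Ident_Mor D.Ident_Comp D.Comp_Ident in auto)
    then show "Fm (K X) (K X) (Km X X (Ident D X)) = Fm (K X) (K X) (Ident C (K X))"
      using that KOb D.Ident_Mor by (simp add: FmKm FmId)
  qed (use that KOb KmMor D.Ident_Mor C.Ident_Mor in auto)
  have Kcomp: "Km X Z (Comp D X Y Z g f) = Comp C (K X) (K Y) (K Z) (Km Y Z g) (Km X Y f)"
    if o: "X \<in> Ob D" "Y \<in> Ob D" "Z \<in> Ob D" and f: "f \<in> Mor D X Y" and g: "g \<in> Mor D Y Z" for X Y Z f g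
  proof (rule inj[of "K X" "K Z"])
    let ?x = "Fo (K X)" and ?y = "Fo (K Y)" and ?z = "Fo (K Z)"
    have gf: "Comp D X Y Z g f \<in> Mor D X Z" using that by (auto intro: D.Comp_Mor)
    have "Comp D ?x ?y ?z (cj Y Z g) (cj X Y f) = cj X Z (Comp D X Y Z g f)"
    proof (rule cj_unique)
      have "Comp D X ?x ?z (Comp D ?x ?y ?z (cj Y Z g) (cj X Y f)) (\<eta> X)
          = Comp D X ?y ?z (cj Y Z g) (Comp D X ?x ?y (cj X Y f) (\<eta> X))"
        by (rule D.Comp_assoc[symmetric]) (use that et KOb cjMor in auto)
      also have "\<dots> = Comp D X ?y ?z (cj Y Z g) (Comp D X Y ?y (\<eta> Y) f)"
        using that by (simp add: cj_eta)
      also have "\<dots> = Comp D X Y ?z (Comp D Y ?y ?z (cj Y Z g) (\<eta> Y)) f"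
        by (rule D.Comp_assoc) (use that et KOb cjMor in auto)
      also have "\<dots> = Comp D X Y ?z (Comp D Y Z ?z (\<eta> Z) g) f"
        using that by (simp add: cj_eta)
      also have "\<dots> = Comp D X Z ?z (\<eta> Z) (Comp D X Y Z g f)"
        by (rule D.Comp_assoc[symmetric]) (use that et KOb cjMor in auto)
      finally show "Comp D X ?x ?z (Comp D ?x ?y ?z (cj Y Z g) (cj X Y f)) (\<eta> X) = \<dots>" .
    qed (use that gf KOb cjMor in \<open>auto intro: D.Comp_Mor\<close>)
    then show "Fm (K X) (K Z) (Km X Z (Comp D X Y Z g f)) = Fm (K X) (K Z) (Comp C (K X) (K Y) (K Z) (Km Y Z g) (Km X Y f))"
      using that gf KOb KmMor by (simp add: FmKm FmComp)
    show "Km X Z (Comp D X Y Z g f) \<in> Mor C (K X) (K Z)" by (rule KmMor[OF o(1,3) gf])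
    show "Comp C (K X) (K Y) (K Z) (Km Y Z g) (Km X Y f) \<in> Mor C (K X) (K Z)"
      by (rule C.Comp_Mor) (use that KOb KmMor in auto)
  qed (use that KOb in auto)
  have Kfun: "is_functor D C K Km"
    unfolding is_functor_def using KOb KmMor Kid Kcomp by auto
  have nat1: "natural_iso D D (\<lambda>A. A) (\<lambda>A B f. f) (\<lambda>A. Fo (K A)) (\<lambda>A B f. Fm (K A) (K B) (Km A B f)) \<eta>"
    unfolding natural_iso_def using K by (simp add: FmKm cj_eta)
  \<comment> \<open>The counit is the lift of the inverse of \<eta> at \<open>Fo A\<close>. The lift
    of \<eta> itself is its inverse, since the two composites are identities after applying
    \<open>Fm\<close>.\<close>
  define \<epsilon> where "\<epsilon> A = inv_into (Mor C (K (Fo A)) A) (Fm (K (Fo A)) A) (\<theta> (Fo A))" for A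
  define \<epsilon>' where "\<epsilon>' A = inv_into (Mor C A (K (Fo A))) (Fm A (K (Fo A))) (\<eta> (Fo A))" for A
  have eps: "\<epsilon> A \<in> Mor C (K (Fo A)) A" "Fm (K (Fo A)) A (\<epsilon> A) = \<theta> (Fo A)"
            "\<epsilon>' A \<in> Mor C A (K (Fo A))" "Fm A (K (Fo A)) (\<epsilon>' A) = \<eta> (Fo A)" if "A \<in> Ob C" for A
  proof -
    have o: "Fo A \<in> Ob D" using that FoOb by auto
    have b: "\<theta> (Fo A) \<in> Fm (K (Fo A)) A ` Mor C (K (Fo A)) A" "\<eta> (Fo A) \<in> Fm A (K (Fo A)) ` Mor C A (K (Fo A))"
      using bij[of "K (Fo A)" A] bij[of A "K (Fo A)"] KOb o that et by (auto simp: bij_betw_def)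
    show "\<epsilon> A \<in> Mor C (K (Fo A)) A" "Fm (K (Fo A)) A (\<epsilon> A) = \<theta> (Fo A)"
         "\<epsilon>' A \<in> Mor C A (K (Fo A))" "Fm A (K (Fo A)) (\<epsilon>' A) = \<eta> (Fo A)"
      unfolding \<epsilon>_def \<epsilon>'_def using inv_into_into[OF b(1)] f_inv_into_f[OF b(1)]
        inv_into_into[OF b(2)] f_inv_into_f[OF b(2)] by auto
  qed
  have epsiso: "is_iso C (K (Fo A)) A (\<epsilon> A)" if "A \<in> Ob C" for A
  proof -
    note e = eps[OF that] and o = FoOb[OF that]
    have 1: "Comp C (K (Fo A)) A (K (Fo A)) (\<epsilon>' A) (\<epsilon> A) = Ident C (K (Fo A))"
      by (rule inj[of "K (Fo A)" "K (Fo A)"]) (use e o that KOb in \<open>simp_all add: C.Comp_Mor C.Ident_Mor FmComp FmId et\<close>)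
    have 2: "Comp C A (K (Fo A)) A (\<epsilon> A) (\<epsilon>' A) = Ident C A"
      by (rule inj[of A A]) (use e o that KOb in \<open>simp_all add: C.Comp_Mor C.Ident_Mor FmComp FmId et\<close>)
    show ?thesis unfolding is_iso_def using e 1 2 by blast
  qed
  have epsnat: "Comp C (K (Fo A)) (K (Fo B)) B (\<epsilon> B) (Km (Fo A) (Fo B) (Fm A B f)) =
     Comp C (K (Fo A)) A B f (\<epsilon> A)" if o: "A \<in> Ob C" "B \<in> Ob C" and f: "f \<in> Mor C A B" for A B f
  proof (rule inj[of "K (Fo A)" B])
    let ?A = "Fo A" and ?B = "Fo B" and ?a = "Fo (K (Fo A))" and ?b = "Fo (K (Fo B))"
    have ob: "?A \<in> Ob D" "?B \<in> Ob D" "?a \<in> Ob D" "?b \<in> Ob D" "K ?A \<in> Ob C" "K ?B \<in> Ob C" using o FoOb KOb by auto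
    have fm: "Fm A B f \<in> Mor D ?A ?B" using FmMor that by auto
    have "Comp D ?a ?b ?B (\<theta> ?B) (cj ?A ?B (Fm A B f))
      = Comp D ?a ?A ?B (Comp D ?A ?b ?B (\<theta> ?B) (Comp D ?A ?B ?b (\<eta> ?B) (Fm A B f))) (\<theta> ?A)"
      unfolding cj_def by (rule D.Comp_assoc) (use ob fm et in \<open>auto intro: D.Comp_Mor\<close>)
    also have "Comp D ?A ?b ?B (\<theta> ?B) (Comp D ?A ?B ?b (\<eta> ?B) (Fm A B f))
      = Comp D ?A ?B ?B (Comp D ?B ?b ?B (\<theta> ?B) (\<eta> ?B)) (Fm A B f)"
      by (rule D.Comp_assoc) (use ob fm et in \<open>auto intro: D.Comp_Mor\<close>)
    also have "\<dots> = Fm A B f" using ob fm et by (simp add: D.Ident_Comp)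
    finally show "Fm (K ?A) B (Comp C (K ?A) (K ?B) B (\<epsilon> B) (Km ?A ?B (Fm A B f))) = Fm (K ?A) B (Comp C (K ?A) A B f (\<epsilon> A))"
      using o ob f fm eps KmMor by (simp add: FmComp FmKm)
    show "Comp C (K ?A) (K ?B) B (\<epsilon> B) (Km ?A ?B (Fm A B f)) \<in> Mor C (K ?A) B"
      "Comp C (K ?A) A B f (\<epsilon> A) \<in> Mor C (K ?A) B"
      using ob o f fm eps KmMor by (simp_all add: C.Comp_Mor[of _ "K ?B"] C.Comp_Mor[of _ A])
  qed (use o FoOb KOb in auto)
  have nat2: "natural_iso C C (\<lambda>A. K (Fo A)) (\<lambda>A B f. Km (Fo A) (Fo B) (Fm A B f)) (\<lambda>A. A) (\<lambda>A B f. f) \<epsilon>"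
    unfolding natural_iso_def using epsiso epsnat by simp
  show ?thesis unfolding equivalent_categories_def
    using C D Kfun ff nat1 nat2 by blast
qed

section \<open>Ore localization\<close>

text \<open>Left fractions over a ring that may have zero divisors: \<open>reversible\<close> trades
  annihilation from the right for annihilation from the left. Through \<open>cancel_right\<close>
  this is what makes equality of fractions transitive.\<close>

locale ore_set = R?: ring R for R :: "('r, 'z) ring_scheme" (structure) +
  fixes S :: "'r set"
  assumes S_sub: "S \<subseteq> carrier R"
    and S_one: "\<one> \<in> S"
    and S_mult: "\<lbrakk>s \<in> S; t \<in> S\<rbrakk> \<Longrightarrow> s \<otimes> t \<in> S"
    and ore: "\<lbrakk>r \<in> carrier R; s \<in> S\<rbrakk> \<Longrightarrow> \<exists>u\<in>S. \<exists>p\<in>carrier R. u \<otimes> r = p \<otimes> s"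
    and reversible: "\<lbrakk>r \<in> carrier R; s \<in> S; r \<otimes> s = \<zero>\<rbrakk> \<Longrightarrow> \<exists>u\<in>S. u \<otimes> r = \<zero>"
begin

lemma S_closed: "s \<in> S \<Longrightarrow> s \<in> carrier R"
  using S_sub by blast

lemma cancel_right:
  assumes "r \<in> carrier R" "r' \<in> carrier R" "s \<in> S" "r \<otimes> s = r' \<otimes> s"
  shows "\<exists>u\<in>S. u \<otimes> r = u \<otimes> r'"
proof -
  have s: "s \<in> carrier R" using assms S_closed by auto
  have "(r \<ominus> r') \<otimes> s = \<zero>"
    using assms s by (simp add: a_minus_def l_distr l_minus r_neg)
  then obtain u where u: "u \<in> S" "u \<otimes> (r \<ominus> r') = \<zero>"
    using reversible[of "r \<ominus> r'" s] assms by auto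
  have uc: "u \<in> carrier R" using u S_closed by auto
  have "u \<otimes> r \<ominus> u \<otimes> r' = \<zero>"
    using u uc assms by (simp add: a_minus_def r_distr r_minus)
  then have "u \<otimes> r = u \<otimes> r'"
    using minus_equality[of "u \<otimes> r" "\<ominus> (u \<otimes> r')"] uc assms by (simp add: a_minus_def)
  then show ?thesis using u by blast
qed

text \<open>The uniqueness of common denominators; everything about well-definedness reduces to it.\<close>

lemma common_multiple:
  assumes c: "a \<in> carrier R" "b \<in> carrier R" "a' \<in> carrier R" "b' \<in> carrier R" "s \<in> carrier R" "t \<in> S"
    and eq: "a \<otimes> s = b \<otimes> t" "a \<otimes> s \<in> S" "a' \<otimes> s = b' \<otimes> t" and sS: "s \<in> S"
  shows "\<exists>w\<in>S. \<exists>z\<in>carrier R. w \<otimes> a' = z \<otimes> a \<and> w \<otimes> b' = z \<otimes> b"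
proof -
  have t: "t \<in> carrier R" using c S_closed by auto
  obtain u p where u: "u \<in> S" "p \<in> carrier R" "u \<otimes> (a' \<otimes> s) = p \<otimes> (a \<otimes> s)"
    using ore[of "a' \<otimes> s" "a \<otimes> s"] c eq(2) m_closed by blast
  have uc: "u \<in> carrier R" using u S_closed by auto
  have "(u \<otimes> a') \<otimes> s = (p \<otimes> a) \<otimes> s" using u uc c by (simp add: m_assoc)
  then obtain w where w: "w \<in> S" "w \<otimes> (u \<otimes> a') = w \<otimes> (p \<otimes> a)"
    using cancel_right[of "u \<otimes> a'" "p \<otimes> a" s] u uc c sS by auto
  have wc: "w \<in> carrier R" using w S_closed by auto
  have "(w \<otimes> u \<otimes> b') \<otimes> t = w \<otimes> (u \<otimes> a') \<otimes> s" using eq c uc wc t by (simp add: m_assoc)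
  also have "\<dots> = (w \<otimes> p \<otimes> b) \<otimes> t" using eq c uc wc t u w by (simp add: m_assoc)
  finally obtain v where v: "v \<in> S" "v \<otimes> (w \<otimes> u \<otimes> b') = v \<otimes> (w \<otimes> p \<otimes> b)"
    using cancel_right[of "w \<otimes> u \<otimes> b'" "w \<otimes> p \<otimes> b" t] u uc wc c by auto
  have vc: "v \<in> carrier R" using v S_closed by auto
  have "v \<otimes> w \<otimes> u \<in> S" using u v w S_mult by auto
  moreover have "v \<otimes> w \<otimes> p \<in> carrier R" using u vc wc by auto
  moreover have "(v \<otimes> w \<otimes> u) \<otimes> a' = (v \<otimes> w \<otimes> p) \<otimes> a" using w u uc vc wc c by (simp add: m_assoc)
  moreover have "(v \<otimes> w \<otimes> u) \<otimes> b' = (v \<otimes> w \<otimes> p) \<otimes> b" using v u uc vc wc c by (simp add: m_assoc)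
  ultimately show ?thesis by blast
qed

abbreviation L where "L \<equiv> ore_localization R S"

definition frac :: "'r \<Rightarrow> 'r \<Rightarrow> ('r \<times> 'r) set" where
  "frac s r = ore_rel R S `` {(s, r)}"

lemma ore_rel_iff: "((s, r), (t, q)) \<in> ore_rel R S \<longleftrightarrow> s \<in> S \<and> r \<in> carrier R \<and> t \<in> S \<and> q \<in> carrier R \<and>
     (\<exists>a\<in>carrier R. \<exists>b\<in>carrier R. a \<otimes> s = b \<otimes> t \<and> a \<otimes> s \<in> S \<and> a \<otimes> r = b \<otimes> q)"
  by (simp add: ore_rel_def)

lemma ore_relI:
  assumes "a \<in> carrier R" "b \<in> carrier R" "a \<otimes> s = b \<otimes> t" "a \<otimes> s \<in> S" "a \<otimes> r = b \<otimes> q"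
    "s \<in> S" "r \<in> carrier R" "t \<in> S" "q \<in> carrier R"
  shows "((s, r), (t, q)) \<in> ore_rel R S"
  using assms unfolding ore_rel_iff by blast

text \<open>Transitivity is the point. Two multiples of the middle denominator \<open>t\<close> are
  brought together by \<open>ore\<close>; cancelling \<open>t\<close> on the right costs one more
  left factor from \<open>S\<close>, which does no harm because \<open>S\<close> is closed under
  products.\<close>

lemma ore_rel_equiv: "equiv (S \<times> carrier R) (ore_rel R S)"
proof (rule equivI)
  show "ore_rel R S \<subseteq> (S \<times> carrier R) \<times> (S \<times> carrier R)" by (auto simp: ore_rel_def)
  show "refl_on (S \<times> carrier R) (ore_rel R S)"
  proof (rule refl_onI, clarify)
    fix s r assume "s \<in> S" "r \<in> carrier R"
    then show "((s, r), (s, r)) \<in> ore_rel R S" using ore_relI[of \<one> \<one> s s r r] S_closed by simp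
  qed
  show "sym (ore_rel R S)"
  proof (rule symI, clarify)
    fix s r t q assume "((s, r), (t, q)) \<in> ore_rel R S"
    then obtain a b where "a \<in> carrier R" "b \<in> carrier R" "a \<otimes> s = b \<otimes> t" "a \<otimes> s \<in> S" "a \<otimes> r = b \<otimes> q"
      "s \<in> S" "t \<in> S" "r \<in> carrier R" "q \<in> carrier R" unfolding ore_rel_iff by blast
    then show "((t, q), (s, r)) \<in> ore_rel R S" using ore_relI[of b a t s q r] by simp
  qed
  show "trans (ore_rel R S)"
  proof (rule transI, clarify)
    fix s r t q v z
    assume 1: "((s, r), (t, q)) \<in> ore_rel R S" and 2: "((t, q), (v, z)) \<in> ore_rel R S"
    obtain a b where ab: "a \<in> carrier R" "b \<in> carrier R" "a \<otimes> s = b \<otimes> t" "a \<otimes> s \<in> S" "a \<otimes> r = b \<otimes> q"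
      using 1 unfolding ore_rel_iff by blast
    obtain c d where cd: "c \<in> carrier R" "d \<in> carrier R" "c \<otimes> t = d \<otimes> v" "c \<otimes> t \<in> S" "c \<otimes> q = d \<otimes> z"
      using 2 unfolding ore_rel_iff by blast
    have S: "s \<in> S" "t \<in> S" "v \<in> S" "r \<in> carrier R" "q \<in> carrier R" "z \<in> carrier R"
      using 1 2 unfolding ore_rel_iff by blast+
    note C = S_closed[OF S(1)] S_closed[OF S(2)] S_closed[OF S(3)]
    obtain u p where u: "u \<in> S" "p \<in> carrier R" "u \<otimes> (b \<otimes> t) = p \<otimes> (c \<otimes> t)"
      using ore[OF m_closed[OF ab(2) C(2)] cd(4)] by blast
    have uc: "u \<in> carrier R" using u(1) by (rule S_closed)
    have "(u \<otimes> b) \<otimes> t = (p \<otimes> c) \<otimes> t"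
      using u(2,3) uc ab(2) cd(1) C(2) by (simp only: m_assoc)
    then obtain w where w: "w \<in> S" "w \<otimes> (u \<otimes> b) = w \<otimes> (p \<otimes> c)"
      using cancel_right[OF m_closed[OF uc ab(2)] m_closed[OF u(2) cd(1)] S(2)] by blast
    have wc: "w \<in> carrier R" using w(1) by (rule S_closed)
    note wu = m_closed[OF wc uc] and wp = m_closed[OF wc u(2)]
    have eq: "(w \<otimes> u) \<otimes> b = (w \<otimes> p) \<otimes> c"
      using w(2) wc uc u(2) ab(2) cd(1) by (simp only: m_assoc)
    have 3: "(w \<otimes> u \<otimes> a) \<otimes> s \<in> S"
      using S_mult[OF S_mult[OF w(1) u(1)] ab(4)] by (simp only: m_assoc[OF wu ab(1) C(1)])
    have 4: "(w \<otimes> u \<otimes> a) \<otimes> s = (w \<otimes> p \<otimes> d) \<otimes> v"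
      by (simp only: m_assoc[OF wu ab(1) C(1)] ab(3) m_assoc[OF wu ab(2) C(2), symmetric] eq
          m_assoc[OF wp cd(1) C(2)] cd(3) m_assoc[OF wp cd(2) C(3)])
    have 5: "(w \<otimes> u \<otimes> a) \<otimes> r = (w \<otimes> p \<otimes> d) \<otimes> z"
      by (simp only: m_assoc[OF wu ab(1) S(4)] ab(5) m_assoc[OF wu ab(2) S(5), symmetric] eq
          m_assoc[OF wp cd(1) S(5)] cd(5) m_assoc[OF wp cd(2) S(6)])
    show "((s, r), (v, z)) \<in> ore_rel R S"
      by (rule ore_relI[OF m_closed[OF wu ab(1)] m_closed[OF wp cd(2)] 4 3 5 S(1,4,3,6)])
  qed
qed

lemma frac_eq_iff:
  assumes "s \<in> S" "r \<in> carrier R" "t \<in> S" "q \<in> carrier R"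
  shows "frac s r = frac t q \<longleftrightarrow> ((s, r), (t, q)) \<in> ore_rel R S"
  unfolding frac_def using eq_equiv_class_iff[OF ore_rel_equiv] assms by auto

lemma mem_frac: "(t, q) \<in> frac s r \<longleftrightarrow> ((s, r), (t, q)) \<in> ore_rel R S"
  by (simp add: frac_def)

lemma frac_self: "s \<in> S \<Longrightarrow> r \<in> carrier R \<Longrightarrow> (s, r) \<in> frac s r"
  using equiv_class_self[OF ore_rel_equiv] by (auto simp: frac_def)

lemma frac_scale:
  assumes "s \<in> S" "r \<in> carrier R" "u \<in> carrier R" "u \<otimes> s \<in> S"
  shows "frac (u \<otimes> s) (u \<otimes> r) = frac s r"
proof -
  have "((s, r), (u \<otimes> s, u \<otimes> r)) \<in> ore_rel R S"
    by (rule ore_relI[of u \<one>]) (use assms S_closed[OF assms(1)] in auto)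
  then show ?thesis using frac_eq_iff[of s r "u \<otimes> s" "u \<otimes> r"] assms by auto
qed

lemma carrier_L: "carrier L = {frac s r | s r. s \<in> S \<and> r \<in> carrier R}"
  by (auto simp: ore_localization_def quotient_def frac_def)

lemma frac_closed: "s \<in> S \<Longrightarrow> r \<in> carrier R \<Longrightarrow> frac s r \<in> carrier L"
  using carrier_L by auto

lemma one_L: "\<one>\<^bsub>L\<^esub> = frac \<one> \<one>" and zero_L: "\<zero>\<^bsub>L\<^esub> = frac \<one> \<zero>"
  by (simp_all add: ore_localization_def frac_def)

lemma ore_map_eq: "ore_map R S r = frac \<one> r"
  by (simp add: ore_map_def frac_def)

lemma common_denominator:
  assumes "s \<in> S" "r \<in> carrier R" "t \<in> S" "q \<in> carrier R"
  shows "\<exists>v\<in>S. \<exists>r'\<in>carrier R. \<exists>q'\<in>carrier R. frac s r = frac v r' \<and> frac t q = frac v q'"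
proof -
  obtain u p where u: "u \<in> S" "p \<in> carrier R" "u \<otimes> s = p \<otimes> t"
    using ore[of s t] assms S_closed by auto
  have uc: "u \<in> carrier R" "s \<in> carrier R" "t \<in> carrier R" using u S_closed assms by auto
  have us: "u \<otimes> s \<in> S" using u(1) assms(1) by (rule S_mult)
  have "frac s r = frac (u \<otimes> s) (u \<otimes> r)" using frac_scale[of s r u] assms u uc us by auto
  moreover have "frac t q = frac (u \<otimes> s) (p \<otimes> q)" using frac_scale[of t q p] assms u uc us by auto
  ultimately show ?thesis using us uc u assms by (intro bexI[of _ "u \<otimes> s"] bexI[of _ "u \<otimes> r"] bexI[of _ "p \<otimes> q"]) auto
qed

text \<open>Sums and products in the localization are images of a whole set of candidate fractions.
  If one candidate is equivalent to all the others, the image is its class, so computing a single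
  representative settles well-definedness at the same time.\<close>

lemma Image_eq_frac:
  assumes "(s, r) \<in> X" "s \<in> S" "r \<in> carrier R" and "\<And>t q. (t, q) \<in> X \<Longrightarrow> ((s, r), (t, q)) \<in> ore_rel R S"
  shows "ore_rel R S `` X = frac s r"
proof
  show "ore_rel R S `` X \<subseteq> frac s r"
  proof clarify
    fix t q v z assume "(t, q) \<in> X" "((t, q), (v, z)) \<in> ore_rel R S"
    then have "((s, r), (v, z)) \<in> ore_rel R S"
      using assms(4) ore_rel_equiv unfolding equiv_def trans_def by blast
    then show "(v, z) \<in> frac s r" by (simp add: mem_frac)
  qed
  show "frac s r \<subseteq> ore_rel R S `` X" using assms(1) by (auto simp: frac_def)
qed

lemma add_frac:
  assumes "s \<in> S" "r \<in> carrier R" "q \<in> carrier R"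
  shows "frac s r \<oplus>\<^bsub>L\<^esub> frac s q = frac s (r \<oplus> q)"
proof -
  have "ore_rel R S `` {(t, r' \<oplus> q') | t r' q'. (t, r') \<in> frac s r \<and> (t, q') \<in> frac s q} = frac s (r \<oplus> q)"
  proof (rule Image_eq_frac)
    show "(s, r \<oplus> q) \<in> {(t, r' \<oplus> q') | t r' q'. (t, r') \<in> frac s r \<and> (t, q') \<in> frac s q}"
      using frac_self assms by blast
  next
    fix t z assume "(t, z) \<in> {(t, r' \<oplus> q') | t r' q'. (t, r') \<in> frac s r \<and> (t, q') \<in> frac s q}"
    then obtain r' q' where z: "z = r' \<oplus> q'" and 1: "((s, r), (t, r')) \<in> ore_rel R S" and 2: "((s, q), (t, q')) \<in> ore_rel R S"
      by (auto simp: mem_frac)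
    obtain a b where ab: "a \<in> carrier R" "b \<in> carrier R" "a \<otimes> s = b \<otimes> t" "a \<otimes> s \<in> S" "a \<otimes> r = b \<otimes> r'"
      using 1 unfolding ore_rel_iff by blast
    obtain a' b' where ab': "a' \<in> carrier R" "b' \<in> carrier R" "a' \<otimes> s = b' \<otimes> t" "a' \<otimes> s \<in> S" "a' \<otimes> q = b' \<otimes> q'"
      using 2 unfolding ore_rel_iff by blast
    have c: "t \<in> S" "r' \<in> carrier R" "q' \<in> carrier R" "s \<in> carrier R" "t \<in> carrier R"
      using 1 2 S_closed assms unfolding ore_rel_iff by blast+
    \<comment> \<open>The two equivalences come with different multipliers \<open>a\<close>,
      \<open>b\<close> and \<open>a'\<close>, \<open>b'\<close>. After scaling by \<open>w\<close>
      the second pair serves for both numerators, so that they can be added.\<close>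
    obtain w x where w: "w \<in> S" "x \<in> carrier R" "w \<otimes> a' = x \<otimes> a" "w \<otimes> b' = x \<otimes> b"
      using common_multiple[OF ab(1,2) ab'(1,2) c(4,1) ab(3,4) ab'(3) assms(1)] by blast
    have wc: "w \<in> carrier R" using w(1) by (rule S_closed)
    have "(w \<otimes> a') \<otimes> s = (w \<otimes> b') \<otimes> t" using ab'(1-3) wc c(4,5) by (simp only: m_assoc)
    moreover have "(w \<otimes> a') \<otimes> s \<in> S" using S_mult[OF w(1) ab'(4)] ab'(1,2) wc c(4) by (simp only: m_assoc)
    moreover have "(w \<otimes> a') \<otimes> r = (w \<otimes> b') \<otimes> r'"
      using ab(1,2,5) w(2) c(2) assms(2) by (simp only: w(3,4) m_assoc)
    moreover have "(w \<otimes> a') \<otimes> q = (w \<otimes> b') \<otimes> q'" using ab'(1,2,5) wc c(3) assms(3) by (simp only: m_assoc)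
    moreover have "(w \<otimes> a') \<otimes> (r \<oplus> q) = (w \<otimes> a') \<otimes> r \<oplus> (w \<otimes> a') \<otimes> q"
      "(w \<otimes> b') \<otimes> (r' \<oplus> q') = (w \<otimes> b') \<otimes> r' \<oplus> (w \<otimes> b') \<otimes> q'"
      using ab'(1,2) wc c assms by (simp_all add: r_distr)
    ultimately show "((s, r \<oplus> q), (t, z)) \<in> ore_rel R S"
      unfolding z using ab'(1,2) wc c assms ore_relI[of "w \<otimes> a'" "w \<otimes> b'" s t "r \<oplus> q" "r' \<oplus> q'"] by simp
  qed (use assms in auto)
  then show ?thesis by (simp add: ore_localization_def)
qed

lemma mult_frac:
  assumes s: "s \<in> S" "r \<in> carrier R" "t \<in> S" "q \<in> carrier R" and u: "u \<in> S" "p \<in> carrier R" "u \<otimes> r = p \<otimes> t"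
  shows "frac s r \<otimes>\<^bsub>L\<^esub> frac t q = frac (u \<otimes> s) (p \<otimes> q)"
proof -
  let ?X = "{(u \<otimes> s', p \<otimes> q') | u s' p q'. u \<in> S \<and> p \<in> carrier R \<and>
        (\<exists>r' t'. (s', r') \<in> frac s r \<and> (t', q') \<in> frac t q \<and> u \<otimes> r' = p \<otimes> t')}"
  have "ore_rel R S `` ?X = frac (u \<otimes> s) (p \<otimes> q)"
  proof (rule Image_eq_frac)
    show "(u \<otimes> s, p \<otimes> q) \<in> ?X" using frac_self assms by blast
  next
    fix x y assume "(x, y) \<in> ?X"
    then obtain u' s' p' q' r' t' where xy: "x = u' \<otimes> s'" "y = p' \<otimes> q'" and u': "u' \<in> S" "p' \<in> carrier R" "u' \<otimes> r' = p' \<otimes> t'"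
      and 1: "((s, r), (s', r')) \<in> ore_rel R S" and 2: "((t, q), (t', q')) \<in> ore_rel R S"
      by (auto simp: mem_frac)
    have S: "s' \<in> S" "t' \<in> S" "r' \<in> carrier R" "q' \<in> carrier R" using 1 2 unfolding ore_rel_iff by blast+
    have C: "s \<in> carrier R" "t \<in> carrier R" "s' \<in> carrier R" "t' \<in> carrier R" "u \<in> carrier R" "u' \<in> carrier R"
      using s u u' S S_closed by auto
    obtain a b where ab: "a \<in> carrier R" "b \<in> carrier R" "a \<otimes> s = b \<otimes> s'" "a \<otimes> s \<in> S" "a \<otimes> r = b \<otimes> r'"
      using 1 unfolding ore_rel_iff by blast
    obtain c d where cd: "c \<in> carrier R" "d \<in> carrier R" "c \<otimes> t = d \<otimes> t'" "c \<otimes> t \<in> S" "c \<otimes> q = d \<otimes> q'"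
      using 2 unfolding ore_rel_iff by blast
    \<comment> \<open>Two rounds of comparison are needed. First the new denominators get a common
      multiple, which is matched with the equivalence of the left factors. Then the numerators are
      compared through \<open>t\<close> and \<open>t'\<close> by means of the equivalence of the
      right factors; this introduces the extra factor \<open>w'\<close>.\<close>
    obtain x0 y0 where x0: "x0 \<in> S" "y0 \<in> carrier R" "x0 \<otimes> (u \<otimes> s) = y0 \<otimes> (u' \<otimes> s')"
      using ore[of "u \<otimes> s" "u' \<otimes> s'"] C S s u u' S_mult by auto
    have x0c: "x0 \<in> carrier R" using x0 S_closed by auto
    obtain w z where w: "w \<in> S" "z \<in> carrier R" "w \<otimes> (x0 \<otimes> u) = z \<otimes> a" "w \<otimes> (y0 \<otimes> u') = z \<otimes> b"
      using common_multiple[of a b "x0 \<otimes> u" "y0 \<otimes> u'" s s'] ab x0 x0c C S s by (auto simp: m_assoc)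
    have wc: "w \<in> carrier R" using w S_closed by auto
    let ?P = "w \<otimes> x0 \<otimes> p" and ?P' = "w \<otimes> y0 \<otimes> p'"
    have "?P \<otimes> t = w \<otimes> (x0 \<otimes> u) \<otimes> r" using u x0c wc C s by (simp add: m_assoc)
    also have "\<dots> = w \<otimes> (y0 \<otimes> u') \<otimes> r'" using ab w S s by (simp add: m_assoc)
    also have "\<dots> = ?P' \<otimes> t'" using u' x0 wc C S by (simp add: m_assoc)
    finally obtain w' z' where w': "w' \<in> S" "z' \<in> carrier R" "w' \<otimes> ?P = z' \<otimes> c" "w' \<otimes> ?P' = z' \<otimes> d"
      using common_multiple[of c d ?P ?P' t t'] cd u u' x0 x0c wc C S s by blast
    have w'c: "w' \<in> carrier R" using w' S_closed by auto
    have e1: "w' \<otimes> ?P \<otimes> q = w' \<otimes> ?P' \<otimes> q'" using w' cd C S s by (simp add: m_assoc)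
    have A: "(w' \<otimes> w \<otimes> x0) \<otimes> (u \<otimes> s) = (w' \<otimes> w \<otimes> y0) \<otimes> (u' \<otimes> s')"
      using x0 x0c wc w'c C by (simp add: m_assoc)
    have B: "(w' \<otimes> w \<otimes> x0) \<otimes> (u \<otimes> s) \<in> S" using x0 w w' u s S_mult by auto
    have D: "(w' \<otimes> w \<otimes> x0) \<otimes> (p \<otimes> q) = (w' \<otimes> w \<otimes> y0) \<otimes> (p' \<otimes> q')"
      using e1 x0 x0c wc w'c C S s u u' by (simp add: m_assoc)
    show "((u \<otimes> s, p \<otimes> q), (x, y)) \<in> ore_rel R S"
      unfolding xy by (rule ore_relI[OF _ _ A B D]) (use x0 x0c wc w'c s u u' S S_mult in auto)
  qed (use s u S_mult in auto)
  then show ?thesis by (simp add: ore_localization_def)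
qed

lemma L_E:
  assumes "A \<in> carrier L" obtains s r where "s \<in> S" "r \<in> carrier R" "A = frac s r"
  using assms carrier_L by auto

lemma mult_frac_ex:
  assumes s: "s \<in> S" "r \<in> carrier R" "t \<in> S" "q \<in> carrier R"
  shows "\<exists>u\<in>S. \<exists>p\<in>carrier R. u \<otimes> r = p \<otimes> t \<and> frac s r \<otimes>\<^bsub>L\<^esub> frac t q = frac (u \<otimes> s) (p \<otimes> q)"
  using ore[of r t] mult_frac assms by metis

lemma L2_E:
  assumes "A \<in> carrier L" "B \<in> carrier L"
  obtains s r q where "s \<in> S" "r \<in> carrier R" "q \<in> carrier R" "A = frac s r" "B = frac s q"
proof -
  obtain s r t q where *: "s \<in> S" "r \<in> carrier R" "A = frac s r" "t \<in> S" "q \<in> carrier R" "B = frac t q"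
    using assms by (elim L_E)
  show thesis using common_denominator[of s r t q] * that by auto
qed

lemma L3_E:
  assumes "A \<in> carrier L" "B \<in> carrier L" "D \<in> carrier L"
  obtains s r q p where "s \<in> S" "r \<in> carrier R" "q \<in> carrier R" "p \<in> carrier R"
    "A = frac s r" "B = frac s q" "D = frac s p"
proof -
  obtain s r q where 1: "s \<in> S" "r \<in> carrier R" "q \<in> carrier R" "A = frac s r" "B = frac s q"
    using assms L2_E by blast
  obtain t p where 2: "t \<in> S" "p \<in> carrier R" "D = frac t p" using assms L_E by blast
  obtain u z where u: "u \<in> S" "z \<in> carrier R" "u \<otimes> s = z \<otimes> t"
    using ore[of s t] 1 2 S_closed by auto
  have uc: "u \<in> carrier R" "s \<in> carrier R" "t \<in> carrier R" using u S_closed 1 2 by auto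
  have us: "u \<otimes> s \<in> S" using u(1) 1(1) by (rule S_mult)
  have us': "z \<otimes> t \<in> S" using us u(3) by simp
  show thesis
    by (rule that[OF us m_closed[OF uc(1) 1(2)] m_closed[OF uc(1) 1(3)] m_closed[OF u(2) 2(2)]])
      (simp_all only: 1(4,5) 2(3) u(3) frac_scale[OF 2(1,2) u(2) us']
        frac_scale[OF 1(1,2) uc(1) us, unfolded u(3)] frac_scale[OF 1(1,3) uc(1) us, unfolded u(3)])
qed

lemma L_ring: "ring L"
proof (rule ringI)
  show "abelian_group L"
  proof (rule abelian_groupI)
    fix A B D assume A: "A \<in> carrier L" and B: "B \<in> carrier L" and D: "D \<in> carrier L"
    show "A \<oplus>\<^bsub>L\<^esub> B \<oplus>\<^bsub>L\<^esub> D = A \<oplus>\<^bsub>L\<^esub> (B \<oplus>\<^bsub>L\<^esub> D)"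
    proof -
      obtain s r q p where "s \<in> S" "r \<in> carrier R" "q \<in> carrier R" "p \<in> carrier R"
        "A = frac s r" "B = frac s q" "D = frac s p"
        using L3_E[OF A B D] .
      then show ?thesis by (simp add: add_frac a_assoc)
    qed
  next
    fix A B assume A: "A \<in> carrier L" and B: "B \<in> carrier L"
    obtain s r q where "s \<in> S" "r \<in> carrier R" "q \<in> carrier R" "A = frac s r" "B = frac s q"
      using L2_E[OF A B] .
    then show "A \<oplus>\<^bsub>L\<^esub> B \<in> carrier L" "A \<oplus>\<^bsub>L\<^esub> B = B \<oplus>\<^bsub>L\<^esub> A"
      by (simp_all add: add_frac a_comm frac_closed)
  next
    show "\<zero>\<^bsub>L\<^esub> \<in> carrier L" using frac_closed S_one by (auto simp: zero_L)
  next
    fix A assume "A \<in> carrier L"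
    then obtain s r where A: "s \<in> S" "r \<in> carrier R" "A = frac s r" by (rule L_E)
    have z: "\<zero>\<^bsub>L\<^esub> = frac s \<zero>"
      using frac_scale[of \<one> \<zero> s] A S_closed S_one by (auto simp: zero_L)
    show "\<zero>\<^bsub>L\<^esub> \<oplus>\<^bsub>L\<^esub> A = A" using A by (simp add: z add_frac)
    have "frac s (\<ominus> r) \<oplus>\<^bsub>L\<^esub> A = \<zero>\<^bsub>L\<^esub>" using A by (simp add: z add_frac l_neg)
    then show "\<exists>B\<in>carrier L. B \<oplus>\<^bsub>L\<^esub> A = \<zero>\<^bsub>L\<^esub>" using frac_closed A by blast
  qed
  show "Group.monoid L"
  proof (rule monoidI)
    show "\<one>\<^bsub>L\<^esub> \<in> carrier L" using frac_closed S_one by (auto simp: one_L)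
  next
    fix A B assume "A \<in> carrier L" "B \<in> carrier L"
    then obtain s r t q where *: "s \<in> S" "r \<in> carrier R" "A = frac s r" "t \<in> S" "q \<in> carrier R" "B = frac t q"
      by (elim L_E)
    then show "A \<otimes>\<^bsub>L\<^esub> B \<in> carrier L"
      using mult_frac_ex[of s r t q] S_mult by (auto intro!: frac_closed)
  next
    fix A assume "A \<in> carrier L"
    then obtain s r where A: "s \<in> S" "r \<in> carrier R" "A = frac s r" by (rule L_E)
    have "s \<in> carrier R" using A S_closed by auto
    then show "\<one>\<^bsub>L\<^esub> \<otimes>\<^bsub>L\<^esub> A = A" "A \<otimes>\<^bsub>L\<^esub> \<one>\<^bsub>L\<^esub> = A"
      using mult_frac[of \<one> \<one> s r s \<one>] mult_frac[of s r \<one> \<one> \<one> r] A S_one by (auto simp: one_L)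
  next
    fix A B D assume "A \<in> carrier L" "B \<in> carrier L" "D \<in> carrier L"
    then obtain s r t q v z where A: "s \<in> S" "r \<in> carrier R" "A = frac s r" and B: "t \<in> S" "q \<in> carrier R" "B = frac t q"
      and D: "v \<in> S" "z \<in> carrier R" "D = frac v z" by (elim L_E)
    obtain u' p' where u': "u' \<in> S" "p' \<in> carrier R" "u' \<otimes> q = p' \<otimes> v" using ore B D by blast
    \<comment> \<open>Rewriting against \<open>u' \<otimes> t\<close>, the denominator of the
      product of \<open>B\<close> and \<open>D\<close>, rather than against \<open>t\<close>, lets
      the same \<open>u\<close> and \<open>p\<close> compute both bracketings.\<close>
    obtain u p where u: "u \<in> S" "p \<in> carrier R" "u \<otimes> r = p \<otimes> (u' \<otimes> t)" using ore[of r "u' \<otimes> t"] A B u' S_mult by blast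
    have C: "s \<in> carrier R" "t \<in> carrier R" "v \<in> carrier R" "u \<in> carrier R" "u' \<in> carrier R"
      using A B D u u' S_closed by auto
    have "A \<otimes>\<^bsub>L\<^esub> B = frac (u \<otimes> s) (p \<otimes> u' \<otimes> q)"
      unfolding A B by (rule mult_frac) (use A B u u' C in \<open>auto simp: m_assoc\<close>)
    moreover have "frac (u \<otimes> s) (p \<otimes> u' \<otimes> q) \<otimes>\<^bsub>L\<^esub> D = frac (\<one> \<otimes> (u \<otimes> s)) (p \<otimes> p' \<otimes> z)"
      unfolding D by (rule mult_frac) (use A B D u u' C S_mult S_one in \<open>auto simp: m_assoc\<close>)
    moreover have "B \<otimes>\<^bsub>L\<^esub> D = frac (u' \<otimes> t) (p' \<otimes> z)"
      unfolding B D by (rule mult_frac) (use B D u' in auto)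
    moreover have "A \<otimes>\<^bsub>L\<^esub> frac (u' \<otimes> t) (p' \<otimes> z) = frac (u \<otimes> s) (p \<otimes> (p' \<otimes> z))"
      unfolding A by (rule mult_frac) (use A B D u u' S_mult in auto)
    ultimately show "A \<otimes>\<^bsub>L\<^esub> B \<otimes>\<^bsub>L\<^esub> D = A \<otimes>\<^bsub>L\<^esub> (B \<otimes>\<^bsub>L\<^esub> D)"
      using C u u' D by (simp add: m_assoc)
  qed
  fix A B D assume A': "A \<in> carrier L" and B': "B \<in> carrier L" and D': "D \<in> carrier L"
  show "(A \<oplus>\<^bsub>L\<^esub> B) \<otimes>\<^bsub>L\<^esub> D = A \<otimes>\<^bsub>L\<^esub> D \<oplus>\<^bsub>L\<^esub> B \<otimes>\<^bsub>L\<^esub> D"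
  proof -
    obtain s r q where A: "s \<in> S" "r \<in> carrier R" "q \<in> carrier R" "A = frac s r" "B = frac s q"
      using L2_E A' B' by blast
    obtain t z where D: "t \<in> S" "z \<in> carrier R" "D = frac t z" using L_E D' by blast
    obtain u1 p1 where u1: "u1 \<in> S" "p1 \<in> carrier R" "u1 \<otimes> r = p1 \<otimes> t" using ore A D by blast
    have u1c: "u1 \<in> carrier R" using u1 S_closed by auto
    \<comment> \<open>The second rewriting starts from \<open>u1 \<otimes> q\<close>, so that the
      single left factor \<open>u2 \<otimes> u1\<close> clears the denominator \<open>t\<close> for
      \<open>r\<close> and \<open>q\<close> simultaneously.\<close>
    obtain u2 p2 where u2: "u2 \<in> S" "p2 \<in> carrier R" "u2 \<otimes> (u1 \<otimes> q) = p2 \<otimes> t" using ore[of "u1 \<otimes> q" t] A D u1c by auto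
    have C: "s \<in> carrier R" "t \<in> carrier R" "u2 \<in> carrier R" using A D u2 S_closed by auto
    have uS: "u2 \<otimes> u1 \<in> S" using u1 u2 S_mult by auto
    have 1: "u2 \<otimes> u1 \<otimes> r = u2 \<otimes> p1 \<otimes> t" using u1 u1c C A by (simp add: m_assoc)
    have 2: "u2 \<otimes> u1 \<otimes> q = p2 \<otimes> t" using u1 u2 u1c C A by (simp add: m_assoc)
    have e1: "A \<otimes>\<^bsub>L\<^esub> D = frac (u2 \<otimes> u1 \<otimes> s) (u2 \<otimes> p1 \<otimes> z)"
      unfolding A D by (rule mult_frac) (use A D uS u1 C 1 in auto)
    have e2: "B \<otimes>\<^bsub>L\<^esub> D = frac (u2 \<otimes> u1 \<otimes> s) (p2 \<otimes> z)"
      unfolding A D by (rule mult_frac) (use A D uS u2 C 2 in auto)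
    have e3: "frac s (r \<oplus> q) \<otimes>\<^bsub>L\<^esub> D = frac (u2 \<otimes> u1 \<otimes> s) ((u2 \<otimes> p1 \<oplus> p2) \<otimes> z)"
      unfolding A D by (rule mult_frac) (use A D uS u1 u2 C 1 2 u1c in \<open>auto simp: l_distr r_distr\<close>)
    have "u2 \<otimes> u1 \<otimes> s \<in> S" using uS A S_mult by auto
    then show ?thesis using e1 e2 e3 A D u1 u2 C by (simp add: add_frac l_distr)
  qed
  show "D \<otimes>\<^bsub>L\<^esub> (A \<oplus>\<^bsub>L\<^esub> B) = D \<otimes>\<^bsub>L\<^esub> A \<oplus>\<^bsub>L\<^esub> D \<otimes>\<^bsub>L\<^esub> B"
  proof -
    obtain s r q where A: "s \<in> S" "r \<in> carrier R" "q \<in> carrier R" "A = frac s r" "B = frac s q"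
      using L2_E A' B' by blast
    obtain t z where D: "t \<in> S" "z \<in> carrier R" "D = frac t z" using L_E D' by blast
    obtain u p where u: "u \<in> S" "p \<in> carrier R" "u \<otimes> z = p \<otimes> s" using ore A D by blast
    have "u \<otimes> t \<in> S" using u D S_mult by auto
    then show ?thesis using A D u mult_frac[of t z s _ u p] by (simp add: add_frac r_distr)
  qed
qed

lemma ore_map_hom: "ore_map R S \<in> Ring.ring_hom R L"
proof (rule ring_hom_memI)
  fix x y assume "x \<in> carrier R" "y \<in> carrier R"
  then show "ore_map R S (x \<otimes> y) = ore_map R S x \<otimes>\<^bsub>L\<^esub> ore_map R S y"
    "ore_map R S (x \<oplus> y) = ore_map R S x \<oplus>\<^bsub>L\<^esub> ore_map R S y"
    using mult_frac[of \<one> x \<one> y \<one> x] S_one by (simp_all add: ore_map_eq add_frac)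
qed (use frac_closed S_one in \<open>auto simp: ore_map_eq one_L\<close>)

lemma ore_map_inverse:
  assumes "s \<in> S"
  shows "frac s \<one> \<otimes>\<^bsub>L\<^esub> ore_map R S s = \<one>\<^bsub>L\<^esub>" "ore_map R S s \<otimes>\<^bsub>L\<^esub> frac s \<one> = \<one>\<^bsub>L\<^esub>"
proof -
  have s: "s \<in> carrier R" using assms S_closed by auto
  have "frac s s = frac \<one> \<one>" using frac_scale[of \<one> \<one> s] assms s S_one by simp
  then show "frac s \<one> \<otimes>\<^bsub>L\<^esub> ore_map R S s = \<one>\<^bsub>L\<^esub>" "ore_map R S s \<otimes>\<^bsub>L\<^esub> frac s \<one> = \<one>\<^bsub>L\<^esub>"
    using mult_frac[of s \<one> \<one> s \<one> \<one>] mult_frac[of \<one> s s \<one> \<one> \<one>] assms s S_one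
    by (simp_all add: ore_map_eq one_L)
qed

lemma frac_decomp:
  assumes "s \<in> S" "r \<in> carrier R"
  shows "frac s r = frac s \<one> \<otimes>\<^bsub>L\<^esub> ore_map R S r"
  using mult_frac[of s \<one> \<one> r \<one> \<one>] assms S_closed[OF assms(1)] S_one by (simp add: ore_map_eq)

end

section \<open>Extending a module to the localization\<close>

text \<open>The fraction s^-1 r sends \<open>x\<close> to the solution \<open>y\<close> of s y = r
  x. Any pair in the class may be used; existence and uniqueness of \<open>y\<close> come from the
  bijectivity assumed in \<open>ore_set_module\<close>.\<close>

definition ore_module :: "('r, 'z) ring_scheme \<Rightarrow> 'r set \<Rightarrow> ('r, 'a, 'y) module_scheme \<Rightarrow> (('r \<times> 'r) set, 'a) module" where
  "ore_module R S M = \<lparr>carrier = carrier M, mult = mult M, one = one M, zero = zero M, add = add M,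
     smult = (\<lambda>A x. THE y. y \<in> carrier M \<and> (\<exists>s r. (s, r) \<in> A \<and> s \<odot>\<^bsub>M\<^esub> y = r \<odot>\<^bsub>M\<^esub> x))\<rparr>"

lemma ore_module_simps [simp]:
  "carrier (ore_module R S M) = carrier M" "zero (ore_module R S M) = zero M" "add (ore_module R S M) = add M"
  by (simp_all add: ore_module_def)

lemma abelian_group_cong:
  assumes "abelian_group M" "carrier N = carrier M" "add N = add M" "zero N = zero M"
  shows "abelian_group N"
proof -
  interpret M: abelian_group M by fact
  show ?thesis
  proof (rule abelian_groupI, unfold assms(2-4))
    fix x assume x: "x \<in> carrier M"
    show "\<exists>y\<in>carrier M. y \<oplus>\<^bsub>M\<^esub> x = \<zero>\<^bsub>M\<^esub>"
      by (rule bexI[of _ "\<ominus>\<^bsub>M\<^esub> x"]) (use x M.l_neg in auto)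
  qed (auto simp: M.a_ac)
qed

locale ore_set_module = ore_set R S + left_module R M
  for R :: "('r, 'z) ring_scheme" and S and M :: "('r, 'a, 'y) module_scheme" +
  assumes S_bij: "s \<in> S \<Longrightarrow> bij_betw (\<lambda>x. s \<odot>\<^bsub>M\<^esub> x) (carrier M) (carrier M)"
begin

abbreviation LM where "LM \<equiv> ore_module R S M"

lemma S_inj: "\<lbrakk>s \<in> S; x \<in> carrier M; y \<in> carrier M; s \<odot>\<^bsub>M\<^esub> x = s \<odot>\<^bsub>M\<^esub> y\<rbrakk> \<Longrightarrow> x = y"
  using S_bij unfolding bij_betw_def inj_on_def by blast

lemma S_surj:
  assumes "s \<in> S" "x \<in> carrier M" obtains y where "y \<in> carrier M" "s \<odot>\<^bsub>M\<^esub> y = x"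
  using S_bij[OF assms(1)] assms(2) unfolding bij_betw_def by (metis imageE)

text \<open>A solution for one representative solves the equation of every other one: multiply both
  equations up to the common denominator, which lies in \<open>S\<close> and therefore acts
  injectively.\<close>

lemma frac_smult_eqI:
  assumes s: "s \<in> S" "r \<in> carrier R" and x: "x \<in> carrier M" and y: "y \<in> carrier M" "s \<odot>\<^bsub>M\<^esub> y = r \<odot>\<^bsub>M\<^esub> x"
  shows "frac s r \<odot>\<^bsub>LM\<^esub> x = y"
proof -
  have "y' = y" if y': "y' \<in> carrier M" "(t, q) \<in> frac s r" "t \<odot>\<^bsub>M\<^esub> y' = q \<odot>\<^bsub>M\<^esub> x" for y' t q
  proof -
    have m: "((s, r), (t, q)) \<in> ore_rel R S" using y'(2) by (simp only: mem_frac)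
    obtain a b where ab: "a \<in> carrier R" "b \<in> carrier R" "a \<otimes>\<^bsub>R\<^esub> s = b \<otimes>\<^bsub>R\<^esub> t" "a \<otimes>\<^bsub>R\<^esub> s \<in> S"
      "a \<otimes>\<^bsub>R\<^esub> r = b \<otimes>\<^bsub>R\<^esub> q" using m unfolding ore_rel_iff by blast
    have c: "s \<in> carrier R" "t \<in> carrier R" "q \<in> carrier R" using m S_closed unfolding ore_rel_iff by blast+
    have "(a \<otimes>\<^bsub>R\<^esub> s) \<odot>\<^bsub>M\<^esub> y = a \<odot>\<^bsub>M\<^esub> (s \<odot>\<^bsub>M\<^esub> y)" by (rule smult_assoc[OF ab(1) c(1) y(1)])
    also have "\<dots> = (a \<otimes>\<^bsub>R\<^esub> r) \<odot>\<^bsub>M\<^esub> x" unfolding y(2) by (rule smult_assoc[OF ab(1) s(2) x, symmetric])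
    also have "\<dots> = b \<odot>\<^bsub>M\<^esub> (q \<odot>\<^bsub>M\<^esub> x)" unfolding ab(5) by (rule smult_assoc[OF ab(2) c(3) x])
    also have "\<dots> = (b \<otimes>\<^bsub>R\<^esub> t) \<odot>\<^bsub>M\<^esub> y'" unfolding y'(3)[symmetric] by (rule smult_assoc[OF ab(2) c(2) y'(1), symmetric])
    finally show ?thesis using S_inj[OF ab(4) y(1) y'(1)] unfolding ab(3) by simp
  qed
  then have "(THE y. y \<in> carrier M \<and> (\<exists>t q. (t, q) \<in> frac s r \<and> t \<odot>\<^bsub>M\<^esub> y = q \<odot>\<^bsub>M\<^esub> x)) = y"
    using y frac_self[OF s] by (intro the_equality) blast+
  then show ?thesis by (simp add: ore_module_def)
qed

lemma frac_smult:
  assumes s: "s \<in> S" "r \<in> carrier R" and x: "x \<in> carrier M"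
  shows "frac s r \<odot>\<^bsub>LM\<^esub> x \<in> carrier M" "s \<odot>\<^bsub>M\<^esub> (frac s r \<odot>\<^bsub>LM\<^esub> x) = r \<odot>\<^bsub>M\<^esub> x"
proof -
  obtain y where "y \<in> carrier M" "s \<odot>\<^bsub>M\<^esub> y = r \<odot>\<^bsub>M\<^esub> x"
    using S_surj[OF s(1) smult_closed[OF s(2) x]] .
  then show "frac s r \<odot>\<^bsub>LM\<^esub> x \<in> carrier M" "s \<odot>\<^bsub>M\<^esub> (frac s r \<odot>\<^bsub>LM\<^esub> x) = r \<odot>\<^bsub>M\<^esub> x"
    using frac_smult_eqI[OF s x] by simp_all
qed

lemma ore_map_smult:
  assumes "r \<in> carrier R" "x \<in> carrier M"
  shows "ore_map R S r \<odot>\<^bsub>LM\<^esub> x = r \<odot>\<^bsub>M\<^esub> x"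
  unfolding ore_map_eq
  by (rule frac_smult_eqI) (use assms S_one smult_closed smult_one in auto)

lemma ore_left_module: "left_module L LM"
proof -
  interpret L: ring L by (rule L_ring)
  interpret LM: abelian_group LM by (rule abelian_group_cong[OF M.abelian_group_axioms]) auto
  show ?thesis
  proof (unfold_locales, unfold ore_module_simps)
    fix A x assume "A \<in> carrier L" "x \<in> carrier M"
    then show "A \<odot>\<^bsub>LM\<^esub> x \<in> carrier M" using frac_smult L_E by metis
  next
    fix A B x assume A: "A \<in> carrier L" and B: "B \<in> carrier L" and x: "x \<in> carrier M"
    obtain s r q where s: "s \<in> S" "r \<in> carrier R" "q \<in> carrier R" "A = frac s r" "B = frac s q"
      using L2_E[OF A B] .
    show "(A \<oplus>\<^bsub>L\<^esub> B) \<odot>\<^bsub>LM\<^esub> x = A \<odot>\<^bsub>LM\<^esub> x \<oplus>\<^bsub>M\<^esub> B \<odot>\<^bsub>LM\<^esub> x"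
      unfolding s(4,5) add_frac[OF s(1-3)]
      by (rule frac_smult_eqI)
        (use s x S_closed in \<open>auto simp: frac_smult smult_r_distr smult_l_distr\<close>)
  next
    fix A x y assume "A \<in> carrier L" and x: "x \<in> carrier M" "y \<in> carrier M"
    then obtain s r where s: "s \<in> S" "r \<in> carrier R" "A = frac s r" using L_E by metis
    show "A \<odot>\<^bsub>LM\<^esub> (x \<oplus>\<^bsub>M\<^esub> y) = A \<odot>\<^bsub>LM\<^esub> x \<oplus>\<^bsub>M\<^esub> A \<odot>\<^bsub>LM\<^esub> y"
      unfolding s(3)
      by (rule frac_smult_eqI)
        (use s x S_closed in \<open>auto simp: frac_smult smult_r_distr\<close>)
  next
    fix A B x assume "A \<in> carrier L" "B \<in> carrier L" and x: "x \<in> carrier M"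
    then obtain s r t q where s: "s \<in> S" "r \<in> carrier R" "A = frac s r" and t: "t \<in> S" "q \<in> carrier R" "B = frac t q"
      by (elim L_E)
    obtain u p where u: "u \<in> S" "p \<in> carrier R" "u \<otimes>\<^bsub>R\<^esub> r = p \<otimes>\<^bsub>R\<^esub> t" using ore[OF s(2) t(1)] by blast
    note c = S_closed[OF s(1)] S_closed[OF t(1)] S_closed[OF u(1)]
    note B = frac_smult[OF t(1,2) x] note A = frac_smult[OF s(1,2) B(1)]
    have "(u \<otimes>\<^bsub>R\<^esub> s) \<odot>\<^bsub>M\<^esub> (frac s r \<odot>\<^bsub>LM\<^esub> (frac t q \<odot>\<^bsub>LM\<^esub> x)) = (u \<otimes>\<^bsub>R\<^esub> r) \<odot>\<^bsub>M\<^esub> (frac t q \<odot>\<^bsub>LM\<^esub> x)"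
      unfolding smult_assoc[OF c(3,1) A(1)] A(2) by (rule smult_assoc[OF c(3) s(2) B(1), symmetric])
    also have "\<dots> = (p \<otimes>\<^bsub>R\<^esub> q) \<odot>\<^bsub>M\<^esub> x"
      unfolding u(3) smult_assoc[OF u(2) c(2) B(1)] B(2) by (rule smult_assoc[OF u(2) t(2) x, symmetric])
    finally show "(A \<otimes>\<^bsub>L\<^esub> B) \<odot>\<^bsub>LM\<^esub> x = A \<odot>\<^bsub>LM\<^esub> (B \<odot>\<^bsub>LM\<^esub> x)"
      unfolding s(3) t(3) mult_frac[OF s(1,2) t(1,2) u]
      by (intro frac_smult_eqI S_mult u s m_closed t x A(1))
  next
    fix x assume x: "x \<in> carrier M"
    show "\<one>\<^bsub>L\<^esub> \<odot>\<^bsub>LM\<^esub> x = x"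
      unfolding one_L by (rule frac_smult_eqI) (use S_one x in auto)
  qed
qed

end

section \<open>Modules over the enveloping algebra\<close>

lemma free_algebra_simps [simp]:
  "f \<oplus>\<^bsub>free_algebra X\<^esub> g = (\<lambda>w. f w + g w)"
  "f \<otimes>\<^bsub>free_algebra X\<^esub> g = (\<lambda>w. \<Sum>k\<le>length w. f (take k w) * g (drop k w))"
  "\<one>\<^bsub>free_algebra X\<^esub> = (\<lambda>w. if w = [] then 1 else 0)"
  "\<zero>\<^bsub>free_algebra X\<^esub> = (\<lambda>w. 0)"
  by (simp_all add: free_algebra_def)

lemma free_algebra_mem:
  "f \<in> carrier (free_algebra X) \<longleftrightarrow> finite {w. f w \<noteq> 0} \<and> (\<forall>w. f w \<noteq> 0 \<longrightarrow> set w \<subseteq> X)"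
  by (auto simp: free_algebra_def)

lemma free_mult_supp:
  assumes "(\<Sum>k\<le>length w. f (take k w) * g (drop k w)) \<noteq> (0::complex)"
  shows "w \<in> (\<lambda>(u, v). u @ v) ` ({w. f w \<noteq> 0} \<times> {w. g w \<noteq> 0})"
proof -
  obtain k where "f (take k w) * g (drop k w) \<noteq> 0"
    using assms by (meson sum.neutral)
  then show ?thesis by (auto intro!: image_eqI[of _ _ "(take k w, drop k w)"])
qed

lemma free_algebra_closed:
  assumes "f \<in> carrier (free_algebra X)" "g \<in> carrier (free_algebra X)"
  shows "f \<oplus>\<^bsub>free_algebra X\<^esub> g \<in> carrier (free_algebra X)" "f \<otimes>\<^bsub>free_algebra X\<^esub> g \<in> carrier (free_algebra X)"
proof -
  have "{w. f w + g w \<noteq> 0} \<subseteq> {w. f w \<noteq> 0} \<union> {w. g w \<noteq> 0}" by auto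
  then have "finite {w. f w + g w \<noteq> 0}"
    by (rule finite_subset) (use assms in \<open>simp add: free_algebra_mem\<close>)
  moreover have "set w \<subseteq> X" if "f w + g w \<noteq> 0" for w
    using that assms unfolding free_algebra_mem by (cases "f w = 0") auto
  ultimately show "f \<oplus>\<^bsub>free_algebra X\<^esub> g \<in> carrier (free_algebra X)"
    by (simp add: free_algebra_mem)
  have sub: "{w. (\<Sum>k\<le>length w. f (take k w) * g (drop k w)) \<noteq> 0} \<subseteq> (\<lambda>(u, v). u @ v) ` ({w. f w \<noteq> 0} \<times> {w. g w \<noteq> 0})"
    using free_mult_supp by blast
  have "finite {w. (\<Sum>k\<le>length w. f (take k w) * g (drop k w)) \<noteq> 0}"
    by (rule finite_subset[OF sub]) (use assms in \<open>simp add: free_algebra_mem\<close>)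
  moreover have "set w \<subseteq> X" if nz: "(\<Sum>k\<le>length w. f (take k w) * g (drop k w)) \<noteq> 0" for w
  proof -
    obtain u v where "w = u @ v" "f u \<noteq> 0" "g v \<noteq> 0" using free_mult_supp[OF nz] by auto
    then show ?thesis using assms by (simp add: free_algebra_mem)
  qed
  ultimately show "f \<otimes>\<^bsub>free_algebra X\<^esub> g \<in> carrier (free_algebra X)"
    by (simp add: free_algebra_mem)
qed

lemma free_mult_assoc:
  fixes f g h :: "'x list \<Rightarrow> complex"
  shows "(\<Sum>k\<le>length w. (\<Sum>j\<le>length (take k w). f (take j (take k w)) * g (drop j (take k w))) * h (drop k w)) =
    (\<Sum>j\<le>length w. f (take j w) * (\<Sum>k\<le>length (drop j w). g (take k (drop j w)) * h (drop k (drop j w))))"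
proof -
  let ?n = "length w"
  have "(\<Sum>k\<le>?n. (\<Sum>j\<le>length (take k w). f (take j (take k w)) * g (drop j (take k w))) * h (drop k w)) =
    (\<Sum>k\<le>?n. \<Sum>j\<le>k. f (take j w) * g (take (k - j) (drop j w)) * h (drop k w))"
    by (intro sum.cong refl) (auto simp: sum_distrib_right min_def drop_take intro!: sum.cong)
  also have "\<dots> = (\<Sum>(k, j)\<in>(SIGMA k:{..?n}. {..k}). f (take j w) * g (take (k - j) (drop j w)) * h (drop k w))"
    by (rule sum.Sigma) auto
  \<comment> \<open>A factorization of the word into three pieces, given by two cuts
    \<open>j\<close> and \<open>k\<close>, is described by the first cut \<open>j\<close> and the
    length \<open>i = k - j\<close> of the middle piece.\<close>
  also have "\<dots> = (\<Sum>(j, i)\<in>(SIGMA j:{..?n}. {..?n - j}). f (take j w) * g (take i (drop j w)) * h (drop (i + j) w))"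
    by (rule sum.reindex_bij_witness[of _ "\<lambda>(j, i). (i + j, j)" "\<lambda>(k, j). (j, k - j)"]) auto
  also have "\<dots> = (\<Sum>j\<le>?n. \<Sum>i\<le>?n - j. f (take j w) * g (take i (drop j w)) * h (drop (i + j) w))"
    by (rule sum.Sigma[symmetric]) auto
  also have "\<dots> = (\<Sum>j\<le>?n. f (take j w) * (\<Sum>k\<le>length (drop j w). g (take k (drop j w)) * h (drop k (drop j w))))"
    by (intro sum.cong refl) (auto simp: sum_distrib_left mult.assoc add.commute)
  finally show ?thesis .
qed

lemma free_algebra_ring: "ring (free_algebra X)"
proof (rule ringI)
  show "abelian_group (free_algebra X)"
  proof (rule abelian_groupI)
    fix f assume "f \<in> carrier (free_algebra X)"
    then show "\<exists>g\<in>carrier (free_algebra X). g \<oplus>\<^bsub>free_algebra X\<^esub> f = \<zero>\<^bsub>free_algebra X\<^esub>"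
      by (intro bexI[of _ "\<lambda>w. - f w"]) (auto simp: free_algebra_mem)
  next
    show "f \<oplus>\<^bsub>free_algebra X\<^esub> g \<in> carrier (free_algebra X)"
      if "f \<in> carrier (free_algebra X)" "g \<in> carrier (free_algebra X)" for f g
      by (rule free_algebra_closed(1)[OF that])
  qed (auto simp: fun_eq_iff free_algebra_mem)
  show "Group.monoid (free_algebra X)"
  proof (rule monoidI)
    fix f g h :: "'a list \<Rightarrow> complex"
    show "f \<otimes>\<^bsub>free_algebra X\<^esub> g \<otimes>\<^bsub>free_algebra X\<^esub> h = f \<otimes>\<^bsub>free_algebra X\<^esub> (g \<otimes>\<^bsub>free_algebra X\<^esub> h)"
      unfolding free_algebra_simps by (rule ext) (rule free_mult_assoc)
  next
    fix f :: "'a list \<Rightarrow> complex"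
    have "(\<Sum>k\<le>length w. (if take k w = [] then 1 else 0) * f (drop k w)) = f w" for w
    proof -
      have "(\<Sum>k\<le>length w. (if take k w = [] then 1 else 0) * f (drop k w)) = (\<Sum>k\<in>{0}. f (drop k w))"
        by (rule sum.mono_neutral_cong_right) auto
      then show ?thesis by simp
    qed
    then show "\<one>\<^bsub>free_algebra X\<^esub> \<otimes>\<^bsub>free_algebra X\<^esub> f = f" by simp
    have "(\<Sum>k\<le>length w. f (take k w) * (if drop k w = [] then 1 else 0)) = f w" for w
    proof -
      have "(\<Sum>k\<le>length w. f (take k w) * (if drop k w = [] then 1 else 0)) = (\<Sum>k\<in>{length w}. f (take k w))"
        by (rule sum.mono_neutral_cong_right) auto
      then show ?thesis by simp
    qed
    then show "f \<otimes>\<^bsub>free_algebra X\<^esub> \<one>\<^bsub>free_algebra X\<^esub> = f" by simp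
  next
    show "\<one>\<^bsub>free_algebra X\<^esub> \<in> carrier (free_algebra X)" by (simp add: free_algebra_mem)
  qed (rule free_algebra_closed(2))
qed (simp_all only: free_algebra_simps distrib_left distrib_right sum.distrib)

definition free_monom :: "complex \<Rightarrow> 'x list \<Rightarrow> 'x list \<Rightarrow> complex" where
  "free_monom c u = (\<lambda>w. if w = u then c else 0)"

lemma free_monom_closed: "u \<in> lists X \<Longrightarrow> free_monom c u \<in> carrier (free_algebra X)"
  by (auto simp: free_monom_def free_algebra_mem)

lemma free_gen_closed: "x \<in> X \<Longrightarrow> free_gen x \<in> carrier (free_algebra X)"
  by (auto simp: free_gen_def free_algebra_mem)

lemma free_scalar_closed: "free_scalar c \<in> carrier (free_algebra X)"
  by (auto simp: free_scalar_def free_algebra_mem)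

lemma free_scalar_mult: "free_scalar c \<otimes>\<^bsub>free_algebra X\<^esub> f = (\<lambda>w. c * f w)"
proof
  fix w
  have "(\<Sum>k\<le>length w. free_scalar c (take k w) * f (drop k w)) = (\<Sum>k\<in>{0}. c * f (drop k w))"
    by (rule sum.mono_neutral_cong_right) (auto simp: free_scalar_def)
  then show "(free_scalar c \<otimes>\<^bsub>free_algebra X\<^esub> f) w = c * f w" by simp
qed

lemma free_mult_scalar: "f \<otimes>\<^bsub>free_algebra X\<^esub> free_scalar c = (\<lambda>w. c * f w)"
proof
  fix w
  have "(\<Sum>k\<le>length w. f (take k w) * free_scalar c (drop k w)) = (\<Sum>k\<in>{length w}. c * f (take k w))"
    by (rule sum.mono_neutral_cong_right) (auto simp: free_scalar_def)
  then show "(f \<otimes>\<^bsub>free_algebra X\<^esub> free_scalar c) w = c * f w" by simp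
qed

lemma free_scalar_comm: "f \<otimes>\<^bsub>free_algebra X\<^esub> free_scalar c = free_scalar c \<otimes>\<^bsub>free_algebra X\<^esub> f"
  by (simp only: free_scalar_mult free_mult_scalar)

lemma free_monom_Nil: "free_monom c [] = free_scalar c"
  by (auto simp: free_monom_def free_scalar_def)

lemma free_gen_mult_monom: "free_gen x \<otimes>\<^bsub>free_algebra X\<^esub> free_monom c u = free_monom c (x # u)"
proof
  fix w
  have "(\<Sum>k\<le>length w. free_gen x (take k w) * free_monom c u (drop k w)) = free_monom c (x # u) w"
  proof (cases w)
    case (Cons y v)
    have "(\<Sum>k\<le>length w. free_gen x (take k w) * free_monom c u (drop k w)) =
       (\<Sum>k\<in>{1}. free_gen x (take k w) * free_monom c u (drop k w))"
      by (rule sum.mono_neutral_right) (auto simp: Cons free_gen_def take_Cons split: nat.splits)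
    then show ?thesis by (auto simp: free_gen_def free_monom_def Cons)
  qed (auto simp: free_gen_def free_monom_def)
  then show "(free_gen x \<otimes>\<^bsub>free_algebra X\<^esub> free_monom c u) w = free_monom c (x # u) w" by simp
qed

lemma free_algebra_sum_induct [consumes 1, case_names zero add]:
  assumes f: "f \<in> carrier (free_algebra X)"
    and zero: "P \<zero>\<^bsub>free_algebra X\<^esub>"
    and step: "\<And>c u g. \<lbrakk>u \<in> lists X; g \<in> carrier (free_algebra X); P g\<rbrakk> \<Longrightarrow> P (free_monom c u \<oplus>\<^bsub>free_algebra X\<^esub> g)"
  shows "P f"
proof -
  have "finite S \<Longrightarrow> (\<And>f. f \<in> carrier (free_algebra X) \<Longrightarrow> {w. f w \<noteq> 0} \<subseteq> S \<Longrightarrow> P f)" for S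
  proof (induction S rule: finite_induct)
    case empty
    then have "f = (\<lambda>w. 0)" by auto
    then show ?case using zero by simp
  next
    case (insert u S)
    define g where "g = f(u := 0)"
    have sub: "{w. g w \<noteq> 0} \<subseteq> {w. f w \<noteq> 0}" "{w. g w \<noteq> 0} \<subseteq> S" using insert.prems by (auto simp: g_def)
    have g: "g \<in> carrier (free_algebra X)"
      using insert.prems(1) finite_subset[OF sub(1)] by (auto simp: free_algebra_mem g_def)
    then have Pg: "P g" using sub(2) by (rule insert.IH)
    have "f = free_monom (f u) u \<oplus>\<^bsub>free_algebra X\<^esub> g" by (auto simp: free_monom_def g_def)
    moreover have "u \<in> lists X \<or> f = g" using insert.prems(1) by (auto simp: g_def free_algebra_mem fun_eq_iff)
    ultimately show ?case using step[of u g "f u"] g Pg by auto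
  qed
  from this[OF _ f order.refl] show ?thesis using f by (simp add: free_algebra_mem)
qed

lemma free_algebra_induct [consumes 1, case_names scalar gen add mult]:
  assumes f: "f \<in> carrier (free_algebra X)"
    and scalar: "\<And>c. P (free_scalar c)"
    and gen: "\<And>x. x \<in> X \<Longrightarrow> P (free_gen x)"
    and add: "\<And>f g. \<lbrakk>f \<in> carrier (free_algebra X); g \<in> carrier (free_algebra X); P f; P g\<rbrakk> \<Longrightarrow> P (f \<oplus>\<^bsub>free_algebra X\<^esub> g)"
    and mult: "\<And>f g. \<lbrakk>f \<in> carrier (free_algebra X); g \<in> carrier (free_algebra X); P f; P g\<rbrakk> \<Longrightarrow> P (f \<otimes>\<^bsub>free_algebra X\<^esub> g)"
  shows "P f"
proof (rule free_algebra_sum_induct[OF f])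
  have "\<zero>\<^bsub>free_algebra X\<^esub> = (free_scalar 0 :: 'a list \<Rightarrow> complex)" by (auto simp: free_scalar_def)
  then show "P \<zero>\<^bsub>free_algebra X\<^esub>" using scalar[of 0] by (simp only:)
  have mono: "P (free_monom c u)" if "u \<in> lists X" for c u
    using that
  proof (induction u)
    case Nil
    show ?case using scalar[of c] by (simp only: free_monom_Nil)
  next
    case (Cons x u)
    then show ?case
      using mult[OF free_gen_closed[OF Cons.hyps(1)] free_monom_closed[OF Cons.hyps(2)] gen[OF Cons.hyps(1)] Cons.IH]
      by (simp only: free_gen_mult_monom)
  qed
  show "P (free_monom c u \<oplus>\<^bsub>free_algebra X\<^esub> g)"
    if "u \<in> lists X" "g \<in> carrier (free_algebra X)" "P g" for c u g
    using free_monom_closed[OF that(1)] that(2) mono[OF that(1)] that(3) by (rule add)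
qed

declare free_algebra_simps [simp del]

section \<open>The enveloping algebra by generators and relations\<close>

text \<open>Precisely what puts the defining relations into the free algebra on the carrier; the
  quotient can be formed for any operations with these closure properties.\<close>

locale lie_ops =
  fixes L :: "(complex, 'g, 'z) lie_algebra_scheme"
  assumes lie_add_closed: "\<lbrakk>x \<in> carrier L; y \<in> carrier L\<rbrakk> \<Longrightarrow> x \<oplus>\<^bsub>L\<^esub> y \<in> carrier L"
    and lie_smult_closed: "x \<in> carrier L \<Longrightarrow> c \<odot>\<^bsub>L\<^esub> x \<in> carrier L"
    and lie_bracket_closed: "\<lbrakk>x \<in> carrier L; y \<in> carrier L\<rbrakk> \<Longrightarrow> bracket L x y \<in> carrier L"
begin

abbreviation F where "F \<equiv> free_algebra (carrier L)"
abbreviation U where "U \<equiv> uea L"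

sublocale F: ring F by (rule free_algebra_ring)

definition proj :: "('g list \<Rightarrow> complex) \<Rightarrow> ('g list \<Rightarrow> complex) set" where
  "proj f = uea_ideal L +>\<^bsub>F\<^esub> f"

lemma uea_relations_sub: "uea_relations L \<subseteq> carrier F"
  unfolding uea_relations_def Let_def
  using free_gen_closed[of _ "carrier L"] free_scalar_closed[of _ "carrier L"]
  by (auto simp: lie_add_closed lie_smult_closed lie_bracket_closed)

lemma uea_ideal_ideal: "ideal (uea_ideal L) F"
  unfolding uea_ideal_def by (rule F.genideal_ideal[OF uea_relations_sub])

sublocale U: ring U
  unfolding uea_def by (rule ideal.quotient_is_ring[OF uea_ideal_ideal])

lemma proj_hom: "proj \<in> Ring.ring_hom F U"
  unfolding uea_def proj_def[abs_def] by (rule ideal.rcos_ring_hom[OF uea_ideal_ideal])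

lemma proj_closed: "f \<in> carrier F \<Longrightarrow> proj f \<in> carrier U"
  and proj_mult: "\<lbrakk>f \<in> carrier F; g \<in> carrier F\<rbrakk> \<Longrightarrow> proj (f \<otimes>\<^bsub>F\<^esub> g) = proj f \<otimes>\<^bsub>U\<^esub> proj g"
  and proj_add: "\<lbrakk>f \<in> carrier F; g \<in> carrier F\<rbrakk> \<Longrightarrow> proj (f \<oplus>\<^bsub>F\<^esub> g) = proj f \<oplus>\<^bsub>U\<^esub> proj g"
  and proj_one: "proj \<one>\<^bsub>F\<^esub> = \<one>\<^bsub>U\<^esub>"
  by (rule ring_hom_closed[OF proj_hom] ring_hom_mult[OF proj_hom] ring_hom_add[OF proj_hom] ring_hom_one[OF proj_hom]; assumption)+

lemma uea_carrierE:
  assumes "a \<in> carrier U" obtains f where "f \<in> carrier F" "a = proj f"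
  using assms by (auto simp: uea_def FactRing_def A_RCOSETS_def' proj_def)

lemma proj_eq_iff: "\<lbrakk>f \<in> carrier F; g \<in> carrier F\<rbrakk> \<Longrightarrow> proj f = proj g \<longleftrightarrow> f \<ominus>\<^bsub>F\<^esub> g \<in> uea_ideal L"
  unfolding proj_def by (rule F.quotient_eq_iff_same_a_r_cos[OF uea_ideal_ideal, symmetric])

lemma uea_gen_proj: "uea_gen L x = proj (free_gen x)" and uea_scalar_proj: "uea_scalar L c = proj (free_scalar c)"
  by (simp_all add: uea_gen_def uea_scalar_def proj_def)

lemma uea_gen_closed: "x \<in> carrier L \<Longrightarrow> uea_gen L x \<in> carrier U"
  unfolding uea_gen_proj by (intro proj_closed free_gen_closed)

lemma uea_scalar_closed: "uea_scalar L c \<in> carrier U"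
  unfolding uea_scalar_proj by (intro proj_closed free_scalar_closed)

lemma relation_eq:
  assumes "f \<ominus>\<^bsub>F\<^esub> g \<in> uea_relations L" "f \<in> carrier F" "g \<in> carrier F"
  shows "proj f = proj g"
  using assms F.genideal_self[OF uea_relations_sub] by (simp add: proj_eq_iff uea_ideal_def subset_iff)

lemma uea_gen_smult:
  assumes "x \<in> carrier L"
  shows "uea_gen L (c \<odot>\<^bsub>L\<^esub> x) = uea_scalar L c \<otimes>\<^bsub>U\<^esub> uea_gen L x"
proof -
  note c = free_gen_closed[OF assms(1)] free_gen_closed[OF lie_smult_closed[OF assms, of c]] free_scalar_closed[of c "carrier L"]
  have "proj (free_gen (c \<odot>\<^bsub>L\<^esub> x)) = proj (free_scalar c \<otimes>\<^bsub>F\<^esub> free_gen x)"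
    by (rule relation_eq) (use assms c in \<open>auto simp: uea_relations_def Let_def\<close>)
  then show ?thesis by (simp add: uea_gen_proj uea_scalar_proj proj_mult c)
qed

lemma uea_gen_commute:
  assumes "x \<in> carrier L" "y \<in> carrier L"
  shows "uea_gen L x \<otimes>\<^bsub>U\<^esub> uea_gen L y = uea_gen L (bracket L x y) \<oplus>\<^bsub>U\<^esub> uea_gen L y \<otimes>\<^bsub>U\<^esub> uea_gen L x"
proof -
  let ?x = "free_gen x" and ?y = "free_gen y" and ?b = "free_gen (bracket L x y)"
  note c = free_gen_closed[OF assms(1)] free_gen_closed[OF assms(2)] free_gen_closed[OF lie_bracket_closed[OF assms]]
  have 1: "proj (?x \<otimes>\<^bsub>F\<^esub> ?y \<ominus>\<^bsub>F\<^esub> ?y \<otimes>\<^bsub>F\<^esub> ?x) = proj ?b"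
  proof (rule relation_eq)
    show "?x \<otimes>\<^bsub>F\<^esub> ?y \<ominus>\<^bsub>F\<^esub> ?y \<otimes>\<^bsub>F\<^esub> ?x \<ominus>\<^bsub>F\<^esub> ?b \<in> uea_relations L"
      unfolding uea_relations_def Let_def using assms by blast
  qed (use c in simp_all)
  have "?x \<otimes>\<^bsub>F\<^esub> ?y = (?x \<otimes>\<^bsub>F\<^esub> ?y \<ominus>\<^bsub>F\<^esub> ?y \<otimes>\<^bsub>F\<^esub> ?x) \<oplus>\<^bsub>F\<^esub> ?y \<otimes>\<^bsub>F\<^esub> ?x"
    using c by (simp add: a_minus_def F.a_assoc F.l_neg)
  from arg_cong[OF this, of proj]
  have "proj (?x \<otimes>\<^bsub>F\<^esub> ?y) = proj (?x \<otimes>\<^bsub>F\<^esub> ?y \<ominus>\<^bsub>F\<^esub> ?y \<otimes>\<^bsub>F\<^esub> ?x) \<oplus>\<^bsub>U\<^esub> proj (?y \<otimes>\<^bsub>F\<^esub> ?x)"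
    by (rule trans, intro proj_add F.minus_closed F.m_closed c(1,2))
  then show ?thesis unfolding 1 by (simp add: uea_gen_proj proj_mult c)
qed

lemma uea_scalar_central:
  assumes "a \<in> carrier U"
  shows "a \<otimes>\<^bsub>U\<^esub> uea_scalar L c = uea_scalar L c \<otimes>\<^bsub>U\<^esub> a"
proof -
  obtain f where f: "f \<in> carrier F" "a = proj f" using assms by (rule uea_carrierE)
  have "proj (f \<otimes>\<^bsub>F\<^esub> free_scalar c) = proj (free_scalar c \<otimes>\<^bsub>F\<^esub> f)"
    by (rule arg_cong[OF free_scalar_comm])
  then show ?thesis
    unfolding f(2) uea_scalar_proj proj_mult[OF f(1) free_scalar_closed] proj_mult[OF free_scalar_closed f(1)] .
qed

lemma uea_scalar_zero: "uea_scalar L 0 = \<zero>\<^bsub>U\<^esub>"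
proof -
  have "free_scalar 0 = \<zero>\<^bsub>F\<^esub>" by (auto simp: free_scalar_def free_algebra_simps)
  then have "uea_scalar L 0 = proj \<zero>\<^bsub>F\<^esub>" by (simp only: uea_scalar_proj)
  also have "\<dots> = \<zero>\<^bsub>U\<^esub>"
    using proj_hom F.ring_axioms U.ring_axioms by (rule ring_hom_zero)
  finally show ?thesis .
qed

lemma uea_induct [consumes 1, case_names scalar gen add mult]:
  assumes a: "a \<in> carrier U"
    and scalar: "\<And>c. P (uea_scalar L c)"
    and gen: "\<And>x. x \<in> carrier L \<Longrightarrow> P (uea_gen L x)"
    and add: "\<And>a b. \<lbrakk>a \<in> carrier U; b \<in> carrier U; P a; P b\<rbrakk> \<Longrightarrow> P (a \<oplus>\<^bsub>U\<^esub> b)"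
    and mult: "\<And>a b. \<lbrakk>a \<in> carrier U; b \<in> carrier U; P a; P b\<rbrakk> \<Longrightarrow> P (a \<otimes>\<^bsub>U\<^esub> b)"
  shows "P a"
proof -
  obtain f where f: "f \<in> carrier F" "a = proj f" using a by (rule uea_carrierE)
  from f(1) have "P (proj f)"
  proof (induction rule: free_algebra_induct)
    case (scalar c)
    show ?case using assms(2)[of c] by (simp only: uea_scalar_proj)
  next
    case (gen x)
    show ?case using assms(3)[OF gen] by (simp only: uea_gen_proj)
  next
    case (add f g)
    show ?case using assms(4)[OF proj_closed[OF add(1)] proj_closed[OF add(2)] add(3,4)] by (simp only: proj_add[OF add(1,2)])
  next
    case (mult f g)
    show ?case using assms(5)[OF proj_closed[OF mult(1)] proj_closed[OF mult(2)] mult(3,4)] by (simp only: proj_mult[OF mult(1,2)])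
  qed
  then show ?thesis by (simp only: f(2))
qed

end

section \<open>Lie algebra modules as modules over the enveloping algebra\<close>

definition free_act :: "('g, 'v, 'y) lie_rep_scheme \<Rightarrow> ('g list \<Rightarrow> complex) \<Rightarrow> 'v \<Rightarrow> 'v" where
  "free_act V f v = (\<Oplus>\<^bsub>V\<^esub>w\<in>{w. f w \<noteq> 0}. f w \<odot>\<^bsub>V\<^esub> foldr (act V) w v)"

text \<open>A class acts through an arbitrarily chosen representative in the free algebra. That the
  choice is immaterial is \<open>uea_module_proj\<close>, which rests on
  \<open>uea_ideal_act\<close>.\<close>

definition uea_module :: "(complex, 'g, 'z) lie_algebra_scheme \<Rightarrow> ('g, 'v, 'y) lie_rep_scheme \<Rightarrow> (('g list \<Rightarrow> complex) set, 'v) module" where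
  "uea_module L V = \<lparr>carrier = carrier V, mult = mult V, one = one V, zero = zero V, add = add V,
     smult = (\<lambda>a v. free_act V (SOME f. f \<in> carrier (free_algebra (carrier L)) \<and>
        a = uea_ideal L +>\<^bsub>free_algebra (carrier L)\<^esub> f) v)\<rparr>"

lemma uea_module_simps [simp]:
  "carrier (uea_module L V) = carrier V" "zero (uea_module L V) = zero V" "add (uea_module L V) = add V"
  by (simp_all add: uea_module_def)

context lie_module begin

lemma smult_add_left: "v \<in> carrier V \<Longrightarrow> (a + b) \<odot>\<^bsub>V\<^esub> v = a \<odot>\<^bsub>V\<^esub> v \<oplus>\<^bsub>V\<^esub> b \<odot>\<^bsub>V\<^esub> v"
  using smult_l_distr[of a b v] by simp

lemma smult_smult: "v \<in> carrier V \<Longrightarrow> a \<odot>\<^bsub>V\<^esub> (b \<odot>\<^bsub>V\<^esub> v) = (a * b) \<odot>\<^bsub>V\<^esub> v"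
  using smult_assoc1[of a b v] by simp

lemma one_smult: "v \<in> carrier V \<Longrightarrow> 1 \<odot>\<^bsub>V\<^esub> v = v"
  using smult_one[of v] by simp

lemma scale_closed: "v \<in> carrier V \<Longrightarrow> a \<odot>\<^bsub>V\<^esub> v \<in> carrier V"
  by (rule smult_closed) auto

lemma scale_add_right: "\<lbrakk>v \<in> carrier V; w \<in> carrier V\<rbrakk> \<Longrightarrow> a \<odot>\<^bsub>V\<^esub> (v \<oplus>\<^bsub>V\<^esub> w) = a \<odot>\<^bsub>V\<^esub> v \<oplus>\<^bsub>V\<^esub> a \<odot>\<^bsub>V\<^esub> w"
  by (rule smult_r_distr) auto

lemma zero_scale: "v \<in> carrier V \<Longrightarrow> 0 \<odot>\<^bsub>V\<^esub> v = \<zero>\<^bsub>V\<^esub>"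
  using smult_l_null[of v] by simp

lemma word_closed: "\<lbrakk>w \<in> lists (carrier L); v \<in> carrier V\<rbrakk> \<Longrightarrow> foldr (act V) w v \<in> carrier V"
  by (induction w) (auto intro: act_closed)

lemma word_add: "\<lbrakk>w \<in> lists (carrier L); u \<in> carrier V; v \<in> carrier V\<rbrakk> \<Longrightarrow>
   foldr (act V) w (u \<oplus>\<^bsub>V\<^esub> v) = foldr (act V) w u \<oplus>\<^bsub>V\<^esub> foldr (act V) w v"
  by (induction w) (auto simp: word_closed act_add_right)

lemma word_smult: "\<lbrakk>w \<in> lists (carrier L); v \<in> carrier V\<rbrakk> \<Longrightarrow>
   foldr (act V) w (c \<odot>\<^bsub>V\<^esub> v) = c \<odot>\<^bsub>V\<^esub> foldr (act V) w v"
  by (induction w) (auto simp: word_closed act_smult_right)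

abbreviation FL where "FL \<equiv> free_algebra (carrier L)"

lemma free_memD: "f \<in> carrier FL \<Longrightarrow> f w \<noteq> 0 \<Longrightarrow> w \<in> lists (carrier L)"
  by (auto simp: free_algebra_mem)

lemma term_closed: "\<lbrakk>f \<in> carrier FL; v \<in> carrier V\<rbrakk> \<Longrightarrow> f w \<noteq> 0 \<Longrightarrow> f w \<odot>\<^bsub>V\<^esub> foldr (act V) w v \<in> carrier V"
  by (intro scale_closed word_closed free_memD)

lemma free_act_closed: "\<lbrakk>f \<in> carrier FL; v \<in> carrier V\<rbrakk> \<Longrightarrow> free_act V f v \<in> carrier V"
  unfolding free_act_def by (rule M.finsum_closed) (auto intro: term_closed)

text \<open>Sums over different supports become comparable once they are extended to one finite set,
  the added terms being zero. The same device serves \<open>ev\<close> and the coordinate map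
  \<open>T\<close> later on.\<close>

lemma free_act_superset:
  assumes "f \<in> carrier FL" "v \<in> carrier V" "finite A" "{w. f w \<noteq> 0} \<subseteq> A" "A \<subseteq> lists (carrier L)"
  shows "free_act V f v = (\<Oplus>\<^bsub>V\<^esub>w\<in>A. f w \<odot>\<^bsub>V\<^esub> foldr (act V) w v)"
  unfolding free_act_def
proof (rule M.add.finprod_mono_neutral_cong_left[OF assms(3,4)])
  have wc: "foldr (act V) w v \<in> carrier V" if "w \<in> A" for w
    by (rule word_closed[OF subsetD[OF assms(5) that] assms(2)])
  show "f w \<odot>\<^bsub>V\<^esub> foldr (act V) w v = \<zero>\<^bsub>V\<^esub>" if "w \<in> A - {w. f w \<noteq> 0}" for w
    using wc that by (simp add: zero_scale)
  show "(\<lambda>w. f w \<odot>\<^bsub>V\<^esub> foldr (act V) w v) \<in> A \<rightarrow> carrier V"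
    by (intro Pi_I scale_closed wc)
qed simp

lemma free_act_add:
  assumes "f \<in> carrier FL" "g \<in> carrier FL" "v \<in> carrier V"
  shows "free_act V (f \<oplus>\<^bsub>FL\<^esub> g) v = free_act V f v \<oplus>\<^bsub>V\<^esub> free_act V g v"
proof -
  let ?A = "{w. f w \<noteq> 0} \<union> {w. g w \<noteq> 0}"
  let ?m = "\<lambda>w. foldr (act V) w v"
  have A: "finite ?A" using assms(1,2) by (simp add: free_algebra_mem)
  have A2: "?A \<subseteq> lists (carrier L)" by (intro Un_least subsetI; elim CollectE; rule free_memD[OF assms(1)] free_memD[OF assms(2)])
  have cl: "c \<odot>\<^bsub>V\<^esub> ?m w \<in> carrier V" if "w \<in> ?A" for c w
    by (rule scale_closed[OF word_closed[OF subsetD[OF A2 that] assms(3)]])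
  have fg: "f \<oplus>\<^bsub>FL\<^esub> g \<in> carrier FL" by (rule free_algebra_closed(1)[OF assms(1,2)])
  have sub: "{w. (f \<oplus>\<^bsub>FL\<^esub> g) w \<noteq> 0} \<subseteq> ?A" by (auto simp: free_algebra_simps)
  have "free_act V (f \<oplus>\<^bsub>FL\<^esub> g) v = (\<Oplus>\<^bsub>V\<^esub>w\<in>?A. (f w + g w) \<odot>\<^bsub>V\<^esub> ?m w)"
    unfolding free_act_superset[OF fg assms(3) A sub A2] by (simp only: free_algebra_simps)
  also have "\<dots> = (\<Oplus>\<^bsub>V\<^esub>w\<in>?A. f w \<odot>\<^bsub>V\<^esub> ?m w \<oplus>\<^bsub>V\<^esub> g w \<odot>\<^bsub>V\<^esub> ?m w)"
  proof (rule M.finsum_cong'[OF refl])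
    show "(f w + g w) \<odot>\<^bsub>V\<^esub> ?m w = f w \<odot>\<^bsub>V\<^esub> ?m w \<oplus>\<^bsub>V\<^esub> g w \<odot>\<^bsub>V\<^esub> ?m w" if "w \<in> ?A" for w
      by (rule smult_add_left[OF word_closed[OF subsetD[OF A2 that] assms(3)]])
  qed (intro Pi_I M.a_closed cl)
  also have "\<dots> = (\<Oplus>\<^bsub>V\<^esub>w\<in>?A. f w \<odot>\<^bsub>V\<^esub> ?m w) \<oplus>\<^bsub>V\<^esub> (\<Oplus>\<^bsub>V\<^esub>w\<in>?A. g w \<odot>\<^bsub>V\<^esub> ?m w)"
    by (rule M.finsum_addf) (intro Pi_I cl; assumption)+
  also have "\<dots> = free_act V f v \<oplus>\<^bsub>V\<^esub> free_act V g v"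
    unfolding free_act_superset[OF assms(1,3) A Un_upper1 A2] free_act_superset[OF assms(2,3) A Un_upper2 A2] ..
  finally show ?thesis .
qed

lemma free_act_monom:
  assumes "u \<in> lists (carrier L)" "v \<in> carrier V"
  shows "free_act V (free_monom c u) v = c \<odot>\<^bsub>V\<^esub> foldr (act V) u v"
proof -
  have "free_act V (free_monom c u) v = (\<Oplus>\<^bsub>V\<^esub>w\<in>{u}. free_monom c u w \<odot>\<^bsub>V\<^esub> foldr (act V) w v)"
    by (rule free_act_superset[OF free_monom_closed]) (use assms in \<open>auto simp: free_monom_def\<close>)
  also have "\<dots> = free_monom c u u \<odot>\<^bsub>V\<^esub> foldr (act V) u v"
    using M.finsum_insert[of "{}" u "\<lambda>w. free_monom c u w \<odot>\<^bsub>V\<^esub> foldr (act V) w v"]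
      scale_closed[OF word_closed[OF assms]] by simp
  finally show ?thesis by (simp add: free_monom_def)
qed

lemma free_act_zero: "free_act V \<zero>\<^bsub>FL\<^esub> v = \<zero>\<^bsub>V\<^esub>"
  by (simp add: free_act_def free_algebra_simps)

lemma free_act_scalar: "v \<in> carrier V \<Longrightarrow> free_act V (free_scalar c) v = c \<odot>\<^bsub>V\<^esub> v"
  using free_act_monom[of "[]" v c] by (simp add: free_scalar_def free_monom_def)

lemma free_act_gen: "x \<in> carrier L \<Longrightarrow> v \<in> carrier V \<Longrightarrow> free_act V (free_gen x) v = act V x v"
  using free_act_monom[of "[x]" v 1] by (simp add: free_gen_def free_monom_def one_smult act_closed)

lemma free_act_add_right:
  assumes "f \<in> carrier FL" "u \<in> carrier V" "v \<in> carrier V"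
  shows "free_act V f (u \<oplus>\<^bsub>V\<^esub> v) = free_act V f u \<oplus>\<^bsub>V\<^esub> free_act V f v"
  using assms(1)
proof (induction rule: free_algebra_sum_induct)
  case (add c w g)
  note c = free_monom_closed[OF add(1), of c] free_act_closed[OF free_monom_closed[OF add(1)]] free_act_closed[OF add(2)]
  show ?case
    using add c assms(2,3) by (simp add: free_act_add free_act_monom word_add scale_add_right word_closed scale_closed M.a_ac)
qed (simp add: free_act_zero)

text \<open>Multiplicativity of the action is obtained in two inductions: here the left factor is a
  monomial and the right factor is built up, and in \<open>free_act_mult\<close> the left factor is
  built up.\<close>

lemma free_act_word:
  assumes "g \<in> carrier FL" "w \<in> lists (carrier L)" "v \<in> carrier V"
  shows "free_act V (free_monom c w \<otimes>\<^bsub>FL\<^esub> g) v = c \<odot>\<^bsub>V\<^esub> foldr (act V) w (free_act V g v)"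
proof -
  interpret FL: ring FL by (rule free_algebra_ring)
  have mm: "free_monom c w \<otimes>\<^bsub>FL\<^esub> free_monom d u = free_monom (c * d) (w @ u)" if "w \<in> lists (carrier L)" "u \<in> lists (carrier L)" for d u w
    using that(1)
  proof (induction w)
    case Nil
    have "free_monom c [] \<otimes>\<^bsub>FL\<^esub> free_monom d u = (\<lambda>w. c * free_monom d u w)"
      by (simp only: free_monom_Nil free_scalar_mult)
    then show ?case by (auto simp: free_monom_def)
  next
    case (Cons x w)
    have "free_monom c (x # w) \<otimes>\<^bsub>FL\<^esub> free_monom d u = (free_gen x \<otimes>\<^bsub>FL\<^esub> free_monom c w) \<otimes>\<^bsub>FL\<^esub> free_monom d u"
      by (simp only: free_gen_mult_monom)
    also have "\<dots> = free_gen x \<otimes>\<^bsub>FL\<^esub> free_monom (c * d) (w @ u)"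
      using FL.m_assoc[OF free_gen_closed[OF Cons.hyps(1)] free_monom_closed[OF Cons.hyps(2)] free_monom_closed[OF that(2)]] Cons.IH
      by (simp only:)
    finally show ?case by (simp only: free_gen_mult_monom append_Cons)
  qed
  from assms(1) show ?thesis
  proof (induction rule: free_algebra_sum_induct)
    case zero
    have "free_monom c w \<otimes>\<^bsub>FL\<^esub> \<zero>\<^bsub>FL\<^esub> = \<zero>\<^bsub>FL\<^esub>" using free_monom_closed[OF assms(2)] by (rule FL.r_null)
    moreover have "foldr (act V) w \<zero>\<^bsub>V\<^esub> = \<zero>\<^bsub>V\<^esub>"
      using word_smult[OF assms(2), of v 0] assms(2,3) by (simp add: zero_scale word_closed)
    ultimately show ?case using smult_r_null[of c] by (simp add: free_act_zero)
  next
    case (add d u g)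
    note c = free_monom_closed[OF add(1), of d] free_monom_closed[OF assms(2), of c]
    note c2 = free_act_closed[OF add(2) assms(3)] free_act_closed[OF c(1) assms(3)]
    have "free_monom c w \<otimes>\<^bsub>FL\<^esub> (free_monom d u \<oplus>\<^bsub>FL\<^esub> g) = free_monom (c * d) (w @ u) \<oplus>\<^bsub>FL\<^esub> free_monom c w \<otimes>\<^bsub>FL\<^esub> g"
      using FL.r_distr[OF c(1) add(2) c(2)] mm[OF assms(2) add(1)] by (simp only:)
    then have "free_act V (free_monom c w \<otimes>\<^bsub>FL\<^esub> (free_monom d u \<oplus>\<^bsub>FL\<^esub> g)) v
       = (c * d) \<odot>\<^bsub>V\<^esub> foldr (act V) (w @ u) v \<oplus>\<^bsub>V\<^esub> c \<odot>\<^bsub>V\<^esub> foldr (act V) w (free_act V g v)"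
      using free_act_add[OF free_monom_closed FL.m_closed[OF c(2) add(2)] assms(3), of "w @ u" "c * d"]
        add assms by (simp add: free_act_monom)
    also have "(c * d) \<odot>\<^bsub>V\<^esub> foldr (act V) (w @ u) v = c \<odot>\<^bsub>V\<^esub> foldr (act V) w (free_act V (free_monom d u) v)"
      using add(1) assms by (simp add: free_act_monom word_smult word_closed smult_smult)
    also have "\<dots> \<oplus>\<^bsub>V\<^esub> c \<odot>\<^bsub>V\<^esub> foldr (act V) w (free_act V g v) =
       c \<odot>\<^bsub>V\<^esub> foldr (act V) w (free_act V (free_monom d u \<oplus>\<^bsub>FL\<^esub> g) v)"
      using c2 assms(2) by (simp add: free_act_add[OF c(1) add(2) assms(3)] word_add word_closed scale_add_right)
    finally show ?case .
  qed
qed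

lemma free_act_mult:
  assumes "f \<in> carrier FL" "g \<in> carrier FL" "v \<in> carrier V"
  shows "free_act V (f \<otimes>\<^bsub>FL\<^esub> g) v = free_act V f (free_act V g v)"
  using assms(1)
proof (induction rule: free_algebra_sum_induct)
  interpret FL: ring FL by (rule free_algebra_ring)
  case zero
  show ?case using FL.l_null[OF assms(2)] by (simp add: free_act_zero)
next
  interpret FL: ring FL by (rule free_algebra_ring)
  case (add c w f)
  note c = free_monom_closed[OF add(1), of c] and gv = free_act_closed[OF assms(2,3)]
  have "free_act V ((free_monom c w \<oplus>\<^bsub>FL\<^esub> f) \<otimes>\<^bsub>FL\<^esub> g) v =
    free_act V (free_monom c w \<otimes>\<^bsub>FL\<^esub> g) v \<oplus>\<^bsub>V\<^esub> free_act V (f \<otimes>\<^bsub>FL\<^esub> g) v"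
    unfolding FL.l_distr[OF c add(2) assms(2)]
    by (rule free_act_add[OF FL.m_closed[OF c assms(2)] FL.m_closed[OF add(2) assms(2)] assms(3)])
  also have "free_act V (free_monom c w \<otimes>\<^bsub>FL\<^esub> g) v = free_act V (free_monom c w) (free_act V g v)"
    unfolding free_act_word[OF assms(2) add(1) assms(3)] free_act_monom[OF add(1) gv] ..
  finally show ?case unfolding free_act_add[OF c add(2) gv] add(3) .
qed

end

locale lie_ops_module = lie_ops L + lie_module L V
  for L :: "(complex, 'g, 'z) lie_algebra_scheme" and V :: "('g, 'v, 'y) lie_rep_scheme"
begin

lemma free_act_minus_zero:
  assumes "f \<in> carrier F" "g \<in> carrier F" "v \<in> carrier V"
  shows "free_act V (f \<ominus>\<^bsub>F\<^esub> g) v = free_act V f v \<ominus>\<^bsub>V\<^esub> free_act V g v"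
proof -
  note c = free_act_closed[OF F.minus_closed[OF assms(1,2)] assms(3)] free_act_closed[OF assms(2,3)]
  have "f = (f \<ominus>\<^bsub>F\<^esub> g) \<oplus>\<^bsub>F\<^esub> g" using assms by (simp add: a_minus_def F.a_assoc F.l_neg)
  then have "free_act V f v = free_act V (f \<ominus>\<^bsub>F\<^esub> g) v \<oplus>\<^bsub>V\<^esub> free_act V g v"
    using free_act_add[OF F.minus_closed[OF assms(1,2)] assms(2,3)] by (simp only:)
  then show ?thesis using c by (simp add: a_minus_def M.a_assoc M.r_neg)
qed

text \<open>The elements of the free algebra that annihilate the module form a two-sided ideal. The
  module axioms place the relations in it, hence also the ideal that they generate.\<close>

lemma uea_ideal_act:
  assumes "f \<in> uea_ideal L" "v \<in> carrier V"
  shows "free_act V f v = \<zero>\<^bsub>V\<^esub>"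
proof -
  define K where "K = {f \<in> carrier F. \<forall>v\<in>carrier V. free_act V f v = \<zero>\<^bsub>V\<^esub>}"
  have act0: "free_act V f \<zero>\<^bsub>V\<^esub> = \<zero>\<^bsub>V\<^esub>" if "f \<in> carrier F" for f
    using free_act_add_right[OF that M.zero_closed M.zero_closed] free_act_closed[OF that M.zero_closed] by simp
  have "subgroup K (add_monoid F)"
  proof (rule F.add.subgroupI)
    show "K \<noteq> {}" unfolding K_def using F.zero_closed free_act_zero by blast
    fix f g assume f: "f \<in> K" and g: "g \<in> K"
    have m: "free_act V (\<ominus>\<^bsub>F\<^esub> f) v = \<zero>\<^bsub>V\<^esub>" if "v \<in> carrier V" for v
      using free_act_minus_zero[of "\<zero>\<^bsub>F\<^esub>" f v] f that by (simp add: K_def free_act_zero a_minus_def)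
    then show "\<ominus>\<^bsub>F\<^esub> f \<in> K" using f unfolding K_def by simp
    show "f \<oplus>\<^bsub>F\<^esub> g \<in> K" using f g unfolding K_def by (simp add: free_act_add)
  qed (auto simp: K_def)
  then have "ideal K F"
    by (rule idealI[OF F.ring_axioms]) (auto simp: K_def free_act_mult free_act_closed act0)
  moreover have "uea_relations L \<subseteq> K"
  proof -
    have vv: "v \<ominus>\<^bsub>V\<^esub> v = \<zero>\<^bsub>V\<^esub>" if "v \<in> carrier V" for v
      using that by (simp add: a_minus_def M.r_neg)
    note gc = free_gen_closed[of _ "carrier L"] and sc = free_scalar_closed[of _ "carrier L"]
    have 1: "free_gen (x \<oplus>\<^bsub>L\<^esub> y) \<ominus>\<^bsub>F\<^esub> (free_gen x \<oplus>\<^bsub>F\<^esub> free_gen y) \<in> K" if "x \<in> carrier L" "y \<in> carrier L" for x y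
      using that gc lie_add_closed[OF that] unfolding K_def
      by (simp add: free_act_minus_zero free_act_add free_act_gen act_add_left act_closed vv)
    have 2: "free_gen (c \<odot>\<^bsub>L\<^esub> x) \<ominus>\<^bsub>F\<^esub> (free_scalar c \<otimes>\<^bsub>F\<^esub> free_gen x) \<in> K" if "x \<in> carrier L" for x c
      using that gc sc lie_smult_closed[OF that] unfolding K_def
      by (simp add: free_act_minus_zero free_act_mult free_act_scalar free_act_gen act_smult_left act_closed scale_closed vv)
    have 3: "(free_gen x \<otimes>\<^bsub>F\<^esub> free_gen y \<ominus>\<^bsub>F\<^esub> free_gen y \<otimes>\<^bsub>F\<^esub> free_gen x) \<ominus>\<^bsub>F\<^esub> free_gen (bracket L x y) \<in> K"
      if "x \<in> carrier L" "y \<in> carrier L" for x y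
      using that gc lie_bracket_closed[OF that] unfolding K_def
      by (simp add: free_act_minus_zero free_act_mult free_act_gen act_bracket act_closed M.minus_closed vv)
    show ?thesis unfolding uea_relations_def Let_def using 1 2 3 by blast
  qed
  ultimately have "uea_ideal L \<subseteq> K" unfolding uea_ideal_def by (rule F.genideal_minimal)
  then show ?thesis using assms by (auto simp: K_def)
qed

lemma uea_module_proj:
  assumes "f \<in> carrier F" "v \<in> carrier V"
  shows "proj f \<odot>\<^bsub>uea_module L V\<^esub> v = free_act V f v"
proof -
  define g where "g = (SOME g. g \<in> carrier F \<and> proj f = proj g)"
  have g: "g \<in> carrier F" "proj f = proj g"
    using someI[of "\<lambda>g. g \<in> carrier F \<and> proj f = proj g" f] assms unfolding g_def by auto
  have "f \<ominus>\<^bsub>F\<^esub> g \<in> uea_ideal L" using g assms proj_eq_iff by blast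
  then have 0: "free_act V f v \<ominus>\<^bsub>V\<^esub> free_act V g v = \<zero>\<^bsub>V\<^esub>"
    using free_act_minus_zero[OF assms(1) g(1) assms(2)] uea_ideal_act[OF _ assms(2)] by simp
  note c = free_act_closed[OF assms] free_act_closed[OF g(1) assms(2)]
  have "free_act V f v = (free_act V f v \<ominus>\<^bsub>V\<^esub> free_act V g v) \<oplus>\<^bsub>V\<^esub> free_act V g v"
    using c by (simp add: a_minus_def M.a_assoc M.l_neg)
  then have "free_act V f v = free_act V g v" unfolding 0 using c by simp
  then show ?thesis by (simp add: uea_module_def g_def proj_def)
qed

lemma uea_left_module: "left_module U (uea_module L V)"
proof -
  interpret A: abelian_group "uea_module L V"
    by (rule abelian_group_cong[OF M.abelian_group_axioms]) auto
  show ?thesis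
  proof (unfold_locales, unfold uea_module_simps)
    fix a x assume "a \<in> carrier U" and x: "x \<in> carrier V"
    then obtain f where f: "f \<in> carrier F" "a = proj f" by (elim uea_carrierE)
    show "a \<odot>\<^bsub>uea_module L V\<^esub> x \<in> carrier V"
      unfolding f(2) uea_module_proj[OF f(1) x] by (rule free_act_closed[OF f(1) x])
  next
    fix a b x assume "a \<in> carrier U" "b \<in> carrier U" and x: "x \<in> carrier V"
    then obtain f g where f: "f \<in> carrier F" "a = proj f" and g: "g \<in> carrier F" "b = proj g" by (elim uea_carrierE)
    show "(a \<oplus>\<^bsub>U\<^esub> b) \<odot>\<^bsub>uea_module L V\<^esub> x = a \<odot>\<^bsub>uea_module L V\<^esub> x \<oplus>\<^bsub>V\<^esub> b \<odot>\<^bsub>uea_module L V\<^esub> x"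
      unfolding f(2) g(2) proj_add[OF f(1) g(1), symmetric] uea_module_proj[OF f(1) x] uea_module_proj[OF g(1) x]
        uea_module_proj[OF F.a_closed[OF f(1) g(1)] x] by (rule free_act_add[OF f(1) g(1) x])
    show "(a \<otimes>\<^bsub>U\<^esub> b) \<odot>\<^bsub>uea_module L V\<^esub> x = a \<odot>\<^bsub>uea_module L V\<^esub> (b \<odot>\<^bsub>uea_module L V\<^esub> x)"
      unfolding f(2) g(2) proj_mult[OF f(1) g(1), symmetric] uea_module_proj[OF g(1) x]
        uea_module_proj[OF f(1) free_act_closed[OF g(1) x]]
        uea_module_proj[OF F.m_closed[OF f(1) g(1)] x] by (rule free_act_mult[OF f(1) g(1) x])
  next
    fix a x y assume "a \<in> carrier U" and x: "x \<in> carrier V" "y \<in> carrier V"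
    then obtain f where f: "f \<in> carrier F" "a = proj f" by (elim uea_carrierE)
    show "a \<odot>\<^bsub>uea_module L V\<^esub> (x \<oplus>\<^bsub>V\<^esub> y) = a \<odot>\<^bsub>uea_module L V\<^esub> x \<oplus>\<^bsub>V\<^esub> a \<odot>\<^bsub>uea_module L V\<^esub> y"
      unfolding f(2) uea_module_proj[OF f(1) x(1)] uea_module_proj[OF f(1) x(2)] uea_module_proj[OF f(1) M.a_closed[OF x]]
      by (rule free_act_add_right[OF f(1) x])
  next
    fix x assume x: "x \<in> carrier V"
    have "\<one>\<^bsub>F\<^esub> = (free_scalar 1 :: 'g list \<Rightarrow> complex)" by (auto simp: free_scalar_def free_algebra_simps)
    then show "\<one>\<^bsub>U\<^esub> \<odot>\<^bsub>uea_module L V\<^esub> x = x"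
      unfolding proj_one[symmetric] uea_module_proj[OF F.one_closed x] by (simp add: free_act_scalar x one_smult)
  qed
qed

lemma uea_module_gen: "\<lbrakk>x \<in> carrier L; v \<in> carrier V\<rbrakk> \<Longrightarrow> uea_gen L x \<odot>\<^bsub>uea_module L V\<^esub> v = act V x v"
  by (simp only: uea_gen_proj uea_module_proj[OF free_gen_closed] free_act_gen)

lemma uea_module_scalar: "v \<in> carrier V \<Longrightarrow> uea_scalar L c \<odot>\<^bsub>uea_module L V\<^esub> v = c \<odot>\<^bsub>V\<^esub> v"
  by (simp only: uea_scalar_proj uea_module_proj[OF free_scalar_closed] free_act_scalar)

end

section \<open>The Ore set of monomials\<close>

context ring begin

definition commutator :: "'a \<Rightarrow> 'a \<Rightarrow> 'a" where
  "commutator e r = e \<otimes> r \<ominus> r \<otimes> e"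

fun ad_nil :: "'a \<Rightarrow> nat \<Rightarrow> 'a \<Rightarrow> bool" where
  "ad_nil e 0 r \<longleftrightarrow> r = \<zero>"
| "ad_nil e (Suc k) r \<longleftrightarrow> ad_nil e k (commutator e r)"

lemma commutator_closed: "\<lbrakk>e \<in> carrier R; r \<in> carrier R\<rbrakk> \<Longrightarrow> commutator e r \<in> carrier R"
  by (simp add: commutator_def)

lemma commutator_zero: "e \<in> carrier R \<Longrightarrow> commutator e \<zero> = \<zero>"
  by (simp add: commutator_def a_minus_def)

lemma commutator_eq: "\<lbrakk>e \<in> carrier R; r \<in> carrier R\<rbrakk> \<Longrightarrow> e \<otimes> r = r \<otimes> e \<oplus> commutator e r"
  by (simp add: commutator_def a_minus_def a_lcomm r_neg)

lemma commutator_add: "\<lbrakk>e \<in> carrier R; r \<in> carrier R; s \<in> carrier R\<rbrakk> \<Longrightarrow>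
  commutator e (r \<oplus> s) = commutator e r \<oplus> commutator e s"
  by (simp add: commutator_def a_minus_def r_distr l_distr minus_add a_ac)

lemma commutator_mult:
  assumes "e \<in> carrier R" "r \<in> carrier R" "s \<in> carrier R"
  shows "commutator e (r \<otimes> s) = commutator e r \<otimes> s \<oplus> r \<otimes> commutator e s"
  using assms by (simp add: commutator_def a_minus_def r_distr l_distr minus_add l_minus r_minus a_ac m_assoc r_neg1 r_neg2)

lemma ad_nil_zero: "e \<in> carrier R \<Longrightarrow> ad_nil e k \<zero>"
  by (induction k) (simp_all add: commutator_zero)

lemma ad_nil_Suc: "\<lbrakk>e \<in> carrier R; r \<in> carrier R; ad_nil e k r\<rbrakk> \<Longrightarrow> ad_nil e (Suc k) r"
proof (induction k arbitrary: r)
  case 0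
  then show ?case by (simp add: commutator_zero)
next
  case (Suc k)
  then show ?case by (metis ad_nil.simps(2) commutator_closed)
qed

lemma ad_nil_mono: "\<lbrakk>k \<le> l; e \<in> carrier R; r \<in> carrier R; ad_nil e k r\<rbrakk> \<Longrightarrow> ad_nil e l r"
  by (induction l rule: dec_induct) (simp_all only: ad_nil_Suc)

lemma ad_nil_add: "\<lbrakk>e \<in> carrier R; r \<in> carrier R; s \<in> carrier R; ad_nil e k r; ad_nil e k s\<rbrakk> \<Longrightarrow> ad_nil e k (r \<oplus> s)"
  by (induction k arbitrary: r s) (simp_all add: commutator_add commutator_closed)

text \<open>The commutator with \<open>e\<close> is a derivation, so one application lowers the
  order of one of the two factors in each summand; induction on the sum of the orders.\<close>

lemma ad_nil_mult:
  assumes "e \<in> carrier R" "r \<in> carrier R" "s \<in> carrier R" "ad_nil e i r" "ad_nil e j s"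
  shows "ad_nil e (i + j) (r \<otimes> s)"
  using assms(2-)
proof (induction "i + j" arbitrary: i j r s rule: less_induct)
  case less
  show ?case
  proof (cases "i = 0 \<or> j = 0")
    case True
    then have "r \<otimes> s = \<zero>" using less.prems by auto
    then show ?thesis using ad_nil_zero[OF assms(1)] by simp
  next
    case False
    then obtain i' j' where ij: "i = Suc i'" "j = Suc j'" by (meson not0_implies_Suc)
    have "ad_nil e (i' + j) (commutator e r \<otimes> s)"
      by (rule less.hyps) (use less.prems ij in \<open>simp_all add: commutator_closed assms(1)\<close>)
    moreover have "ad_nil e (i + j') (r \<otimes> commutator e s)"
      by (rule less.hyps) (use less.prems ij in \<open>simp_all add: commutator_closed assms(1)\<close>)
    ultimately have "ad_nil e (i' + j) (commutator e r \<otimes> s \<oplus> r \<otimes> commutator e s)"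
      using less.prems(1,2) assms(1) ij by (intro ad_nil_add) (simp_all add: commutator_closed)
    then show ?thesis using ij less.prems(1,2) assms(1) by (simp add: commutator_mult)
  qed
qed

text \<open>Moving one \<open>e\<close> across \<open>r\<close> from left to right leaves a
  commutator behind, and \<open>j\<close> successive commutators vanish. Hence at most
  \<open>j\<close> of the \<open>M\<close> factors fail to reach the right side. The truncated
  difference makes the claim trivial for small \<open>M\<close>.\<close>

lemma ad_nil_power:
  assumes e: "e \<in> carrier R"
  shows "\<lbrakk>r \<in> carrier R; ad_nil e j r\<rbrakk> \<Longrightarrow> \<exists>p\<in>carrier R. e [^] M \<otimes> r = p \<otimes> e [^] (M - j)"
proof (induction M arbitrary: j r)
  case 0
  then show ?case by (intro bexI[of _ r]) simp_all
next
  case (Suc M)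
  show ?case
  proof (cases j)
    case 0
    then show ?thesis using Suc.prems e by (intro bexI[of _ \<zero>]) simp_all
  next
    case (Suc j')
    let ?c = "commutator e r"
    have c: "?c \<in> carrier R" "ad_nil e j' ?c" using Suc Suc.prems e by (simp_all add: commutator_closed)
    obtain p where p: "p \<in> carrier R" "e [^] M \<otimes> r = p \<otimes> e [^] (M - j)" using Suc.IH[OF Suc.prems] by blast
    obtain q where q: "q \<in> carrier R" "e [^] M \<otimes> ?c = q \<otimes> e [^] (M - j')" using Suc.IH[OF c] by blast
    have "e [^] Suc M \<otimes> r = e [^] M \<otimes> (e \<otimes> r)" using e Suc.prems(1) by (simp add: m_assoc)
    also have "\<dots> = e [^] M \<otimes> r \<otimes> e \<oplus> e [^] M \<otimes> ?c"
      unfolding commutator_eq[OF e Suc.prems(1)] using e Suc.prems(1) c(1) by (simp add: r_distr m_assoc)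
    also have "\<dots> = p \<otimes> (e [^] (M - j) \<otimes> e) \<oplus> q \<otimes> e [^] (M - j')"
      unfolding p(2) q(2) using p(1) e by (simp add: m_assoc)
    finally have eq: "e [^] Suc M \<otimes> r = p \<otimes> (e [^] (M - j) \<otimes> e) \<oplus> q \<otimes> e [^] (M - j')" .
    show ?thesis
    proof (cases "j' < M")
      case True
      then have "Suc M - j = Suc (M - j)" "M - j' = Suc (M - j)" using Suc by auto
      then have "e [^] Suc M \<otimes> r = (p \<oplus> q) \<otimes> e [^] (Suc M - j)"
        unfolding eq using p(1) q(1) e by (simp add: l_distr)
      then show ?thesis using p(1) q(1) by blast
    next
      case False
      then have "Suc M - j = 0" using Suc by simp
      then show ?thesis using e Suc.prems(1) by (intro bexI[of _ "e [^] Suc M \<otimes> r"]) (simp_all del: nat_pow_Suc)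
    qed
  qed
qed

text \<open>If r e = 0, the commutator of \<open>e\<close> and \<open>r\<close> is just e r, and (e
  r) e = 0 again; so the iterated commutator is e^k r.\<close>

lemma ad_nil_annihilate:
  assumes e: "e \<in> carrier R"
  shows "\<lbrakk>r \<in> carrier R; ad_nil e k r; r \<otimes> e = \<zero>\<rbrakk> \<Longrightarrow> e [^] k \<otimes> r = \<zero>"
proof (induction k arbitrary: r)
  case (Suc k)
  have er: "commutator e r = e \<otimes> r" using Suc.prems e by (simp add: commutator_def a_minus_def)
  have "e \<otimes> r \<otimes> e = \<zero>" using Suc.prems e by (simp add: m_assoc)
  then have "e [^] k \<otimes> (e \<otimes> r) = \<zero>" using Suc.IH[of "e \<otimes> r"] Suc.prems e er by simp
  then show ?case using e Suc.prems by (simp add: m_assoc)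
qed simp

definition monomial :: "('i \<Rightarrow> 'a) \<Rightarrow> 'i list \<Rightarrow> ('i \<Rightarrow> nat) \<Rightarrow> 'a" where
  "monomial e xs k = foldr (\<lambda>i p. (e i [^] k i) \<otimes> p) xs \<one>"

lemma monomial_closed: "(\<And>i. i \<in> set xs \<Longrightarrow> e i \<in> carrier R) \<Longrightarrow> monomial e xs k \<in> carrier R"
  by (induction xs) (simp_all add: monomial_def)

lemma monomial_comm:
  assumes "\<And>i. i \<in> set xs \<Longrightarrow> e i \<in> carrier R" "y \<in> carrier R" "\<And>i. i \<in> set xs \<Longrightarrow> e i \<otimes> y = y \<otimes> e i"
  shows "monomial e xs k \<otimes> y = y \<otimes> monomial e xs k"
  using assms(1,3)
proof (induction xs)
  case (Cons x xs)
  let ?m = "monomial e xs k" and ?p = "e x [^] k x"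
  have c: "?m \<in> carrier R" "?p \<in> carrier R" using Cons.prems by (auto intro!: monomial_closed)
  have IH: "?m \<otimes> y = y \<otimes> ?m" using Cons by simp
  have py: "?p \<otimes> y = y \<otimes> ?p"
    using Cons.prems assms(2) by (intro group_commutes_pow) simp_all
  have "?p \<otimes> ?m \<otimes> y = ?p \<otimes> (y \<otimes> ?m)" unfolding IH[symmetric] by (rule m_assoc[OF c(2,1) assms(2)])
  also have "\<dots> = y \<otimes> (?p \<otimes> ?m)" unfolding m_assoc[OF c(2) assms(2) c(1), symmetric] py by (rule m_assoc[OF assms(2) c(2,1)])
  finally show ?case by (simp add: monomial_def)
qed (use assms(2) in \<open>simp add: monomial_def\<close>)

lemma monomial_mult:
  assumes "\<And>i. i \<in> set xs \<Longrightarrow> e i \<in> carrier R" "\<And>i j. \<lbrakk>i \<in> set xs; j \<in> set xs\<rbrakk> \<Longrightarrow> e i \<otimes> e j = e j \<otimes> e i"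
  shows "monomial e xs k \<otimes> monomial e xs l = monomial e xs (\<lambda>i. k i + l i)"
  using assms
proof (induction xs)
  case (Cons x xs)
  let ?m = "monomial e xs k" and ?n = "monomial e xs l" and ?p = "e x [^] k x" and ?q = "e x [^] l x"
  have x: "e x \<in> carrier R" using Cons.prems by simp
  have c: "?m \<in> carrier R" "?n \<in> carrier R" "?p \<in> carrier R" "?q \<in> carrier R"
    using Cons.prems by (auto intro!: monomial_closed)
  have IH: "?m \<otimes> ?n = monomial e xs (\<lambda>i. k i + l i)" using Cons by simp
  have mq: "?m \<otimes> ?q = ?q \<otimes> ?m"
  proof (rule monomial_comm)
    fix i assume i: "i \<in> set xs"
    show "e i \<otimes> ?q = ?q \<otimes> e i"
      by (rule group_commutes_pow[symmetric]) (use Cons.prems(1,2) x i in simp_all)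
  qed (use Cons.prems c in simp_all)
  have "(?p \<otimes> ?m) \<otimes> (?q \<otimes> ?n) = ?p \<otimes> (?m \<otimes> ?q) \<otimes> ?n" using c by (simp add: m_assoc)
  also have "\<dots> = (?p \<otimes> ?q) \<otimes> (?m \<otimes> ?n)" unfolding mq using c by (simp add: m_assoc)
  also have "?p \<otimes> ?q = e x [^] (k x + l x)" by (rule nat_pow_mult[OF x])
  finally show ?case unfolding IH by (simp add: monomial_def)
qed (simp add: monomial_def)

lemma monomial_zero: "monomial e xs (\<lambda>_. 0) = \<one>"
  by (induction xs) (simp_all add: monomial_def)

lemma monomial_single:
  assumes "\<And>i. i \<in> set xs \<Longrightarrow> e i \<in> carrier R" "distinct xs" "i \<in> set xs"
  shows "monomial e xs (\<lambda>j. if j = i then 1 else 0) = e i"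
proof -
  have 0: "monomial e ys (\<lambda>j. if j = i then 1 else 0) = \<one>" if "i \<notin> set ys" for ys
    using that by (induction ys) (auto simp: monomial_def)
  from assms show ?thesis
  proof (induction xs)
    case (Cons x xs)
    show ?case
    proof (cases "i = x")
      case True
      then show ?thesis using 0[of xs] Cons.prems by (simp add: monomial_def)
    next
      case False
      then have "monomial e xs (\<lambda>j. if j = i then 1 else 0) = e i" "e i \<in> carrier R"
        using Cons by simp_all
      then show ?thesis using False by (simp add: monomial_def)
    qed
  qed simp
qed

text \<open>Reversibility follows from ad-nilpotence, without the absence of zero divisors.\<close>

lemma monomials_ore_set:
  assumes e: "\<And>i. i \<in> set xs \<Longrightarrow> e i \<in> carrier R" and dist: "distinct xs"
    and comm: "\<And>i j. \<lbrakk>i \<in> set xs; j \<in> set xs\<rbrakk> \<Longrightarrow> e i \<otimes> e j = e j \<otimes> e i"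
    and nil: "\<And>i r. \<lbrakk>i \<in> set xs; r \<in> carrier R\<rbrakk> \<Longrightarrow> \<exists>k. ad_nil (e i) k r"
  shows "ore_set R (range (monomial e xs))"
proof -
  let ?S = "range (monomial e xs)"
  have one: "\<one> \<in> ?S" using monomial_zero[of e xs] by (metis rangeI)
  have mult: "s \<otimes> t \<in> ?S" if "s \<in> ?S" "t \<in> ?S" for s t
    proof -
    from that obtain k l where "s = monomial e xs k" "t = monomial e xs l" by blast
    then show ?thesis using monomial_mult[of xs e k l] e comm by simp
  qed
  have eS: "e i \<in> ?S" if "i \<in> set xs" for i
    using rangeI[of "monomial e xs" "\<lambda>j. if j = i then 1 else 0"] monomial_single[of xs e i] e dist that by simp
  have closed: "s \<in> carrier R" if "s \<in> ?S" for s
    using that monomial_closed[of xs e] e by blast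
  have pow: "s [^] (k::nat) \<in> ?S" if "s \<in> ?S" for s k
    by (induction k) (use that one mult in simp_all)
  \<comment> \<open>Both Ore conditions for one fixed denominator. They hold for each
    \<open>e i\<close> by nilpotence of commutators and pass to products, hence to all monomials,
    while the left factor \<open>u\<close> may be any monomial.\<close>
  define good where "good s \<longleftrightarrow> s \<in> carrier R \<and> (\<forall>r\<in>carrier R. \<exists>u\<in>?S. \<exists>p\<in>carrier R. u \<otimes> r = p \<otimes> s) \<and>
     (\<forall>r\<in>carrier R. r \<otimes> s = \<zero> \<longrightarrow> (\<exists>u\<in>?S. u \<otimes> r = \<zero>))" for s
  have good1: "good \<one>"
    unfolding good_def
  proof (intro conjI ballI impI one_closed)
    fix r assume r: "r \<in> carrier R"
    show "\<exists>u\<in>?S. \<exists>p\<in>carrier R. u \<otimes> r = p \<otimes> \<one>"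
      by (rule bexI[OF _ one], rule bexI[OF _ r]) (use r in simp)
    show "\<exists>u\<in>?S. u \<otimes> r = \<zero>" if "r \<otimes> \<one> = \<zero>"
      by (rule bexI[OF _ one]) (use r that in simp)
  qed
  have goode: "good (e i)" if i: "i \<in> set xs" for i
    unfolding good_def
  proof (intro conjI ballI impI e[OF i])
    fix r assume r: "r \<in> carrier R"
    obtain k where k: "ad_nil (e i) k r" using nil[OF i r] by blast
    \<comment> \<open>One factor more than the nilpotency order of \<open>r\<close> guarantees that
      one \<open>e i\<close> is left over on the right.\<close>
    obtain p where p: "p \<in> carrier R" "e i [^] Suc k \<otimes> r = p \<otimes> e i [^] (Suc k - k)"
      using ad_nil_power[OF e[OF i] r k] by blast
    then have "e i [^] Suc k \<otimes> r = p \<otimes> e i" using e[OF i] by simp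
    then show "\<exists>u\<in>?S. \<exists>p\<in>carrier R. u \<otimes> r = p \<otimes> e i" using pow[OF eS[OF i]] p(1) by blast
    show "\<exists>u\<in>?S. u \<otimes> r = \<zero>" if "r \<otimes> e i = \<zero>"
      using ad_nil_annihilate[OF e[OF i] r k that] pow[OF eS[OF i]] by blast
  qed
  have goodm: "good (s \<otimes> t)" if s: "good s" and t: "good t" for s t
    unfolding good_def
  proof (intro conjI ballI impI)
    have sc: "s \<in> carrier R" "t \<in> carrier R" using s t by (simp_all add: good_def)
    then show "s \<otimes> t \<in> carrier R" by simp
    fix r assume r: "r \<in> carrier R"
    obtain u p where u: "u \<in> ?S" "p \<in> carrier R" "u \<otimes> r = p \<otimes> t" using t r unfolding good_def by blast
    obtain v q where v: "v \<in> ?S" "q \<in> carrier R" "v \<otimes> p = q \<otimes> s" using s u(2) unfolding good_def by blast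
    note c = closed[OF u(1)] closed[OF v(1)]
    have "(v \<otimes> u) \<otimes> r = q \<otimes> (s \<otimes> t)"
      unfolding m_assoc[OF c(2,1) r] u(3) m_assoc[OF c(2) u(2) sc(2), symmetric] v(3)
      by (rule m_assoc[OF v(2) sc])
    then show "\<exists>u\<in>?S. \<exists>p\<in>carrier R. u \<otimes> r = p \<otimes> (s \<otimes> t)" using mult[OF v(1) u(1)] v(2) by blast
    assume "r \<otimes> (s \<otimes> t) = \<zero>"
    then have "r \<otimes> s \<otimes> t = \<zero>" using r sc by (simp only: m_assoc)
    then obtain u where u: "u \<in> ?S" "u \<otimes> (r \<otimes> s) = \<zero>" using t r sc(1) unfolding good_def by blast
    note uc = closed[OF u(1)]
    have "(u \<otimes> r) \<otimes> s = \<zero>" using u(2) m_assoc[OF uc r sc(1)] by (simp only:)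
    then obtain v where v: "v \<in> ?S" "v \<otimes> (u \<otimes> r) = \<zero>" using s r uc unfolding good_def by blast
    have "(v \<otimes> u) \<otimes> r = \<zero>" using v(2) m_assoc[OF closed[OF v(1)] uc r] by (simp only:)
    then show "\<exists>u\<in>?S. u \<otimes> r = \<zero>" using mult[OF v(1) u(1)] by blast
  qed
  have goodp: "good (e i [^] (k::nat))" if "i \<in> set xs" for i k
    by (induction k) (use good1 goode[OF that] goodm in simp_all)
  have "set ys \<subseteq> set xs \<Longrightarrow> good (monomial e ys k)" for ys k
    by (induction ys) (use good1 goodp goodm in \<open>simp_all add: monomial_def\<close>)
  then have good: "good s" if "s \<in> ?S" for s using that by blast
  show ?thesis
    by (unfold_locales) (use closed one mult good in \<open>auto simp: good_def\<close>)
qed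

end

section \<open>The Lie algebra \<open>s_alg n\<close> and its localized enveloping algebra\<close>

lemma s_alg_simps [simp]:
  "carrier (s_alg n) = carrier_mat n n \<times> carrier_vec n"
  "zero (s_alg n) = (0\<^sub>m n n, 0\<^sub>v n)"
  "add (s_alg n) (A, v) (B, w) = (A + B, v + w)"
  "smult (s_alg n) c (A, v) = (c \<cdot>\<^sub>m A, c \<cdot>\<^sub>v v)"
  "bracket (s_alg n) (A, v) (B, w) = (A * B - B * A, A *\<^sub>v w - B *\<^sub>v v)"
  by (simp_all add: s_alg_def)

lemma s_alg_lie_ops: "lie_ops (s_alg n)"
  by (unfold_locales) (auto intro!: minus_carrier_mat mult_carrier_mat mult_mat_vec_carrier)

interpretation s: lie_ops "s_alg n" for n
  by (rule s_alg_lie_ops)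

abbreviation U_e :: "nat \<Rightarrow> nat \<Rightarrow> (s_elem list \<Rightarrow> complex) set" where
  "U_e n i \<equiv> uea_gen (s_alg n) (e_vec n i)"

lemma e_vec_closed [simp]: "e_vec n i \<in> carrier (s_alg n)"
  by (simp add: e_vec_def)

lemma uea_gen_zero: "uea_gen (s_alg n) (0\<^sub>m n n, 0\<^sub>v n) = \<zero>\<^bsub>uea (s_alg n)\<^esub>"
proof -
  have "uea_gen (s_alg n) (0 \<odot>\<^bsub>s_alg n\<^esub> (0\<^sub>m n n, 0\<^sub>v n)) = \<zero>\<^bsub>uea (s_alg n)\<^esub>"
    using s.uea_gen_smult[of "(0\<^sub>m n n, 0\<^sub>v n)" n 0] s.uea_gen_closed[of "(0\<^sub>m n n, 0\<^sub>v n)" n]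
    by (simp add: s.uea_scalar_zero)
  moreover have "(0::complex) \<cdot>\<^sub>v 0\<^sub>v n = 0\<^sub>v n" by (rule eq_vecI) auto
  ultimately show ?thesis by simp
qed

lemma zero_mat_mult_vec: "w \<in> carrier_vec n \<Longrightarrow> 0\<^sub>m m n *\<^sub>v w = (0\<^sub>v m :: complex vec)"
  by (rule eq_vecI) (auto simp: scalar_prod_def)

lemma uea_commutator_gen:
  assumes "x \<in> carrier (s_alg n)" "y \<in> carrier (s_alg n)"
  shows "s.U.commutator n (uea_gen (s_alg n) x) (uea_gen (s_alg n) y) = uea_gen (s_alg n) (bracket (s_alg n) x y)"
  unfolding s.U.commutator_def s.uea_gen_commute[OF assms]
  using s.uea_gen_closed[OF assms(1)] s.uea_gen_closed[OF assms(2)] s.uea_gen_closed[OF s.lie_bracket_closed[OF assms]]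
  by (simp add: a_minus_def s.U.a_assoc s.U.r_neg)

lemma U_e_comm: "U_e n i \<otimes>\<^bsub>uea (s_alg n)\<^esub> U_e n j = U_e n j \<otimes>\<^bsub>uea (s_alg n)\<^esub> U_e n i"
proof -
  have "bracket (s_alg n) (e_vec n i) (e_vec n j) = (0\<^sub>m n n, 0\<^sub>v n)"
    by (auto simp: e_vec_def)
  then show ?thesis
    using s.uea_gen_commute[OF e_vec_closed e_vec_closed, of n i j] s.uea_gen_closed[OF e_vec_closed]
    by (simp add: uea_gen_zero)
qed

text \<open>C^n is an abelian ideal: the bracket of e_i with any element lies in it and is therefore
  killed by a second bracket with e_i. Scalars die after one commutator, and sums and products
  inherit nilpotence.\<close>

lemma U_e_ad_nil:
  assumes "r \<in> carrier (uea (s_alg n))"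
  shows "\<exists>k. s.U.ad_nil n (U_e n i) k r"
  using assms
proof (induction rule: s.uea_induct)
  case (scalar c)
  have "s.U.ad_nil n (U_e n i) 1 (uea_scalar (s_alg n) c)"
    using s.uea_scalar_closed s.uea_gen_closed[OF e_vec_closed]
    by (simp add: s.U.commutator_def s.uea_scalar_central a_minus_def s.U.r_neg)
  then show ?case by blast
next
  case (gen x)
  obtain A v where x: "x = (A, v)" "A \<in> carrier_mat n n" "v \<in> carrier_vec n" using gen by auto
  let ?y = "bracket (s_alg n) (e_vec n i) x"
  have y: "?y \<in> carrier (s_alg n)" by (rule s.lie_bracket_closed[OF e_vec_closed gen])
  have "bracket (s_alg n) (e_vec n i) ?y = (0\<^sub>m n n, 0\<^sub>v n)"
  proof -
    have 0: "0\<^sub>m n n - 0\<^sub>m n n = (0\<^sub>m n n :: complex mat)" by (rule eq_matI) auto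
    have "0\<^sub>v n - 0\<^sub>v n = (0\<^sub>v n :: complex vec)" by (rule eq_vecI) auto
    then show ?thesis using x by (simp add: e_vec_def zero_mat_mult_vec 0)
  qed
  then have "s.U.ad_nil n (U_e n i) (Suc (Suc 0)) (uea_gen (s_alg n) x)"
    by (simp add: uea_commutator_gen[OF e_vec_closed gen] uea_commutator_gen[OF e_vec_closed y] uea_gen_zero del: s_alg_simps)
  then show ?case by blast
next
  case (add a b)
  then obtain k l where "s.U.ad_nil n (U_e n i) k a" "s.U.ad_nil n (U_e n i) l b" by blast
  then have "s.U.ad_nil n (U_e n i) (max k l) a" "s.U.ad_nil n (U_e n i) (max k l) b"
    using s.U.ad_nil_mono[OF max.cobounded1 s.uea_gen_closed[OF e_vec_closed] add(1)]
      s.U.ad_nil_mono[OF max.cobounded2 s.uea_gen_closed[OF e_vec_closed] add(2)] by blast+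
  then show ?case using s.U.ad_nil_add[OF s.uea_gen_closed[OF e_vec_closed] add(1,2)] by blast
next
  case (mult a b)
  then show ?case using s.U.ad_nil_mult[OF s.uea_gen_closed[OF e_vec_closed] mult(1,2)] by blast
qed

lemma X_set_eq: "X_set n = range (s.U.monomial n (U_e n) [0..<n])"
  by (auto simp: X_set_def s.U.monomial_def)

lemma X_set_ore: "ore_set (uea (s_alg n)) (X_set n)"
  unfolding X_set_eq
proof (rule s.U.monomials_ore_set)
  show "U_e n i \<in> carrier (uea (s_alg n))" for i by (rule s.uea_gen_closed[OF e_vec_closed])
  show "U_e n i \<otimes>\<^bsub>uea (s_alg n)\<^esub> U_e n j = U_e n j \<otimes>\<^bsub>uea (s_alg n)\<^esub> U_e n i" for i j by (rule U_e_comm)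
qed (use U_e_ad_nil in auto)

interpretation X: ore_set "uea (s_alg n)" "X_set n" for n
  by (rule X_set_ore)

lemma U_e_in_X: "i < n \<Longrightarrow> U_e n i \<in> X_set n"
proof -
  assume "i < n"
  then have "s.U.monomial n (U_e n) [0..<n] (\<lambda>j. if j = i then 1 else 0) = U_e n i"
    by (intro s.U.monomial_single s.uea_gen_closed e_vec_closed) auto
  then show ?thesis unfolding X_set_eq by (metis rangeI)
qed

lemma U_loc_eq: "U_loc n = ore_localization (uea (s_alg n)) (X_set n)"
  by (rule U_loc_def)

definition loc_gen :: "nat \<Rightarrow> s_elem \<Rightarrow> loc_elem" where
  "loc_gen n x = ore_map (uea (s_alg n)) (X_set n) (uea_gen (s_alg n) x)"

definition loc_scalar :: "nat \<Rightarrow> complex \<Rightarrow> loc_elem" where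
  "loc_scalar n c = ore_map (uea (s_alg n)) (X_set n) (uea_scalar (s_alg n) c)"

lemma as_s_module_simps [simp]:
  "carrier (as_s_module n M) = carrier M" "zero (as_s_module n M) = zero M" "add (as_s_module n M) = add M"
  "smult (as_s_module n M) = (\<lambda>c v. loc_scalar n c \<odot>\<^bsub>M\<^esub> v)"
  "act (as_s_module n M) = (\<lambda>x v. loc_gen n x \<odot>\<^bsub>M\<^esub> v)"
  by (simp_all add: as_s_module_def loc_gen_def loc_scalar_def)

lemma loc_gen_closed: "x \<in> carrier (s_alg n) \<Longrightarrow> loc_gen n x \<in> carrier (U_loc n)"
  and loc_scalar_closed: "loc_scalar n c \<in> carrier (U_loc n)"
  unfolding loc_gen_def loc_scalar_def U_loc_eq
  by (rule ring_hom_closed[OF X.ore_map_hom], rule s.uea_gen_closed s.uea_scalar_closed, assumption?)+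

lemma loc_smult_bij:
  assumes M: "left_module (U_loc n) M" and i: "i < n"
  shows "bij_betw (\<lambda>v. loc_gen n (e_vec n i) \<odot>\<^bsub>M\<^esub> v) (carrier M) (carrier M)"
proof -
  interpret left_module "U_loc n" M by (rule M)
  let ?e = "loc_gen n (e_vec n i)" and ?f = "X.frac n (U_e n i) \<one>\<^bsub>uea (s_alg n)\<^esub>"
  note X = U_e_in_X[OF i]
  have e: "?e \<in> carrier (U_loc n)" by (rule loc_gen_closed[OF e_vec_closed])
  have f: "?f \<in> carrier (U_loc n)" unfolding U_loc_eq by (rule X.frac_closed[OF X s.U.one_closed])
  have inv: "?f \<otimes>\<^bsub>U_loc n\<^esub> ?e = \<one>\<^bsub>U_loc n\<^esub>" "?e \<otimes>\<^bsub>U_loc n\<^esub> ?f = \<one>\<^bsub>U_loc n\<^esub>"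
    unfolding U_loc_eq loc_gen_def by (rule X.ore_map_inverse[OF X])+
  show ?thesis
  proof (rule bij_betw_byWitness[of _ "\<lambda>v. ?f \<odot>\<^bsub>M\<^esub> v"])
    show "\<forall>v\<in>carrier M. ?f \<odot>\<^bsub>M\<^esub> (?e \<odot>\<^bsub>M\<^esub> v) = v"
      using smult_assoc[OF f e, symmetric] inv(1) smult_one by simp
    show "\<forall>v\<in>carrier M. ?e \<odot>\<^bsub>M\<^esub> (?f \<odot>\<^bsub>M\<^esub> v) = v"
      using smult_assoc[OF e f, symmetric] inv(2) smult_one by simp
  qed (use smult_closed e f in auto)
qed

text \<open>Compatibility with a denominator t gives compatibility with its inverse: write h (t^-1
  y) as t^-1 t h (t^-1 y) and pull t inside. So scalars and Lie algebra elements suffice, and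
  fractions need no separate check later.\<close>

lemma U_loc_hom_criterion:
  assumes M: "left_module (U_loc n) M" and N: "left_module (U_loc n) N"
    and h: "h \<in> carrier M \<rightarrow>\<^sub>E carrier N"
    and add: "\<And>x y. \<lbrakk>x \<in> carrier M; y \<in> carrier M\<rbrakk> \<Longrightarrow> h (x \<oplus>\<^bsub>M\<^esub> y) = h x \<oplus>\<^bsub>N\<^esub> h y"
    and scalar: "\<And>c x. x \<in> carrier M \<Longrightarrow> h (loc_scalar n c \<odot>\<^bsub>M\<^esub> x) = loc_scalar n c \<odot>\<^bsub>N\<^esub> h x"
    and gen: "\<And>y x. \<lbrakk>y \<in> carrier (s_alg n); x \<in> carrier M\<rbrakk> \<Longrightarrow> h (loc_gen n y \<odot>\<^bsub>M\<^esub> x) = loc_gen n y \<odot>\<^bsub>N\<^esub> h x"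
  shows "h \<in> left_module_hom (U_loc n) M N"
proof -
  interpret M: left_module "U_loc n" M by (rule M)
  interpret N: left_module "U_loc n" N by (rule N)
  let ?i = "ore_map (uea (s_alg n)) (X_set n)"
  note hom = X.ore_map_hom[of n, folded U_loc_eq]
  have hc: "h x \<in> carrier N" if "x \<in> carrier M" for x using h that by auto
  have U: "\<forall>x\<in>carrier M. h (?i a \<odot>\<^bsub>M\<^esub> x) = ?i a \<odot>\<^bsub>N\<^esub> h x" if "a \<in> carrier (uea (s_alg n))" for a
    using that
  proof (induction rule: s.uea_induct)
    case (scalar c)
    show ?case using assms(5) unfolding loc_scalar_def by blast
  next
    case (gen x)
    show ?case using assms(6)[OF gen] unfolding loc_gen_def by blast
  next
    case (add a b)
    note c = ring_hom_closed[OF hom add(1)] ring_hom_closed[OF hom add(2)]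
    show ?case
      unfolding ring_hom_add[OF hom add(1,2)]
      using add(3,4) by (simp add: M.smult_l_distr[OF c] N.smult_l_distr[OF c] M.smult_closed[OF c(1)] M.smult_closed[OF c(2)] assms(4) hc)
  next
    case (mult a b)
    note c = ring_hom_closed[OF hom mult(1)] ring_hom_closed[OF hom mult(2)]
    show ?case
      unfolding ring_hom_mult[OF hom mult(1,2)]
      using mult(3,4) by (simp add: M.smult_assoc[OF c] N.smult_assoc[OF c] M.smult_closed[OF c(2)] hc)
  qed
  have "h (a \<odot>\<^bsub>M\<^esub> x) = a \<odot>\<^bsub>N\<^esub> h x" if a: "a \<in> carrier (U_loc n)" and x: "x \<in> carrier M" for a x
  proof -
    obtain t r where t: "t \<in> X_set n" "r \<in> carrier (uea (s_alg n))" "a = X.frac n t r"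
      using a unfolding U_loc_eq by (rule X.L_E)
    have tc: "t \<in> carrier (uea (s_alg n))" by (rule X.S_closed[OF t(1)])
    let ?f = "X.frac n t \<one>\<^bsub>uea (s_alg n)\<^esub>"
    have f: "?f \<in> carrier (U_loc n)" unfolding U_loc_eq by (rule X.frac_closed[OF t(1) s.U.one_closed])
    have inv: "?f \<otimes>\<^bsub>U_loc n\<^esub> ?i t = \<one>\<^bsub>U_loc n\<^esub>" "?i t \<otimes>\<^bsub>U_loc n\<^esub> ?f = \<one>\<^bsub>U_loc n\<^esub>"
      unfolding U_loc_eq by (rule X.ore_map_inverse[OF t(1)])+
    note ic = ring_hom_closed[OF hom tc] ring_hom_closed[OF hom t(2)]
    have a_eq: "a = ?f \<otimes>\<^bsub>U_loc n\<^esub> ?i r" unfolding t(3) U_loc_eq by (rule X.frac_decomp[OF t(1,2)])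
    have fh: "h (?f \<odot>\<^bsub>M\<^esub> y) = ?f \<odot>\<^bsub>N\<^esub> h y" if y: "y \<in> carrier M" for y
    proof -
      note fy = M.smult_closed[OF f y]
      have "h (?f \<odot>\<^bsub>M\<^esub> y) = (?f \<otimes>\<^bsub>U_loc n\<^esub> ?i t) \<odot>\<^bsub>N\<^esub> h (?f \<odot>\<^bsub>M\<^esub> y)"
        unfolding inv(1) by (rule N.smult_one[OF hc[OF fy], symmetric])
      also have "\<dots> = ?f \<odot>\<^bsub>N\<^esub> h (?i t \<odot>\<^bsub>M\<^esub> (?f \<odot>\<^bsub>M\<^esub> y))"
        unfolding N.smult_assoc[OF f ic(1) hc[OF fy]] using U[OF tc] fy by simp
      also have "?i t \<odot>\<^bsub>M\<^esub> (?f \<odot>\<^bsub>M\<^esub> y) = y"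
        unfolding M.smult_assoc[OF ic(1) f y, symmetric] inv(2) by (rule M.smult_one[OF y])
      finally show ?thesis .
    qed
    show ?thesis
      unfolding a_eq M.smult_assoc[OF f ic(2) x] N.smult_assoc[OF f ic(2) hc[OF x]] fh[OF M.smult_closed[OF ic(2) x]]
      using U[OF t(2)] x by simp
  qed
  then show ?thesis unfolding left_module_hom_def using h add by blast
qed

definition loc_module :: "nat \<Rightarrow> (s_elem, 'a) lie_rep \<Rightarrow> (loc_elem, 'a) module" where
  "loc_module n V = ore_module (uea (s_alg n)) (X_set n) (uea_module (s_alg n) V)"

lemma loc_module_simps [simp]:
  "carrier (loc_module n V) = carrier V" "zero (loc_module n V) = zero V" "add (loc_module n V) = add V"
  by (simp_all add: loc_module_def)

text \<open>The elements acting bijectively are closed under products, so bijectivity of the e_i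
  extends to all monomials. The action is then prolonged twice, to the enveloping algebra and to the
  localization, without changing it on the Lie algebra or on scalars.\<close>

lemma loc_module:
  fixes V :: "(s_elem, 'a) lie_rep"
  assumes V: "lie_module (s_alg n) V"
    and bij: "\<And>i. i < n \<Longrightarrow> bij_betw (act V (e_vec n i)) (carrier V) (carrier V)"
  shows "left_module (U_loc n) (loc_module n V)"
    and "\<And>x v. \<lbrakk>x \<in> carrier (s_alg n); v \<in> carrier V\<rbrakk> \<Longrightarrow> loc_gen n x \<odot>\<^bsub>loc_module n V\<^esub> v = act V x v"
    and "\<And>c v. v \<in> carrier V \<Longrightarrow> loc_scalar n c \<odot>\<^bsub>loc_module n V\<^esub> v = c \<odot>\<^bsub>V\<^esub> v"
proof -
  interpret V: lie_ops_module "s_alg n" V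
    by (rule lie_ops_module.intro[OF s_alg_lie_ops V])
  let ?W = "uea_module (s_alg n) V"
  interpret W: left_module "uea (s_alg n)" ?W by (rule V.uea_left_module)
  define P where "P t \<longleftrightarrow> t \<in> carrier (uea (s_alg n)) \<and> bij_betw (\<lambda>x. t \<odot>\<^bsub>?W\<^esub> x) (carrier V) (carrier V)" for t
  have P_one: "P \<one>\<^bsub>uea (s_alg n)\<^esub>"
  proof -
    have "bij_betw (\<lambda>x. \<one>\<^bsub>uea (s_alg n)\<^esub> \<odot>\<^bsub>?W\<^esub> x) (carrier V) (carrier V) = bij_betw id (carrier V) (carrier V)"
      by (rule bij_betw_cong) (use W.smult_one in simp)
    then show ?thesis by (simp add: P_def)
  qed
  have P_mult: "P (t \<otimes>\<^bsub>uea (s_alg n)\<^esub> u)" if t: "P t" and u: "P u" for t u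
  proof -
    have c: "t \<in> carrier (uea (s_alg n))" "u \<in> carrier (uea (s_alg n))" using t u by (simp_all add: P_def)
    have "bij_betw ((\<lambda>x. t \<odot>\<^bsub>?W\<^esub> x) \<circ> (\<lambda>x. u \<odot>\<^bsub>?W\<^esub> x)) (carrier V) (carrier V)"
      using t u unfolding P_def by (blast intro: bij_betw_trans)
    moreover have "bij_betw (\<lambda>x. (t \<otimes>\<^bsub>uea (s_alg n)\<^esub> u) \<odot>\<^bsub>?W\<^esub> x) (carrier V) (carrier V) =
      bij_betw ((\<lambda>x. t \<odot>\<^bsub>?W\<^esub> x) \<circ> (\<lambda>x. u \<odot>\<^bsub>?W\<^esub> x)) (carrier V) (carrier V)"
      by (rule bij_betw_cong) (use W.smult_assoc[OF c] in simp)
    ultimately show ?thesis using c by (simp add: P_def)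
  qed
  have P_e: "P (U_e n i)" if "i < n" for i
  proof -
    have "bij_betw (\<lambda>x. U_e n i \<odot>\<^bsub>?W\<^esub> x) (carrier V) (carrier V) = bij_betw (act V (e_vec n i)) (carrier V) (carrier V)"
      by (rule bij_betw_cong) (rule V.uea_module_gen[OF e_vec_closed])
    then show ?thesis using bij[OF that] s.uea_gen_closed[OF e_vec_closed] by (simp add: P_def)
  qed
  have P_pow: "P (U_e n i [^]\<^bsub>uea (s_alg n)\<^esub> (k::nat))" if "i < n" for i k
    by (induction k) (use P_one P_mult P_e[OF that] in simp_all)
  have "set xs \<subseteq> {..<n} \<Longrightarrow> P (s.U.monomial n (U_e n) xs k)" for xs k
    by (induction xs) (use P_one P_mult P_pow in \<open>simp_all add: s.U.monomial_def\<close>)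
  from this[of "[0..<n]"] have "P t" if "t \<in> X_set n" for t
    using that unfolding X_set_eq by (auto simp: lessThan_atLeast0)
  then interpret W: ore_set_module "uea (s_alg n)" "X_set n" ?W
    by unfold_locales (simp add: P_def)
  show "left_module (U_loc n) (loc_module n V)"
    unfolding U_loc_eq loc_module_def by (rule W.ore_left_module)
  show "loc_gen n x \<odot>\<^bsub>loc_module n V\<^esub> v = act V x v" if x: "x \<in> carrier (s_alg n)" and v: "v \<in> carrier V" for x v
    unfolding loc_gen_def loc_module_def
    using W.ore_map_smult[OF s.uea_gen_closed[OF x], of v] v V.uea_module_gen[OF x v] by simp
  show "loc_scalar n c \<odot>\<^bsub>loc_module n V\<^esub> v = c \<odot>\<^bsub>V\<^esub> v" if v: "v \<in> carrier V" for c v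
    unfolding loc_scalar_def loc_module_def
    using W.ore_map_smult[OF s.uea_scalar_closed, of v c] v V.uea_module_scalar[OF v] by simp
qed

section \<open>Representations in coordinates\<close>

text \<open>Vector spaces whose addition is that of a type, so that \<open>+\<close>,
  \<open>-\<close> and \<open>sum\<close> can be used instead of record operations. The scalar
  action is a parameter because it occurs for vectors (\<open>csc\<close>) and for vector-valued
  functions (\<open>fsc\<close>).\<close>

locale scaling =
  fixes sc :: "complex \<Rightarrow> 'w::ab_group_add \<Rightarrow> 'w"
  assumes sc_add_right: "sc c (x + y) = sc c x + sc c y"
    and sc_add_left: "sc (b + c) x = sc b x + sc c x"
    and sc_sc: "sc b (sc c x) = sc (b * c) x"
    and sc_one: "sc 1 x = x"
begin

lemma sc_zero_right: "sc c 0 = 0"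
  using sc_add_right[of c 0 0] by simp

lemma sc_zero_left: "sc 0 x = 0"
  using sc_add_left[of 0 0 x] by simp

lemma sc_minus: "sc (- 1) x = - x"
  using sc_add_left[of 1 "- 1" x] by (simp add: sc_zero_left sc_one eq_neg_iff_add_eq_0 add.commute)

lemma sc_diff_right: "sc c (x - y) = sc c x - sc c y"
  using sc_add_right[of c "x - y" y] by (simp add: algebra_simps)

lemma sc_sum_right: "sc c (sum f A) = (\<Sum>i\<in>A. sc c (f i))"
  by (induction A rule: infinite_finite_induct) (simp_all add: sc_zero_right sc_add_right)

end

locale scaling_subspace = scaling sc
  for sc :: "complex \<Rightarrow> 'w::ab_group_add \<Rightarrow> 'w" +
  fixes S :: "'w set"
  assumes S_zero: "0 \<in> S" and S_add: "\<lbrakk>x \<in> S; y \<in> S\<rbrakk> \<Longrightarrow> x + y \<in> S"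
    and S_sc: "x \<in> S \<Longrightarrow> sc c x \<in> S"
begin

lemma S_minus: "x \<in> S \<Longrightarrow> - x \<in> S"
  using S_sc[of x "-1"] by (simp add: sc_minus)

lemma S_diff: "\<lbrakk>x \<in> S; y \<in> S\<rbrakk> \<Longrightarrow> x - y \<in> S"
  using S_add[of x "- y"] S_minus by simp

lemma S_sum: "(\<And>i. i \<in> A \<Longrightarrow> f i \<in> S) \<Longrightarrow> sum f A \<in> S"
  by (induction A rule: infinite_finite_induct) (simp_all add: S_zero S_add)

end

text \<open>A linear bijection from a concrete space to a record that is not yet known to be a
  vector space: the axioms are transported in \<open>coords_vectorspace\<close>. For this reason
  \<open>T_zero\<close> is listed although it follows from additivity in a group.\<close>

locale coords = scaling_subspace sc S
  for sc :: "complex \<Rightarrow> 'w::ab_group_add \<Rightarrow> 'w" and S +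
  fixes V :: "(complex, 'v, 'y) module_scheme" and T :: "'w \<Rightarrow> 'v"
  assumes T_bij: "bij_betw T S (carrier V)"
    and T_add: "\<lbrakk>x \<in> S; y \<in> S\<rbrakk> \<Longrightarrow> T (x + y) = T x \<oplus>\<^bsub>V\<^esub> T y"
    and T_sc: "x \<in> S \<Longrightarrow> T (sc c x) = c \<odot>\<^bsub>V\<^esub> T x"
    and T_zero: "T 0 = \<zero>\<^bsub>V\<^esub>"
begin

lemma T_closed: "x \<in> S \<Longrightarrow> T x \<in> carrier V"
  using T_bij by (auto simp: bij_betw_def)

lemma T_inj: "\<lbrakk>x \<in> S; y \<in> S; T x = T y\<rbrakk> \<Longrightarrow> x = y"
  using T_bij by (auto simp: bij_betw_def inj_on_def)

definition Tinv :: "'v \<Rightarrow> 'w" where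
  "Tinv = inv_into S T"

lemma Tinv_closed: "v \<in> carrier V \<Longrightarrow> Tinv v \<in> S"
  unfolding Tinv_def using T_bij by (auto simp: bij_betw_def intro: inv_into_into)

lemma T_Tinv: "v \<in> carrier V \<Longrightarrow> T (Tinv v) = v"
  unfolding Tinv_def using T_bij by (auto simp: bij_betw_def intro: f_inv_into_f)

lemma Tinv_T: "x \<in> S \<Longrightarrow> Tinv (T x) = x"
  unfolding Tinv_def using T_bij by (auto simp: bij_betw_def)

lemma Tinv_add: "\<lbrakk>u \<in> carrier V; v \<in> carrier V\<rbrakk> \<Longrightarrow> Tinv (u \<oplus>\<^bsub>V\<^esub> v) = Tinv u + Tinv v"
  using T_add[of "Tinv u" "Tinv v"] Tinv_T[OF S_add[of "Tinv u" "Tinv v"]] by (simp add: Tinv_closed T_Tinv)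

lemma Tinv_sc: "v \<in> carrier V \<Longrightarrow> Tinv (c \<odot>\<^bsub>V\<^esub> v) = sc c (Tinv v)"
  using T_sc[of "Tinv v" c] Tinv_T[OF S_sc[of "Tinv v" c]] by (simp add: Tinv_closed T_Tinv)

lemma TE:
  assumes "v \<in> carrier V" obtains x where "x \<in> S" "v = T x"
  using Tinv_closed[OF assms] T_Tinv[OF assms] by metis

lemma coords_vectorspace: "vectorspace (class_ring :: complex ring) V"
proof (rule vs_criteria)
  show "field (class_ring :: complex ring)" by (rule class_field)
  show "\<zero>\<^bsub>V\<^esub> \<in> carrier V" using T_closed[OF S_zero] by (simp add: T_zero)
  show "\<forall>v w. v \<in> carrier V \<and> w \<in> carrier V \<longrightarrow> v \<oplus>\<^bsub>V\<^esub> w \<in> carrier V"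
    by (auto elim!: TE simp flip: T_add intro!: T_closed S_add)
  show "\<forall>v\<in>carrier V. \<exists>neg_v\<in>carrier V. v \<oplus>\<^bsub>V\<^esub> neg_v = \<zero>\<^bsub>V\<^esub>"
  proof
    fix v assume "v \<in> carrier V"
    then obtain x where x: "x \<in> S" "v = T x" by (rule TE)
    have "T x \<oplus>\<^bsub>V\<^esub> T (- x) = \<zero>\<^bsub>V\<^esub>" using T_add[OF x(1) S_minus[OF x(1)]] by (simp add: T_zero)
    then show "\<exists>w\<in>carrier V. v \<oplus>\<^bsub>V\<^esub> w = \<zero>\<^bsub>V\<^esub>" using T_closed[OF S_minus[OF x(1)]] x(2) by blast
  qed
  show "\<forall>c v. c \<in> carrier class_ring \<and> v \<in> carrier V \<longrightarrow> c \<odot>\<^bsub>V\<^esub> v \<in> carrier V"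
    by (auto elim!: TE simp flip: T_sc intro!: T_closed S_sc)
  show "\<forall>v w. v \<in> carrier V \<and> w \<in> carrier V \<longrightarrow> v \<oplus>\<^bsub>V\<^esub> w = w \<oplus>\<^bsub>V\<^esub> v"
    by (auto elim!: TE simp flip: T_add simp: add.commute)
  show "\<forall>v w x. v \<in> carrier V \<and> w \<in> carrier V \<and> x \<in> carrier V \<longrightarrow> v \<oplus>\<^bsub>V\<^esub> w \<oplus>\<^bsub>V\<^esub> x = v \<oplus>\<^bsub>V\<^esub> (w \<oplus>\<^bsub>V\<^esub> x)"
    by (auto elim!: TE simp flip: T_add simp: add.assoc S_add)
  show "\<forall>v\<in>carrier V. v \<oplus>\<^bsub>V\<^esub> \<zero>\<^bsub>V\<^esub> = v"
    by (auto elim!: TE simp flip: T_add T_zero simp: S_zero)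
  show "\<forall>a b v. a \<in> carrier class_ring \<and> b \<in> carrier class_ring \<and> v \<in> carrier V \<longrightarrow>
    (a \<otimes>\<^bsub>class_ring\<^esub> b) \<odot>\<^bsub>V\<^esub> v = a \<odot>\<^bsub>V\<^esub> (b \<odot>\<^bsub>V\<^esub> v)"
    by (auto elim!: TE simp flip: T_sc simp: S_sc sc_sc)
  show "\<forall>v\<in>carrier V. \<one>\<^bsub>class_ring\<^esub> \<odot>\<^bsub>V\<^esub> v = v"
    by (auto elim!: TE simp flip: T_sc simp: sc_one)
  show "\<forall>a b v. a \<in> carrier class_ring \<and> b \<in> carrier class_ring \<and> v \<in> carrier V \<longrightarrow>
    (a \<oplus>\<^bsub>class_ring\<^esub> b) \<odot>\<^bsub>V\<^esub> v = a \<odot>\<^bsub>V\<^esub> v \<oplus>\<^bsub>V\<^esub> b \<odot>\<^bsub>V\<^esub> v"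
    by (auto elim!: TE simp flip: T_sc T_add simp: S_sc sc_add_left)
  show "\<forall>a v w. a \<in> carrier class_ring \<and> v \<in> carrier V \<and> w \<in> carrier V \<longrightarrow>
    a \<odot>\<^bsub>V\<^esub> (v \<oplus>\<^bsub>V\<^esub> w) = a \<odot>\<^bsub>V\<^esub> v \<oplus>\<^bsub>V\<^esub> a \<odot>\<^bsub>V\<^esub> w"
    by (auto elim!: TE simp flip: T_sc T_add simp: S_sc S_add sc_add_right)
qed

lemma T_sum:
  assumes "finite A" "\<And>i. i \<in> A \<Longrightarrow> f i \<in> S"
  shows "T (sum f A) = (\<Oplus>\<^bsub>V\<^esub>i\<in>A. T (f i))"
proof -
  interpret V: vectorspace class_ring V by (rule coords_vectorspace)
  show ?thesis using assms
  proof (induction A rule: finite_induct)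
    case (insert i A)
    have "(\<Oplus>\<^bsub>V\<^esub>i\<in>insert i A. T (f i)) = T (f i) \<oplus>\<^bsub>V\<^esub> (\<Oplus>\<^bsub>V\<^esub>i\<in>A. T (f i))"
      by (rule V.finsum_insert) (use insert in \<open>auto intro: T_closed\<close>)
    then show ?case using insert by (simp add: T_add S_sum)
  qed (simp add: T_zero)
qed

end

section \<open>Coordinates in C^d\<close>

definition csc :: "complex \<Rightarrow> ('i \<Rightarrow> complex) \<Rightarrow> 'i \<Rightarrow> complex" where
  "csc c x = (\<lambda>i. c * x i)"

text \<open>The spaces C^d of all dimensions live in one type as the sequences that vanish from
  \<open>d\<close> on; a single category can then contain representations of every
  dimension.\<close>

definition Cd :: "nat \<Rightarrow> (nat \<Rightarrow> complex) set" where
  "Cd d = {x. \<forall>i\<ge>d. x i = 0}"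

lemma Cd_subspace: "scaling_subspace csc (Cd d)"
  by unfold_locales (auto simp: csc_def Cd_def fun_eq_iff algebra_simps)

interpretation Cd: scaling_subspace csc "Cd d" for d
  by (rule Cd_subspace)

definition unit_fun :: "'i \<Rightarrow> 'i \<Rightarrow> complex" where
  "unit_fun r = (\<lambda>i. if i = r then 1 else 0)"

lemma Cd_sum: "x \<in> Cd d \<Longrightarrow> x = (\<Sum>r<d. csc (x r) (unit_fun r))"
proof (rule ext)
  fix i assume x: "x \<in> Cd d"
  have "(\<Sum>r<d. csc (x r) (unit_fun r)) i = (\<Sum>r<d. csc (x r) (unit_fun r) i)"
    by (induction d) simp_all
  also have "\<dots> = (\<Sum>r<d. if r = i then x i else 0)"
    by (rule sum.cong) (auto simp: csc_def unit_fun_def)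
  also have "\<dots> = x i" using x by (auto simp: Cd_def)
  finally show "x i = (\<Sum>r<d. csc (x r) (unit_fun r)) i" by simp
qed

lemma coords_fin_dim:
  fixes V :: "(complex, 'v, 'y) module_scheme"
  assumes "coords csc (Cd d) V T"
  shows "vectorspace.fin_dim class_ring V"
proof -
  interpret coords csc "Cd d" V T by (rule assms)
  interpret V: vectorspace class_ring V by (rule coords_vectorspace)
  let ?A = "(\<lambda>r. T (unit_fun r)) ` {..<d}"
  have u: "unit_fun r \<in> Cd d" if "r < d" for r using that by (auto simp: Cd_def unit_fun_def)
  have A: "finite ?A" "?A \<subseteq> carrier V" using u T_closed by auto
  have sub: "submodule class_ring (V.span ?A) V" by (rule V.span_is_submodule[OF A(2)])
  have "T (\<Sum>r\<in>I. csc (x r) (unit_fun r)) \<in> V.span ?A" if "finite I" "I \<subseteq> {..<d}" for I x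
    using that
  proof (induction I rule: finite_induct)
    case empty
    show ?case unfolding sum.empty T_zero by (rule submodule.zero_closed[OF sub])
  next
    case (insert i I)
    have i: "unit_fun i \<in> Cd d" using insert u by auto
    have "(\<Sum>r\<in>I. csc (x r) (unit_fun r)) \<in> Cd d" using insert u by (intro Cd.S_sum Cd.S_sc) auto
    then have eq: "T (\<Sum>r\<in>insert i I. csc (x r) (unit_fun r)) = x i \<odot>\<^bsub>V\<^esub> T (unit_fun i) \<oplus>\<^bsub>V\<^esub> T (\<Sum>r\<in>I. csc (x r) (unit_fun r))"
      using i unfolding sum.insert[OF insert(1,2)] by (simp only: T_add Cd.S_sc T_sc)
    have "T (unit_fun i) \<in> V.span ?A" using V.in_own_span[OF A(2)] insert by auto
    then show ?case
      unfolding eq by (intro submodule.m_closed[OF sub] submodule.smult_closed[OF sub] insert.IH) (use insert in auto)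
  qed
  from this[of "{..<d}"] have "T x \<in> V.span ?A" if "x \<in> Cd d" for x
    using Cd_sum[OF that] by (metis finite_lessThan order_refl)
  then have "carrier V \<subseteq> V.span ?A" by (auto elim!: TE)
  moreover have "V.span ?A \<subseteq> carrier V" using submodule.subset[OF sub] .
  ultimately show ?thesis unfolding V.fin_dim_def using A by blast
qed

lemma fin_dim_coords:
  fixes V :: "(complex, 'v, 'y) module_scheme"
  assumes "vectorspace class_ring V" "vectorspace.fin_dim class_ring V"
  shows "\<exists>d T. coords csc (Cd d) V T"
proof -
  interpret V: vectorspace class_ring V by (rule assms)
  obtain B where B: "finite B" "V.basis B" using V.finite_basis_exists[OF assms(2)] by blast
  have BV: "B \<subseteq> carrier V" using B(2) by (simp add: V.basis_def)
  have uniq: "\<exists>!a. a \<in> B \<rightarrow>\<^sub>E UNIV \<and> V.lincomb a B = v" if "v \<in> carrier V" for v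
    using V.basis_criterion[OF B(1) BV] B(2) that by simp
  obtain b where b: "bij_betw b {..<card B} B"
    using ex_bij_betw_nat_finite[OF B(1)] by (auto simp: atLeast0LessThan)
  let ?d = "card B" and ?inv = "inv_into {..<card B} b"
  have inv: "?inv v < ?d" "b (?inv v) = v" if "v \<in> B" for v
    using that b inv_into_into[of v b "{..<?d}"] f_inv_into_f[of v b "{..<?d}"] by (auto simp: bij_betw_def)
  have inv': "?inv (b r) = r" if "r < ?d" for r
    using that b by (auto simp: bij_betw_def)
  define T where "T x = (\<Oplus>\<^bsub>V\<^esub>v\<in>B. x (?inv v) \<odot>\<^bsub>V\<^esub> v)" for x :: "nat \<Rightarrow> complex"
  have cl: "c \<odot>\<^bsub>V\<^esub> v \<in> carrier V" if "v \<in> B" for c v using that BV by (intro V.smult_closed) auto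
  have Tl: "T x = V.lincomb (\<lambda>v\<in>B. x (?inv v)) B" for x
    unfolding T_def V.lincomb_def by (rule V.finsum_cong') (use cl in auto)
  show ?thesis
  proof (rule exI[of _ ?d], rule exI[of _ T], unfold_locales)
    have inj: "x = y" if xy: "x \<in> Cd ?d" "y \<in> Cd ?d" "T x = T y" for x y
    proof -
      have "T y \<in> carrier V" unfolding T_def by (rule V.finsum_closed) (use cl in auto)
      then have "(\<lambda>v\<in>B. x (?inv v)) = (\<lambda>v\<in>B. y (?inv v))"
        using uniq[of "T y"] xy(3) unfolding Tl by (metis restrict_PiE_iff UNIV_I)
      then have "x (?inv v) = y (?inv v)" if "v \<in> B" for v using that by (metis restrict_apply')
      then have "x r = y r" if "r < ?d" for r using inv'[OF that] bij_betwE[OF b] that by (metis lessThan_iff)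
      moreover have "x r = y r" if "r \<ge> ?d" for r using xy that by (simp add: Cd_def)
      ultimately show ?thesis by (meson ext not_le)
    qed
    have surj: "\<exists>x\<in>Cd ?d. v = T x" if v: "v \<in> carrier V" for v
    proof -
      obtain a where a: "a \<in> B \<rightarrow>\<^sub>E UNIV" "V.lincomb a B = v" using uniq[OF v] by blast
      let ?x = "\<lambda>r. if r < ?d then a (b r) else 0"
      have "(\<lambda>v\<in>B. ?x (?inv v)) = a" using a(1) inv by (auto simp: fun_eq_iff PiE_def extensional_def)
      then have "T ?x = v" using a(2) by (simp add: Tl)
      moreover have "?x \<in> Cd ?d" by (simp add: Cd_def)
      ultimately show ?thesis by blast
    qed
    have "T x \<in> carrier V" for x unfolding T_def by (rule V.finsum_closed) (use cl in auto)
    then show "bij_betw T (Cd ?d) (carrier V)"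
      using inj surj unfolding bij_betw_def inj_on_def by blast
    show "T (x + y) = T x \<oplus>\<^bsub>V\<^esub> T y" for x y
    proof -
      have "T (x + y) = (\<Oplus>\<^bsub>V\<^esub>v\<in>B. x (?inv v) \<odot>\<^bsub>V\<^esub> v \<oplus>\<^bsub>V\<^esub> y (?inv v) \<odot>\<^bsub>V\<^esub> v)"
        unfolding T_def
      proof (rule V.finsum_cong'[OF refl])
        show "(x + y) (?inv v) \<odot>\<^bsub>V\<^esub> v = x (?inv v) \<odot>\<^bsub>V\<^esub> v \<oplus>\<^bsub>V\<^esub> y (?inv v) \<odot>\<^bsub>V\<^esub> v" if "v \<in> B" for v
          using V.smult_l_distr[of "x (?inv v)" "y (?inv v)" v] that BV by auto
      qed (use cl in auto)
      also have "\<dots> = T x \<oplus>\<^bsub>V\<^esub> T y" unfolding T_def by (rule V.finsum_addf) (use cl in auto)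
      finally show ?thesis .
    qed
    show "T (csc c x) = c \<odot>\<^bsub>V\<^esub> T x" for c x
    proof -
      have "c \<odot>\<^bsub>V\<^esub> T x = (\<Oplus>\<^bsub>V\<^esub>v\<in>B. c \<odot>\<^bsub>V\<^esub> (x (?inv v) \<odot>\<^bsub>V\<^esub> v))"
        unfolding T_def by (rule V.finsum_smult) (use cl in auto)
      also have "\<dots> = T (csc c x)" unfolding T_def
      proof (rule V.finsum_cong'[OF refl])
        show "c \<odot>\<^bsub>V\<^esub> (x (?inv v) \<odot>\<^bsub>V\<^esub> v) = csc c x (?inv v) \<odot>\<^bsub>V\<^esub> v" if "v \<in> B" for v
          using V.smult_assoc1[of c "x (?inv v)" v] that BV by (auto simp: csc_def)
      qed (use cl in auto)
      finally show ?thesis by simp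
    qed
    have "T 0 = (\<Oplus>\<^bsub>V\<^esub>v\<in>B. \<zero>\<^bsub>V\<^esub>)" unfolding T_def
    proof (rule V.finsum_cong'[OF refl])
      show "(0::nat \<Rightarrow> complex) (?inv v) \<odot>\<^bsub>V\<^esub> v = \<zero>\<^bsub>V\<^esub>" if "v \<in> B" for v
        using V.smult_l_null[of v] that BV by auto
    qed auto
    then show "T 0 = \<zero>\<^bsub>V\<^esub>" by simp
  qed
qed

section \<open>Representations on concrete spaces\<close>

locale conc_rep = scaling_subspace sc S
  for sc :: "complex \<Rightarrow> 'w::ab_group_add \<Rightarrow> 'w" and S +
  fixes L :: "(complex, 'g, 'z) lie_algebra_scheme" and \<rho> :: "'g \<Rightarrow> 'w \<Rightarrow> 'w"
  assumes rho_closed: "\<lbrakk>x \<in> carrier L; v \<in> S\<rbrakk> \<Longrightarrow> \<rho> x v \<in> S"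
    and rho_add_left: "\<lbrakk>x \<in> carrier L; y \<in> carrier L; v \<in> S\<rbrakk> \<Longrightarrow> \<rho> (x \<oplus>\<^bsub>L\<^esub> y) v = \<rho> x v + \<rho> y v"
    and rho_sc_left: "\<lbrakk>x \<in> carrier L; v \<in> S\<rbrakk> \<Longrightarrow> \<rho> (c \<odot>\<^bsub>L\<^esub> x) v = sc c (\<rho> x v)"
    and rho_add_right: "\<lbrakk>x \<in> carrier L; v \<in> S; w \<in> S\<rbrakk> \<Longrightarrow> \<rho> x (v + w) = \<rho> x v + \<rho> x w"
    and rho_sc_right: "\<lbrakk>x \<in> carrier L; v \<in> S\<rbrakk> \<Longrightarrow> \<rho> x (sc c v) = sc c (\<rho> x v)"
    and rho_bracket: "\<lbrakk>x \<in> carrier L; y \<in> carrier L; v \<in> S\<rbrakk> \<Longrightarrow> \<rho> (bracket L x y) v = \<rho> x (\<rho> y v) - \<rho> y (\<rho> x v)"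
begin

lemma rho_zero_right: "x \<in> carrier L \<Longrightarrow> \<rho> x 0 = 0"
  using rho_add_right[of x 0 0] S_zero by simp

end

lemma lie_module_of_coords:
  fixes V :: "('g, 'v) lie_rep"
  assumes "coords sc S V T" "conc_rep sc S L \<rho>"
    and act: "\<And>x v. \<lbrakk>x \<in> carrier L; v \<in> S\<rbrakk> \<Longrightarrow> act V x (T v) = T (\<rho> x v)"
    and L: "lie_ops L"
  shows "lie_module L V"
proof -
  interpret coords sc S V T by fact
  interpret conc_rep sc S L \<rho> by fact
  interpret L: lie_ops L by fact
  interpret V: vectorspace class_ring V by (rule coords_vectorspace)
  show ?thesis
  proof unfold_locales
    fix x y v w c assume x: "x \<in> carrier L" and v: "v \<in> carrier V"
    obtain v' where v': "v' \<in> S" "v = T v'" using v by (rule TE)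
    show "act V x v \<in> carrier V" using x v' by (simp add: act T_closed rho_closed)
    show "act V (c \<odot>\<^bsub>L\<^esub> x) v = c \<odot>\<^bsub>V\<^esub> act V x v"
      using x v' by (simp add: act L.lie_smult_closed rho_sc_left T_sc rho_closed)
    show "act V x (c \<odot>\<^bsub>V\<^esub> v) = c \<odot>\<^bsub>V\<^esub> act V x v"
      using x v' by (simp add: act rho_sc_right T_sc[symmetric] rho_closed S_sc)
    show "act V x (v \<oplus>\<^bsub>V\<^esub> w) = act V x v \<oplus>\<^bsub>V\<^esub> act V x w" if w: "w \<in> carrier V"
    proof -
      obtain w' where w': "w' \<in> S" "w = T w'" using w by (rule TE)
      show ?thesis using x v' w' by (simp add: act rho_add_right T_add[symmetric] rho_closed S_add)
    qed
    assume y: "y \<in> carrier L"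
    show "act V (x \<oplus>\<^bsub>L\<^esub> y) v = act V x v \<oplus>\<^bsub>V\<^esub> act V y v"
      using x y v' by (simp add: act L.lie_add_closed rho_add_left T_add rho_closed)
    let ?a = "\<rho> x (\<rho> y v')" and ?b = "\<rho> y (\<rho> x v')"
    have ab: "?a \<in> S" "?b \<in> S" using x y v' by (auto intro: rho_closed)
    \<comment> \<open>\<open>coords\<close> transports sums only; the difference is recognized by
      adding \<open>?b\<close> back.\<close>
    have "T ?a = T (?a - ?b) \<oplus>\<^bsub>V\<^esub> T ?b" using ab by (simp add: T_add[symmetric] S_diff)
    then have "T (?a - ?b) = T ?a \<ominus>\<^bsub>V\<^esub> T ?b"
      using T_closed[OF ab(2)] T_closed[OF S_diff[OF ab]] by (simp add: a_minus_def V.a_assoc V.r_neg)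
    then show "act V (bracket L x y) v = act V x (act V y v) \<ominus>\<^bsub>V\<^esub> act V y (act V x v)"
      using x y v' by (simp add: act L.lie_bracket_closed rho_bracket rho_closed)
  qed
qed

lemma conc_rep_of_lie_module:
  fixes V :: "('g, 'v) lie_rep"
  assumes "coords sc S V T" "lie_module L V"
  shows "conc_rep sc S L (\<lambda>x s. coords.Tinv S T (act V x (T s)))"
proof -
  interpret coords sc S V T by fact
  interpret V: lie_module L V by fact
  have ac: "act V x (T s) \<in> carrier V" if "x \<in> carrier L" "s \<in> S" for x s
    using that T_closed by (simp add: V.act_closed)
  show ?thesis
  proof unfold_locales
    fix x y v w c assume x: "x \<in> carrier L" and v: "v \<in> S"
    note Tv = T_closed[OF v]
    show "Tinv (act V x (T v)) \<in> S" using x v by (simp add: ac Tinv_closed)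
    show "Tinv (act V (c \<odot>\<^bsub>L\<^esub> x) (T v)) = sc c (Tinv (act V x (T v)))"
      unfolding V.act_smult_left[OF x Tv] by (rule Tinv_sc[OF ac[OF x v]])
    show "Tinv (act V x (T (sc c v))) = sc c (Tinv (act V x (T v)))"
      unfolding T_sc[OF v] V.act_smult_right[OF x Tv] by (rule Tinv_sc[OF ac[OF x v]])
    show "Tinv (act V x (T (v + w))) = Tinv (act V x (T v)) + Tinv (act V x (T w))" if w: "w \<in> S"
      unfolding T_add[OF v w] V.act_add_right[OF x Tv T_closed[OF w]] by (rule Tinv_add[OF ac[OF x v] ac[OF x w]])
    assume y: "y \<in> carrier L"
    show "Tinv (act V (x \<oplus>\<^bsub>L\<^esub> y) (T v)) = Tinv (act V x (T v)) + Tinv (act V y (T v))"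
      unfolding V.act_add_left[OF x y Tv] by (rule Tinv_add[OF ac[OF x v] ac[OF y v]])
    let ?a = "Tinv (act V x (T (Tinv (act V y (T v)))))" and ?b = "Tinv (act V y (T (Tinv (act V x (T v)))))"
    have ab: "?a \<in> S" "?b \<in> S" using x y v by (simp_all add: Tinv_closed ac)
    have "T ?a = act V x (act V y (T v))" "T ?b = act V y (act V x (T v))"
      using x y v by (simp_all add: T_Tinv ac V.act_closed T_closed)
    moreover have "T (?a - ?b) = T ?a \<ominus>\<^bsub>V\<^esub> T ?b"
    proof -
      have "T ?a = T (?a - ?b) \<oplus>\<^bsub>V\<^esub> T ?b" using T_add[OF S_diff[OF ab] ab(2)] by simp
      then show ?thesis
        using T_closed[OF ab(2)] T_closed[OF S_diff[OF ab]] by (simp add: a_minus_def V.M.a_assoc V.M.r_neg)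
    qed
    ultimately have "T (?a - ?b) = act V (bracket L x y) (T v)"
      using V.act_bracket[OF x y T_closed[OF v]] by simp
    then show "Tinv (act V (bracket L x y) (T v)) = ?a - ?b"
      using Tinv_T[OF S_diff[OF ab]] by simp
  qed
qed

text \<open>Copies a representation into a prescribed type along an injection of its space. The
  existence of such injections is the content of the cardinality assumptions.\<close>

definition transport_rep :: "(complex \<Rightarrow> 'w \<Rightarrow> 'w) \<Rightarrow> 'w set \<Rightarrow> ('g \<Rightarrow> 'w \<Rightarrow> 'w) \<Rightarrow> ('w::ab_group_add \<Rightarrow> 'v) \<Rightarrow> ('g, 'v) lie_rep" where
  "transport_rep sc S \<rho> j = \<lparr>carrier = j ` S, mult = undefined, one = undefined, zero = j 0,
     add = (\<lambda>u v. j (inv_into S j u + inv_into S j v)),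
     smult = (\<lambda>c u. j (sc c (inv_into S j u))),
     act = (\<lambda>x u. j (\<rho> x (inv_into S j u)))\<rparr>"

lemma transport_rep_coords:
  assumes "scaling_subspace sc S" "inj_on j S"
  shows "coords sc S (transport_rep sc S \<rho> j) j"
    and "v \<in> S \<Longrightarrow> act (transport_rep sc S \<rho> j) x (j v) = j (\<rho> x v)"
proof -
  interpret scaling_subspace sc S by fact
  show "coords sc S (transport_rep sc S \<rho> j) j"
    by unfold_locales (use assms(2) in \<open>auto simp: transport_rep_def bij_betw_def\<close>)
  show "v \<in> S \<Longrightarrow> act (transport_rep sc S \<rho> j) x (j v) = j (\<rho> x v)"
    using assms(2) by (simp add: transport_rep_def)
qed

section \<open>Laurent modules\<close>

definition kd :: "nat \<Rightarrow> nat \<Rightarrow> complex" where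
  "kd i j = (if i = j then 1 else 0)"

definition mat_unit :: "nat \<Rightarrow> nat \<Rightarrow> nat \<Rightarrow> complex mat" where
  "mat_unit n i j = mat n n (\<lambda>(r, c). kd r i * kd c j)"

lemma mat_unit_closed [simp]: "mat_unit n i j \<in> carrier_mat n n"
  by (simp add: mat_unit_def)

lemma mat_unit_dim [simp]: "dim_row (mat_unit n i j) = n" "dim_col (mat_unit n i j) = n"
  by (simp_all add: mat_unit_def)

lemma mat_unit_index [simp]: "r < n \<Longrightarrow> c < n \<Longrightarrow> mat_unit n i j $$ (r, c) = kd r i * kd c j"
  by (simp add: mat_unit_def)

text \<open>The linear combination of matrix units is never formed as a matrix sum: the induction
  runs through the truncations \<open>cut I\<close> of \<open>A\<close> to a set of entries, which
  all keep the size \<open>n\<close>.\<close>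

lemma (in scaling) mat_linear_expand:
  assumes add: "\<And>A B. \<lbrakk>A \<in> carrier_mat n n; B \<in> carrier_mat n n\<rbrakk> \<Longrightarrow> f (A + B) = f A + f B"
    and scale: "\<And>A c. A \<in> carrier_mat n n \<Longrightarrow> f (c \<cdot>\<^sub>m A) = sc c (f A)"
    and A: "A \<in> carrier_mat n n"
  shows "f A = (\<Sum>i<n. \<Sum>j<n. sc (A $$ (i, j)) (f (mat_unit n i j)))"
proof -
  define cut where "cut I = mat n n (\<lambda>p. if p \<in> I then A $$ p else 0)" for I
  have cut: "cut I \<in> carrier_mat n n" for I by (simp add: cut_def)
  have "f (cut I) = (\<Sum>p\<in>I. sc (A $$ p) (f (mat_unit n (fst p) (snd p))))"
    if "finite I" "I \<subseteq> {..<n} \<times> {..<n}" for I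
    using that
  proof (induction I rule: finite_induct)
    case empty
    have "cut {} = 0 \<cdot>\<^sub>m cut {}" by (rule eq_matI) (auto simp: cut_def)
    then have "f (cut {}) = sc 0 (f (cut {}))" using scale[OF cut, of 0 "{}"] by simp
    then show ?case by (simp add: sc_zero_left)
  next
    case (insert p I)
    obtain i j where p: "p = (i, j)" "i < n" "j < n" using insert.prems by (cases p) auto
    have "cut (insert p I) = A $$ p \<cdot>\<^sub>m mat_unit n i j + cut I"
      by (rule eq_matI) (use p insert.hyps(2) in \<open>auto simp: cut_def kd_def\<close>)
    then have "f (cut (insert p I)) = sc (A $$ p) (f (mat_unit n i j)) + f (cut I)"
      using add[of "A $$ p \<cdot>\<^sub>m mat_unit n i j" "cut I"] scale cut by simp
    then show ?case using insert p by simp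
  qed
  from this[of "{..<n} \<times> {..<n}"]
  have "f (cut ({..<n} \<times> {..<n})) = (\<Sum>p\<in>{..<n} \<times> {..<n}. sc (A $$ p) (f (mat_unit n (fst p) (snd p))))" by simp
  moreover have "cut ({..<n} \<times> {..<n}) = A" by (rule eq_matI) (use A in \<open>auto simp: cut_def\<close>)
  ultimately show ?thesis by (simp add: sum.cartesian_product split_beta)
qed

lemma (in scaling) vec_linear_expand:
  assumes add: "\<And>v w. \<lbrakk>v \<in> carrier_vec n; w \<in> carrier_vec n\<rbrakk> \<Longrightarrow> f (v + w) = f v + f w"
    and scale: "\<And>v c. v \<in> carrier_vec n \<Longrightarrow> f (c \<cdot>\<^sub>v v) = sc c (f v)"
    and v: "v \<in> carrier_vec n"
  shows "f v = (\<Sum>k<n. sc (v $ k) (f (unit_vec n k)))"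
proof -
  define cut where "cut I = vec n (\<lambda>k. if k \<in> I then v $ k else 0)" for I
  have cut: "cut I \<in> carrier_vec n" for I by (simp add: cut_def)
  have "f (cut I) = (\<Sum>k\<in>I. sc (v $ k) (f (unit_vec n k)))" if "finite I" "I \<subseteq> {..<n}" for I
    using that
  proof (induction I rule: finite_induct)
    case empty
    have "cut {} = 0 \<cdot>\<^sub>v cut {}" by (rule eq_vecI) (auto simp: cut_def)
    then have "f (cut {}) = sc 0 (f (cut {}))" using scale[OF cut, of 0 "{}"] by simp
    then show ?case by (simp add: sc_zero_left)
  next
    case (insert k I)
    have "cut (insert k I) = v $ k \<cdot>\<^sub>v unit_vec n k + cut I"
      by (rule eq_vecI) (use insert in \<open>auto simp: cut_def unit_vec_def\<close>)
    then have "f (cut (insert k I)) = sc (v $ k) (f (unit_vec n k)) + f (cut I)"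
      using add[of "v $ k \<cdot>\<^sub>v unit_vec n k" "cut I"] scale cut by simp
    then show ?case using insert by simp
  qed
  from this[of "{..<n}"] have "f (cut {..<n}) = (\<Sum>k<n. sc (v $ k) (f (unit_vec n k)))" by simp
  moreover have "cut {..<n} = v" by (rule eq_vecI) (use v in \<open>auto simp: cut_def\<close>)
  ultimately show ?thesis by simp
qed

text \<open>The \<open>m + 1\<close> by \<open>m + 1\<close> matrices whose columns sum to zero are the stabilizer of the point
  \<open>t = (1, \<dots>, 1)\<close> of the torus; they form a Lie algebra isomorphic to \<open>s_m\<close> via \<open>sig\<close>.\<close>

definition colsum_zero :: "nat \<Rightarrow> complex mat set" where
  "colsum_zero m = {X \<in> carrier_mat (Suc m) (Suc m). \<forall>c<Suc m. (\<Sum>r<Suc m. X $$ (r, c)) = 0}"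

text \<open>A matrix with vanishing column sums maps into the hyperplane H of vectors with
  coordinate sum zero. In the basis e_r - e_m (\<open>r < m\<close>) of H its restriction has the
  entries X_rc - X_rm, and its value at e_m, which lies outside H, has the coordinates X_rm. These
  are the linear part and the translation part of an infinitesimal affine map of e_m + H.\<close>

definition sig :: "nat \<Rightarrow> complex mat \<Rightarrow> s_elem" where
  "sig m X = (mat m m (\<lambda>(r, c). X $$ (r, c) - X $$ (r, m)), vec m (\<lambda>r. X $$ (r, m)))"

definition sig_inv :: "nat \<Rightarrow> s_elem \<Rightarrow> complex mat" where
  "sig_inv m x = mat (Suc m) (Suc m) (\<lambda>(r, c).
     if r < m then (if c < m then fst x $$ (r, c) + snd x $ r else snd x $ r)
     else - (\<Sum>i<m. if c < m then fst x $$ (i, c) + snd x $ i else snd x $ i))"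

text \<open>The projection onto the matrices with vanishing column sums along the diagonal ones,
  which act by weights and carry no information about the fibre. It takes the matrix unit e_ij to
  e_ij - e_jj.\<close>

definition colsum_proj :: "nat \<Rightarrow> complex mat \<Rightarrow> complex mat" where
  "colsum_proj m X = mat (Suc m) (Suc m) (\<lambda>(r, c). X $$ (r, c) - kd r c * (\<Sum>i<Suc m. X $$ (i, c)))"

lemma sig_closed [simp]: "sig m X \<in> carrier (s_alg m)"
  by (simp add: sig_def)

lemma sig_inv_colsum: "sig_inv m x \<in> colsum_zero m"
  by (auto simp: sig_inv_def colsum_zero_def)

lemma sig_inv_closed [simp]: "sig_inv m x \<in> carrier_mat (Suc m) (Suc m)"
  by (simp add: sig_inv_def)

lemma sig_sig_inv: "x \<in> carrier (s_alg m) \<Longrightarrow> sig m (sig_inv m x) = x"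
  by (cases x) (auto simp: sig_def sig_inv_def intro!: eq_matI eq_vecI)

lemma sig_inv_sig:
  assumes "X \<in> colsum_zero m"
  shows "sig_inv m (sig m X) = X"
proof (rule eq_matI)
  have X: "X \<in> carrier_mat (Suc m) (Suc m)" using assms by (simp add: colsum_zero_def)
  fix r c assume "r < dim_row X" "c < dim_col X"
  then have rc: "r < Suc m" "c < Suc m" using X by auto
  have "X $$ (m, c) = - (\<Sum>i<m. X $$ (i, c))"
    using assms rc(2) by (auto simp: colsum_zero_def eq_neg_iff_add_eq_0 add.commute)
  moreover have "(\<Sum>i<m. if c < m then X $$ (i, c) - X $$ (i, m) + X $$ (i, m) else X $$ (i, m)) = (\<Sum>i<m. X $$ (i, c))"
    by (rule sum.cong) (use rc in \<open>auto simp: less_Suc_eq\<close>)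
  moreover have "r < m \<or> r = m" "c < m \<or> c = m" using rc by auto
  ultimately show "sig_inv m (sig m X) $$ (r, c) = X $$ (r, c)"
    using rc by (auto simp: sig_inv_def sig_def intro!: sum.cong)
qed (use assms in \<open>auto simp: sig_inv_def colsum_zero_def\<close>)

lemma sig_add: "\<lbrakk>X \<in> carrier_mat (Suc m) (Suc m); Y \<in> carrier_mat (Suc m) (Suc m)\<rbrakk> \<Longrightarrow>
  sig m (X + Y) = sig m X \<oplus>\<^bsub>s_alg m\<^esub> sig m Y"
  by (auto simp: sig_def intro!: eq_matI eq_vecI)

lemma sig_scale: "X \<in> carrier_mat (Suc m) (Suc m) \<Longrightarrow> sig m (c \<cdot>\<^sub>m X) = c \<odot>\<^bsub>s_alg m\<^esub> sig m X"
  by (auto simp: sig_def algebra_simps intro!: eq_matI eq_vecI)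

text \<open>The last row of \<open>Y\<close> is minus the sum of the other rows. Eliminating it from
  an entry of X Y leaves a sum over k < m in which X_rk is replaced by X_rk - X_rm, that is, by an
  entry of the linear part of \<open>sig m X\<close>.\<close>

lemma sig_bracket:
  assumes X: "X \<in> colsum_zero m" and Y: "Y \<in> colsum_zero m"
  shows "sig m (X * Y - Y * X) = bracket (s_alg m) (sig m X) (sig m Y)"
proof -
  have prod: "(\<Sum>k<Suc m. X $$ (r, k) * Y $$ (k, c)) = (\<Sum>k<m. (X $$ (r, k) - X $$ (r, m)) * Y $$ (k, c))"
    if "Y \<in> colsum_zero m" "c < Suc m" for X Y r c
  proof -
    have "Y $$ (m, c) = - (\<Sum>i<m. Y $$ (i, c))"
      using that by (auto simp: colsum_zero_def eq_neg_iff_add_eq_0 add.commute)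
    then show ?thesis by (simp add: left_diff_distrib sum_subtractf sum_distrib_left)
  qed
  have entry: "(X * Y) $$ (r, c) = (\<Sum>k<m. (X $$ (r, k) - X $$ (r, m)) * Y $$ (k, c))"
    if "X \<in> colsum_zero m" "Y \<in> colsum_zero m" "r < Suc m" "c < Suc m" for X Y r c
  proof -
    have d: "X \<in> carrier_mat (Suc m) (Suc m)" "Y \<in> carrier_mat (Suc m) (Suc m)"
      using that by (simp_all add: colsum_zero_def)
    have "(X * Y) $$ (r, c) = (\<Sum>k<Suc m. X $$ (r, k) * Y $$ (k, c))"
      using carrier_matD[OF d(1)] carrier_matD[OF d(2)] that(3,4)
      by (simp add: scalar_prod_def atLeast0LessThan del: sum.lessThan_Suc)
    then show ?thesis using prod[OF that(2,4), of X r] by (simp only:)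
  qed
  have d: "X \<in> carrier_mat (Suc m) (Suc m)" "Y \<in> carrier_mat (Suc m) (Suc m)"
    using X Y by (simp_all add: colsum_zero_def)
  have dd: "dim_row (X * Y) = Suc m" "dim_col (X * Y) = Suc m" "dim_row (Y * X) = Suc m" "dim_col (Y * X) = Suc m"
    using d by auto
  have rp: "(mat m m (\<lambda>(r, c). X $$ (r, c) - X $$ (r, m)) * mat m m (\<lambda>(r, c). Y $$ (r, c) - Y $$ (r, m))) $$ (r, c) =
      (\<Sum>i<m. (X $$ (r, i) - X $$ (r, m)) * (Y $$ (i, c) - Y $$ (i, m)))" if "r < m" "c < m" for X Y :: "complex mat" and r c
    using that by (simp add: scalar_prod_def atLeast0LessThan)
  show ?thesis
    unfolding sig_def s_alg_simps prod.inject
  proof (intro conjI eq_matI eq_vecI, goal_cases)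
    case (1 r c)
    then show ?case using d
      by (simp add: entry[OF X Y] entry[OF Y X] dd rp right_diff_distrib sum_subtractf del: index_mult_mat(1))
  next
    case (4 r)
    then show ?case using d
      by (simp add: entry[OF X Y] entry[OF Y X] dd scalar_prod_def atLeast0LessThan del: index_mult_mat)
  qed auto
qed

lemma colsum_proj_closed [simp]: "colsum_proj m X \<in> carrier_mat (Suc m) (Suc m)"
  by (simp add: colsum_proj_def)

lemma sum_kd: "finite I \<Longrightarrow> (\<Sum>i\<in>I. kd i j * f i) = (if j \<in> I then f j else 0)"
proof -
  assume "finite I"
  moreover have "(\<Sum>i\<in>I. kd i j * f i) = (\<Sum>i\<in>I. if i = j then f i else 0)"
    by (rule sum.cong) (auto simp: kd_def)
  ultimately show ?thesis by simp
qed

lemma colsum_proj_colsum: "X \<in> carrier_mat (Suc m) (Suc m) \<Longrightarrow> colsum_proj m X \<in> colsum_zero m"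
  unfolding colsum_zero_def
proof (intro CollectI conjI allI impI)
  fix c assume c: "c < Suc m"
  have "(\<Sum>r<Suc m. colsum_proj m X $$ (r, c)) = (\<Sum>r<Suc m. X $$ (r, c) - kd r c * (\<Sum>i<Suc m. X $$ (i, c)))"
    by (rule sum.cong) (use c in \<open>auto simp: colsum_proj_def\<close>)
  also have "\<dots> = 0" using c sum_kd[of "{..<Suc m}" c "\<lambda>_. \<Sum>i<Suc m. X $$ (i, c)"]
    by (simp only: sum_subtractf) simp
  finally show "(\<Sum>r<Suc m. colsum_proj m X $$ (r, c)) = 0" .
qed simp

lemma colsum_proj_id: "X \<in> colsum_zero m \<Longrightarrow> colsum_proj m X = X"
  by (rule eq_matI) (auto simp: colsum_proj_def colsum_zero_def)

lemma colsum_proj_add: "\<lbrakk>X \<in> carrier_mat (Suc m) (Suc m); Y \<in> carrier_mat (Suc m) (Suc m)\<rbrakk> \<Longrightarrow>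
  colsum_proj m (X + Y) = colsum_proj m X + colsum_proj m Y"
  by (rule eq_matI) (auto simp: colsum_proj_def sum.distrib algebra_simps)

lemma colsum_proj_scale: "X \<in> carrier_mat (Suc m) (Suc m) \<Longrightarrow> colsum_proj m (c \<cdot>\<^sub>m X) = c \<cdot>\<^sub>m colsum_proj m X"
  by (rule eq_matI) (auto simp: colsum_proj_def sum_distrib_left algebra_simps)

text \<open>The element of \<open>s_alg m\<close> that corresponds to e_ij - e_jj; its operator on
  the fibre is the correction term in the formula for the action of e_ij.\<close>

definition stab_unit :: "nat \<Rightarrow> nat \<Rightarrow> nat \<Rightarrow> s_elem" where
  "stab_unit m i j = sig m (colsum_proj m (mat_unit (Suc m) i j))"

lemma stab_unit_closed [simp]: "stab_unit m i j \<in> carrier (s_alg m)"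
  by (simp add: stab_unit_def del: s_alg_simps)

lemma colsum_proj_unit:
  assumes "i < Suc m" "j < Suc m" "r < Suc m" "c < Suc m"
  shows "colsum_proj m (mat_unit (Suc m) i j) $$ (r, c) = (kd r i - kd r j) * kd c j"
proof -
  have "(\<Sum>k<Suc m. mat_unit (Suc m) i j $$ (k, c)) = (\<Sum>k<Suc m. kd k i * kd c j)"
    by (rule sum.cong) (use assms in auto)
  also have "\<dots> = kd c j" using sum_kd[of "{..<Suc m}" i "\<lambda>_. kd c j"] assms by simp
  finally show ?thesis using assms by (auto simp: colsum_proj_def kd_def)
qed

lemma stab_unit_diag:
  assumes "j < Suc m"
  shows "stab_unit m j j = (0\<^sub>m m m, 0\<^sub>v m)"
  unfolding stab_unit_def sig_def prod.inject
  by (intro conjI eq_matI eq_vecI) (use assms in \<open>auto simp: colsum_proj_unit\<close>)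

text \<open>e_ij - e_jj is the rank one matrix (e_i - e_j) e_j^T. The product with (e_k - e_l) e_l^T
  is (delta_jk - delta_jl) (e_i - e_j) e_l^T, and (e_i - e_j) e_l^T is the difference of the rank
  one matrices belonging to (i, l) and (j, l).\<close>

lemma stab_unit_bracket:
  assumes ij: "i < Suc m" "j < Suc m" and kl: "k < Suc m" "l < Suc m"
  shows "bracket (s_alg m) (stab_unit m i j) (stab_unit m k l) =
    (kd j k - kd j l) \<odot>\<^bsub>s_alg m\<^esub> (stab_unit m i l \<oplus>\<^bsub>s_alg m\<^esub> (-1) \<odot>\<^bsub>s_alg m\<^esub> stab_unit m j l) \<oplus>\<^bsub>s_alg m\<^esub>
    (kd l j - kd l i) \<odot>\<^bsub>s_alg m\<^esub> (stab_unit m k j \<oplus>\<^bsub>s_alg m\<^esub> (-1) \<odot>\<^bsub>s_alg m\<^esub> stab_unit m l j)"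
proof -
  let ?q = "\<lambda>i j. colsum_proj m (mat_unit (Suc m) i j)"
  let ?c = "\<lambda>A. A \<in> carrier_mat (Suc m) (Suc m)"
  have prod: "(?q i j * ?q k l) $$ (r, c) = (kd j k - kd j l) * ((kd r i - kd r j) * kd c l)"
    if "i < Suc m" "j < Suc m" "k < Suc m" "l < Suc m" "r < Suc m" "c < Suc m" for i j k l r c
  proof -
    have "(?q i j * ?q k l) $$ (r, c) = (\<Sum>u<Suc m. ?q i j $$ (r, u) * ?q k l $$ (u, c))"
      using that carrier_matD[OF colsum_proj_closed] by (simp add: scalar_prod_def atLeast0LessThan del: sum.lessThan_Suc)
    also have "\<dots> = (\<Sum>u<Suc m. kd u j * ((kd r i - kd r j) * ((kd u k - kd u l) * kd c l)))"
      by (rule sum.cong) (use that in \<open>auto simp: colsum_proj_unit\<close>)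
    also have "\<dots> = (kd r i - kd r j) * ((kd j k - kd j l) * kd c l)"
      using sum_kd[of "{..<Suc m}" j "\<lambda>u. (kd r i - kd r j) * ((kd u k - kd u l) * kd c l)"] that by simp
    finally show ?thesis by simp
  qed
  have cc: "?c (?q i j * ?q k l)" for i j k l by (rule mult_carrier_mat[OF colsum_proj_closed colsum_proj_closed])
  have "?q i j * ?q k l - ?q k l * ?q i j =
    (kd j k - kd j l) \<cdot>\<^sub>m (?q i l + (-1) \<cdot>\<^sub>m ?q j l) + (kd l j - kd l i) \<cdot>\<^sub>m (?q k j + (-1) \<cdot>\<^sub>m ?q l j)" (is "_ = ?rhs")
  proof (rule eq_matI)
    have cr: "?c ?rhs" by simp
    fix r c assume "r < dim_row ?rhs" "c < dim_col ?rhs"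
    then have rc: "r < Suc m" "c < Suc m" by (simp_all only: carrier_matD[OF cr])
    have sym: "kd l j = kd j l" "kd l i = kd i l" by (auto simp: kd_def)
    show "(?q i j * ?q k l - ?q k l * ?q i j) $$ (r, c) = ?rhs $$ (r, c)"
      using rc ij kl cc carrier_matD[OF cc] carrier_matD[OF colsum_proj_closed] prod[OF ij kl rc] prod[OF kl ij rc]
      by (simp add: colsum_proj_unit del: index_mult_mat(1)) (simp add: algebra_simps kd_def)
  qed (use cc[of i j k l] cc[of k l i j] carrier_matD[OF cc] in auto)
  then show ?thesis
    unfolding stab_unit_def
    by (subst sig_bracket[symmetric]) (simp_all add: colsum_proj_colsum sig_add sig_scale del: s_alg_simps)
qed

lemma mat_unit_mult:
  assumes "j < n" "k < n"
  shows "mat_unit n i j * mat_unit n k l = kd j k \<cdot>\<^sub>m mat_unit n i l"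
proof (rule eq_matI)
  fix r c assume "r < dim_row (kd j k \<cdot>\<^sub>m mat_unit n i l)" "c < dim_col (kd j k \<cdot>\<^sub>m mat_unit n i l)"
  then have rc: "r < n" "c < n" by simp_all
  have "(mat_unit n i j * mat_unit n k l) $$ (r, c) = (\<Sum>u<n. kd u j * (kd r i * (kd u k * kd c l)))"
    using rc by (auto simp: scalar_prod_def atLeast0LessThan intro!: sum.cong)
  also have "\<dots> = kd r i * (kd j k * kd c l)" using sum_kd[of "{..<n}" j "\<lambda>u. kd r i * (kd u k * kd c l)"] assms by simp
  finally show "(mat_unit n i j * mat_unit n k l) $$ (r, c) = (kd j k \<cdot>\<^sub>m mat_unit n i l) $$ (r, c)"
    using rc by simp
qed auto

lemma mat_unit_vec:
  assumes "j < n" "k < n"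
  shows "mat_unit n i j *\<^sub>v unit_vec n k = kd j k \<cdot>\<^sub>v unit_vec n i"
proof (rule eq_vecI)
  fix r assume "r < dim_vec (kd j k \<cdot>\<^sub>v unit_vec n i)"
  then have r: "r < n" by simp
  have "(mat_unit n i j *\<^sub>v unit_vec n k) $ r = (\<Sum>u<n. kd u j * (kd r i * kd u k))"
    using r assms by (auto simp: scalar_prod_def atLeast0LessThan kd_def unit_vec_def intro!: sum.cong)
  also have "\<dots> = kd r i * kd j k" using sum_kd[of "{..<n}" j "\<lambda>u. kd r i * kd u k"] assms by simp
  finally show "(mat_unit n i j *\<^sub>v unit_vec n k) $ r = (kd j k \<cdot>\<^sub>v unit_vec n i) $ r"
    using r by (simp add: kd_def unit_vec_def)
qed auto

lemma colsum_zero_add: "\<lbrakk>X \<in> colsum_zero m; Y \<in> colsum_zero m\<rbrakk> \<Longrightarrow> X + Y \<in> colsum_zero m"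
  by (auto simp: colsum_zero_def sum.distrib add_eq_0_iff)

lemma colsum_zero_smult: "X \<in> colsum_zero m \<Longrightarrow> a \<cdot>\<^sub>m X \<in> colsum_zero m"
proof -
  assume X: "X \<in> colsum_zero m"
  have "(\<Sum>r<Suc m. (a \<cdot>\<^sub>m X) $$ (r, c)) = a * (\<Sum>r<Suc m. X $$ (r, c))" if "c < Suc m" for c
    unfolding sum_distrib_left using X that by (intro sum.cong) (auto simp: colsum_zero_def)
  then show ?thesis using X by (simp add: colsum_zero_def del: sum.lessThan_Suc)
qed

section \<open>Vector-valued Laurent polynomials\<close>

definition Zn :: "nat \<Rightarrow> (nat \<Rightarrow> int) set" where
  "Zn n = {a. \<forall>i\<ge>n. a i = 0}"

text \<open>Laurent polynomials in \<open>n\<close> variables with coefficients in C^d: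
  \<open>F a\<close> is the coefficient of t^a. Below, \<open>single a y\<close> is the monomial t^a
  y, and \<open>ev\<close> is the value at t = (1, ..., 1).\<close>

definition FS :: "nat \<Rightarrow> nat \<Rightarrow> ((nat \<Rightarrow> int) \<Rightarrow> nat \<Rightarrow> complex) set" where
  "FS n d = {F. finite {a. F a \<noteq> 0} \<and> (\<forall>a. F a \<noteq> 0 \<longrightarrow> a \<in> Zn n) \<and> (\<forall>a. F a \<in> Cd d)}"

definition fsc :: "complex \<Rightarrow> ('i \<Rightarrow> 'j \<Rightarrow> complex) \<Rightarrow> 'i \<Rightarrow> 'j \<Rightarrow> complex" where
  "fsc c F = (\<lambda>a. csc c (F a))"

definition single :: "'i \<Rightarrow> 'b \<Rightarrow> 'i \<Rightarrow> 'b::zero" where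
  "single a y = (\<lambda>b. if b = a then y else 0)"

definition ev :: "('i \<Rightarrow> 'b) \<Rightarrow> 'b::comm_monoid_add" where
  "ev F = (\<Sum>a | F a \<noteq> 0. F a)"

lemma csc_scaling: "scaling csc"
  by unfold_locales (auto simp: csc_def fun_eq_iff algebra_simps)

interpretation csc: scaling csc
  by (rule csc_scaling)

lemma fsc_scaling: "scaling fsc"
  by unfold_locales (auto simp: fsc_def csc_def fun_eq_iff algebra_simps)

interpretation fsc: scaling fsc
  by (rule fsc_scaling)

lemma FS_subspace: "scaling_subspace fsc (FS n d)"
proof unfold_locales
  show "0 \<in> FS n d" by (simp add: FS_def Cd.S_zero)
next
  fix F G assume F: "F \<in> FS n d" and G: "G \<in> FS n d"
  have "{a. F a + G a \<noteq> 0} \<subseteq> {a. F a \<noteq> 0} \<union> {a. G a \<noteq> 0}" by auto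
  then have "finite {a. F a + G a \<noteq> 0}" by (rule finite_subset) (use F G in \<open>simp add: FS_def\<close>)
  moreover have "a \<in> Zn n" if "F a + G a \<noteq> 0" for a
    using that F G unfolding FS_def by (cases "F a = 0") auto
  ultimately show "F + G \<in> FS n d" using F G by (simp add: FS_def Cd.S_add)
next
  fix F c assume F: "F \<in> FS n d"
  have 0: "csc c 0 = (0 :: nat \<Rightarrow> complex)" by (rule csc.sc_zero_right)
  have "{a. csc c (F a) \<noteq> 0} \<subseteq> {a. F a \<noteq> 0}" using 0 by auto
  then have "finite {a. csc c (F a) \<noteq> 0}" by (rule finite_subset) (use F in \<open>simp add: FS_def\<close>)
  moreover have "a \<in> Zn n" if "csc c (F a) \<noteq> 0" for a
    using that F 0 unfolding FS_def by (cases "F a = 0") auto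
  ultimately show "fsc c F \<in> FS n d" using F by (simp add: FS_def fsc_def Cd.S_sc)
qed

interpretation FS: scaling_subspace fsc "FS n d" for n d
  by (rule FS_subspace)

lemma single_apply [simp]: "single a y a = y" "b \<noteq> a \<Longrightarrow> single a y b = 0"
  by (simp_all add: single_def)

lemma single_zero [simp]: "single a 0 = 0"
  by (auto simp: single_def)

lemma single_add: "single a (x + y) = single a x + (single a y :: _ \<Rightarrow> _::ab_group_add)"
  by (auto simp: single_def)

lemma single_diff: "single a (x - y) = single a x - (single a y :: _ \<Rightarrow> _::ab_group_add)"
  by (auto simp: single_def)

lemma single_fsc: "single a (csc c y) = fsc c (single a y)"
proof (rule ext)
  show "single a (csc c y) b = fsc c (single a y) b" for b
    by (cases "b = a") (simp_all add: single_def fsc_def csc.sc_zero_right)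
qed

lemma single_closed: "a \<in> Zn n \<Longrightarrow> y \<in> Cd d \<Longrightarrow> single a y \<in> FS n d"
proof -
  assume a: "a \<in> Zn n" "y \<in> Cd d"
  have "{b. single a y b \<noteq> 0} \<subseteq> {a}" by (auto simp: single_def)
  then have "finite {b. single a y b \<noteq> 0}" by (rule finite_subset) simp
  then show ?thesis using a by (auto simp: FS_def single_def Cd.S_zero)
qed

lemma single_inj: "single a x = single a y \<Longrightarrow> x = y"
  by (metis single_apply(1))

lemma FS_closed: "F \<in> FS n d \<Longrightarrow> F a \<in> Cd d"
  and FS_finite: "F \<in> FS n d \<Longrightarrow> finite {a. F a \<noteq> 0}"
  and FS_Zn: "F \<in> FS n d \<Longrightarrow> F a \<noteq> 0 \<Longrightarrow> a \<in> Zn n"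
  by (simp_all add: FS_def)

lemma sum_fun_apply: "(\<Sum>i\<in>I. f i) x = (\<Sum>i\<in>I. f i x)"
  for f :: "'i \<Rightarrow> 'a \<Rightarrow> 'b::comm_monoid_add"
  by (induction I rule: infinite_finite_induct) simp_all

lemma FS_sum_single:
  assumes "F \<in> FS n d" shows "F = (\<Sum>a | F a \<noteq> 0. single a (F a))"
proof
  fix b
  have "(\<Sum>a | F a \<noteq> 0. single a (F a)) b = (\<Sum>a | F a \<noteq> 0. if a = b then F a else 0)"
    by (subst sum_fun_apply, rule sum.cong) (auto simp: single_def)
  then show "F b = (\<Sum>a | F a \<noteq> 0. single a (F a)) b" using FS_finite[OF assms] by simp
qed

text \<open>The vector \<open>y\<close> in a monomial is arbitrary and absorbs scalars, so additive
  maps agree as soon as they agree on the monomials. Most operator identities below are reduced to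
  monomials in this way.\<close>

lemma FS_additive_ext:
  fixes f g :: "((nat \<Rightarrow> int) \<Rightarrow> nat \<Rightarrow> complex) \<Rightarrow> 'w::ab_group_add"
  assumes f: "\<And>F G. \<lbrakk>F \<in> FS n d; G \<in> FS n d\<rbrakk> \<Longrightarrow> f (F + G) = f F + f G"
    and g: "\<And>F G. \<lbrakk>F \<in> FS n d; G \<in> FS n d\<rbrakk> \<Longrightarrow> g (F + G) = g F + g G"
    and eq: "\<And>a y. \<lbrakk>a \<in> Zn n; y \<in> Cd d\<rbrakk> \<Longrightarrow> f (single a y) = g (single a y)"
    and F: "F \<in> FS n d"
  shows "f F = g F"
proof -
  have 0: "f 0 = 0" "g 0 = 0" using f[OF FS.S_zero FS.S_zero] g[OF FS.S_zero FS.S_zero] by simp_all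
  have "f (\<Sum>a\<in>I. single a (F a)) = g (\<Sum>a\<in>I. single a (F a))" if "finite I" "I \<subseteq> {a. F a \<noteq> 0}" for I
    using that
  proof (induction I rule: finite_induct)
    case empty
    show ?case unfolding sum.empty 0 ..
  next
    case (insert a I)
    have s: "single b (F b) \<in> FS n d" if "b \<in> insert a I" for b
      by (rule single_closed[OF FS_Zn[OF F] FS_closed[OF F]]) (use that insert.prems in blast)
    have c: "(\<Sum>a\<in>I. single a (F a)) \<in> FS n d" by (rule FS.S_sum) (use s in auto)
    have IH: "f (\<Sum>a\<in>I. single a (F a)) = g (\<Sum>a\<in>I. single a (F a))" using insert by simp
    have "f (single a (F a)) = g (single a (F a))"
      by (rule eq[OF FS_Zn[OF F] FS_closed[OF F]]) (use insert.prems in blast)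
    then show ?case unfolding sum.insert[OF insert.hyps] f[OF s[OF insertI1] c] g[OF s[OF insertI1] c] IH by simp
  qed
  from this[OF FS_finite[OF F] order.refl] show ?thesis using FS_sum_single[OF F] by simp
qed

lemma ev_superset:
  assumes "finite A" "{a. F a \<noteq> 0} \<subseteq> A" shows "ev F = (\<Sum>a\<in>A. F a)"
  unfolding ev_def by (rule sum.mono_neutral_left) (use assms in auto)

lemma ev_add:
  assumes "F \<in> FS n d" "G \<in> FS n d" shows "ev (F + G) = ev F + ev G"
proof -
  let ?A = "{a. F a \<noteq> 0} \<union> {a. G a \<noteq> 0}"
  have A: "finite ?A" using assms by (simp add: FS_finite)
  have "ev (F + G) = (\<Sum>a\<in>?A. (F + G) a)" by (rule ev_superset[OF A]) auto
  also have "\<dots> = (\<Sum>a\<in>?A. F a) + (\<Sum>a\<in>?A. G a)" by (simp add: sum.distrib)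
  also have "\<dots> = ev F + ev G" using ev_superset[OF A, of F] ev_superset[OF A, of G] by auto
  finally show ?thesis .
qed

lemma ev_single [simp]: "ev (single a y) = y"
proof -
  have "ev (single a y) = (\<Sum>b\<in>{a}. single a y b)" by (rule ev_superset) (auto simp: single_def)
  then show ?thesis by simp
qed

lemma ev_fsc: "F \<in> FS n d \<Longrightarrow> ev (fsc c F) = csc c (ev F)"
  by (rule FS_additive_ext[of n d "\<lambda>F. ev (fsc c F)" "\<lambda>F. csc c (ev F)"])
    (simp_all add: fsc.sc_add_right ev_add[of _ n d] FS.S_sc csc.sc_add_right flip: single_fsc)

lemma ev_closed: "F \<in> FS n d \<Longrightarrow> ev F \<in> Cd d"
  unfolding ev_def by (rule Cd.S_sum) (rule FS_closed)

lemma ev_minus: "F \<in> FS n d \<Longrightarrow> G \<in> FS n d \<Longrightarrow> ev (F - G) = ev F - ev G"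
  using ev_add[of "F - G" n d G] FS.S_diff[of F n d G] by (simp add: algebra_simps)

lemma ev_sum: "(\<And>i. i \<in> I \<Longrightarrow> f i \<in> FS n d) \<Longrightarrow> ev (sum f I) = (\<Sum>i\<in>I. ev (f i))"
proof (induction I rule: infinite_finite_induct)
  case (insert i I)
  have "sum f I \<in> FS n d" by (rule FS.S_sum) (use insert in auto)
  then have "ev (f i + sum f I) = ev (f i) + ev (sum f I)" using ev_add[of "f i" n d "sum f I"] insert by simp
  then show ?case using insert(3,4) unfolding sum.insert[OF insert(1,2)] by (simp only: insertI2)
qed (simp_all add: ev_def)

text \<open>Multiplication by t_k: the new coefficient at \<open>a\<close> is the old one at a -
  eps_k.\<close>

definition shift :: "nat \<Rightarrow> ((nat \<Rightarrow> int) \<Rightarrow> 'b) \<Rightarrow> (nat \<Rightarrow> int) \<Rightarrow> 'b" where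
  "shift k F = (\<lambda>a. F (a(k := a k - 1)))"

text \<open>The exponent after multiplication by t_i and division by t_j. Written as a sum of two
  corrections, it is the identity for i = j.\<close>

definition move :: "nat \<Rightarrow> nat \<Rightarrow> (nat \<Rightarrow> int) \<Rightarrow> nat \<Rightarrow> int" where
  "move i j a = (\<lambda>k. a k + (if k = i then 1 else 0) - (if k = j then 1 else 0))"

lemma shift_single: "shift k (single a y) = single (a(k := a k + 1)) y"
proof (rule ext)
  fix b
  have "b(k := b k - 1) = a \<longleftrightarrow> b = a(k := a k + 1)" by auto
  then show "shift k (single a y) b = single (a(k := a k + 1)) y b" by (simp only: shift_def single_def)
qed

lemma shift_add: "shift k (F + G) = shift k F + shift k G"
  by (auto simp: shift_def)

lemma shift_fsc: "shift k (fsc c F) = fsc c (shift k F)"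
  by (auto simp: shift_def fsc_def)

lemma Zn_upd: "a \<in> Zn n \<Longrightarrow> k < n \<Longrightarrow> a(k := z) \<in> Zn n"
  by (auto simp: Zn_def)

lemma Zn_move: "a \<in> Zn n \<Longrightarrow> i < n \<Longrightarrow> j < n \<Longrightarrow> move i j a \<in> Zn n"
  by (auto simp: Zn_def move_def)

lemma move_inverse: "move i j (move j i a) = a"
  by (auto simp: move_def)

lemma FS_closedI:
  assumes "F \<in> FS n d" and "\<And>a. G a \<noteq> 0 \<Longrightarrow> F (h a) \<noteq> 0" and "\<And>a. g (h a) = a"
    and "\<And>a. a \<in> Zn n \<Longrightarrow> g a \<in> Zn n" and "\<And>a. G a \<in> Cd d"
  shows "G \<in> FS n d"
proof -
  have sub: "{a. G a \<noteq> 0} \<subseteq> g ` {a. F a \<noteq> 0}"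
  proof
    fix a assume "a \<in> {a. G a \<noteq> 0}"
    then show "a \<in> g ` {a. F a \<noteq> 0}" using assms(2)[of a] assms(3)[of a] by (intro image_eqI[of _ _ "h a"]) auto
  qed
  then have "finite {a. G a \<noteq> 0}" by (rule finite_subset) (simp add: FS_finite[OF assms(1)])
  moreover have "a \<in> Zn n" if "G a \<noteq> 0" for a
    using sub that assms(4) FS_Zn[OF assms(1)] by blast
  ultimately show ?thesis using assms(5) by (simp add: FS_def)
qed

lemma shift_closed:
  assumes "k < n" "F \<in> FS n d" shows "shift k F \<in> FS n d"
  by (rule FS_closedI[OF assms(2), of _ "\<lambda>a. a(k := a k - 1)" "\<lambda>a. a(k := a k + 1)"])
    (use assms in \<open>auto simp: shift_def Zn_upd FS_closed[OF assms(2)]\<close>)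

lemma shift_bij:
  assumes k: "k < n" shows "bij_betw (shift k) (FS n d) (FS n d)"
proof (rule bij_betw_byWitness[of _ "\<lambda>F a. F (a(k := a k + 1))"])
  show "(\<lambda>F a. F (a(k := a k + 1))) ` FS n d \<subseteq> FS n d"
  proof clarify
    fix F assume F: "F \<in> FS n d"
    show "(\<lambda>a. F (a(k := a k + 1))) \<in> FS n d"
      by (rule FS_closedI[OF F, of _ "\<lambda>a. a(k := a k + 1)" "\<lambda>a. a(k := a k - 1)"])
        (use k in \<open>auto simp: Zn_upd FS_closed[OF F]\<close>)
  qed
qed (use shift_closed[OF k] in \<open>auto simp: shift_def\<close>)

lemma ev_shift:
  assumes k: "k < n" and F: "F \<in> FS n d" shows "ev (shift k F) = ev F"
  by (rule FS_additive_ext[of n d "\<lambda>F. ev (shift k F)" ev F])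
    (use F shift_closed[OF k] in \<open>simp_all add: shift_add ev_add[of _ n d] shift_single\<close>)

text \<open>An induction over Z^n in all directions for the price of one upward step. It is often
  applied to truth values: there the hypothesis says that a statement at \<open>a\<close> is
  equivalent to the statement at a + eps_k, which follows from injectivity of e_k without ever
  handling negative powers.\<close>

lemma Zn_shift_const:
  assumes inv: "\<And>a k. \<lbrakk>a \<in> Zn n; k < n\<rbrakk> \<Longrightarrow> g (a(k := a k + 1)) = g a" and a: "a \<in> Zn n"
  shows "g a = g (\<lambda>_. 0)"
proof -
  have step: "g (a(k := z)) = g a" if a: "a \<in> Zn n" and k: "k < n" for a k and z :: int
  proof -
    define h where "h z = g (a(k := z))" for z
    have h: "h (z + 1) = h z" for z
      using inv[OF Zn_upd[OF a k, of z] k] by (simp add: h_def)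
    have "h z = h (a k)"
    proof (induction z rule: int_induct[of _ "a k"])
      case (step2 i)
      then show ?case using h[of "i - 1"] by simp
    qed (simp_all add: h)
    then show ?thesis by (simp add: h_def)
  qed
  have "g (\<lambda>i. if i < j then 0 else a i) = g a" if "j \<le> n" for j
    using that
  proof (induction j)
    case (Suc j)
    have "(\<lambda>i. if i < Suc j then 0 else a i) = (\<lambda>i. if i < j then 0 else a i)(j := 0)"
      by (auto simp: fun_eq_iff less_Suc_eq)
    moreover have "(\<lambda>i. if i < j then 0 else a i) \<in> Zn n" using a by (auto simp: Zn_def)
    ultimately show ?case using Suc step[of "\<lambda>i. if i < j then 0 else a i" j 0] by simp
  qed simp
  from this[of n] have "g (\<lambda>i. if i < n then 0 else a i) = g a" by simp
  moreover have "(\<lambda>i. if i < n then 0 else a i) = (\<lambda>_. 0)" using a by (auto simp: Zn_def fun_eq_iff)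
  ultimately show ?thesis by simp
qed

section \<open>The standard module of a representation of \<open>s_alg m\<close>\<close>

text \<open>The operator of e_ij: the vector field t_i d/dt_j, twisted by the weight lam_j and by
  the fibre operator of e_ij - e_jj. It is written from the target exponent \<open>b\<close>, whose
  source is \<open>move j i b\<close>; on monomials it takes the more readable form of
  \<open>E_single\<close>.\<close>

definition unit_op :: "nat \<Rightarrow> (nat \<Rightarrow> complex) \<Rightarrow> (s_elem \<Rightarrow> (nat \<Rightarrow> complex) \<Rightarrow> nat \<Rightarrow> complex) \<Rightarrow> nat \<Rightarrow> nat \<Rightarrow>
    ((nat \<Rightarrow> int) \<Rightarrow> nat \<Rightarrow> complex) \<Rightarrow> (nat \<Rightarrow> int) \<Rightarrow> nat \<Rightarrow> complex" where
  "unit_op m lam \<rho> i j F = (\<lambda>b. csc (lam j + of_int (move j i b j)) (F (move j i b)) + \<rho> (stab_unit m i j) (F (move j i b)))"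

definition std_act :: "nat \<Rightarrow> (nat \<Rightarrow> complex) \<Rightarrow> (s_elem \<Rightarrow> (nat \<Rightarrow> complex) \<Rightarrow> nat \<Rightarrow> complex) \<Rightarrow> s_elem \<Rightarrow>
    ((nat \<Rightarrow> int) \<Rightarrow> nat \<Rightarrow> complex) \<Rightarrow> (nat \<Rightarrow> int) \<Rightarrow> nat \<Rightarrow> complex" where
  "std_act m lam \<rho> x F = (\<Sum>i<Suc m. \<Sum>j<Suc m. fsc (fst x $$ (i, j)) (unit_op m lam \<rho> i j F)) +
     (\<Sum>k<Suc m. fsc (snd x $ k) (shift k F))"

lemma csc_apply: "csc c x i = c * x i"
  by (simp add: csc_def)

lemma fsc_apply: "fsc c F a = csc c (F a)"
  by (simp add: fsc_def)

lemma kd_sum: "j < n \<Longrightarrow> (\<Sum>i<n. fsc (kd i j) (f i)) = f j"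
proof -
  assume "j < n"
  moreover have "(\<Sum>i<n. fsc (kd i j) (f i)) = (\<Sum>i<n. if i = j then f i else 0)"
    by (rule sum.cong) (auto simp: kd_def fsc.sc_one fsc.sc_zero_left)
  ultimately show ?thesis by simp
qed

lemma kd_sum2: "i < n \<Longrightarrow> j < n \<Longrightarrow> (\<Sum>r<n. \<Sum>c<n. fsc (kd r i * kd c j) (f r c)) = f i j"
proof -
  assume ij: "i < n" "j < n"
  have "(\<Sum>r<n. \<Sum>c<n. fsc (kd r i * kd c j) (f r c)) = (\<Sum>r<n. fsc (kd r i) (\<Sum>c<n. fsc (kd c j) (f r c)))"
    by (simp only: fsc.sc_sum_right fsc.sc_sc)
  also have "\<dots> = f i j" unfolding kd_sum[OF ij(2)] kd_sum[OF ij(1)] ..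
  finally show ?thesis .
qed

locale std_rep = conc_rep csc "Cd d" "s_alg m" \<rho>
  for d m and \<rho> :: "s_elem \<Rightarrow> (nat \<Rightarrow> complex) \<Rightarrow> nat \<Rightarrow> complex" +
  fixes lam :: "nat \<Rightarrow> complex"
begin

abbreviation R where "R i j \<equiv> \<rho> (stab_unit m i j)"
abbreviation E where "E \<equiv> unit_op m lam \<rho>"
abbreviation W where "W \<equiv> FS (Suc m) d"

lemmas R_closed = rho_closed[OF stab_unit_closed]
  and R_add = rho_add_right[OF stab_unit_closed]
  and R_sc = rho_sc_right[OF stab_unit_closed]
  and R_zero = rho_zero_right[OF stab_unit_closed]

lemma zero_rep: "y \<in> Cd d \<Longrightarrow> \<rho> (0\<^sub>m m m, 0\<^sub>v m) y = 0"
proof -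
  assume y: "y \<in> Cd d"
  have "\<rho> (0 \<odot>\<^bsub>s_alg m\<^esub> (0\<^sub>m m m, 0\<^sub>v m)) y = csc 0 (\<rho> (0\<^sub>m m m, 0\<^sub>v m) y)"
    by (rule rho_sc_left[OF _ y]) simp
  moreover have "0 \<odot>\<^bsub>s_alg m\<^esub> (0\<^sub>m m m, 0\<^sub>v m) = (0\<^sub>m m m, 0\<^sub>v m)" by auto
  ultimately show ?thesis by (simp only: csc.sc_zero_left)
qed

lemma R_diag: "j < Suc m \<Longrightarrow> y \<in> Cd d \<Longrightarrow> R j j y = 0"
  by (simp only: stab_unit_diag zero_rep)

lemma R_bracket:
  assumes ij: "i < Suc m" "j < Suc m" and kl: "k < Suc m" "l < Suc m" and y: "y \<in> Cd d"
  shows "R i j (R k l y) - R k l (R i j y) =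
    csc (kd j k - kd j l) (R i l y - R j l y) + csc (kd l j - kd l i) (R k j y - R l j y)"
proof -
  note c = stab_unit_closed
  have lin: "\<rho> (a \<odot>\<^bsub>s_alg m\<^esub> (x \<oplus>\<^bsub>s_alg m\<^esub> (-1) \<odot>\<^bsub>s_alg m\<^esub> z)) y = csc a (\<rho> x y - \<rho> z y)"
    if "x \<in> carrier (s_alg m)" "z \<in> carrier (s_alg m)" for a x z
    using that y s.lie_smult_closed[of z m "-1"] s.lie_add_closed[of x m "(-1) \<odot>\<^bsub>s_alg m\<^esub> z"]
    by (simp add: rho_sc_left rho_add_left csc.sc_minus del: s_alg_simps)
  have cl: "a \<odot>\<^bsub>s_alg m\<^esub> (x \<oplus>\<^bsub>s_alg m\<^esub> (-1) \<odot>\<^bsub>s_alg m\<^esub> z) \<in> carrier (s_alg m)"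
    if "x \<in> carrier (s_alg m)" "z \<in> carrier (s_alg m)" for a x z
    using that by (intro s.lie_smult_closed s.lie_add_closed)
  have "R i j (R k l y) - R k l (R i j y) = \<rho> (bracket (s_alg m) (stab_unit m i j) (stab_unit m k l)) y"
    by (rule rho_bracket[OF c c y, symmetric])
  then show ?thesis
    unfolding stab_unit_bracket[OF ij kl] rho_add_left[OF cl[OF c c] cl[OF c c] y] lin[OF c c] .
qed

lemma E_single:
  assumes y: "y \<in> Cd d"
  shows "E i j (single a y) = single (move i j a) (csc (lam j + of_int (a j)) y + R i j y)"
proof (rule ext)
  fix b
  have "move j i b = a \<longleftrightarrow> b = move i j a" using move_inverse by metis
  then show "E i j (single a y) b = single (move i j a) (csc (lam j + of_int (a j)) y + R i j y) b"
    by (cases "b = move i j a") (simp_all add: unit_op_def single_def csc.sc_zero_right R_zero)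
qed

lemma E_add: "F \<in> W \<Longrightarrow> G \<in> W \<Longrightarrow> E i j (F + G) = E i j F + E i j G"
  by (rule ext) (simp add: unit_op_def csc.sc_add_right R_add FS_closed[of _ "Suc m" d] add_ac)

lemma E_fsc: "F \<in> W \<Longrightarrow> E i j (fsc c F) = fsc c (E i j F)"
  by (rule ext) (simp add: unit_op_def fsc_apply csc.sc_add_right csc.sc_sc R_sc FS_closed[of _ "Suc m" d] mult.commute)

lemma E_closed:
  assumes "i < Suc m" "j < Suc m" "F \<in> W" shows "E i j F \<in> W"
proof (rule FS_closedI[OF assms(3), of _ "move j i" "move i j"])
  show "F (move j i a) \<noteq> 0" if "E i j F a \<noteq> 0" for a
    using that by (auto simp: unit_op_def csc.sc_zero_right R_zero)
  show "E i j F a \<in> Cd d" for a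
    by (simp add: unit_op_def FS_closed[OF assms(3)] Cd.S_add Cd.S_sc R_closed)
qed (use assms in \<open>simp_all add: move_inverse Zn_move\<close>)

text \<open>On a monomial all contributing terms have the same exponent, so only coefficients in C^d
  are compared. The changes of exponent contribute delta_jk - delta_jl and delta_li - delta_lj, and
  exactly these make up for the difference between \<open>R_bracket\<close> and the bracket of
  matrix units. The terms with j = l cancel because \<open>R j j\<close> vanishes.\<close>

lemma E_commutator:
  assumes ij: "i < Suc m" "j < Suc m" and kl: "k < Suc m" "l < Suc m" and F: "F \<in> W"
  shows "E i j (E k l F) - E k l (E i j F) = fsc (kd j k) (E i l F) - fsc (kd l i) (E k j F)"
proof -
  define f where "f F = E i j (E k l F) - E k l (E i j F)" for F
  define g where "g F = fsc (kd j k) (E i l F) - fsc (kd l i) (E k j F)" for F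
  have "f F = g F"
proof (rule FS_additive_ext[of "Suc m" d f g, OF _ _ _ F])
  show "f (F + G) = f F + f G" if "F \<in> W" "G \<in> W" for F G
    unfolding f_def using that ij kl by (simp only: E_add E_closed add_diff_add)
  show "g (F + G) = g F + g G" if "F \<in> W" "G \<in> W" for F G
    unfolding g_def using that by (simp only: E_add fsc.sc_add_right add_diff_add)
  fix a y assume y: "y \<in> Cd d"
  define z where "z i j = csc (lam j + of_int (a j)) y + R i j y" for i j
  have z: "z i j \<in> Cd d" for i j using y by (simp add: z_def Cd.S_add Cd.S_sc R_closed)
  define b where "b = move i j (move k l a)"
  have b2: "move k l (move i j a) = b" by (auto simp: b_def move_def)
  \<comment> \<open>The two terms on the right have the exponent \<open>b\<close> only when their
    Kronecker factor is nonzero; otherwise the exponent is immaterial.\<close>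
  have b3: "j = k \<Longrightarrow> move i l a = b" "l = i \<Longrightarrow> move k j a = b" by (auto simp: b_def move_def)
  have lhs: "f (single a y) = single b (csc (lam j + of_int (move k l a j)) (z k l) + R i j (z k l) -
      (csc (lam l + of_int (move i j a l)) (z i j) + R k l (z i j)))"
    unfolding f_def E_single[OF y] z_def[symmetric] E_single[OF z] b2 b_def[symmetric] single_diff ..
  have rhs: "g (single a y) = single b (csc (kd j k) (z i l) - csc (kd l i) (z k j))"
  proof -
    have "single (move i l a) (csc (kd j k) w) = single b (csc (kd j k) w)" for w :: "nat \<Rightarrow> complex"
      using b3(1) by (cases "j = k") (simp_all add: kd_def csc.sc_zero_left)
    moreover have "single (move k j a) (csc (kd l i) w) = single b (csc (kd l i) w)" for w :: "nat \<Rightarrow> complex"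
      using b3(2) by (cases "l = i") (simp_all add: kd_def csc.sc_zero_left)
    ultimately show ?thesis
      unfolding g_def E_single[OF y] z_def[symmetric] single_fsc[symmetric] single_diff by (simp only:)
  qed
  have Rz: "R i j (z k l) = csc (lam l + of_int (a l)) (R i j y) + R i j (R k l y)" for i j k l
    unfolding z_def using y by (simp add: R_add R_sc Cd.S_sc R_closed)
  have br: "R i j (R k l y) = R k l (R i j y) +
    (csc (kd j k - kd j l) (R i l y - R j l y) + csc (kd l j - kd l i) (R k j y - R l j y))"
    using R_bracket[OF ij kl y] by (simp add: algebra_simps)
  have diag: "R j j y = 0" "R l l y = 0" using R_diag ij kl y by auto
  have mv: "(of_int (move k l a j) :: complex) = of_int (a j) + kd j k - kd j l"
    "(of_int (move i j a l) :: complex) = of_int (a l) + kd l i - kd l j"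
    by (simp_all add: move_def kd_def)
  have "csc (lam j + of_int (move k l a j)) (z k l) + R i j (z k l) -
      (csc (lam l + of_int (move i j a l)) (z i j) + R k l (z i j)) = csc (kd j k) (z i l) - csc (kd l i) (z k j)"
  proof (rule ext)
    fix r
    have d: "R j j y r = 0" "R l l y r = 0" by (simp_all add: diag)
    show "(csc (lam j + of_int (move k l a j)) (z k l) + R i j (z k l) -
      (csc (lam l + of_int (move i j a l)) (z i j) + R k l (z i j))) r = (csc (kd j k) (z i l) - csc (kd l i) (z k j)) r"
      unfolding Rz br mv unfolding z_def
      by (cases "j = k"; cases "l = i"; cases "j = l") (use d in \<open>simp_all add: kd_def csc_apply algebra_simps\<close>)
  qed
  then show "f (single a y) = g (single a y)" unfolding lhs rhs by simp
qed
  then show ?thesis by (simp only: f_def g_def)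
qed

text \<open>Multiplying by t_k raises the exponent of t_j only if j = k, so the weight lam_j + a_j
  changes only then. The fibre term commutes with all shifts.\<close>

lemma E_shift:
  assumes F: "F \<in> W" and k: "k < Suc m"
  shows "E i j (shift k F) - shift k (E i j F) = fsc (kd j k) (shift i F)"
proof -
  define f where "f F = E i j (shift k F) - shift k (E i j F)" for F
  define g where "g F = fsc (kd j k) (shift i F)" for F :: "(nat \<Rightarrow> int) \<Rightarrow> nat \<Rightarrow> complex"
  have "f F = g F"
proof (rule FS_additive_ext[of "Suc m" d f g, OF _ _ _ F])
  show "f (F + G) = f F + f G" if "F \<in> W" "G \<in> W" for F G
    unfolding f_def using that k by (simp only: shift_add E_add shift_closed add_diff_add)
  show "g (F + G) = g F + g G" for F G
    unfolding g_def by (simp only: shift_add fsc.sc_add_right)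
  fix a y assume y: "y \<in> Cd d"
  have b: "(move i j a)(k := move i j a k + 1) = move i j (a(k := a k + 1))"
    "j = k \<Longrightarrow> a(i := a i + 1) = move i j (a(k := a k + 1))" by (auto simp: move_def fun_eq_iff)
  show "f (single a y) = g (single a y)"
    unfolding f_def g_def shift_single E_single[OF y] b(1) single_fsc[symmetric]
  proof (rule ext, rule ext)
    fix c r
    show "(single (move i j (a(k := a k + 1))) (csc (lam j + of_int ((a(k := a k + 1)) j)) y + R i j y) -
        single (move i j (a(k := a k + 1))) (csc (lam j + of_int (a j)) y + R i j y)) c r =
      single (a(i := a i + 1)) (csc (kd j k) y) c r"
      using b(2) by (cases "j = k") (simp_all add: single_def kd_def csc_apply algebra_simps)
  qed
qed
  then show ?thesis by (simp only: f_def g_def)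
qed

definition PA where "PA A F = (\<Sum>i<Suc m. \<Sum>j<Suc m. fsc (A $$ (i, j)) (E i j F))"
definition QA where "QA v F = (\<Sum>k<Suc m. fsc (v $ k) (shift k F))"

lemma std_act_eq: "std_act m lam \<rho> (A, v) F = PA A F + QA v F"
  by (simp add: std_act_def PA_def QA_def del: sum.lessThan_Suc)

abbreviation CM where "CM \<equiv> carrier_mat (Suc m) (Suc m) :: complex mat set"
abbreviation CV where "CV \<equiv> carrier_vec (Suc m) :: complex vec set"

lemma PA_add: "A \<in> CM \<Longrightarrow> B \<in> CM \<Longrightarrow> PA (A + B) F = PA A F + PA B F"
  unfolding PA_def sum.distrib[symmetric] by (intro sum.cong refl) (simp add: fsc.sc_add_left)

lemma PA_smult: "A \<in> CM \<Longrightarrow> PA (c \<cdot>\<^sub>m A) F = fsc c (PA A F)"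
  unfolding PA_def fsc.sc_sum_right by (intro sum.cong refl) (simp add: fsc.sc_sc)

lemma QA_add: "v \<in> CV \<Longrightarrow> w \<in> CV \<Longrightarrow> QA (v + w) F = QA v F + QA w F"
  unfolding QA_def sum.distrib[symmetric] by (intro sum.cong refl) (simp add: fsc.sc_add_left)

lemma QA_smult: "v \<in> CV \<Longrightarrow> QA (c \<cdot>\<^sub>v v) F = fsc c (QA v F)"
  unfolding QA_def fsc.sc_sum_right by (intro sum.cong refl) (simp add: fsc.sc_sc)

lemma PA_closed: "F \<in> W \<Longrightarrow> PA A F \<in> W" and QA_closed: "F \<in> W \<Longrightarrow> QA v F \<in> W"
  unfolding PA_def QA_def by (intro FS.S_sum FS.S_sc E_closed shift_closed; simp)+

lemma PA_add_right: "F \<in> W \<Longrightarrow> G \<in> W \<Longrightarrow> PA A (F + G) = PA A F + PA A G"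
  unfolding PA_def sum.distrib[symmetric] by (intro sum.cong refl) (simp add: E_add fsc.sc_add_right)

lemma QA_add_right: "QA v (F + G) = QA v F + QA v G"
  unfolding QA_def sum.distrib[symmetric] by (intro sum.cong refl) (simp add: shift_add fsc.sc_add_right)

lemma PA_fsc: "F \<in> W \<Longrightarrow> PA A (fsc c F) = fsc c (PA A F)"
  unfolding PA_def fsc.sc_sum_right by (intro sum.cong refl) (simp add: E_fsc fsc.sc_sc mult.commute)

lemma QA_fsc: "QA v (fsc c F) = fsc c (QA v F)"
  unfolding QA_def fsc.sc_sum_right by (intro sum.cong refl) (simp add: shift_fsc fsc.sc_sc mult.commute)

lemma PA_unit: "i < Suc m \<Longrightarrow> j < Suc m \<Longrightarrow> PA (mat_unit (Suc m) i j) F = E i j F"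
proof -
  assume ij: "i < Suc m" "j < Suc m"
  have "PA (mat_unit (Suc m) i j) F = (\<Sum>r<Suc m. \<Sum>c<Suc m. fsc (kd r i * kd c j) (E r c F))"
    unfolding PA_def by (intro sum.cong refl) simp
  then show ?thesis unfolding kd_sum2[OF ij] .
qed

lemma QA_unit: "k < Suc m \<Longrightarrow> QA (unit_vec (Suc m) k) F = shift k F"
proof -
  assume k: "k < Suc m"
  have "QA (unit_vec (Suc m) k) F = (\<Sum>i<Suc m. fsc (kd i k) (shift i F))"
    unfolding QA_def by (intro sum.cong refl) (auto simp: kd_def unit_vec_def)
  then show ?thesis unfolding kd_sum[OF k] .
qed

text \<open>The defect \<open>f A B\<close> is linear in each matrix, so by two expansions it
  vanishes once it vanishes on pairs of matrix units, where \<open>E_commutator\<close> applies. The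
  mixed bracket with vectors is reduced to \<open>E_shift\<close> in the same manner.\<close>

lemma PA_commutator:
  assumes A: "A \<in> CM" and B: "B \<in> CM" and F: "F \<in> W"
  shows "PA A (PA B F) - PA B (PA A F) = PA (A * B - B * A) F"
proof -
  have cl: "A * B - B * A \<in> CM" if "A \<in> CM" "B \<in> CM" for A B
    by (rule minus_carrier_mat[OF mult_carrier_mat[OF that(2,1)]])
  have sub: "PA (A - B) F = PA A F - PA B F" if "A \<in> CM" "B \<in> CM" for A B
  proof -
    have e: "(A - B) + B = A" by (rule eq_matI) (use that in auto)
    have "PA ((A - B) + B) F = PA (A - B) F + PA B F" by (rule PA_add) (use that in auto)
    then show ?thesis unfolding e by simp
  qed
  have mm: "A * B \<in> CM" if "A \<in> CM" "B \<in> CM" for A B using that by simp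
  define f where "f A B = PA A (PA B F) - PA B (PA A F) - (PA (A * B) F - PA (B * A) F)" for A B
  have fl: "f (A + A') B = f A B + f A' B" if "A \<in> CM" "A' \<in> CM" "B \<in> CM" for A A' B
    unfolding f_def using that F mm
    by (simp add: PA_add PA_add_right PA_closed add_mult_distrib_mat[of _ "Suc m" "Suc m"] mult_add_distrib_mat[of _ "Suc m" "Suc m"])
  have fr: "f A (B + B') = f A B + f A B'" if "A \<in> CM" "B \<in> CM" "B' \<in> CM" for A B B'
    unfolding f_def using that F mm
    by (simp add: PA_add PA_add_right PA_closed add_mult_distrib_mat[of _ "Suc m" "Suc m"] mult_add_distrib_mat[of _ "Suc m" "Suc m"])
  have fls: "f (c \<cdot>\<^sub>m A) B = fsc c (f A B)" if "A \<in> CM" "B \<in> CM" for A B c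
    unfolding f_def using that F mm
    by (simp add: PA_smult PA_fsc PA_closed fsc.sc_diff_right mult_smult_assoc_mat[of _ "Suc m" "Suc m"] mult_smult_distrib[of _ "Suc m" "Suc m"])
  have frs: "f A (c \<cdot>\<^sub>m B) = fsc c (f A B)" if "A \<in> CM" "B \<in> CM" for A B c
    unfolding f_def using that F mm
    by (simp add: PA_smult PA_fsc PA_closed fsc.sc_diff_right mult_smult_assoc_mat[of _ "Suc m" "Suc m"] mult_smult_distrib[of _ "Suc m" "Suc m"])
  have unit: "f (mat_unit (Suc m) i j) (mat_unit (Suc m) k l) = 0"
    if "i < Suc m" "j < Suc m" "k < Suc m" "l < Suc m" for i j k l
    unfolding f_def mat_unit_mult[OF that(2,3)] mat_unit_mult[OF that(4,1)]
    using E_commutator[OF that F] that by (simp add: PA_unit PA_smult)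
  have "f (mat_unit (Suc m) i j) B = 0" if "i < Suc m" "j < Suc m" for i j
    using fsc.mat_linear_expand[of "Suc m" "f (mat_unit (Suc m) i j)" B] fr frs B unit[OF that]
    by (simp add: fsc.sc_zero_right del: sum.lessThan_Suc)
  then have "f A B = 0"
    using fsc.mat_linear_expand[of "Suc m" "\<lambda>A. f A B" A] fl fls A B
    by (simp add: fsc.sc_zero_right del: sum.lessThan_Suc)
  then show ?thesis unfolding f_def using sub[OF mm[OF A B] mm[OF B A]] by simp
qed

lemma PA_QA_commutator:
  assumes A: "A \<in> CM" and v: "v \<in> CV" and F: "F \<in> W"
  shows "PA A (QA v F) - QA v (PA A F) = QA (A *\<^sub>v v) F"
proof -
  have mv: "A *\<^sub>v v \<in> CV" if "A \<in> CM" for A v using that unfolding carrier_vec_def by simp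
  define f where "f A v = PA A (QA v F) - QA v (PA A F) - QA (A *\<^sub>v v) F" for A v
  have fl: "f (A + A') v = f A v + f A' v" if "A \<in> CM" "A' \<in> CM" "v \<in> CV" for A A' v
    unfolding f_def using that F mv
    by (simp add: PA_add QA_add QA_add_right QA_closed add_mult_distrib_mat_vec[of _ "Suc m" "Suc m"])
  have fr: "f A (v + w) = f A v + f A w" if "A \<in> CM" "v \<in> CV" "w \<in> CV" for A v w
    unfolding f_def using that F mv
    by (simp add: QA_add PA_add_right QA_closed mult_add_distrib_mat_vec[of _ "Suc m" "Suc m"])
  have fls: "f (c \<cdot>\<^sub>m A) v = fsc c (f A v)" if "A \<in> CM" "v \<in> CV" for A v c
  proof -
    have "(c \<cdot>\<^sub>m A) *\<^sub>v v = c \<cdot>\<^sub>v (A *\<^sub>v v)"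
      by (rule eq_vecI) (use that in auto)
    then show ?thesis
      unfolding f_def using that F mv
      by (simp add: PA_smult QA_smult QA_fsc PA_closed QA_closed fsc.sc_diff_right)
  qed
  have frs: "f A (c \<cdot>\<^sub>v v) = fsc c (f A v)" if "A \<in> CM" "v \<in> CV" for A v c
    unfolding f_def using that F mv
    by (simp add: QA_smult PA_fsc QA_closed PA_closed fsc.sc_diff_right mult_mat_vec[of _ "Suc m" "Suc m"])
  have unit: "f (mat_unit (Suc m) i j) (unit_vec (Suc m) k) = 0" if "i < Suc m" "j < Suc m" "k < Suc m" for i j k
    unfolding f_def mat_unit_vec[OF that(2,3)]
    using E_shift[OF F that(3), of i j] that by (simp add: PA_unit QA_unit QA_smult)
  have "f (mat_unit (Suc m) i j) v = 0" if "i < Suc m" "j < Suc m" for i j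
    using fsc.vec_linear_expand[of "Suc m" "f (mat_unit (Suc m) i j)" v] fr frs v unit[OF that]
    by (simp add: fsc.sc_zero_right del: sum.lessThan_Suc)
  then have "f A v = 0"
    using fsc.mat_linear_expand[of "Suc m" "\<lambda>A. f A v" A] fl fls A v
    by (simp add: fsc.sc_zero_right del: sum.lessThan_Suc)
  then show ?thesis unfolding f_def by simp
qed

lemma QA_comm: "QA v (QA w F) = QA w (QA v F)"
proof -
  have ss: "shift i (shift j F) = shift j (shift i F)" for i j
  proof (cases "i = j")
    case False
    show ?thesis
    proof (rule ext)
      fix a :: "nat \<Rightarrow> int"
      have "(a(i := a i - 1))(j := (a(i := a i - 1)) j - 1) = (a(j := a j - 1))(i := (a(j := a j - 1)) i - 1)"
        using False by auto
      then show "shift i (shift j F) a = shift j (shift i F) a" by (simp only: shift_def)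
    qed
  qed simp
  have lin: "shift i (\<Sum>j\<in>J. fsc (c j) (shift j F)) = (\<Sum>j\<in>J. fsc (c j) (shift i (shift j F)))" for i J c
    by (rule ext) (simp add: shift_def sum_fun_apply fsc_def)
  show ?thesis unfolding QA_def lin fsc.sc_sum_right fsc.sc_sc
    by (subst sum.swap) (simp add: ss mult.commute del: sum.lessThan_Suc)
qed

lemma std_conc_rep: "conc_rep fsc W (s_alg (Suc m)) (std_act m lam \<rho>)"
proof unfold_locales
  fix x y :: s_elem and F G c
  assume x: "x \<in> carrier (s_alg (Suc m))" and F: "F \<in> W"
  obtain A v where xe: "x = (A, v)" "A \<in> CM" "v \<in> CV" using x by auto
  show "std_act m lam \<rho> x F \<in> W"
    unfolding xe(1) std_act_eq using F by (intro FS.S_add PA_closed QA_closed)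
  show "std_act m lam \<rho> (c \<odot>\<^bsub>s_alg (Suc m)\<^esub> x) F = fsc c (std_act m lam \<rho> x F)"
    unfolding xe(1) s_alg_simps std_act_eq using xe by (simp add: PA_smult QA_smult fsc.sc_add_right)
  show "std_act m lam \<rho> x (fsc c F) = fsc c (std_act m lam \<rho> x F)"
    unfolding xe(1) std_act_eq using F by (simp add: PA_fsc QA_fsc fsc.sc_add_right)
  show "std_act m lam \<rho> x (F + G) = std_act m lam \<rho> x F + std_act m lam \<rho> x G" if "G \<in> W"
    unfolding xe(1) std_act_eq using F that by (simp add: PA_add_right QA_add_right)
  assume y: "y \<in> carrier (s_alg (Suc m))"
  obtain B w where ye: "y = (B, w)" "B \<in> CM" "w \<in> CV" using y by auto
  show "std_act m lam \<rho> (x \<oplus>\<^bsub>s_alg (Suc m)\<^esub> y) F = std_act m lam \<rho> x F + std_act m lam \<rho> y F"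
    unfolding xe(1) ye(1) s_alg_simps std_act_eq using xe ye by (simp add: PA_add QA_add)
  have mv: "A *\<^sub>v w \<in> CV" "B *\<^sub>v v \<in> CV" using xe ye by auto
  have "QA (A *\<^sub>v w - B *\<^sub>v v) F + QA (B *\<^sub>v v) F = QA (A *\<^sub>v w) F"
  proof -
    have "(A *\<^sub>v w - B *\<^sub>v v) + B *\<^sub>v v = A *\<^sub>v w" by (rule eq_vecI) (use mv xe ye in auto)
    then show ?thesis using QA_add[of "A *\<^sub>v w - B *\<^sub>v v" "B *\<^sub>v v" F] mv by simp
  qed
  then show "std_act m lam \<rho> (bracket (s_alg (Suc m)) x y) F =
      std_act m lam \<rho> x (std_act m lam \<rho> y F) - std_act m lam \<rho> y (std_act m lam \<rho> x F)"
    unfolding xe(1) ye(1) s_alg_simps std_act_eq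
    using PA_commutator[OF xe(2) ye(2) F] PA_QA_commutator[OF xe(2) ye(3) F] PA_QA_commutator[OF ye(2) xe(3) F] QA_comm[of v w F]
      PA_closed[OF F] QA_closed[OF F]
    by (simp add: PA_add_right QA_add_right algebra_simps)
qed

lemma std_act_e: "k < Suc m \<Longrightarrow> std_act m lam \<rho> (e_vec (Suc m) k) F = shift k F"
proof -
  assume k: "k < Suc m"
  have "PA (0\<^sub>m (Suc m) (Suc m)) F = 0"
    unfolding PA_def by (intro sum.neutral ballI) (simp add: fsc.sc_zero_left)
  then show ?thesis unfolding e_vec_def std_act_eq by (simp add: QA_unit[OF k])
qed

lemma std_act_mat: "std_act m lam \<rho> (A, 0\<^sub>v (Suc m)) F = PA A F"
proof -
  have "QA (0\<^sub>v (Suc m)) F = 0"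
    unfolding QA_def by (intro sum.neutral ballI) (simp add: fsc.sc_zero_left)
  then show ?thesis unfolding std_act_eq by simp
qed

lemma std_act_diag:
  assumes H: "H \<in> CM" "diagonal_mat H"
  shows "F \<in> W \<Longrightarrow> std_act m lam \<rho> (H, 0\<^sub>v (Suc m)) F = (\<lambda>a. csc (\<Sum>i<Suc m. (lam i + of_int (a i)) * H $$ (i, i)) (F a))"
proof -
  assume F: "F \<in> W"
  have E: "E i i F = (\<lambda>a. csc (lam i + of_int (a i)) (F a))" if "i < Suc m" for i
    using that by (auto simp: unit_op_def move_def R_diag FS_closed[OF F])
  have "(\<Sum>j<Suc m. fsc (H $$ (i, j)) (E i j F)) = fsc (H $$ (i, i)) (E i i F)" if "i < Suc m" for i
  proof -
    have "(\<Sum>j<Suc m. fsc (H $$ (i, j)) (E i j F)) = (\<Sum>j\<in>{i}. fsc (H $$ (i, j)) (E i j F))"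
      by (rule sum.mono_neutral_right) (use that H in \<open>auto simp: diagonal_mat_def fsc.sc_zero_left\<close>)
    then show ?thesis by simp
  qed
  then have "PA H F = (\<Sum>i<Suc m. fsc (H $$ (i, i)) (E i i F))" unfolding PA_def by (intro sum.cong) auto
  also have "\<dots> = (\<Sum>i<Suc m. (\<lambda>a. csc ((lam i + of_int (a i)) * H $$ (i, i)) (F a)))"
    by (rule sum.cong) (auto simp: E fsc_def csc.sc_sc mult.commute)
  also have "\<dots> = (\<lambda>a. csc (\<Sum>i<Suc m. (lam i + of_int (a i)) * H $$ (i, i)) (F a))"
    by (rule ext, rule ext) (simp add: sum_fun_apply csc_apply sum_distrib_right del: sum.lessThan_Suc)
  finally show ?thesis unfolding std_act_mat .
qed

text \<open>At (1, ..., 1) the scalar terms of a monomial add up to the sum over j of (sum_i X_ij)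
  (lam_j + a_j), which vanishes by the condition on the columns. What remains expands the operator
  of \<open>colsum_proj m X\<close>, which is \<open>X\<close>. So the fibre of the standard module
  is the representation one started from.\<close>

lemma ev_std_act:
  assumes X: "X \<in> colsum_zero m" and F: "F \<in> W"
  shows "ev (std_act m lam \<rho> (X, 0\<^sub>v (Suc m)) F) = \<rho> (sig m X) (ev F)"
  unfolding std_act_mat
proof (rule FS_additive_ext[of "Suc m" d "\<lambda>F. ev (PA X F)" "\<lambda>F. \<rho> (sig m X) (ev F)", OF _ _ _ F])
  have XM: "X \<in> CM" using X by (simp add: colsum_zero_def)
  show "ev (PA X (F + G)) = ev (PA X F) + ev (PA X G)" if "F \<in> W" "G \<in> W" for F G
    using that by (simp add: PA_add_right PA_closed ev_add[of _ "Suc m" d])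
  show "\<rho> (sig m X) (ev (F + G)) = \<rho> (sig m X) (ev F) + \<rho> (sig m X) (ev G)" if "F \<in> W" "G \<in> W" for F G
    using that by (simp add: ev_add[of _ "Suc m" d] rho_add_right ev_closed[of _ "Suc m" d] del: s_alg_simps)
  fix a y assume a: "a \<in> Zn (Suc m)" and y: "y \<in> Cd d"
  have s: "single a y \<in> W" by (rule single_closed[OF a y])
  have "ev (PA X (single a y)) = (\<Sum>i<Suc m. \<Sum>j<Suc m. ev (fsc (X $$ (i, j)) (E i j (single a y))))"
    unfolding PA_def by (subst ev_sum[of _ _ "Suc m" d], (intro FS.S_sum FS.S_sc E_closed s; simp),
      intro sum.cong refl, subst ev_sum[of _ _ "Suc m" d]) (intro FS.S_sc E_closed s refl; simp)+
  also have "\<dots> = (\<Sum>i<Suc m. \<Sum>j<Suc m. csc (X $$ (i, j)) (csc (lam j + of_int (a j)) y + R i j y))"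
    by (intro sum.cong refl) (simp only: E_single[OF y] single_fsc[symmetric] ev_single)
  also have "\<dots> = (\<Sum>i<Suc m. \<Sum>j<Suc m. csc (X $$ (i, j) * (lam j + of_int (a j))) y) + (\<Sum>i<Suc m. \<Sum>j<Suc m. csc (X $$ (i, j)) (R i j y))"
    by (simp only: csc.sc_add_right csc.sc_sc sum.distrib)
  also have "(\<Sum>i<Suc m. \<Sum>j<Suc m. csc (X $$ (i, j) * (lam j + of_int (a j))) y) = 0"
  proof (rule ext)
    fix r
    have "(\<Sum>i<Suc m. \<Sum>j<Suc m. csc (X $$ (i, j) * (lam j + of_int (a j))) y) r =
      (\<Sum>j<Suc m. \<Sum>i<Suc m. X $$ (i, j) * ((lam j + of_int (a j)) * y r))"
      by (subst sum.swap) (simp only: sum_fun_apply csc_apply mult.assoc)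
    also have "\<dots> = (\<Sum>j<Suc m. (\<Sum>i<Suc m. X $$ (i, j)) * ((lam j + of_int (a j)) * y r))"
      by (simp only: sum_distrib_right)
    also have "\<dots> = 0" using X unfolding colsum_zero_def by (intro sum.neutral) auto
    finally show "(\<Sum>i<Suc m. \<Sum>j<Suc m. csc (X $$ (i, j) * (lam j + of_int (a j))) y) r = 0 r" by simp
  qed
  also have "(\<Sum>i<Suc m. \<Sum>j<Suc m. csc (X $$ (i, j)) (R i j y)) = \<rho> (sig m (colsum_proj m X)) y"
    unfolding stab_unit_def
    by (rule csc.mat_linear_expand[of "Suc m" "\<lambda>X. \<rho> (sig m (colsum_proj m X)) y", symmetric, OF _ _ XM])
      (simp_all add: colsum_proj_add colsum_proj_scale sig_add sig_scale rho_add_left rho_sc_left y del: s_alg_simps)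
  finally show "ev (PA X (single a y)) = \<rho> (sig m X) (ev (single a y))"
    by (simp add: colsum_proj_id[OF X])
qed

end

section \<open>Recovering a Laurent module from its fibre\<close>

lemma mat_unit_commutator_diag:
  assumes "i < n" "j < n" "k < n"
  shows "mat_unit n k k * mat_unit n i j - mat_unit n i j * mat_unit n k k = (kd k i - kd k j) \<cdot>\<^sub>m mat_unit n i j"
  unfolding mat_unit_mult[OF assms(3,1)] mat_unit_mult[OF assms(2,3)]
  by (rule eq_matI) (auto simp: kd_def)

lemma colsum_proj_unit_eq:
  assumes "i < Suc m" "j < Suc m"
  shows "colsum_proj m (mat_unit (Suc m) i j) = mat_unit (Suc m) i j + (-1) \<cdot>\<^sub>m mat_unit (Suc m) j j"
  by (rule eq_matI) (use assms carrier_matD[OF colsum_proj_closed] in \<open>auto simp: colsum_proj_unit algebra_simps\<close>)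

text \<open>An arbitrary action on Laurent polynomials, prescribed only for the e_k and for the
  diagonal matrices. Everything else is shown to be the standard action attached to the fibre
  representation \<open>rho\<close> (\<open>D_eq_std\<close>).\<close>

locale laurent_rep = conc_rep fsc "FS (Suc m) d" "s_alg (Suc m)" D
  for m d and D :: "s_elem \<Rightarrow> ((nat \<Rightarrow> int) \<Rightarrow> nat \<Rightarrow> complex) \<Rightarrow> (nat \<Rightarrow> int) \<Rightarrow> nat \<Rightarrow> complex" +
  fixes lam :: "nat \<Rightarrow> complex"
  assumes D_e: "\<lbrakk>k < Suc m; F \<in> FS (Suc m) d\<rbrakk> \<Longrightarrow> D (e_vec (Suc m) k) F = shift k F"
    and D_diag: "\<lbrakk>k < Suc m; F \<in> FS (Suc m) d\<rbrakk> \<Longrightarrow>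
      D (mat_unit (Suc m) k k, 0\<^sub>v (Suc m)) F = (\<lambda>a. csc (lam k + of_int (a k)) (F a))"
begin

abbreviation W where "W \<equiv> FS (Suc m) d"
abbreviation n where "n \<equiv> Suc m"
abbreviation DM where "DM A \<equiv> D (A, 0\<^sub>v n)"

definition rho where "rho x y = ev (DM (sig_inv m x) (single (\<lambda>_. 0) y))"

lemma vec0: "0\<^sub>v n + 0\<^sub>v n = (0\<^sub>v n :: complex vec)" "c \<cdot>\<^sub>v 0\<^sub>v n = (0\<^sub>v n :: complex vec)"
  by (auto intro!: eq_vecI)

lemma mat0: "0\<^sub>m n n + 0\<^sub>m n n = (0\<^sub>m n n :: complex mat)" "c \<cdot>\<^sub>m 0\<^sub>m n n = (0\<^sub>m n n :: complex mat)"
  by (auto intro!: eq_matI)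

lemma mat_mem: "A \<in> carrier_mat n n \<Longrightarrow> (A, 0\<^sub>v n) \<in> carrier (s_alg n)"
  by simp

lemma DM_closed: "A \<in> carrier_mat n n \<Longrightarrow> F \<in> W \<Longrightarrow> DM A F \<in> W"
  by (rule rho_closed[OF mat_mem])

lemma DM_add: "A \<in> carrier_mat n n \<Longrightarrow> B \<in> carrier_mat n n \<Longrightarrow> F \<in> W \<Longrightarrow> DM (A + B) F = DM A F + DM B F"
  using rho_add_left[OF mat_mem mat_mem, of A B F] by (simp only: s_alg_simps vec0)

lemma DM_smult: "A \<in> carrier_mat n n \<Longrightarrow> F \<in> W \<Longrightarrow> DM (c \<cdot>\<^sub>m A) F = fsc c (DM A F)"
  using rho_sc_left[OF mat_mem, of A F c] by (simp only: s_alg_simps vec0)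

lemma DM_expand: "A \<in> carrier_mat n n \<Longrightarrow> F \<in> W \<Longrightarrow> DM A F = (\<Sum>i<n. \<Sum>j<n. fsc (A $$ (i, j)) (DM (mat_unit n i j) F))"
  by (rule fsc.mat_linear_expand[of n "\<lambda>A. DM A F"]) (simp_all only: DM_add DM_smult)

lemma DV_expand:
  assumes v: "v \<in> carrier_vec n" and F: "F \<in> W"
  shows "D (0\<^sub>m n n, v) F = (\<Sum>k<n. fsc (v $ k) (shift k F))"
proof -
  have vm: "(0\<^sub>m n n, v) \<in> carrier (s_alg n)" if "v \<in> carrier_vec n" for v using that by simp
  have "D (0\<^sub>m n n, v) F = (\<Sum>k<n. fsc (v $ k) (D (0\<^sub>m n n, unit_vec n k) F))"
  proof (rule fsc.vec_linear_expand[of n "\<lambda>v. D (0\<^sub>m n n, v) F", OF _ _ v])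
    show "D (0\<^sub>m n n, v + w) F = D (0\<^sub>m n n, v) F + D (0\<^sub>m n n, w) F"
      if "v \<in> carrier_vec n" "w \<in> carrier_vec n" for v w
      using rho_add_left[OF vm[OF that(1)] vm[OF that(2)] F] by (simp only: s_alg_simps mat0)
    show "D (0\<^sub>m n n, c \<cdot>\<^sub>v v) F = fsc c (D (0\<^sub>m n n, v) F)" if "v \<in> carrier_vec n" for v c
      using rho_sc_left[OF vm[OF that(1)] F] by (simp only: s_alg_simps mat0)
  qed
  also have "\<dots> = (\<Sum>k<n. fsc (v $ k) (shift k F))"
    by (rule sum.cong) (use D_e F in \<open>auto simp: e_vec_def\<close>)
  finally show ?thesis .
qed

text \<open>\<open>X\<close> stabilizes the ideal of the point \<open>(1, \<dots>, 1)\<close>, hence acts on the fibre there.\<close>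

lemma ev_DM_shift:
  assumes X: "X \<in> colsum_zero m" and F: "F \<in> W" and k: "k < n"
  shows "ev (DM X (shift k F)) = ev (DM X F)"
proof -
  have XM: "X \<in> carrier_mat n n" using X by (simp add: colsum_zero_def)
  have Xu: "X *\<^sub>v unit_vec n k \<in> carrier_vec n" using XM unfolding carrier_vec_def by simp
  have br: "bracket (s_alg n) (X, 0\<^sub>v n) (e_vec n k) = (0\<^sub>m n n, X *\<^sub>v unit_vec n k)"
  proof -
    have "X * 0\<^sub>m n n - 0\<^sub>m n n * X = 0\<^sub>m n n" by (rule eq_matI) (use XM in auto)
    moreover have "X *\<^sub>v unit_vec n k - 0\<^sub>m n n *\<^sub>v 0\<^sub>v n = X *\<^sub>v unit_vec n k"
      by (rule eq_vecI) (use XM in \<open>auto simp: zero_mat_mult_vec\<close>)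
    ultimately show ?thesis by (simp only: e_vec_def s_alg_simps)
  qed
  have "D (bracket (s_alg n) (X, 0\<^sub>v n) (e_vec n k)) F = DM X (D (e_vec n k) F) - D (e_vec n k) (DM X F)"
    by (rule rho_bracket[OF mat_mem[OF XM] e_vec_closed F])
  then have "DM X (shift k F) = shift k (DM X F) + (\<Sum>i<n. fsc ((X *\<^sub>v unit_vec n k) $ i) (shift i F))"
    unfolding br DV_expand[OF Xu F] D_e[OF k F] D_e[OF k DM_closed[OF XM F]] by (simp add: algebra_simps)
  then have "ev (DM X (shift k F)) = ev (shift k (DM X F)) + ev (\<Sum>i<n. fsc ((X *\<^sub>v unit_vec n k) $ i) (shift i F))"
    using ev_add[OF shift_closed[OF k DM_closed[OF XM F]], of "\<Sum>i<n. fsc ((X *\<^sub>v unit_vec n k) $ i) (shift i F)"]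
      FS.S_sum[of "{..<n}" "\<lambda>i. fsc ((X *\<^sub>v unit_vec n k) $ i) (shift i F)" n d] shift_closed[OF _ F] FS.S_sc by simp
  also have "ev (shift k (DM X F)) = ev (DM X F)" by (rule ev_shift[OF k DM_closed[OF XM F]])
  also have "ev (\<Sum>i<n. fsc ((X *\<^sub>v unit_vec n k) $ i) (shift i F)) = (\<Sum>i<n. csc (X $$ (i, k)) (ev F))"
  proof (subst ev_sum[of _ _ n d])
    show "fsc ((X *\<^sub>v unit_vec n k) $ i) (shift i F) \<in> FS n d" if "i \<in> {..<n}" for i
      using that by (intro FS.S_sc shift_closed[OF _ F]) simp
    show "(\<Sum>i<n. ev (fsc ((X *\<^sub>v unit_vec n k) $ i) (shift i F))) = (\<Sum>i<n. csc (X $$ (i, k)) (ev F))"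
    proof (rule sum.cong[OF refl])
      fix i assume "i \<in> {..<n}"
      then have i: "i < n" by simp
      have "(X *\<^sub>v unit_vec n k) $ i = X $$ (i, k)" using i k XM by simp
      then show "ev (fsc ((X *\<^sub>v unit_vec n k) $ i) (shift i F)) = csc (X $$ (i, k)) (ev F)"
        by (simp only: ev_fsc[OF shift_closed[OF i F]] ev_shift[OF i F])
    qed
  qed
  also have "(\<Sum>i<n. csc (X $$ (i, k)) (ev F)) = csc (\<Sum>i<n. X $$ (i, k)) (ev F)"
    by (rule ext) (simp only: sum_fun_apply csc_apply sum_distrib_right)
  also have "\<dots> = 0" using X k by (simp add: colsum_zero_def csc.sc_zero_left del: sum.lessThan_Suc)
  finally show ?thesis by simp
qed

lemma zero_Zn: "(\<lambda>_. 0) \<in> Zn n"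
  by (simp add: Zn_def)

text \<open>By \<open>ev_DM_shift\<close> the value of X t^a y at (1, ..., 1) does not depend on
  \<open>a\<close>, and for a = 0 it is the definition of \<open>rho\<close>. Thus the fibre action
  may be computed from any lift of a fibre vector.\<close>

lemma ev_DM:
  assumes X: "X \<in> colsum_zero m" and F: "F \<in> W"
  shows "ev (DM X F) = rho (sig m X) (ev F)"
proof -
  have XM: "X \<in> carrier_mat n n" using X by (simp add: colsum_zero_def)
  have s0: "single (\<lambda>_. 0) y \<in> W" if "y \<in> Cd d" for y by (rule single_closed[OF zero_Zn that])
  show ?thesis
    unfolding rho_def sig_inv_sig[OF X]
  proof (rule FS_additive_ext[of n d "\<lambda>F. ev (DM X F)" "\<lambda>F. ev (DM X (single (\<lambda>_. 0) (ev F)))", OF _ _ _ F])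
    show "ev (DM X (F + G)) = ev (DM X F) + ev (DM X G)" if "F \<in> W" "G \<in> W" for F G
      using that by (simp only: rho_add_right[OF mat_mem[OF XM]] ev_add[OF DM_closed[OF XM] DM_closed[OF XM]])
    show "ev (DM X (single (\<lambda>_. 0) (ev (F + G)))) = ev (DM X (single (\<lambda>_. 0) (ev F))) + ev (DM X (single (\<lambda>_. 0) (ev G)))"
      if "F \<in> W" "G \<in> W" for F G
      unfolding ev_add[OF that] single_add
      using s0[OF ev_closed[OF that(1)]] s0[OF ev_closed[OF that(2)]]
      by (simp only: rho_add_right[OF mat_mem[OF XM]] ev_add[OF DM_closed[OF XM] DM_closed[OF XM]])
    fix a y assume a: "a \<in> Zn n" and y: "y \<in> Cd d"
    have "ev (DM X (single a y)) = ev (DM X (single (\<lambda>_. 0) y))"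
    proof (rule Zn_shift_const[where g = "\<lambda>a. ev (DM X (single a y))", OF _ a])
      fix a k assume a: "a \<in> Zn n" and k: "k < n"
      show "ev (DM X (single (a(k := a k + 1)) y)) = ev (DM X (single a y))"
        using ev_DM_shift[OF X single_closed[OF a y] k] by (simp only: shift_single)
    qed
    then show "ev (DM X (single a y)) = ev (DM X (single (\<lambda>_. 0) (ev (single a y))))" by simp
  qed
qed

lemma sig_inv_add: "\<lbrakk>x \<in> carrier (s_alg m); y \<in> carrier (s_alg m)\<rbrakk> \<Longrightarrow> sig_inv m (x \<oplus>\<^bsub>s_alg m\<^esub> y) = sig_inv m x + sig_inv m y"
proof -
  assume x: "x \<in> carrier (s_alg m)" "y \<in> carrier (s_alg m)"
  have "sig_inv m x + sig_inv m y \<in> colsum_zero m"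
    by (rule colsum_zero_add[OF sig_inv_colsum sig_inv_colsum])
  then have "sig_inv m (sig m (sig_inv m x + sig_inv m y)) = sig_inv m x + sig_inv m y" by (rule sig_inv_sig)
  then show ?thesis by (simp only: sig_add sig_inv_closed sig_sig_inv x)
qed

lemma sig_inv_smult: "x \<in> carrier (s_alg m) \<Longrightarrow> sig_inv m (c \<odot>\<^bsub>s_alg m\<^esub> x) = c \<cdot>\<^sub>m sig_inv m x"
proof -
  assume x: "x \<in> carrier (s_alg m)"
  have "c \<cdot>\<^sub>m sig_inv m x \<in> colsum_zero m"
    by (rule colsum_zero_smult[OF sig_inv_colsum])
  then have "sig_inv m (sig m (c \<cdot>\<^sub>m sig_inv m x)) = c \<cdot>\<^sub>m sig_inv m x" by (rule sig_inv_sig)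
  then show ?thesis by (simp only: sig_scale sig_inv_closed sig_sig_inv x)
qed

lemma rho_rep: "conc_rep csc (Cd d) (s_alg m) rho"
proof unfold_locales
  fix x y v w c assume x: "x \<in> carrier (s_alg m)" and v: "v \<in> Cd d"
  note sv = single_closed[OF zero_Zn v]
  note xm = mat_mem[OF sig_inv_closed]
  show "rho x v \<in> Cd d" unfolding rho_def by (rule ev_closed[OF DM_closed[OF sig_inv_closed sv]])
  show "rho (c \<odot>\<^bsub>s_alg m\<^esub> x) v = csc c (rho x v)"
    unfolding rho_def sig_inv_smult[OF x] DM_smult[OF sig_inv_closed sv] by (rule ev_fsc[OF DM_closed[OF sig_inv_closed sv]])
  show "rho x (v + w) = rho x v + rho x w" if w: "w \<in> Cd d"
    unfolding rho_def single_add rho_add_right[OF xm sv single_closed[OF zero_Zn w]]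
    by (rule ev_add[OF DM_closed[OF sig_inv_closed sv] DM_closed[OF sig_inv_closed single_closed[OF zero_Zn w]]])
  show "rho x (csc c v) = csc c (rho x v)"
    unfolding rho_def single_fsc rho_sc_right[OF xm sv] by (rule ev_fsc[OF DM_closed[OF sig_inv_closed sv]])
  assume y: "y \<in> carrier (s_alg m)"
  show "rho (x \<oplus>\<^bsub>s_alg m\<^esub> y) v = rho x v + rho y v"
    unfolding rho_def sig_inv_add[OF x y] DM_add[OF sig_inv_closed sig_inv_closed sv]
    by (rule ev_add[OF DM_closed[OF sig_inv_closed sv] DM_closed[OF sig_inv_closed sv]])
  let ?X = "sig_inv m x" and ?Y = "sig_inv m y"
  have XY: "?X * ?Y - ?Y * ?X \<in> colsum_zero m"
  proof -
    \<comment> \<open>The column sums of a product are combinations of the column sums of its left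
      factor, so the condition on \<open>A\<close> alone suffices.\<close>
    have c0: "(\<Sum>r<n. (A * B) $$ (r, c)) = 0" if "A \<in> colsum_zero m" "B \<in> carrier_mat n n" "c < n" for A B c
    proof -
      have A: "A \<in> carrier_mat n n" using that by (simp add: colsum_zero_def)
      have "(\<Sum>r<n. (A * B) $$ (r, c)) = (\<Sum>r<n. \<Sum>k<n. A $$ (r, k) * B $$ (k, c))"
        by (rule sum.cong) (use A that in \<open>auto simp: scalar_prod_def atLeast0LessThan simp del: sum.lessThan_Suc\<close>)
      also have "\<dots> = (\<Sum>k<n. (\<Sum>r<n. A $$ (r, k)) * B $$ (k, c))"
        by (subst sum.swap) (simp only: sum_distrib_right)
      also have "\<dots> = 0" using that(1) unfolding colsum_zero_def by (intro sum.neutral) auto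
      finally show ?thesis .
    qed
    have cm: "?X * ?Y \<in> carrier_mat n n" "?Y * ?X \<in> carrier_mat n n"
      by (rule mult_carrier_mat[OF sig_inv_closed sig_inv_closed])+
    show ?thesis
      unfolding colsum_zero_def
    proof (intro CollectI conjI allI impI)
      show "?X * ?Y - ?Y * ?X \<in> carrier_mat n n" by (rule minus_carrier_mat[OF cm(2)])
      fix c assume c: "c < n"
      have "(\<Sum>r<n. (?X * ?Y - ?Y * ?X) $$ (r, c)) = (\<Sum>r<n. (?X * ?Y) $$ (r, c) - (?Y * ?X) $$ (r, c))"
        by (rule sum.cong) (use cm c carrier_matD[OF cm(2)] in \<open>auto simp del: index_mult_mat\<close>)
      then show "(\<Sum>r<n. (?X * ?Y - ?Y * ?X) $$ (r, c)) = 0"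
        by (simp only: sum_subtractf c0[OF sig_inv_colsum sig_inv_closed c]) simp
    qed
  qed
  have sb: "sig m (?X * ?Y - ?Y * ?X) = bracket (s_alg m) x y"
    by (simp only: sig_bracket[OF sig_inv_colsum sig_inv_colsum] sig_sig_inv x y)
  have br: "bracket (s_alg n) (?X, 0\<^sub>v n) (?Y, 0\<^sub>v n) = (?X * ?Y - ?Y * ?X, 0\<^sub>v n)"
  proof -
    have "?X *\<^sub>v 0\<^sub>v n - ?Y *\<^sub>v 0\<^sub>v n = 0\<^sub>v n" by (rule eq_vecI) (auto simp: scalar_prod_def sig_inv_def)
    then show ?thesis by (simp only: s_alg_simps)
  qed
  \<comment> \<open>The inner action produces a polynomial that is in general not constant, while
    \<open>rho\<close> is defined by constant lifts; \<open>ev_DM\<close> bridges the gap and makes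
    composition in the fibre possible.\<close>
  have one: "ev (DM (sig_inv m x) (DM (sig_inv m y) (single (\<lambda>_. 0) v))) = rho x (rho y v)"
    if "x \<in> carrier (s_alg m)" "y \<in> carrier (s_alg m)" for x y
    using ev_DM[OF sig_inv_colsum DM_closed[OF sig_inv_closed sv], of x y] ev_DM[OF sig_inv_colsum sv, of y]
    by (simp only: sig_sig_inv[OF that(1)] sig_sig_inv[OF that(2)] ev_single)
  have dc: "DM ?X (DM ?Y F) \<in> W" "DM ?Y (DM ?X F) \<in> W" if "F \<in> W" for F
    by (intro DM_closed sig_inv_closed that)+
  have "rho (bracket (s_alg m) x y) v = ev (DM (?X * ?Y - ?Y * ?X) (single (\<lambda>_. 0) v))"
    using ev_DM[OF XY sv] by (simp only: sb ev_single)
  also have "DM (?X * ?Y - ?Y * ?X) (single (\<lambda>_. 0) v) =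
      DM ?X (DM ?Y (single (\<lambda>_. 0) v)) - DM ?Y (DM ?X (single (\<lambda>_. 0) v))"
    using rho_bracket[OF xm xm sv, of x y] by (simp only: br)
  finally show "rho (bracket (s_alg m) x y) v = rho x (rho y v) - rho y (rho x v)"
    by (simp only: ev_minus[OF dc[OF sv]] one[OF x y] one[OF y x])
qed

text \<open>e_ij has weight eps_i - eps_j under the diagonal matrices, so it turns a monomial into a
  single monomial. The coefficient of that monomial equals its value at (1, ..., 1), where e_ij =
  (e_ij - e_jj) + e_jj contributes the fibre operator and the weight lam_j + b_j.\<close>

lemma DM_unit_single:
  assumes ij: "i < n" "j < n" and b: "b \<in> Zn n" and y: "y \<in> Cd d"
  shows "DM (mat_unit n i j) (single b y) = single (move i j b) (csc (lam j + of_int (b j)) y + rho (stab_unit m i j) y)"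
proof -
  let ?u = "mat_unit n i j"
  note s = single_closed[OF b y]
  note um = mat_mem[OF mat_unit_closed]
  define G where "G = DM ?u (single b y)"
  have G: "G \<in> W" unfolding G_def by (rule DM_closed[OF mat_unit_closed s])
  have diag_s: "DM (mat_unit n k k) (single b y) = fsc (lam k + of_int (b k)) (single b y)" if "k < n" for k
    unfolding D_diag[OF that s] by (rule ext) (auto simp: fsc_def single_def csc.sc_zero_right)
  \<comment> \<open>The coefficient at \<open>c\<close> of the relation [e_kk, e_ij] = (delta_ki -
    delta_kj) e_ij applied to the monomial; a nonzero coefficient can be cancelled and determines
    \<open>c k\<close>.\<close>
  have wt: "c k = b k + (if k = i then 1 else 0) - (if k = j then 1 else 0)" if Gc: "G c \<noteq> 0" and k: "k < n" for c k
  proof -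
    have br: "bracket (s_alg n) (mat_unit n k k, 0\<^sub>v n) (?u, 0\<^sub>v n) = ((kd k i - kd k j) \<cdot>\<^sub>m ?u, 0\<^sub>v n)"
    proof -
      have "mat_unit n k k *\<^sub>v 0\<^sub>v n - ?u *\<^sub>v 0\<^sub>v n = 0\<^sub>v n" by (rule eq_vecI) (auto simp: scalar_prod_def)
      then show ?thesis by (simp only: s_alg_simps mat_unit_commutator_diag[OF ij k])
    qed
    have "fsc (kd k i - kd k j) G = DM (mat_unit n k k) G - fsc (lam k + of_int (b k)) G"
      using rho_bracket[OF um um s, of k k i j]
      unfolding br DM_smult[OF mat_unit_closed s] diag_s[OF k] rho_sc_right[OF um s] G_def[symmetric] .
    then have "fsc (kd k i - kd k j) G c = DM (mat_unit n k k) G c - fsc (lam k + of_int (b k)) G c"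
      by (simp only: minus_apply)
    then have eqc: "csc (kd k i - kd k j) (G c) = csc (lam k + of_int (c k)) (G c) - csc (lam k + of_int (b k)) (G c)"
      by (simp only: D_diag[OF k G] fsc_apply)
    have e: "(kd k i - kd k j) * G c r = (lam k + of_int (c k)) * G c r - (lam k + of_int (b k)) * G c r" for r
      by (rule fun_cong[OF eqc, of r, unfolded minus_apply csc_apply])
    obtain r where "G c r \<noteq> 0" using Gc by (auto simp: fun_eq_iff)
    moreover have "(kd k i - kd k j) * G c r = (of_int (c k) - of_int (b k)) * G c r"
      using e[of r] by (simp add: algebra_simps)
    ultimately have "kd k i - kd k j = of_int (c k) - of_int (b k)" by (simp only: mult_cancel_right) simp
    then have "(of_int (c k) :: complex) = of_int (b k + (if k = i then 1 else 0) - (if k = j then 1 else 0))"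
      by (auto simp: kd_def algebra_simps split: if_splits)
    then show ?thesis by (simp only: of_int_eq_iff)
  qed
  have supp: "c = move i j b" if "G c \<noteq> 0" for c
  proof (rule ext)
    fix k
    show "c k = move i j b k"
      using wt[OF that, of k] FS_Zn[OF G that] b ij by (cases "k < n") (auto simp: move_def Zn_def)
  qed
  have Gs: "G = single (move i j b) (G (move i j b))"
    by (rule ext) (use supp in \<open>auto simp: single_def\<close>)
  have eG: "ev G = csc (lam j + of_int (b j)) y + rho (stab_unit m i j) y"
  proof -
    have "ev (DM (colsum_proj m ?u) (single b y)) = rho (stab_unit m i j) y"
      using ev_DM[OF colsum_proj_colsum[OF mat_unit_closed] s] by (simp only: stab_unit_def ev_single)
    moreover have "DM (colsum_proj m ?u) (single b y) = G - fsc (lam j + of_int (b j)) (single b y)"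
      unfolding colsum_proj_unit_eq[OF ij] DM_add[OF mat_unit_closed smult_carrier_mat[OF mat_unit_closed] s]
        DM_smult[OF mat_unit_closed s] fsc.sc_minus diag_s[OF ij(2)] G_def by simp
    ultimately show ?thesis
      using ev_minus[OF G FS.S_sc[OF s]] unfolding single_fsc[symmetric] ev_single by (simp only: diff_eq_eq add.commute)
  qed
  have "ev G = G (move i j b)" using arg_cong[OF Gs, of ev] by (simp only: ev_single)
  then show ?thesis using Gs eG unfolding G_def[symmetric] by simp
qed

lemma std: "std_rep d m rho"
  unfolding std_rep_def by (rule rho_rep)

text \<open>Matrix units and the vectors e_k span the Lie algebra. For the former the two actions
  agree on monomials by \<open>DM_unit_single\<close>, and the latter act by shifts on both
  sides.\<close>

lemma D_eq_std:
  assumes x: "x \<in> carrier (s_alg n)" and F: "F \<in> W"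
  shows "D x F = std_act m lam rho x F"
proof -
  interpret S: std_rep d m rho lam by (rule std)
  have u: "DM (mat_unit n i j) F = unit_op m lam rho i j F" if ij: "i < n" "j < n" for i j
  proof (rule FS_additive_ext[of n d "DM (mat_unit n i j)" "unit_op m lam rho i j", OF _ _ _ F])
    show "DM (mat_unit n i j) (F + G) = DM (mat_unit n i j) F + DM (mat_unit n i j) G" if "F \<in> W" "G \<in> W" for F G
      by (rule rho_add_right[OF mat_mem[OF mat_unit_closed] that])
    show "unit_op m lam rho i j (F + G) = unit_op m lam rho i j F + unit_op m lam rho i j G" if "F \<in> W" "G \<in> W" for F G
      by (rule S.E_add[OF that])
    show "DM (mat_unit n i j) (single a y) = unit_op m lam rho i j (single a y)" if "a \<in> Zn n" "y \<in> Cd d" for a y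
      unfolding DM_unit_single[OF ij that] S.E_single[OF that(2)] ..
  qed
  obtain A v where xe: "x = (A, v)" "A \<in> carrier_mat n n" "v \<in> carrier_vec n" using x by auto
  have "x = (A, 0\<^sub>v n) \<oplus>\<^bsub>s_alg n\<^esub> (0\<^sub>m n n, v)"
    unfolding xe(1) s_alg_simps using xe(2,3) by simp
  moreover have "(0\<^sub>m n n, v) \<in> carrier (s_alg n)" using xe(3) by simp
  ultimately have "D x F = DM A F + D (0\<^sub>m n n, v) F"
    using rho_add_left[OF mat_mem[OF xe(2)] _ F] by (simp only:)
  also have "\<dots> = S.PA A F + S.QA v F"
    unfolding DM_expand[OF xe(2) F] DV_expand[OF xe(3) F] S.PA_def S.QA_def
    by (intro arg_cong2[of _ _ _ _ plus] sum.cong refl) (simp add: u)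
  finally show ?thesis unfolding xe(1) S.std_act_eq .
qed

end

section \<open>Harish-Chandra modules as Laurent modules\<close>

definition wt :: "nat \<Rightarrow> complex vec \<Rightarrow> (nat \<Rightarrow> int) \<Rightarrow> complex vec" where
  "wt n l a = vec n (\<lambda>i. l $ i + of_int (a i))"

lemma wt_closed [simp]: "wt n l a \<in> carrier_vec n"
  by (simp add: wt_def)

lemma wt_dim [simp]: "dim_vec (wt n l a) = n"
  by (simp add: wt_def)

lemma wt_index [simp]: "i < n \<Longrightarrow> wt n l a $ i = l $ i + of_int (a i)"
  by (simp add: wt_def)

lemma wt_inj: "inj_on (wt n l) (Zn n)"
proof (rule inj_onI)
  fix a b assume a: "a \<in> Zn n" and b: "b \<in> Zn n" and eq: "wt n l a = wt n l b"
  show "a = b"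
  proof
    fix i
    show "a i = b i"
    proof (cases "i < n")
      case True
      then have "l $ i + of_int (a i) = l $ i + (of_int (b i) :: complex)"
        using arg_cong[OF eq, of "\<lambda>v. v $ i"] by simp
      then show ?thesis by simp
    qed (use a b in \<open>simp add: Zn_def\<close>)
  qed
qed

lemma weight_coset_eq:
  assumes l: "l \<in> carrier_vec n"
  shows "weight_coset n l = wt n l ` Zn n"
proof
  show "weight_coset n l \<subseteq> wt n l ` Zn n"
  proof
    fix \<mu> assume "\<mu> \<in> weight_coset n l"
    then obtain z where z: "\<mu> = l + z" "z \<in> carrier_vec n" "\<And>i. i < n \<Longrightarrow> z $ i \<in> \<int>"
      by (auto simp: weight_coset_def)
    then have "\<forall>i. \<exists>b. i < n \<longrightarrow> z $ i = of_int b" by (meson Ints_cases)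
    then obtain b where b: "\<And>i. i < n \<Longrightarrow> z $ i = of_int (b i)" by metis
    have "\<mu> = wt n l (\<lambda>i. if i < n then b i else 0)"
      by (rule eq_vecI) (use z b l in auto)
    then show "\<mu> \<in> wt n l ` Zn n" by (auto simp: Zn_def)
  qed
  show "wt n l ` Zn n \<subseteq> weight_coset n l"
  proof clarify
    fix a
    have "wt n l a = l + vec n (\<lambda>i. of_int (a i))" by (rule eq_vecI) (use l in auto)
    then show "wt n l a \<in> weight_coset n l" unfolding weight_coset_def by force
  qed
qed

text \<open>\<open>T\<close> identifies the standard module of \<rho> with \<open>M\<close>. The
  condition \<open>gen\<close> concerns Lie algebra elements only: scalars are covered by
  \<open>coords\<close>, and the inverses of the e_i are determined by the rest of the
  action.\<close>

locale laurent_model =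
  R: std_rep d m \<rho> "\<lambda>i. l $ i" + C: coords fsc "FS (Suc m) d" "as_s_module (Suc m) M" T
  for d m \<rho> l and M :: "(loc_elem, 'a) module" and T +
  assumes M: "left_module (U_loc (Suc m)) M" and l: "l \<in> carrier_vec (Suc m)"
    and gen: "\<lbrakk>x \<in> carrier (s_alg (Suc m)); F \<in> FS (Suc m) d\<rbrakk> \<Longrightarrow>
      loc_gen (Suc m) x \<odot>\<^bsub>M\<^esub> T F = T (std_act m (\<lambda>i. l $ i) \<rho> x F)"
begin

abbreviation n where "n \<equiv> Suc m"
abbreviation V where "V \<equiv> as_s_module n M"
abbreviation sact where "sact \<equiv> std_act m (\<lambda>i. l $ i) \<rho>"

lemma act_T: "\<lbrakk>x \<in> carrier (s_alg n); F \<in> FS n d\<rbrakk> \<Longrightarrow> act V x (T F) = T (sact x F)"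
  by (simp add: gen del: s_alg_simps)

lemma lie_module_V: "lie_module (s_alg n) V"
  by (rule lie_module_of_coords[OF C.coords_axioms R.std_conc_rep _ s_alg_lie_ops]) (rule act_T)

lemma cartan_closed: "h \<in> cartan n \<Longrightarrow> h \<in> carrier (s_alg n)"
  by (auto simp: cartan_def)

lemma sact_cartan:
  assumes h: "h \<in> cartan n" and F: "F \<in> FS n d"
  shows "sact h F = (\<lambda>a. csc (weight_eval n (wt n l a) h) (F a))"
proof -
  obtain H where H: "h = (H, 0\<^sub>v n)" "H \<in> carrier_mat n n" "diagonal_mat H" using h by (auto simp: cartan_def)
  have "weight_eval n (wt n l a) h = (\<Sum>i<n. (l $ i + of_int (a i)) * H $$ (i, i))" for a
    unfolding weight_eval_def H(1) by (rule sum.cong) auto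
  then show ?thesis unfolding H(1) R.std_act_diag[OF H(2,3) F] by simp
qed

text \<open>A diagonal matrix multiplies the coefficient at \<open>a\<close> by its weight at l + a.
  The matrices e_ii read off the coordinates of a weight, so a nonzero coefficient of a vector of
  weight \<mu> can occur only where l + a = \<mu>.\<close>

lemma T_weight_space:
  assumes F: "F \<in> FS n d" and \<mu>: "\<mu> \<in> carrier_vec n"
  shows "T F \<in> weight_space n V \<mu> \<longleftrightarrow> (\<forall>a. F a \<noteq> 0 \<longrightarrow> wt n l a = \<mu>)"
proof -
  have sF: "fsc c F \<in> FS n d" for c by (rule FS.S_sc[OF F])
  have "T F \<in> weight_space n V \<mu> \<longleftrightarrow> (\<forall>h\<in>cartan n. act V h (T F) = weight_eval n \<mu> h \<odot>\<^bsub>V\<^esub> T F)"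
    using C.T_closed[OF F] by (simp only: weight_space_def mem_Collect_eq simp_thms)
  also have "\<dots> \<longleftrightarrow> (\<forall>h\<in>cartan n. \<forall>a. csc (weight_eval n (wt n l a) h) (F a) = csc (weight_eval n \<mu> h) (F a))"
  proof (rule ball_cong[OF refl])
    fix h assume h: "h \<in> cartan n"
    have "act V h (T F) = weight_eval n \<mu> h \<odot>\<^bsub>V\<^esub> T F \<longleftrightarrow> T (sact h F) = T (fsc (weight_eval n \<mu> h) F)"
      by (simp only: act_T[OF cartan_closed[OF h] F] C.T_sc[OF F])
    also have "\<dots> \<longleftrightarrow> sact h F = fsc (weight_eval n \<mu> h) F"
      by (rule iffI, erule C.T_inj[OF conc_rep.rho_closed[OF R.std_conc_rep cartan_closed[OF h] F] sF], erule arg_cong)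
    also have "\<dots> \<longleftrightarrow> (\<forall>a. csc (weight_eval n (wt n l a) h) (F a) = csc (weight_eval n \<mu> h) (F a))"
      unfolding sact_cartan[OF h F] fsc_def by (simp only: fun_eq_iff[of "\<lambda>a. csc (weight_eval n (wt n l a) h) (F a)"])
    finally show "act V h (T F) = weight_eval n \<mu> h \<odot>\<^bsub>V\<^esub> T F \<longleftrightarrow> \<dots>" .
  qed
  also have "\<dots> \<longleftrightarrow> (\<forall>a. F a \<noteq> 0 \<longrightarrow> wt n l a = \<mu>)"
  proof (intro iffI allI impI ballI)
    fix a assume *: "\<forall>h\<in>cartan n. \<forall>a. csc (weight_eval n (wt n l a) h) (F a) = csc (weight_eval n \<mu> h) (F a)"
      and Fa: "F a \<noteq> 0"
    obtain r where r: "F a r \<noteq> 0" using Fa by (auto simp: fun_eq_iff)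
    show "wt n l a = \<mu>"
    proof (rule eq_vecI)
      fix i assume "i < dim_vec \<mu>"
      then have i: "i < n" using \<mu> by simp
      let ?h = "(mat_unit n i i, 0\<^sub>v n)"
      have h: "?h \<in> cartan n" by (auto simp: cartan_def diagonal_mat_def kd_def)
      have we: "weight_eval n \<nu> ?h = \<nu> $ i" for \<nu>
      proof -
        have "weight_eval n \<nu> ?h = (\<Sum>j<n. kd j i * \<nu> $ j)"
          unfolding weight_eval_def by (rule sum.cong) (auto simp: kd_def)
        then show ?thesis using sum_kd[of "{..<n}" i "\<lambda>j. \<nu> $ j"] i by simp
      qed
      have "csc (wt n l a $ i) (F a) = csc (\<mu> $ i) (F a)" using * h unfolding we[symmetric] by blast
      from fun_cong[OF this, of r] show "wt n l a $ i = \<mu> $ i" unfolding csc_apply using r by simp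
    qed (use \<mu> in simp)
  next
    fix h a assume "\<forall>a. F a \<noteq> 0 \<longrightarrow> wt n l a = \<mu>"
    then show "csc (weight_eval n (wt n l a) h) (F a) = csc (weight_eval n \<mu> h) (F a)"
      by (cases "F a = 0") (auto simp: csc.sc_zero_right)
  qed
  finally show ?thesis .
qed

definition part :: "complex vec \<Rightarrow> ((nat \<Rightarrow> int) \<Rightarrow> nat \<Rightarrow> complex) \<Rightarrow> (nat \<Rightarrow> int) \<Rightarrow> nat \<Rightarrow> complex" where
  "part \<mu> F = (\<lambda>a. if wt n l a = \<mu> then F a else 0)"

lemma part_closed: "F \<in> FS n d \<Longrightarrow> part \<mu> F \<in> FS n d"
  by (rule FS_closedI[of F n d _ id id])
    (auto simp: part_def FS_closed[of _ n d] Cd.S_zero split: if_splits)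

text \<open>The component of weight \<mu> is the part of the polynomial supported on the exponents
  of that weight. Any other decomposition, pulled back along \<open>T\<close>, has its summands
  supported in the same places, so it agrees with this one coefficient by coefficient.\<close>

lemma V_weight_module: "weight_module n V"
  unfolding weight_module_def internal_direct_sum_def
proof
  interpret VV: vectorspace class_ring V by (rule C.coords_vectorspace)
  fix v assume "v \<in> carrier V"
  then obtain F where F: "F \<in> FS n d" "v = T F" by (rule C.TE)
  let ?f = "\<lambda>\<mu>\<in>carrier_vec n. T (part \<mu> F)"
  have Tz: "T G = \<zero>\<^bsub>V\<^esub> \<longleftrightarrow> G = 0" if "G \<in> FS n d" for G
    using C.T_inj[OF that FS.S_zero] C.T_zero by metis
  have dec: "\<exists>A. finite A \<and> {\<mu> \<in> carrier_vec n. g \<mu> \<noteq> \<zero>\<^bsub>V\<^esub>} = A \<and> (\<forall>\<mu>\<in>A. C.Tinv (g \<mu>) \<in> FS n d \<and> g \<mu> = T (C.Tinv (g \<mu>))) \<and>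
      (\<Oplus>\<^bsub>V\<^esub>\<mu>\<in>A. g \<mu>) = T (\<Sum>\<mu>\<in>A. C.Tinv (g \<mu>))"
    if g: "g \<in> (\<Pi>\<^sub>E \<mu>\<in>carrier_vec n. weight_space n V \<mu>)" and fin: "finite {\<mu> \<in> carrier_vec n. g \<mu> \<noteq> \<zero>\<^bsub>V\<^esub>}" for g
  proof -
    let ?A = "{\<mu> \<in> carrier_vec n. g \<mu> \<noteq> \<zero>\<^bsub>V\<^esub>}"
    have gc: "g \<mu> \<in> carrier V" if "\<mu> \<in> ?A" for \<mu>
    proof -
      have "g \<mu> \<in> weight_space n V \<mu>" using g that by (auto simp: PiE_iff)
      then show ?thesis by (simp add: weight_space_def)
    qed
    have "(\<Oplus>\<^bsub>V\<^esub>\<mu>\<in>?A. g \<mu>) = (\<Oplus>\<^bsub>V\<^esub>\<mu>\<in>?A. T (C.Tinv (g \<mu>)))"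
      by (rule VV.finsum_cong') (use gc C.T_Tinv in auto)
    also have "\<dots> = T (\<Sum>\<mu>\<in>?A. C.Tinv (g \<mu>))"
      by (rule C.T_sum[OF fin, symmetric]) (use gc C.Tinv_closed in blast)
    finally show ?thesis using fin gc C.Tinv_closed C.T_Tinv by (intro exI[of _ ?A]) auto
  qed
  show "\<exists>!f. f \<in> (\<Pi>\<^sub>E i\<in>carrier_vec n. weight_space n V i) \<and> finite {i \<in> carrier_vec n. f i \<noteq> \<zero>\<^bsub>V\<^esub>} \<and>
      v = (\<Oplus>\<^bsub>V\<^esub>i\<in>{i \<in> carrier_vec n. f i \<noteq> \<zero>\<^bsub>V\<^esub>}. f i)"
  proof (rule ex1I[of _ ?f], intro conjI)
    show mem: "?f \<in> (\<Pi>\<^sub>E i\<in>carrier_vec n. weight_space n V i)"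
    proof (rule PiE_I)
      fix \<mu> :: "complex vec" assume \<mu>: "\<mu> \<in> carrier_vec n"
      have "T (part \<mu> F) \<in> weight_space n V \<mu>"
        unfolding T_weight_space[OF part_closed[OF F(1)] \<mu>] by (auto simp: part_def)
      then show "?f \<mu> \<in> weight_space n V \<mu>" using \<mu> by simp
    qed simp
    have sub: "{\<mu> \<in> carrier_vec n. ?f \<mu> \<noteq> \<zero>\<^bsub>V\<^esub>} \<subseteq> wt n l ` {a. F a \<noteq> 0}"
    proof
      fix \<mu> assume "\<mu> \<in> {\<mu> \<in> carrier_vec n. ?f \<mu> \<noteq> \<zero>\<^bsub>V\<^esub>}"
      then have "part \<mu> F \<noteq> 0" using C.T_zero by auto
      then obtain a where "part \<mu> F a \<noteq> 0" by (auto simp: fun_eq_iff[of "part \<mu> F"])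
      then show "\<mu> \<in> wt n l ` {a. F a \<noteq> 0}" by (auto simp: part_def split: if_splits)
    qed
    then show fin: "finite {\<mu> \<in> carrier_vec n. ?f \<mu> \<noteq> \<zero>\<^bsub>V\<^esub>}"
      by (rule finite_subset) (simp add: FS_finite[OF F(1)])
    let ?A = "{\<mu> \<in> carrier_vec n. ?f \<mu> \<noteq> \<zero>\<^bsub>V\<^esub>}"
    have "(\<Oplus>\<^bsub>V\<^esub>\<mu>\<in>?A. ?f \<mu>) = T (\<Sum>\<mu>\<in>?A. C.Tinv (?f \<mu>))" using dec[OF mem fin] by auto
    also have "(\<Sum>\<mu>\<in>?A. C.Tinv (?f \<mu>)) = (\<Sum>\<mu>\<in>?A. part \<mu> F)"
      by (rule sum.cong) (auto simp: C.Tinv_T part_closed[OF F(1)])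
    also have "\<dots> = F"
    proof
      fix a
      have "(\<Sum>\<mu>\<in>?A. part \<mu> F) a = (\<Sum>\<mu>\<in>?A. if wt n l a = \<mu> then F a else 0)"
        by (subst sum_fun_apply) (simp add: part_def)
      also have "\<dots> = (if wt n l a \<in> ?A then F a else 0)" using fin by simp
      also have "\<dots> = F a"
      proof (cases "wt n l a \<in> ?A")
        case False
        then have "part (wt n l a) F = 0" using Tz[OF part_closed[OF F(1)]] by auto
        then have "F a = 0" by (metis part_def zero_fun_apply)
        then show ?thesis by simp
      qed simp
      finally show "(\<Sum>\<mu>\<in>?A. part \<mu> F) a = F a" .
    qed
    finally show "v = (\<Oplus>\<^bsub>V\<^esub>\<mu>\<in>?A. ?f \<mu>)" using F(2) by simp
  next
    fix g assume g: "g \<in> (\<Pi>\<^sub>E i\<in>carrier_vec n. weight_space n V i) \<and> finite {i \<in> carrier_vec n. g i \<noteq> \<zero>\<^bsub>V\<^esub>} \<and>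
      v = (\<Oplus>\<^bsub>V\<^esub>i\<in>{i \<in> carrier_vec n. g i \<noteq> \<zero>\<^bsub>V\<^esub>}. g i)"
    let ?A = "{\<mu> \<in> carrier_vec n. g \<mu> \<noteq> \<zero>\<^bsub>V\<^esub>}"
    have fin: "finite ?A" using g by blast
    have gw: "g \<mu> \<in> weight_space n V \<mu>" if "\<mu> \<in> carrier_vec n" for \<mu> using g that by (auto simp: PiE_iff)
    have gc: "g \<mu> \<in> carrier V" if "\<mu> \<in> carrier_vec n" for \<mu> using gw[OF that] by (simp add: weight_space_def)
    have G: "C.Tinv (g \<mu>) \<in> FS n d" "T (C.Tinv (g \<mu>)) = g \<mu>" if "\<mu> \<in> carrier_vec n" for \<mu>
      using C.Tinv_closed[OF gc[OF that]] C.T_Tinv[OF gc[OF that]] by auto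
    have Gw: "wt n l a = \<mu>" if "\<mu> \<in> carrier_vec n" "C.Tinv (g \<mu>) a \<noteq> 0" for \<mu> a
      using gw[OF that(1)] T_weight_space[OF G(1)[OF that(1)] that(1)] that(2) G(2)[OF that(1)] by simp
    have TFG: "T F = T (\<Sum>\<mu>\<in>?A. C.Tinv (g \<mu>))" using dec[of g] g F(2) by auto
    have FG: "F = (\<Sum>\<mu>\<in>?A. C.Tinv (g \<mu>))"
      by (rule C.T_inj[OF F(1) FS.S_sum TFG]) (use G in blast)
    have "C.Tinv (g \<mu>) = part \<mu> F" if \<mu>: "\<mu> \<in> carrier_vec n" for \<mu>
    proof
      fix a
      show "C.Tinv (g \<mu>) a = part \<mu> F a"
      proof (cases "wt n l a = \<mu>")
        case True
        have "F a = (\<Sum>\<nu>\<in>?A. C.Tinv (g \<nu>) a)" using fun_cong[OF FG, of a] unfolding sum_fun_apply .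
        also have "\<dots> = (\<Sum>\<nu>\<in>?A. if \<nu> = \<mu> then C.Tinv (g \<mu>) a else 0)"
          by (rule sum.cong) (use Gw True in auto)
        also have "\<dots> = (if \<mu> \<in> ?A then C.Tinv (g \<mu>) a else 0)" using fin by simp
        also have "\<dots> = C.Tinv (g \<mu>) a"
        proof (cases "\<mu> \<in> ?A")
          case False
          then have "g \<mu> = \<zero>\<^bsub>V\<^esub>" using \<mu> by simp
          then have "C.Tinv (g \<mu>) = 0" using Tz[OF G(1)[OF \<mu>]] G(2)[OF \<mu>] by simp
          then show ?thesis by simp
        qed simp
        finally show ?thesis using True by (simp add: part_def)
      next
        case False
        then show ?thesis using Gw[OF \<mu>] by (auto simp: part_def)
      qed
    qed
    then have "g \<mu> = ?f \<mu>" if "\<mu> \<in> carrier_vec n" for \<mu> using G(2)[OF that] that by simp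
    then show "g = ?f" using g by (intro extensionalityI[of g "carrier_vec n" ?f]) (auto simp: PiE_iff)
  qed
qed

lemma single_weight: "\<lbrakk>b \<in> Zn n; y \<in> Cd d\<rbrakk> \<Longrightarrow> T (single b y) \<in> weight_space n V (wt n l b)"
  using T_weight_space[OF single_closed wt_closed] by (auto simp: single_def)

lemma weight_space_E:
  assumes "b \<in> Zn n" "v \<in> weight_space n V (wt n l b)"
  obtains y where "y \<in> Cd d" "v = T (single b y)"
proof -
  have "v \<in> carrier V" using assms(2) by (simp add: weight_space_def)
  then obtain F where F: "F \<in> FS n d" "v = T F" by (rule C.TE)
  have w: "\<forall>a. F a \<noteq> 0 \<longrightarrow> wt n l a = wt n l b"
    using assms(2) unfolding F(2) T_weight_space[OF F(1) wt_closed] .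
  have "F a = 0" if "a \<noteq> b" for a
  proof (rule ccontr)
    assume Fa: "F a \<noteq> 0"
    then have "wt n l a = wt n l b" using w by simp
    from inj_onD[OF wt_inj this FS_Zn[OF F(1) Fa] assms(1)] show False using that by simp
  qed
  then have "F = single b (F b)" by (auto simp: single_def)
  then show thesis using that[OF FS_closed[OF F(1)]] F(2) by metis
qed

lemma weight_space_empty:
  assumes "\<mu> \<in> carrier_vec n" "\<mu> \<notin> wt n l ` Zn n" shows "weight_space n V \<mu> = {\<zero>\<^bsub>V\<^esub>}"
proof -
  have "T 0 \<in> weight_space n V \<mu>" unfolding T_weight_space[OF FS.S_zero assms(1)] by simp
  moreover have "v = \<zero>\<^bsub>V\<^esub>" if v: "v \<in> weight_space n V \<mu>" for v
  proof -
    have "v \<in> carrier V" using v by (simp add: weight_space_def)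
    then obtain F where F: "F \<in> FS n d" "v = T F" by (rule C.TE)
    have "F a = 0" for a
    proof (rule ccontr)
      assume Fa: "F a \<noteq> 0"
      then have "wt n l a = \<mu>" using v unfolding F(2) T_weight_space[OF F(1) assms(1)] by simp
      then show False using FS_Zn[OF F(1) Fa] assms(2) by blast
    qed
    then have "F = 0" by (simp add: fun_eq_iff[of F])
    then show ?thesis using F(2) C.T_zero by simp
  qed
  ultimately show ?thesis unfolding C.T_zero by blast
qed

lemma weight_space_fin_dim:
  assumes \<mu>: "\<mu> \<in> carrier_vec n"
  shows "vectorspace.fin_dim class_ring (V\<lparr>carrier := weight_space n V \<mu>\<rparr>)"
proof (cases "\<mu> \<in> wt n l ` Zn n")
  case True
  then obtain b where b: "b \<in> Zn n" "\<mu> = wt n l b" by auto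
  have "coords csc (Cd d) (V\<lparr>carrier := weight_space n V \<mu>\<rparr>) (\<lambda>y. T (single b y))"
  proof (rule coords.intro[OF Cd_subspace], unfold_locales)
    have "inj_on (\<lambda>y. T (single b y)) (Cd d)"
      by (rule inj_onI, rule single_inj, rule C.T_inj[OF single_closed[OF b(1)] single_closed[OF b(1)]])
    moreover have "(\<lambda>y. T (single b y)) ` Cd d = weight_space n V \<mu>"
      unfolding b(2) using single_weight[OF b(1)] weight_space_E[OF b(1)] by blast
    ultimately show "bij_betw (\<lambda>y. T (single b y)) (Cd d) (carrier (V\<lparr>carrier := weight_space n V \<mu>\<rparr>))"
      by (simp add: bij_betw_def)
  qed (use C.T_zero C.T_add[OF single_closed[OF b(1)] single_closed[OF b(1)]] C.T_sc[OF single_closed[OF b(1)]]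
      in \<open>simp_all add: single_add single_fsc\<close>)
  then show ?thesis by (rule coords_fin_dim)
next
  case False
  interpret VV: vectorspace class_ring V by (rule C.coords_vectorspace)
  have C0: "Cd 0 = {0}" by (auto simp: Cd_def)
  have z: "c \<odot>\<^bsub>V\<^esub> \<zero>\<^bsub>V\<^esub> = \<zero>\<^bsub>V\<^esub>" for c using VV.smult_r_null[of c] by simp
  have "coords csc (Cd 0) (V\<lparr>carrier := weight_space n V \<mu>\<rparr>) (\<lambda>y. \<zero>\<^bsub>V\<^esub>)"
  proof (rule coords.intro[OF Cd_subspace], unfold_locales)
    show "bij_betw (\<lambda>y. \<zero>\<^bsub>V\<^esub>) (Cd 0) (carrier (V\<lparr>carrier := weight_space n V \<mu>\<rparr>))"
      using weight_space_empty[OF \<mu> False] C0 by (simp add: bij_betw_def)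
    show "\<zero>\<^bsub>V\<^esub> = \<zero>\<^bsub>V\<^esub> \<oplus>\<^bsub>V\<lparr>carrier := weight_space n V \<mu>\<rparr>\<^esub> \<zero>\<^bsub>V\<^esub>"
      using VV.l_zero[OF VV.zero_closed] by simp
    show "\<zero>\<^bsub>V\<^esub> = c \<odot>\<^bsub>V\<lparr>carrier := weight_space n V \<mu>\<rparr>\<^esub> \<zero>\<^bsub>V\<^esub>" for c
      using z[of c] by simp
  qed simp
  then show ?thesis by (rule coords_fin_dim)
qed

text \<open>The alternative in the definition of the objects is the dimension of the fibre: for d =
  0 the module is zero, and otherwise each weight of the coset occurs, through a copy of
  C^d.\<close>

lemma model_Ob: "M \<in> Ob (C_cat n l)"
proof -
  have hc: "harish_chandra n V"
    unfolding harish_chandra_def using lie_module_V V_weight_module weight_space_fin_dim by blast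
  have "carrier M = {\<zero>\<^bsub>M\<^esub>} \<or> weight_support n V = weight_coset n l"
  proof (cases "d = 0")
    case True
    have "F = 0" if "F \<in> FS n d" for F
      using FS_closed[OF that] unfolding True by (auto simp: Cd_def fun_eq_iff)
    then have "FS n d = {0}" using FS.S_zero[of n d] by blast
    then have "carrier V = {\<zero>\<^bsub>V\<^esub>}" using C.T_bij C.T_zero by (auto simp: bij_betw_def)
    then show ?thesis by simp
  next
    case False
    have "weight_space n V (wt n l b) \<noteq> {\<zero>\<^bsub>V\<^esub>}" if b: "b \<in> Zn n" for b
    proof -
      have y: "unit_fun 0 \<in> Cd d" using False by (auto simp: Cd_def unit_fun_def)
      have "T (single b (unit_fun 0)) \<noteq> T 0"
      proof
        assume "T (single b (unit_fun 0)) = T 0"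
        from C.T_inj[OF single_closed[OF b y] FS.S_zero this] have "single b (unit_fun 0) = (0 :: _ \<Rightarrow> nat \<Rightarrow> complex)" .
        from fun_cong[OF fun_cong[OF this, of b], of 0] have "unit_fun 0 (0::nat) = (0 :: complex)" by simp
        then show False by (simp add: unit_fun_def)
      qed
      then show ?thesis using single_weight[OF b y] C.T_zero by auto
    qed
    then have "weight_support n V = wt n l ` Zn n"
      unfolding weight_support_def using weight_space_empty wt_closed by blast
    then show ?thesis by (simp add: weight_coset_eq[OF l])
  qed
  then show ?thesis using M hc by (simp add: C_cat_def)
qed

end

section \<open>Homomorphisms of Laurent modules and of their fibres\<close>

definition concrete_hom where
  "concrete_hom sc S sc' S' L \<rho> \<rho>' = {P \<in> S \<rightarrow>\<^sub>E S'.
     (\<forall>x\<in>S. \<forall>y\<in>S. P (x + y) = P x + P y) \<and> (\<forall>c. \<forall>x\<in>S. P (sc c x) = sc' c (P x)) \<and>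
     (\<forall>g\<in>carrier L. \<forall>x\<in>S. P (\<rho> g x) = \<rho>' g (P x))}"

lemma concrete_homD:
  assumes "P \<in> concrete_hom sc S sc' S' L \<rho> \<rho>'"
  shows "x \<in> S \<Longrightarrow> P x \<in> S'" "\<lbrakk>x \<in> S; y \<in> S\<rbrakk> \<Longrightarrow> P (x + y) = P x + P y"
    "x \<in> S \<Longrightarrow> P (sc c x) = sc' c (P x)" "\<lbrakk>g \<in> carrier L; x \<in> S\<rbrakk> \<Longrightarrow> P (\<rho> g x) = \<rho>' g (P x)"
    "P \<in> S \<rightarrow>\<^sub>E S'"
  using assms by (auto simp only: concrete_hom_def mem_Collect_eq PiE_iff)

lemma concrete_homI:
  assumes "P \<in> S \<rightarrow>\<^sub>E S'" "\<And>x y. \<lbrakk>x \<in> S; y \<in> S\<rbrakk> \<Longrightarrow> P (x + y) = P x + P y"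
    "\<And>c x. x \<in> S \<Longrightarrow> P (sc c x) = sc' c (P x)" "\<And>g x. \<lbrakk>g \<in> carrier L; x \<in> S\<rbrakk> \<Longrightarrow> P (\<rho> g x) = \<rho>' g (P x)"
  shows "P \<in> concrete_hom sc S sc' S' L \<rho> \<rho>'"
  using assms unfolding concrete_hom_def by blast

definition push :: "('b \<Rightarrow> 'c) \<Rightarrow> ('i \<Rightarrow> 'b) \<Rightarrow> 'i \<Rightarrow> 'c" where
  "push P F = (\<lambda>a. P (F a))"

locale std_hom = R: std_rep d m \<rho> lam + R': std_rep d' m \<rho>' lam for d m \<rho> d' \<rho>' lam +
  fixes P
  assumes P: "P \<in> concrete_hom csc (Cd d) csc (Cd d') (s_alg m) \<rho> \<rho>'"
begin

lemmas P_closed = concrete_homD(1)[OF P]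
lemmas P_add = concrete_homD(2)[OF P]
lemmas P_csc = concrete_homD(3)[OF P]
lemmas P_rho = concrete_homD(4)[OF P]

lemma P_zero: "P 0 = 0"
  using P_add[OF Cd.S_zero Cd.S_zero] by simp

lemma push_single: "push P (single a y) = single a (P y)"
  by (rule ext) (simp add: push_def single_def P_zero)

lemma push_add: "F \<in> FS n d \<Longrightarrow> G \<in> FS n d \<Longrightarrow> push P (F + G) = push P F + push P G"
  by (rule ext) (simp add: push_def P_add FS_closed)

lemma push_fsc: "F \<in> FS n d \<Longrightarrow> push P (fsc c F) = fsc c (push P F)"
  by (rule ext) (simp add: push_def P_csc FS_closed fsc_def)

lemma push_closed:
  assumes F: "F \<in> FS n d" shows "push P F \<in> FS n d'"
proof -
  have "push P F = (\<Sum>a | F a \<noteq> 0. single a (P (F a)))"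
  proof
    fix b
    have "(\<Sum>a | F a \<noteq> 0. single a (P (F a))) b = (\<Sum>a | F a \<noteq> 0. if a = b then P (F b) else 0)"
      by (subst sum_fun_apply, rule sum.cong) (auto simp: single_def)
    also have "\<dots> = push P F b" using FS_finite[OF F] by (auto simp: push_def P_zero)
    finally show "push P F b = (\<Sum>a | F a \<noteq> 0. single a (P (F a))) b" ..
  qed
  also have "\<dots> \<in> FS n d'"
    by (rule FS.S_sum, rule single_closed) (use FS_Zn[OF F] P_closed[OF FS_closed[OF F]] in auto)
  finally show ?thesis .
qed

lemma push_shift: "push P (shift k F) = shift k (push P F)"
  by (simp add: push_def shift_def)

lemma push_E:
  assumes F: "F \<in> FS (Suc m) d"
  shows "push P (unit_op m lam \<rho> i j F) = unit_op m lam \<rho>' i j (push P F)"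
proof
  fix a
  show "push P (unit_op m lam \<rho> i j F) a = unit_op m lam \<rho>' i j (push P F) a"
    unfolding push_def unit_op_def
    by (simp only: P_add P_csc P_rho Cd.S_sc R.rho_closed stab_unit_closed FS_closed[OF F])
qed

lemma push_sum: "(\<And>i. i \<in> I \<Longrightarrow> f i \<in> FS n d) \<Longrightarrow> push P (sum f I) = (\<Sum>i\<in>I. push P (f i))"
proof (induction I rule: infinite_finite_induct)
  case (insert i I)
  have "push P (sum f (insert i I)) = push P (f i) + push P (sum f I)"
    unfolding sum.insert[OF insert(1,2)] by (rule push_add[of _ n]) (use insert(4) in \<open>auto intro: FS.S_sum\<close>)
  also have "\<dots> = (\<Sum>i\<in>insert i I. push P (f i))"
    unfolding sum.insert[OF insert(1,2)] using insert(3,4) by (simp only: insertI2)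
  finally show ?case .
qed (simp_all add: push_def P_zero fun_eq_iff)

lemma push_std_act:
  assumes x: "x \<in> carrier (s_alg (Suc m))" and F: "F \<in> FS (Suc m) d"
  shows "push P (std_act m lam \<rho> x F) = std_act m lam \<rho>' x (push P F)"
proof -
  obtain A v where xe: "x = (A, v)" by (cases x)
  have E: "unit_op m lam \<rho> i j F \<in> FS (Suc m) d" if "i < Suc m" "j < Suc m" for i j
    by (rule R.E_closed[OF that F])
  have s: "shift k F \<in> FS (Suc m) d" if "k < Suc m" for k by (rule shift_closed[OF that F])
  have "push P (R.PA A F) = R'.PA A (push P F)"
    unfolding R.PA_def R'.PA_def
    by (subst push_sum[of _ _ "Suc m"], (intro FS.S_sum FS.S_sc E; simp), intro sum.cong refl,
      subst push_sum[of _ _ "Suc m"]) (simp_all add: FS.S_sc E push_fsc[of _ "Suc m"] push_E[OF F] del: sum.lessThan_Suc)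
  moreover have "push P (R.QA v F) = R'.QA v (push P F)"
    unfolding R.QA_def R'.QA_def
    by (subst push_sum[of _ _ "Suc m"]) (simp_all add: FS.S_sc s push_fsc[of _ "Suc m"] push_shift del: sum.lessThan_Suc)
  ultimately show ?thesis
    unfolding xe R.std_act_eq R'.std_act_eq by (simp add: push_add[OF R.PA_closed[OF F] R.QA_closed[OF F]])
qed

end

text \<open>\<open>H\<close> preserves weights, so it sends t^a y to some t^a z, and since it
  commutes with the shifts, z is independent of \<open>a\<close>. Setting P y = z, evaluation at (1,
  ..., 1) turns \<open>H\<close> into \<open>P\<close>, and \<open>ev_std_act\<close> for both
  modules shows that \<open>P\<close> intertwines the fibre representations.\<close>

lemma std_hom_of_shift_hom:
  assumes R: "std_rep d m \<rho>" and R': "std_rep d' m \<rho>'"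
    and cl: "\<And>F. F \<in> FS (Suc m) d \<Longrightarrow> H F \<in> FS (Suc m) d'"
    and add: "\<And>F G. \<lbrakk>F \<in> FS (Suc m) d; G \<in> FS (Suc m) d\<rbrakk> \<Longrightarrow> H (F + G) = H F + H G"
    and sc: "\<And>c F. F \<in> FS (Suc m) d \<Longrightarrow> H (fsc c F) = fsc c (H F)"
    and act: "\<And>x F. \<lbrakk>x \<in> carrier (s_alg (Suc m)); F \<in> FS (Suc m) d\<rbrakk> \<Longrightarrow>
      H (std_act m lam \<rho> x F) = std_act m lam \<rho>' x (H F)"
  obtains P where "P \<in> concrete_hom csc (Cd d) csc (Cd d') (s_alg m) \<rho> \<rho>'"
    "\<And>F. F \<in> FS (Suc m) d \<Longrightarrow> H F = push P F"
proof -
  interpret R: std_rep d m \<rho> lam by (rule R)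
  interpret R': std_rep d' m \<rho>' lam by (rule R')
  let ?n = "Suc m"
  define P where "P = (\<lambda>y\<in>Cd d. ev (H (single (\<lambda>_. 0) y)))"
  have Z: "(\<lambda>_. 0) \<in> Zn ?n" by (simp add: Zn_def)
  have sup: "H (single a y) = single a (H (single a y) a)" if a: "a \<in> Zn ?n" and y: "y \<in> Cd d" for a y
  proof
    fix b
    let ?G = "H (single a y)"
    have s: "single a y \<in> FS ?n d" by (rule single_closed[OF a y])
    show "?G b = single a (?G a) b"
    proof (cases "b = a")
      case False
      have "?G b = 0"
      proof (rule ccontr)
        assume nz: "?G b \<noteq> 0"
        have "\<exists>k<?n. a k \<noteq> b k"
        proof (rule ccontr)
          assume "\<not> (\<exists>k<?n. a k \<noteq> b k)"
          then have "b = a" using FS_Zn[OF cl[OF s] nz] a by (auto simp: Zn_def fun_eq_iff) (metis not_le)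
          then show False using False by simp
        qed
        then obtain k where k: "k < ?n" "a k \<noteq> b k" by blast
        \<comment> \<open>The exponents differ in coordinate \<open>k\<close>, so e_kk has different
          eigenvalues on the two monomials.\<close>
        let ?h = "(mat_unit ?n k k, 0\<^sub>v ?n)"
        have h: "?h \<in> carrier (s_alg ?n)" by simp
        have kk: "mat_unit ?n k k \<in> carrier_mat ?n ?n" "diagonal_mat (mat_unit ?n k k)"
          by (auto simp: diagonal_mat_def kd_def)
        have tr: "(\<Sum>i<?n. (lam i + of_int (c i)) * mat_unit ?n k k $$ (i, i)) = lam k + of_int (c k)" for c
        proof -
          have "(\<Sum>i<?n. (lam i + of_int (c i)) * mat_unit ?n k k $$ (i, i)) = (\<Sum>i<?n. kd i k * (lam i + of_int (c i)))"
            by (rule sum.cong) (auto simp: kd_def)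
          then show ?thesis using sum_kd[of "{..<?n}" k "\<lambda>i. lam i + of_int (c i)"] k(1) by simp
        qed
        have dg: "std_act m lam \<rho> ?h (single a y) = fsc (lam k + of_int (a k)) (single a y)"
          unfolding R.std_act_diag[OF kk s] tr by (rule ext) (auto simp: single_def fsc_def csc.sc_zero_right)
        have "fsc (lam k + of_int (a k)) ?G = (\<lambda>c. csc (lam k + of_int (c k)) (?G c))"
          using act[OF h s] unfolding dg sc[OF s] R'.std_act_diag[OF kk cl[OF s]] tr .
        from fun_cong[OF this, of b] have e: "csc (lam k + of_int (a k)) (?G b) = csc (lam k + of_int (b k)) (?G b)"
          by (simp only: fsc_def)
        obtain r where r: "?G b r \<noteq> 0" using nz by (auto simp: fun_eq_iff[of "?G b"])
        show False using fun_cong[OF e, of r] r k(2) by (simp add: csc_apply)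
      qed
      then show ?thesis using False by simp
    qed simp
  qed
  have Hs: "H (single a y) = single a (P y)" if a: "a \<in> Zn ?n" and y: "y \<in> Cd d" for a y
  proof -
    define g where "g a = ev (H (single a y))" for a
    have g: "g (a(k := a k + 1)) = g a" if a: "a \<in> Zn ?n" and k: "k < ?n" for a k
    proof -
      have s: "single a y \<in> FS ?n d" by (rule single_closed[OF a y])
      have "H (single (a(k := a k + 1)) y) = shift k (H (single a y))"
        using act[OF e_vec_closed[of _ k] s] unfolding R.std_act_e[OF k] R'.std_act_e[OF k] shift_single .
      then show ?thesis unfolding g_def using ev_shift[OF k cl[OF s]] by simp
    qed
    have "g a = P y" using Zn_shift_const[of ?n g, OF g a] y by (simp add: g_def P_def)
    moreover have "g a = H (single a y) a"
      unfolding g_def using arg_cong[OF sup[OF a y], of ev] by simp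
    ultimately show ?thesis using sup[OF a y] by simp
  qed
  have P: "P \<in> concrete_hom csc (Cd d) csc (Cd d') (s_alg m) \<rho> \<rho>'"
  proof (rule concrete_homI)
    show "P \<in> Cd d \<rightarrow>\<^sub>E Cd d'"
      using ev_closed[OF cl[OF single_closed[OF Z]]] by (auto simp: P_def)
    fix x y assume x: "x \<in> Cd d"
    note s = single_closed[OF Z]
    show "P (csc c x) = csc c (P x)" for c
      using x by (simp add: P_def Cd.S_sc single_fsc sc[OF s[OF x]] ev_fsc[OF cl[OF s[OF x]]])
    show "P (x + y) = P x + P y" if y: "y \<in> Cd d"
      using x y by (simp add: P_def Cd.S_add single_add add[OF s[OF x] s[OF y]] ev_add[OF cl[OF s[OF x]] cl[OF s[OF y]]])
    fix g assume g: "g \<in> carrier (s_alg m)"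
    let ?X = "sig_inv m g"
    have X: "?X \<in> colsum_zero m" by (rule sig_inv_colsum)
    have Xc: "(?X, 0\<^sub>v ?n) \<in> carrier (s_alg ?n)" by simp
    \<comment> \<open>The value of \<open>F\<close> at (1, ..., 1) is the image of \<open>x\<close>
      under \<open>g\<close>, but \<open>F\<close> need not be constant; therefore
      \<open>evH\<close> is established for every polynomial before it is used on
      \<open>F\<close>.\<close>
    define F where "F = std_act m lam \<rho> (?X, 0\<^sub>v ?n) (single (\<lambda>_. 0) x)"
    have F: "F \<in> FS ?n d" unfolding F_def by (rule conc_rep.rho_closed[OF R.std_conc_rep Xc s[OF x]])
    have evH: "ev (H G) = P (ev G)" if G: "G \<in> FS ?n d" for G
    proof (rule FS_additive_ext[of ?n d "\<lambda>G. ev (H G)" "\<lambda>G. P (ev G)", OF _ _ _ G])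
      show "ev (H (F + G)) = ev (H F) + ev (H G)" if "F \<in> FS ?n d" "G \<in> FS ?n d" for F G
        unfolding add[OF that] by (rule ev_add[OF cl[OF that(1)] cl[OF that(2)]])
      show "P (ev (F + G)) = P (ev F) + P (ev G)" if FG: "F \<in> FS ?n d" "G \<in> FS ?n d" for F G
      proof -
        have e: "ev F \<in> Cd d" "ev G \<in> Cd d" using FG by (auto intro: ev_closed)
        show ?thesis unfolding ev_add[OF FG]
          using e by (simp add: P_def Cd.S_add single_add add[OF s[OF e(1)] s[OF e(2)]] ev_add[OF cl[OF s[OF e(1)]] cl[OF s[OF e(2)]]])
      qed
      show "ev (H (single a y)) = P (ev (single a y))" if "a \<in> Zn ?n" "y \<in> Cd d" for a y
        by (simp add: Hs[OF that])
    qed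
    have "P (\<rho> g x) = P (ev F)"
      unfolding F_def R.ev_std_act[OF X s[OF x]] ev_single sig_sig_inv[OF g] ..
    also have "\<dots> = ev (H F)" using evH[OF F] ..
    also have "H F = std_act m lam \<rho>' (?X, 0\<^sub>v ?n) (H (single (\<lambda>_. 0) x))" unfolding F_def by (rule act[OF Xc s[OF x]])
    also have "ev \<dots> = \<rho>' g (ev (H (single (\<lambda>_. 0) x)))"
      unfolding R'.ev_std_act[OF X cl[OF s[OF x]]] sig_sig_inv[OF g] ..
    finally show "P (\<rho> g x) = \<rho>' g (P x)" using x by (simp add: P_def)
  qed
  interpret std_hom d m \<rho> d' \<rho>' lam P
    by (unfold_locales) (rule P)
  have "H F = push P F" if F: "F \<in> FS ?n d" for F
    by (rule FS_additive_ext[of ?n d H "push P", OF _ _ _ F]) (simp_all only: add push_add Hs push_single)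
  then show thesis using that P by blast
qed

lemma push_inj:
  assumes "P \<in> Cd d \<rightarrow>\<^sub>E S" "Q \<in> Cd d \<rightarrow>\<^sub>E S" "\<And>F. F \<in> FS n d \<Longrightarrow> push P F = push Q F"
  shows "P = Q"
proof (rule extensionalityI[of P "Cd d" Q])
  fix y assume y: "y \<in> Cd d"
  have "(\<lambda>_. 0) \<in> Zn n" by (simp add: Zn_def)
  from fun_cong[OF assms(3)[OF single_closed[OF this y]], of "\<lambda>_. 0"]
  show "P y = Q y" by (simp add: push_def)
qed (use assms in \<open>auto simp: PiE_iff\<close>)

locale two_laurent_models = M: laurent_model d m \<rho> l M T + N: laurent_model d' m \<rho>' l N T'
  for d m \<rho> l and M :: "(loc_elem, 'a) module" and T and d' \<rho>' and N :: "(loc_elem, 'b) module" and T'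
begin

abbreviation n where "n \<equiv> Suc m"
abbreviation hom_B where "hom_B \<equiv> concrete_hom csc (Cd d) csc (Cd d') (s_alg m) \<rho> \<rho>'"

definition hom_of where "hom_of P = (\<lambda>u\<in>carrier M. T' (push P (M.C.Tinv u)))"

lemma M_T: "F \<in> FS n d \<Longrightarrow> T F \<in> carrier M"
  using M.C.T_closed[of F] by simp

lemma N_T: "F \<in> FS n d' \<Longrightarrow> T' F \<in> carrier N"
  using N.C.T_closed[of F] by simp

lemma hom_of_T: "F \<in> FS n d \<Longrightarrow> hom_of P (T F) = T' (push P F)"
  by (simp add: hom_of_def M_T M.C.Tinv_T)

lemma M_scalar: "F \<in> FS n d \<Longrightarrow> loc_scalar n c \<odot>\<^bsub>M\<^esub> T F = T (fsc c F)"
  using M.C.T_sc[of F c] by simp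

lemma N_scalar: "F \<in> FS n d' \<Longrightarrow> loc_scalar n c \<odot>\<^bsub>N\<^esub> T' F = T' (fsc c F)"
  using N.C.T_sc[of F c] by simp

lemma M_add: "\<lbrakk>F \<in> FS n d; G \<in> FS n d\<rbrakk> \<Longrightarrow> T F \<oplus>\<^bsub>M\<^esub> T G = T (F + G)"
  using M.C.T_add[of F G] by simp

lemma N_add: "\<lbrakk>F \<in> FS n d'; G \<in> FS n d'\<rbrakk> \<Longrightarrow> T' F \<oplus>\<^bsub>N\<^esub> T' G = T' (F + G)"
  using N.C.T_add[of F G] by simp

lemma M_TE: assumes "u \<in> carrier M" obtains F where "F \<in> FS n d" "u = T F"
  using M.C.TE[of u] assms by auto

lemma hom_of_closed:
  assumes P: "P \<in> hom_B"
  shows "hom_of P \<in> left_module_hom (U_loc n) M N"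
proof -
  interpret std_hom d m \<rho> d' \<rho>' "\<lambda>i. l $ i" P by unfold_locales (rule P)
  note sM = conc_rep.rho_closed[OF M.R.std_conc_rep] and sN = conc_rep.rho_closed[OF N.R.std_conc_rep]
  show ?thesis
  proof (rule U_loc_hom_criterion[OF M.M N.M])
    show "hom_of P \<in> carrier M \<rightarrow>\<^sub>E carrier N"
    proof (rule PiE_I)
      fix u assume "u \<in> carrier M"
      then obtain F where F: "F \<in> FS n d" "u = T F" by (rule M_TE)
      show "hom_of P u \<in> carrier N" unfolding F(2) hom_of_T[OF F(1)] by (rule N_T[OF push_closed[OF F(1)]])
    qed (simp add: hom_of_def)
    fix u assume "u \<in> carrier M"
    then obtain F where F: "F \<in> FS n d" "u = T F" by (rule M_TE)
    show "hom_of P (loc_scalar n c \<odot>\<^bsub>M\<^esub> u) = loc_scalar n c \<odot>\<^bsub>N\<^esub> hom_of P u" for c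
      unfolding F(2) M_scalar[OF F(1)] hom_of_T[OF F(1)] hom_of_T[OF FS.S_sc[OF F(1)]]
        N_scalar[OF push_closed[OF F(1)]] push_fsc[OF F(1)] ..
    show "hom_of P (loc_gen n x \<odot>\<^bsub>M\<^esub> u) = loc_gen n x \<odot>\<^bsub>N\<^esub> hom_of P u" if x: "x \<in> carrier (s_alg n)" for x
      unfolding F(2) M.gen[OF x F(1)] hom_of_T[OF F(1)] hom_of_T[OF sM[OF x F(1)]]
        N.gen[OF x push_closed[OF F(1)]] push_std_act[OF x F(1)] ..
    fix v assume "v \<in> carrier M"
    then obtain G where G: "G \<in> FS n d" "v = T G" by (rule M_TE)
    show "hom_of P (u \<oplus>\<^bsub>M\<^esub> v) = hom_of P u \<oplus>\<^bsub>N\<^esub> hom_of P v"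
      unfolding F(2) G(2) M_add[OF F(1) G(1)] hom_of_T[OF F(1)] hom_of_T[OF G(1)]
        hom_of_T[OF FS.S_add[OF F(1) G(1)]] push_add[OF F(1) G(1)]
        N_add[OF push_closed[OF F(1)] push_closed[OF G(1)]] ..
  qed
qed

lemma hom_of_inj: "inj_on hom_of hom_B"
proof (rule inj_onI)
  fix P Q assume P: "P \<in> hom_B" and Q: "Q \<in> hom_B" and eq: "hom_of P = hom_of Q"
  interpret P: std_hom d m \<rho> d' \<rho>' "\<lambda>i. l $ i" P by unfold_locales (rule P)
  interpret Q: std_hom d m \<rho> d' \<rho>' "\<lambda>i. l $ i" Q by unfold_locales (rule Q)
  show "P = Q"
  proof (rule push_inj[OF concrete_homD(5)[OF P] concrete_homD(5)[OF Q]])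
    fix F assume F: "F \<in> FS n d"
    have "T' (push P F) = T' (push Q F)" using hom_of_T[OF F, of P] hom_of_T[OF F, of Q] eq by simp
    then show "push P F = push Q F" by (rule N.C.T_inj[OF P.push_closed[OF F] Q.push_closed[OF F]])
  qed
qed

lemma hom_of_surj:
  assumes h: "h \<in> left_module_hom (U_loc n) M N"
  shows "\<exists>P\<in>hom_B. hom_of P = h"
proof -
  have hE: "h \<in> carrier M \<rightarrow>\<^sub>E carrier N"
    and hadd: "\<And>u v. \<lbrakk>u \<in> carrier M; v \<in> carrier M\<rbrakk> \<Longrightarrow> h (u \<oplus>\<^bsub>M\<^esub> v) = h u \<oplus>\<^bsub>N\<^esub> h v"
    and hsm: "\<And>r u. \<lbrakk>r \<in> carrier (U_loc n); u \<in> carrier M\<rbrakk> \<Longrightarrow> h (r \<odot>\<^bsub>M\<^esub> u) = r \<odot>\<^bsub>N\<^esub> h u"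
    using h unfolding left_module_hom_def by blast+
  have hc: "h (T F) \<in> carrier N" if "F \<in> FS n d" for F using hE M_T[OF that] by (auto simp: PiE_iff)
  have hcV: "h (T F) \<in> carrier N.V" if "F \<in> FS n d" for F using hc[OF that] by simp
  define H where "H F = N.C.Tinv (h (T F))" for F
  have Hc: "H F \<in> FS n d'" if "F \<in> FS n d" for F
    unfolding H_def by (rule N.C.Tinv_closed[OF hcV[OF that]])
  have TH: "T' (H F) = h (T F)" if "F \<in> FS n d" for F
    unfolding H_def by (rule N.C.T_Tinv[OF hcV[OF that]])
  note sM = conc_rep.rho_closed[OF M.R.std_conc_rep] and sN = conc_rep.rho_closed[OF N.R.std_conc_rep]
  obtain P where P: "P \<in> hom_B" and HP: "\<And>F. F \<in> FS n d \<Longrightarrow> H F = push P F"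
  proof (rule std_hom_of_shift_hom[OF M.R.std_rep_axioms N.R.std_rep_axioms, of H "\<lambda>i. l $ i"])
    fix F assume F: "F \<in> FS n d"
    show "H F \<in> FS n d'" by (rule Hc[OF F])
    show "H (fsc c F) = fsc c (H F)" for c
    proof (rule N.C.T_inj[OF Hc[OF FS.S_sc[OF F]] FS.S_sc[OF Hc[OF F]]])
      show "T' (H (fsc c F)) = T' (fsc c (H F))"
        unfolding TH[OF FS.S_sc[OF F]] N_scalar[OF Hc[OF F], symmetric] M_scalar[OF F, symmetric] TH[OF F]
        by (rule hsm[OF loc_scalar_closed M_T[OF F]])
    qed
    show "H (std_act m (\<lambda>i. l $ i) \<rho> x F) = std_act m (\<lambda>i. l $ i) \<rho>' x (H F)"
      if x: "x \<in> carrier (s_alg n)" for x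
    proof (rule N.C.T_inj[OF Hc[OF sM[OF x F]] sN[OF x Hc[OF F]]])
      show "T' (H (std_act m (\<lambda>i. l $ i) \<rho> x F)) = T' (std_act m (\<lambda>i. l $ i) \<rho>' x (H F))"
        unfolding TH[OF sM[OF x F]] N.gen[OF x Hc[OF F], symmetric] M.gen[OF x F, symmetric] TH[OF F]
        by (rule hsm[OF loc_gen_closed[OF x] M_T[OF F]])
    qed
    fix G assume G: "G \<in> FS n d"
    show "H (F + G) = H F + H G"
    proof (rule N.C.T_inj[OF Hc[OF FS.S_add[OF F G]] FS.S_add[OF Hc[OF F] Hc[OF G]]])
      show "T' (H (F + G)) = T' (H F + H G)"
        unfolding TH[OF FS.S_add[OF F G]] N_add[OF Hc[OF F] Hc[OF G], symmetric] M_add[OF F G, symmetric] TH[OF F] TH[OF G]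
        by (rule hadd[OF M_T[OF F] M_T[OF G]])
    qed
  qed blast
  have "hom_of P = h"
  proof (rule extensionalityI[of _ "carrier M"])
    show "h \<in> extensional (carrier M)" using hE by (simp add: PiE_iff)
    fix u assume "u \<in> carrier M"
    then obtain F where F: "F \<in> FS n d" "u = T F" by (rule M_TE)
    show "hom_of P u = h u" unfolding F(2) hom_of_T[OF F(1)] HP[OF F(1), symmetric] by (rule TH[OF F(1)])
  qed (simp add: hom_of_def)
  then show ?thesis using P by blast
qed

lemma hom_of_bij: "bij_betw hom_of hom_B (left_module_hom (U_loc n) M N)"
  unfolding bij_betw_def
proof
  show "hom_of ` hom_B = left_module_hom (U_loc n) M N"
    using hom_of_closed hom_of_surj by blast
qed (rule hom_of_inj)

end

section \<open>Integer powers of commuting bijections\<close>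

lemma integer_powers:
  assumes e: "bij_betw e S S"
  obtains P where "\<And>v. P 0 v = v" "\<And>z v. v \<in> S \<Longrightarrow> P z v \<in> S" "\<And>z v. v \<in> S \<Longrightarrow> P (z + 1 :: int) v = e (P z v)"
proof -
  define i where "i = inv_into S e"
  have eS: "e v \<in> S" if "v \<in> S" for v using e that by (auto simp: bij_betw_def)
  have iS: "i v \<in> S" "e (i v) = v" if "v \<in> S" for v
    using e that inv_into_into[of v e S] f_inv_into_f[of v e S] by (auto simp: bij_betw_def i_def)
  define P where "P z = (if z \<ge> 0 then e ^^ nat z else i ^^ nat (- z))" for z
  have eP: "(e ^^ k) v \<in> S" if "v \<in> S" for k v by (induction k) (simp_all add: eS that)
  have iP: "(i ^^ k) v \<in> S" if "v \<in> S" for k v by (induction k) (simp_all add: iS(1) that)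
  have "P (z + 1) v = e (P z v)" if v: "v \<in> S" for z v
  proof (cases "z \<ge> 0")
    case True
    then have "nat (z + 1) = Suc (nat z)" by simp
    then show ?thesis using True by (simp add: P_def)
  next
    case False
    then obtain k where k: "nat (- z) = Suc k" "nat (- (z + 1)) = k" by (cases "nat (- z)") auto
    have "P (z + 1) v = (i ^^ k) v"
      using False k(2) by (cases "z + 1 \<ge> 0") (auto simp: P_def)
    then show ?thesis using False k(1) iS(2)[OF iP[OF v]] by (simp add: P_def)
  qed
  then show thesis using that[of P] eP iP by (simp add: P_def)
qed

text \<open>\<open>tau a\<close> stands for the product of the powers e_k^(a_k) with integer
  exponents. The last clause makes it blind to the coordinates from \<open>n\<close> on, as required
  in \<open>commuting_integer_powers\<close> when the exponent of the newly added map
  changes.\<close>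

definition power_system :: "nat \<Rightarrow> (nat \<Rightarrow> 'v \<Rightarrow> 'v) \<Rightarrow> 'v set \<Rightarrow> ((nat \<Rightarrow> int) \<Rightarrow> 'v \<Rightarrow> 'v) \<Rightarrow> bool" where
  "power_system n e S tau \<longleftrightarrow> (\<forall>v. tau (\<lambda>_. 0) v = v) \<and> (\<forall>a. \<forall>v\<in>S. tau a v \<in> S) \<and>
    (\<forall>a. \<forall>k<n. \<forall>v\<in>S. tau (a(k := a k + 1)) v = e k (tau a v)) \<and>
    (\<forall>a b v. (\<forall>i<n. a i = b i) \<longrightarrow> tau a v = tau b v)"

lemma power_systemD:
  assumes "power_system n e S tau"
  shows "tau (\<lambda>_. 0) v = v" "v \<in> S \<Longrightarrow> tau a v \<in> S" "\<lbrakk>k < n; v \<in> S\<rbrakk> \<Longrightarrow> tau (a(k := a k + 1)) v = e k (tau a v)"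
    "(\<And>i. i < n \<Longrightarrow> a i = b i) \<Longrightarrow> tau a v = tau b v"
  using assms unfolding power_system_def by blast+

lemma commuting_integer_powers:
  fixes e :: "nat \<Rightarrow> 'v \<Rightarrow> 'v"
  assumes "\<And>k. k < n \<Longrightarrow> bij_betw (e k) S S"
    and "\<And>j k v. \<lbrakk>j < n; k < n; v \<in> S\<rbrakk> \<Longrightarrow> e j (e k v) = e k (e j v)"
  shows "\<exists>tau. power_system n e S tau"
  using assms
proof (induction n)
  case 0
  show ?case by (rule exI[of _ "\<lambda>a v. v"]) (simp add: power_system_def)
next
  case (Suc n)
  have "\<exists>tau. power_system n e S tau"
    by (rule Suc.IH) (simp_all add: Suc.prems less_SucI)
  then obtain tau where tau: "power_system n e S tau" by blast
  note t0 = power_systemD(1)[OF tau] and tS = power_systemD(2)[OF tau] and te = power_systemD(3)[OF tau]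
    and tc = power_systemD(4)[OF tau]
  obtain P where P0: "\<And>v. P 0 v = v" and PS: "\<And>z v. v \<in> S \<Longrightarrow> P z v \<in> S"
    and Pe: "\<And>z v. v \<in> S \<Longrightarrow> P (z + 1 :: int) v = e n (P z v)"
    using integer_powers[OF Suc.prems(1)[of n]] by blast
  have eS: "e k v \<in> S" if "k < Suc n" "v \<in> S" for k v
    using Suc.prems(1)[OF that(1)] that(2) by (auto simp: bij_betw_def)
  have Pc: "P z (e k v) = e k (P z v)" if k: "k < Suc n" and v: "v \<in> S" for z k v
  proof (induction z rule: int_induct[of _ 0])
    case base
    show ?case by (simp only: P0)
  next
    case (step1 z)
    then show ?case unfolding Pe[OF v] Pe[OF eS[OF k v]] using Suc.prems(2)[OF k lessI PS[OF v]] by simp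
  next
    \<comment> \<open>For decreasing exponents, commutation is verified after applying
      \<open>e n\<close>, which raises both sides to the known case and is injective.\<close>
    case (step2 z)
    have "e n (P (z - 1) (e k v)) = e n (e k (P (z - 1) v))"
      using step2(2) Pe[OF v, of "z - 1"] Pe[OF eS[OF k v], of "z - 1"] Suc.prems(2)[OF k lessI PS[OF v, of "z - 1"]] by simp
    moreover have "inj_on (e n) S" using Suc.prems(1)[of n] by (simp add: bij_betw_def)
    ultimately show ?case by (metis inj_onD PS[OF eS[OF k v]] eS[OF k PS[OF v]])
  qed
  define tau' where "tau' a v = P (a n) (tau a v)" for a v
  have "tau' (a(k := a k + 1)) v = e k (tau' a v)" if k: "k < Suc n" and v: "v \<in> S" for a k v
  proof (cases "k = n")
    case True
    have "tau (a(n := a n + 1)) v = tau a v" by (rule tc) simp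
    then show ?thesis using True by (simp add: tau'_def Pe[OF tS[OF v]])
  next
    case False
    then have kn: "k < n" using k by simp
    then show ?thesis unfolding tau'_def te[OF kn v] using Pc[OF k tS[OF v]] by simp
  qed
  moreover have "tau' (\<lambda>_. 0) v = v" for v by (simp add: tau'_def t0 P0)
  moreover have "tau' a v \<in> S" if "v \<in> S" for a v unfolding tau'_def by (rule PS[OF tS[OF that]])
  moreover have "tau' a v = tau' b v" if "\<And>i. i < Suc n \<Longrightarrow> a i = b i" for a b v
    unfolding tau'_def using that tc[of a b v] by simp
  ultimately have "power_system (Suc n) e S tau'" unfolding power_system_def by blast
  then show ?case by blast
qed

section \<open>From weight modules to Laurent coordinates\<close>

text \<open>Finite dimension is demanded at the single weight \<open>l\<close>, since the bijections
  e_k carry this weight space onto those of the whole coset; \<open>outside\<close> excludes all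
  other weights. In this form the zero module is included.\<close>

locale laurent_lie_module = lie_module "s_alg (Suc m)" V for m and V :: "(s_elem, 'v) lie_rep" +
  fixes l
  assumes l: "l \<in> carrier_vec (Suc m)"
    and e_bij: "k < Suc m \<Longrightarrow> bij_betw (act V (e_vec (Suc m) k)) (carrier V) (carrier V)"
    and weights: "weight_module (Suc m) V"
    and fin_dim0: "vectorspace.fin_dim class_ring (V\<lparr>carrier := weight_space (Suc m) V l\<rparr>)"
    and outside: "\<lbrakk>\<mu> \<in> carrier_vec (Suc m); \<mu> \<notin> wt (Suc m) l ` Zn (Suc m)\<rbrakk> \<Longrightarrow> weight_space (Suc m) V \<mu> = {\<zero>\<^bsub>V\<^esub>}"
begin

abbreviation n where "n \<equiv> Suc m"
abbreviation e where "e k \<equiv> act V (e_vec n k)"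

lemma e_closed: "v \<in> carrier V \<Longrightarrow> e k v \<in> carrier V"
  by (rule act_closed[OF e_vec_closed])

lemma e_inj: "\<lbrakk>k < n; u \<in> carrier V; v \<in> carrier V; e k u = e k v\<rbrakk> \<Longrightarrow> u = v"
  using e_bij by (auto simp: bij_betw_def inj_on_def)

lemma sm_closed: "v \<in> carrier V \<Longrightarrow> c \<odot>\<^bsub>V\<^esub> v \<in> carrier V"
  by (rule smult_closed) simp

lemma add_cancel:
  assumes "x \<in> carrier V" "u \<in> carrier V" "v \<in> carrier V"
  shows "x \<oplus>\<^bsub>V\<^esub> u = x \<oplus>\<^bsub>V\<^esub> v \<longleftrightarrow> u = v"
  using M.r_neg1[OF assms(1,2)] M.r_neg1[OF assms(1,3)] by metis

lemma act_zero: assumes v: "v \<in> carrier V" shows "act V (0\<^sub>m n n, 0\<^sub>v n) v = \<zero>\<^bsub>V\<^esub>"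
proof -
  have "(0 :: complex) \<cdot>\<^sub>v 0\<^sub>v n = 0\<^sub>v n" by (rule eq_vecI) auto
  then have "(0\<^sub>m n n, 0\<^sub>v n) = (0::complex) \<odot>\<^bsub>s_alg n\<^esub> (0\<^sub>m n n, 0\<^sub>v n)" by simp
  then have "act V (0\<^sub>m n n, 0\<^sub>v n) v = 0 \<odot>\<^bsub>V\<^esub> act V (0\<^sub>m n n, 0\<^sub>v n) v"
    using act_smult_left[of "(0\<^sub>m n n, 0\<^sub>v n)" v 0] v by simp
  also have "\<dots> = \<zero>\<^bsub>V\<^esub>" using smult_l_null[OF act_closed[of "(0\<^sub>m n n, 0\<^sub>v n)" v]] v by simp
  finally show ?thesis .
qed

lemma e_comm:
  assumes v: "v \<in> carrier V" shows "e j (e k v) = e k (e j v)"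
proof -
  have "bracket (s_alg n) (e_vec n j) (e_vec n k) = (0\<^sub>m n n, 0\<^sub>v n)"
    by (simp add: e_vec_def zero_mat_mult_vec)
  then have "e j (e k v) \<ominus>\<^bsub>V\<^esub> e k (e j v) = \<zero>\<^bsub>V\<^esub>"
    using act_bracket[OF e_vec_closed[of n j] e_vec_closed[of n k] v] act_zero[OF v] by (simp only:)
  moreover have c: "e j (e k v) \<in> carrier V" "e k (e j v) \<in> carrier V" using v by (auto intro!: e_closed)
  moreover have "e j (e k v) = (e j (e k v) \<ominus>\<^bsub>V\<^esub> e k (e j v)) \<oplus>\<^bsub>V\<^esub> e k (e j v)"
    using c by (simp add: a_minus_def M.a_assoc M.l_neg)
  ultimately show ?thesis by simp
qed

lemma act_cartan_e:
  assumes h: "h \<in> cartan n" and k: "k < n" and v: "v \<in> carrier V"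
  shows "act V h (e k v) = (fst h $$ (k, k)) \<odot>\<^bsub>V\<^esub> e k v \<oplus>\<^bsub>V\<^esub> e k (act V h v)"
proof -
  obtain H where H: "h = (H, 0\<^sub>v n)" "H \<in> carrier_mat n n" "diagonal_mat H" using h by (auto simp: cartan_def)
  have hc: "h \<in> carrier (s_alg n)" using H by simp
  have "H *\<^sub>v unit_vec n k = H $$ (k, k) \<cdot>\<^sub>v unit_vec n k"
    by (rule eq_vecI) (use H k in \<open>auto simp: diagonal_mat_def\<close>)
  then have "bracket (s_alg n) h (e_vec n k) = fst h $$ (k, k) \<odot>\<^bsub>s_alg n\<^esub> e_vec n k"
    using H by (simp add: e_vec_def zero_mat_mult_vec)
  then have eq: "fst h $$ (k, k) \<odot>\<^bsub>V\<^esub> e k v = act V h (e k v) \<ominus>\<^bsub>V\<^esub> e k (act V h v)"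
    using act_bracket[OF hc e_vec_closed[of n k] v] act_smult_left[OF e_vec_closed[of n k] v] by (simp only:)
  have c: "act V h (e k v) \<in> carrier V" "e k (act V h v) \<in> carrier V"
    using hc v by (simp_all add: act_closed e_closed del: s_alg_simps)
  show ?thesis unfolding eq using c by (simp add: a_minus_def M.a_assoc M.l_neg)
qed

text \<open>e_k raises weights by eps_k, and its injectivity makes this an equivalence. An
  equivalence is what the two-sided induction in \<open>tau_weight\<close> consumes.\<close>

lemma weight_step:
  assumes k: "k < n" and v: "v \<in> carrier V"
  shows "e k v \<in> weight_space n V (wt n l (a(k := a k + 1))) \<longleftrightarrow> v \<in> weight_space n V (wt n l a)"
proof -
  have "act V h (e k v) = weight_eval n (wt n l (a(k := a k + 1))) h \<odot>\<^bsub>V\<^esub> e k v \<longleftrightarrow>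
      act V h v = weight_eval n (wt n l a) h \<odot>\<^bsub>V\<^esub> v" if h: "h \<in> cartan n" for h
  proof -
    let ?c = "weight_eval n (wt n l a) h" and ?d = "fst h $$ (k, k)"
    have hc: "h \<in> carrier (s_alg n)" using h by (auto simp: cartan_def)
    have "weight_eval n (wt n l (a(k := a k + 1))) h = (\<Sum>i<n. wt n l a $ i * fst h $$ (i, i) + kd i k * ?d)"
      unfolding weight_eval_def by (rule sum.cong) (auto simp: kd_def algebra_simps)
    also have "\<dots> = ?c + ?d"
      using k sum_kd[of "{..<n}" k "\<lambda>i. ?d"] by (simp add: sum.distrib weight_eval_def del: sum.lessThan_Suc)
    finally have we: "weight_eval n (wt n l (a(k := a k + 1))) h = ?d + ?c" by (simp only: add.commute)
    have ev: "e k v \<in> carrier V" by (rule e_closed[OF v])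
    have hv: "act V h v \<in> carrier V" by (rule act_closed[OF hc v])
    have d: "(?d + ?c) \<odot>\<^bsub>V\<^esub> e k v = ?d \<odot>\<^bsub>V\<^esub> e k v \<oplus>\<^bsub>V\<^esub> e k (?c \<odot>\<^bsub>V\<^esub> v)"
      using smult_l_distr[of ?d ?c "e k v"] ev act_smult_right[OF e_vec_closed v] by simp
    show ?thesis
      unfolding we d act_cartan_e[OF h k v]
      unfolding add_cancel[OF sm_closed[OF ev] e_closed[OF hv] e_closed[OF sm_closed[OF v]]]
      by (rule iffI) (erule e_inj[OF k hv sm_closed[OF v]], erule arg_cong)
  qed
  then show ?thesis using v e_closed[OF v] by (simp add: weight_space_def)
qed

lemma wt_zero: "wt n l (\<lambda>_. 0) = l"
  by (rule eq_vecI) (use l in auto)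

lemma weight_subspace: "subspace class_ring (weight_space n V \<mu>) V"
proof -
  have hc: "h \<in> carrier (s_alg n)" if "h \<in> cartan n" for h using that by (auto simp: cartan_def)
  have z: "act V h \<zero>\<^bsub>V\<^esub> = \<zero>\<^bsub>V\<^esub>" if "h \<in> cartan n" for h
  proof -
    have "act V h (0 \<odot>\<^bsub>V\<^esub> \<zero>\<^bsub>V\<^esub>) = 0 \<odot>\<^bsub>V\<^esub> act V h \<zero>\<^bsub>V\<^esub>"
      by (rule act_smult_right[OF hc[OF that] M.zero_closed])
    then show ?thesis using smult_l_null[OF M.zero_closed] smult_l_null[OF act_closed[OF hc[OF that] M.zero_closed]] by simp
  qed
  have sm0: "c \<odot>\<^bsub>V\<^esub> \<zero>\<^bsub>V\<^esub> = \<zero>\<^bsub>V\<^esub>" for c using smult_r_null[of c] by simp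
  show ?thesis
  proof (rule subspace.intro[OF vectorspace_axioms], rule submodule.intro[OF module_axioms])
    show "weight_space n V \<mu> \<subseteq> carrier V" by (auto simp: weight_space_def)
    show "\<zero>\<^bsub>V\<^esub> \<in> weight_space n V \<mu>" by (simp add: weight_space_def z sm0)
    fix u assume u: "u \<in> weight_space n V \<mu>"
    have uc: "u \<in> carrier V" and uh: "\<And>h. h \<in> cartan n \<Longrightarrow> act V h u = weight_eval n \<mu> h \<odot>\<^bsub>V\<^esub> u"
      using u by (auto simp: weight_space_def)
    show "c \<odot>\<^bsub>V\<^esub> u \<in> weight_space n V \<mu>" for c
      using uc uh smult_assoc1[of _ _ u, symmetric]
      by (simp add: weight_space_def sm_closed act_smult_right[OF hc] mult.commute)
    fix v assume v: "v \<in> weight_space n V \<mu>"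
    then show "u \<oplus>\<^bsub>V\<^esub> v \<in> weight_space n V \<mu>"
      using uc uh smult_r_distr[of _ u v] by (simp add: weight_space_def act_add_right[OF hc])
  qed
qed

definition tau where "tau = (SOME t. power_system n e (carrier V) t)"

lemma power_system_tau: "power_system n e (carrier V) tau"
proof -
  have "\<exists>t. power_system n e (carrier V) t"
    by (rule commuting_integer_powers[OF e_bij e_comm])
  then show ?thesis unfolding tau_def by (rule someI_ex)
qed

lemmas tau_0 = power_systemD(1)[OF power_system_tau]
lemmas tau_closed = power_systemD(2)[OF power_system_tau]
lemmas tau_step = power_systemD(3)[OF power_system_tau]

text \<open>The identity at a + eps_k is e_k applied to the identity at \<open>a\<close>. As e_k is
  injective, the truth value is constant on Z^n, and at a = 0 the identity is trivial. The other
  properties of \<open>tau\<close> are obtained by the same argument.\<close>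

lemma tau_add:
  assumes a: "a \<in> Zn n" and u: "u \<in> carrier V" and v: "v \<in> carrier V"
  shows "tau a (u \<oplus>\<^bsub>V\<^esub> v) = tau a u \<oplus>\<^bsub>V\<^esub> tau a v"
proof -
  have "(tau (a(k := a k + 1)) (u \<oplus>\<^bsub>V\<^esub> v) = tau (a(k := a k + 1)) u \<oplus>\<^bsub>V\<^esub> tau (a(k := a k + 1)) v) =
      (tau a (u \<oplus>\<^bsub>V\<^esub> v) = tau a u \<oplus>\<^bsub>V\<^esub> tau a v)" if k: "k < n" for a k
  proof -
    note c = tau_closed[OF u, of a] tau_closed[OF v, of a] tau_closed[OF M.add.m_closed[OF u v], of a]
    show ?thesis
      unfolding tau_step[OF k u] tau_step[OF k v] tau_step[OF k M.add.m_closed[OF u v]] act_add_right[OF e_vec_closed c(1,2), symmetric]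
      by (rule iffI) (erule e_inj[OF k c(3) M.add.m_closed[OF c(1,2)]], erule arg_cong)
  qed
  note step = this
  define g where "g a = (tau a (u \<oplus>\<^bsub>V\<^esub> v) = tau a u \<oplus>\<^bsub>V\<^esub> tau a v)" for a
  have "g (a(k := a k + 1)) = g a" if "a \<in> Zn n" "k < n" for a k
    unfolding g_def by (rule step[OF that(2)])
  from Zn_shift_const[of n g, OF this a] show ?thesis by (simp only: g_def tau_0)
qed

lemma tau_smult:
  assumes a: "a \<in> Zn n" and v: "v \<in> carrier V"
  shows "tau a (c \<odot>\<^bsub>V\<^esub> v) = c \<odot>\<^bsub>V\<^esub> tau a v"
proof -
  have "(tau (a(k := a k + 1)) (c \<odot>\<^bsub>V\<^esub> v) = c \<odot>\<^bsub>V\<^esub> tau (a(k := a k + 1)) v) =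
      (tau a (c \<odot>\<^bsub>V\<^esub> v) = c \<odot>\<^bsub>V\<^esub> tau a v)" if k: "k < n" for a k
    unfolding tau_step[OF k v] tau_step[OF k sm_closed[OF v]] act_smult_right[OF e_vec_closed tau_closed[OF v], symmetric]
    by (rule iffI) (erule e_inj[OF k tau_closed[OF sm_closed[OF v]] sm_closed[OF tau_closed[OF v]]], erule arg_cong)
  note step = this
  define g where "g a = (tau a (c \<odot>\<^bsub>V\<^esub> v) = c \<odot>\<^bsub>V\<^esub> tau a v)" for a
  have "g (a(k := a k + 1)) = g a" if "a \<in> Zn n" "k < n" for a k
    unfolding g_def by (rule step[OF that(2)])
  from Zn_shift_const[of n g, OF this a] show ?thesis by (simp only: g_def tau_0)
qed

lemma tau_inj:
  assumes a: "a \<in> Zn n" and u: "u \<in> carrier V" and v: "v \<in> carrier V"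
  shows "tau a u = tau a v \<longleftrightarrow> u = v"
proof -
  have "(tau (a(k := a k + 1)) u = tau (a(k := a k + 1)) v) = (tau a u = tau a v)" if k: "k < n" for a k
    unfolding tau_step[OF k u] tau_step[OF k v]
    by (rule iffI) (erule e_inj[OF k tau_closed[OF u] tau_closed[OF v]], erule arg_cong)
  note step = this
  define g where "g a = (tau a u = tau a v)" for a
  have "g (a(k := a k + 1)) = g a" if "a \<in> Zn n" "k < n" for a k
    unfolding g_def by (rule step[OF that(2)])
  from Zn_shift_const[of n g, OF this a] show ?thesis by (simp only: g_def tau_0)
qed

lemma tau_surj:
  assumes a: "a \<in> Zn n" shows "tau a ` carrier V = carrier V"
proof -
  have "(tau (a(k := a k + 1)) ` carrier V = carrier V) = (tau a ` carrier V = carrier V)" if k: "k < n" for a k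
  proof -
    have s: "tau (a(k := a k + 1)) ` carrier V = e k ` (tau a ` carrier V)"
      unfolding image_image by (rule image_cong[OF refl]) (rule tau_step[OF k])
    have "e k ` carrier V = carrier V" using e_bij[OF k] by (simp add: bij_betw_def)
    moreover have "inj_on (e k) (carrier V)" using e_bij[OF k] by (simp add: bij_betw_def)
    moreover have "tau a ` carrier V \<subseteq> carrier V" using tau_closed by blast
    ultimately show ?thesis unfolding s by (metis inj_on_image_eq_iff order_refl)
  qed
  note step = this
  define g where "g a = (tau a ` carrier V = carrier V)" for a
  have "g (a(k := a k + 1)) = g a" if "a \<in> Zn n" "k < n" for a k
    unfolding g_def by (rule step[OF that(2)])
  from Zn_shift_const[of n g, OF this a] show ?thesis by (simp add: g_def tau_0)
qed

lemma tau_weight: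
  assumes a: "a \<in> Zn n" and v: "v \<in> carrier V"
  shows "tau a v \<in> weight_space n V (wt n l a) \<longleftrightarrow> v \<in> weight_space n V l"
proof -
  have "(tau (a(k := a k + 1)) v \<in> weight_space n V (wt n l (a(k := a k + 1)))) = (tau a v \<in> weight_space n V (wt n l a))"
    if k: "k < n" for a k
    unfolding tau_step[OF k v] by (rule weight_step[OF k tau_closed[OF v]])
  note step = this
  define g where "g a = (tau a v \<in> weight_space n V (wt n l a))" for a
  have "g (a(k := a k + 1)) = g a" if "a \<in> Zn n" "k < n" for a k
    unfolding g_def by (rule step[OF that(2)])
  from Zn_shift_const[of n g, OF this a] show ?thesis by (simp only: g_def tau_0 wt_zero)
qed

lemma weight_carrier: "v \<in> weight_space n V \<mu> \<Longrightarrow> v \<in> carrier V"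
  by (simp add: weight_space_def)

lemma coords_exist:
  "\<exists>d T0. coords csc (Cd d) (V\<lparr>carrier := weight_space n V l\<rparr>) T0"
proof (rule fin_dim_coords[OF _ fin_dim0])
  show "vectorspace class_ring (V\<lparr>carrier := weight_space n V l\<rparr>)"
    using subspace_is_vs[OF weight_subspace] by simp
qed

end

locale laurent_lie_module_coords = laurent_lie_module +
  fixes d T0
  assumes T0: "coords csc (Cd d) (V\<lparr>carrier := weight_space (Suc m) V l\<rparr>) T0"
begin

sublocale T0: coords csc "Cd d" "V\<lparr>carrier := weight_space (Suc m) V l\<rparr>" T0
  by (rule T0)

definition part where "part F a = tau a (T0 (F a))"

text \<open>The multiplication map from Laurent polynomials over the weight space at
  \<open>l\<close> to the module: t^a y goes to e^a y.\<close>

definition T where "T F = (\<Oplus>\<^bsub>V\<^esub>a\<in>{a. F a \<noteq> 0}. part F a)"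

lemma T0_weight: "y \<in> Cd d \<Longrightarrow> T0 y \<in> weight_space n V l"
  using T0.T_closed[of y] by simp

lemma T0_closed: "y \<in> Cd d \<Longrightarrow> T0 y \<in> carrier V"
  by (rule weight_carrier[OF T0_weight])

lemma part_closed: "F \<in> FS n d \<Longrightarrow> part F a \<in> carrier V"
  unfolding part_def by (intro tau_closed T0_closed FS_closed)

lemma part_weight: "\<lbrakk>F \<in> FS n d; a \<in> Zn n\<rbrakk> \<Longrightarrow> part F a \<in> weight_space n V (wt n l a)"
  unfolding part_def by (subst tau_weight) (auto intro: T0_closed T0_weight FS_closed)

lemma weight_zero: "\<zero>\<^bsub>V\<^esub> \<in> weight_space n V \<mu>"
  using weight_subspace[of \<mu>] by (auto simp: subspace_def dest: submodule.zero_closed)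

lemma tau_zero: "a \<in> Zn n \<Longrightarrow> tau a \<zero>\<^bsub>V\<^esub> = \<zero>\<^bsub>V\<^esub>"
  using tau_smult[of a "\<zero>\<^bsub>V\<^esub>" 0] smult_l_null[OF M.zero_closed] smult_l_null[OF tau_closed[OF M.zero_closed]] by simp

lemma part_zero: assumes a: "a \<in> Zn n" and F: "F \<in> FS n d" shows "part F a = \<zero>\<^bsub>V\<^esub> \<longleftrightarrow> F a = 0"
proof -
  have z: "T0 0 = \<zero>\<^bsub>V\<^esub>" using T0.T_zero by simp
  have "part F a = \<zero>\<^bsub>V\<^esub> \<longleftrightarrow> tau a (T0 (F a)) = tau a \<zero>\<^bsub>V\<^esub>" by (simp add: part_def tau_zero[OF a])
  also have "\<dots> \<longleftrightarrow> T0 (F a) = \<zero>\<^bsub>V\<^esub>" by (rule tau_inj[OF a T0_closed[OF FS_closed[OF F]] M.zero_closed])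
  also have "\<dots> \<longleftrightarrow> F a = 0" using T0.T_inj[OF FS_closed[OF F] Cd.S_zero] z by metis
  finally show ?thesis .
qed

lemma T_superset:
  assumes F: "F \<in> FS n d" and A: "finite A" "{a. F a \<noteq> 0} \<subseteq> A" "A \<subseteq> Zn n"
  shows "T F = (\<Oplus>\<^bsub>V\<^esub>a\<in>A. part F a)"
  unfolding T_def
proof (rule M.add.finprod_mono_neutral_cong_left[OF A(1,2)])
  show "part F a = \<zero>\<^bsub>V\<^esub>" if "a \<in> A - {a. F a \<noteq> 0}" for a
    using that A(3) part_zero[OF _ F] by blast
qed (use part_closed[OF F] in auto)

lemma T_closed: "F \<in> FS n d \<Longrightarrow> T F \<in> carrier V"
  unfolding T_def by (rule M.finsum_closed) (use part_closed in auto)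

lemma supp_Zn: "F \<in> FS n d \<Longrightarrow> {a. F a \<noteq> 0} \<subseteq> Zn n"
  using FS_Zn by blast

lemma T_add:
  assumes F: "F \<in> FS n d" and G: "G \<in> FS n d" shows "T (F + G) = T F \<oplus>\<^bsub>V\<^esub> T G"
proof -
  let ?A = "{a. F a \<noteq> 0} \<union> {a. G a \<noteq> 0}"
  have A: "finite ?A" "?A \<subseteq> Zn n" using FS_finite[OF F] FS_finite[OF G] supp_Zn[OF F] supp_Zn[OF G] by auto
  have "T (F + G) = (\<Oplus>\<^bsub>V\<^esub>a\<in>?A. part (F + G) a)"
    by (rule T_superset[OF FS.S_add[OF F G] A(1) _ A(2)]) auto
  also have "\<dots> = (\<Oplus>\<^bsub>V\<^esub>a\<in>?A. part F a \<oplus>\<^bsub>V\<^esub> part G a)"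
  proof (rule M.finsum_cong'[OF refl])
    fix a assume "a \<in> ?A"
    then have a: "a \<in> Zn n" using A(2) by blast
    have "T0 (F a + G a) = T0 (F a) \<oplus>\<^bsub>V\<^esub> T0 (G a)"
      using T0.T_add[OF FS_closed[OF F] FS_closed[OF G], of a a] by simp
    then show "part (F + G) a = part F a \<oplus>\<^bsub>V\<^esub> part G a"
      unfolding part_def using tau_add[OF a T0_closed[OF FS_closed[OF F]] T0_closed[OF FS_closed[OF G]]]
      by (simp only: plus_fun_apply)
  qed (use part_closed[OF F] part_closed[OF G] in auto)
  also have "\<dots> = (\<Oplus>\<^bsub>V\<^esub>a\<in>?A. part F a) \<oplus>\<^bsub>V\<^esub> (\<Oplus>\<^bsub>V\<^esub>a\<in>?A. part G a)"
    by (rule M.finsum_addf) (use part_closed[OF F] part_closed[OF G] in auto)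
  also have "\<dots> = T F \<oplus>\<^bsub>V\<^esub> T G"
    using T_superset[OF F A(1) _ A(2)] T_superset[OF G A(1) _ A(2)] by simp
  finally show ?thesis .
qed

lemma T_fsc:
  assumes F: "F \<in> FS n d" shows "T (fsc c F) = c \<odot>\<^bsub>V\<^esub> T F"
proof -
  let ?A = "{a. F a \<noteq> 0}"
  have A: "finite ?A" "?A \<subseteq> Zn n" using FS_finite[OF F] supp_Zn[OF F] by auto
  have "T (fsc c F) = (\<Oplus>\<^bsub>V\<^esub>a\<in>?A. part (fsc c F) a)"
    by (rule T_superset[OF FS.S_sc[OF F] A(1) _ A(2)]) (auto simp: fsc_def csc.sc_zero_right)
  also have "\<dots> = (\<Oplus>\<^bsub>V\<^esub>a\<in>?A. c \<odot>\<^bsub>V\<^esub> part F a)"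
  proof (rule M.finsum_cong'[OF refl])
    fix a assume "a \<in> ?A"
    then have a: "a \<in> Zn n" using A(2) by blast
    have "T0 (csc c (F a)) = c \<odot>\<^bsub>V\<^esub> T0 (F a)"
      using T0.T_sc[OF FS_closed[OF F, of a], of c] by simp
    then show "part (fsc c F) a = c \<odot>\<^bsub>V\<^esub> part F a"
      unfolding part_def using tau_smult[OF a T0_closed[OF FS_closed[OF F]]]
      by (simp only: fsc_apply)
  qed (use part_closed[OF F] in \<open>auto intro: sm_closed\<close>)
  also have "\<dots> = c \<odot>\<^bsub>V\<^esub> T F"
    unfolding T_def by (rule finsum_smult[symmetric]) (use A part_closed[OF F] in auto)
  finally show ?thesis .
qed

text \<open>The summands of \<open>T F\<close>, indexed by weights instead of exponents and filled
  up with zero off the coset. This is the format in which \<open>internal_direct_sum\<close> speaks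
  of uniqueness; both injectivity and surjectivity of \<open>T\<close> are read off from it.\<close>

definition weight_part where
  "weight_part F = (\<lambda>\<mu>\<in>carrier_vec n. if \<mu> \<in> wt n l ` Zn n then part F (inv_into (Zn n) (wt n l) \<mu>) else \<zero>\<^bsub>V\<^esub>)"

lemma weight_part_wt: "a \<in> Zn n \<Longrightarrow> weight_part F (wt n l a) = part F a"
  by (simp add: weight_part_def inv_into_f_f[OF wt_inj])

lemma weight_part_mem:
  assumes F: "F \<in> FS n d" shows "weight_part F \<in> (\<Pi>\<^sub>E \<mu>\<in>carrier_vec n. weight_space n V \<mu>)"
proof (rule PiE_I)
  fix \<mu> :: "complex vec" assume \<mu>: "\<mu> \<in> carrier_vec n"
  show "weight_part F \<mu> \<in> weight_space n V \<mu>"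
  proof (cases "\<mu> \<in> wt n l ` Zn n")
    case True
    then obtain a where a: "a \<in> Zn n" "\<mu> = wt n l a" by blast
    show ?thesis unfolding a(2) weight_part_wt[OF a(1)] by (rule part_weight[OF F a(1)])
  next
    case False
    then show ?thesis using \<mu> by (simp add: weight_part_def weight_zero)
  qed
qed (simp add: weight_part_def)

lemma weight_part_supp:
  assumes F: "F \<in> FS n d"
  shows "{\<mu> \<in> carrier_vec n. weight_part F \<mu> \<noteq> \<zero>\<^bsub>V\<^esub>} = wt n l ` {a. F a \<noteq> 0}"
proof (intro equalityI subsetI)
  fix \<mu> assume "\<mu> \<in> {\<mu> \<in> carrier_vec n. weight_part F \<mu> \<noteq> \<zero>\<^bsub>V\<^esub>}"
  then have \<mu>: "\<mu> \<in> carrier_vec n" "weight_part F \<mu> \<noteq> \<zero>\<^bsub>V\<^esub>" by auto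
  then have "\<mu> \<in> wt n l ` Zn n" by (auto simp: weight_part_def split: if_splits)
  then obtain a where a: "a \<in> Zn n" "\<mu> = wt n l a" by blast
  then have "F a \<noteq> 0" using \<mu>(2) weight_part_wt[OF a(1), of F] part_zero[OF a(1) F] by simp
  then show "\<mu> \<in> wt n l ` {a. F a \<noteq> 0}" using a(2) by blast
next
  fix \<mu> assume "\<mu> \<in> wt n l ` {a. F a \<noteq> 0}"
  then obtain a where a: "F a \<noteq> 0" "\<mu> = wt n l a" by blast
  have "a \<in> Zn n" by (rule FS_Zn[OF F a(1)])
  then show "\<mu> \<in> {\<mu> \<in> carrier_vec n. weight_part F \<mu> \<noteq> \<zero>\<^bsub>V\<^esub>}"
    using a weight_part_wt[of a F] part_zero[OF _ F, of a] by simp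
qed

lemma weight_part_sum:
  assumes F: "F \<in> FS n d"
  shows "T F = (\<Oplus>\<^bsub>V\<^esub>\<mu>\<in>{\<mu> \<in> carrier_vec n. weight_part F \<mu> \<noteq> \<zero>\<^bsub>V\<^esub>}. weight_part F \<mu>)"
proof -
  have inj: "inj_on (wt n l) {a. F a \<noteq> 0}" by (rule inj_on_subset[OF wt_inj supp_Zn[OF F]])
  have wp: "weight_part F (wt n l a) = part F a" if "F a \<noteq> 0" for a
    by (rule weight_part_wt[OF FS_Zn[OF F that]])
  have "(\<Oplus>\<^bsub>V\<^esub>\<mu>\<in>wt n l ` {a. F a \<noteq> 0}. weight_part F \<mu>) = (\<Oplus>\<^bsub>V\<^esub>a\<in>{a. F a \<noteq> 0}. weight_part F (wt n l a))"
    by (rule M.finsum_reindex[OF _ inj]) (use wp part_closed[OF F] in auto)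
  also have "\<dots> = T F"
    unfolding T_def by (rule M.finsum_cong'[OF refl]) (use wp part_closed[OF F] in auto)
  finally show ?thesis unfolding weight_part_supp[OF F] ..
qed

lemma weight_decomposition:
  assumes "v \<in> carrier V"
  shows "\<exists>!f. f \<in> (\<Pi>\<^sub>E \<mu>\<in>carrier_vec n. weight_space n V \<mu>) \<and> finite {\<mu> \<in> carrier_vec n. f \<mu> \<noteq> \<zero>\<^bsub>V\<^esub>} \<and>
    v = (\<Oplus>\<^bsub>V\<^esub>\<mu>\<in>{\<mu> \<in> carrier_vec n. f \<mu> \<noteq> \<zero>\<^bsub>V\<^esub>}. f \<mu>)"
  using weights assms unfolding weight_module_def internal_direct_sum_def by blast

lemma T_inj: "inj_on T (FS n d)"
proof (rule inj_onI)
  fix F G assume F: "F \<in> FS n d" and G: "G \<in> FS n d" and eq: "T F = T G"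
  have fin: "finite {\<mu> \<in> carrier_vec n. weight_part H \<mu> \<noteq> \<zero>\<^bsub>V\<^esub>}" if "H \<in> FS n d" for H
    unfolding weight_part_supp[OF that] by (rule finite_imageI[OF FS_finite[OF that]])
  \<comment> \<open>Stated for all polynomials with the same image at once, so that the unique
    decomposition is shared by \<open>F\<close> and \<open>G\<close>.\<close>
  have uniq: "\<exists>h. \<forall>H\<in>FS n d. T H = T F \<longrightarrow> weight_part H = h"
  proof (rule ex1E[OF weight_decomposition[OF T_closed[OF F]]])
    fix h assume h: "\<forall>f. f \<in> (\<Pi>\<^sub>E \<mu>\<in>carrier_vec n. weight_space n V \<mu>) \<and> finite {\<mu> \<in> carrier_vec n. f \<mu> \<noteq> \<zero>\<^bsub>V\<^esub>} \<and>
      T F = (\<Oplus>\<^bsub>V\<^esub>\<mu>\<in>{\<mu> \<in> carrier_vec n. f \<mu> \<noteq> \<zero>\<^bsub>V\<^esub>}. f \<mu>) \<longrightarrow> f = h"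
    have "weight_part H = h" if H: "H \<in> FS n d" "T H = T F" for H
      by (rule h[rule_format], intro conjI, rule weight_part_mem[OF H(1)], rule fin[OF H(1)],
        rule trans[OF H(2)[symmetric] weight_part_sum[OF H(1)]])
    then show ?thesis by blast
  qed
  then have wp: "weight_part F = weight_part G" using F G eq by metis
  show "F = G"
  proof
    fix a
    show "F a = G a"
    proof (cases "a \<in> Zn n")
      case True
      have "tau a (T0 (F a)) = tau a (T0 (G a))"
        using weight_part_wt[OF True, of F] weight_part_wt[OF True, of G] wp by (simp add: part_def)
      then have "T0 (F a) = T0 (G a)"
        unfolding tau_inj[OF True T0_closed[OF FS_closed[OF F]] T0_closed[OF FS_closed[OF G]]] .
      then show ?thesis by (rule T0.T_inj[OF FS_closed[OF F] FS_closed[OF G]])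
    next
      case False
      then show ?thesis using FS_Zn[OF F] FS_Zn[OF G] by metis
    qed
  qed
qed

lemma T_surj:
  assumes v: "v \<in> carrier V" shows "\<exists>F\<in>FS n d. T F = v"
proof -
  obtain f where f: "f \<in> (\<Pi>\<^sub>E \<mu>\<in>carrier_vec n. weight_space n V \<mu>)" "finite {\<mu> \<in> carrier_vec n. f \<mu> \<noteq> \<zero>\<^bsub>V\<^esub>}"
    "v = (\<Oplus>\<^bsub>V\<^esub>\<mu>\<in>{\<mu> \<in> carrier_vec n. f \<mu> \<noteq> \<zero>\<^bsub>V\<^esub>}. f \<mu>)"
    using weight_decomposition[OF v] by blast
  \<comment> \<open>e^a maps the weight space at \<open>l\<close> onto the one at l + a, so the
    component of that weight comes from a vector of the fibre.\<close>
  have "\<exists>y\<in>Cd d. f (wt n l a) = tau a (T0 y)" if a: "a \<in> Zn n" for a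
  proof -
    have fw: "f (wt n l a) \<in> weight_space n V (wt n l a)" using f(1) by (auto simp: PiE_iff)
    obtain u where u: "u \<in> carrier V" "f (wt n l a) = tau a u"
      using weight_carrier[OF fw] tau_surj[OF a] by blast
    have "u \<in> weight_space n V l" using fw unfolding u(2) tau_weight[OF a u(1)] .
    then have "u \<in> carrier (V\<lparr>carrier := weight_space n V l\<rparr>)" by simp
    then obtain y where "y \<in> Cd d" "u = T0 y" by (rule T0.TE)
    then show ?thesis using u(2) by blast
  qed
  then obtain y where y: "\<And>a. a \<in> Zn n \<Longrightarrow> y a \<in> Cd d" "\<And>a. a \<in> Zn n \<Longrightarrow> f (wt n l a) = tau a (T0 (y a))" by metis
  define F where "F a = (if a \<in> Zn n then y a else 0)" for a
  have z: "T0 0 = \<zero>\<^bsub>V\<^esub>" using T0.T_zero by simp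
  have "f (wt n l a) \<noteq> \<zero>\<^bsub>V\<^esub>" if a: "a \<in> Zn n" "y a \<noteq> 0" for a
  proof
    assume "f (wt n l a) = \<zero>\<^bsub>V\<^esub>"
    then have "tau a (T0 (y a)) = tau a \<zero>\<^bsub>V\<^esub>" using y(2)[OF a(1)] tau_zero[OF a(1)] by simp
    then have "T0 (y a) = T0 0" unfolding z tau_inj[OF a(1) T0_closed[OF y(1)[OF a(1)]] M.zero_closed] .
    from T0.T_inj[OF y(1)[OF a(1)] Cd.S_zero this] show False using a(2) by simp
  qed
  then have "wt n l ` {a. F a \<noteq> 0} \<subseteq> {\<mu> \<in> carrier_vec n. f \<mu> \<noteq> \<zero>\<^bsub>V\<^esub>}"
    by (auto simp: F_def split: if_splits)
  then have "finite (wt n l ` {a. F a \<noteq> 0})" by (rule finite_subset[OF _ f(2)])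
  moreover have sZ: "{a. F a \<noteq> 0} \<subseteq> Zn n" by (auto simp: F_def)
  ultimately have "finite {a. F a \<noteq> 0}" using finite_imageD[OF _ inj_on_subset[OF wt_inj sZ]] by blast
  then have F: "F \<in> FS n d" using sZ y(1) by (auto simp: FS_def F_def Cd.S_zero)
  have "weight_part F = f"
  proof (rule extensionalityI[of _ "carrier_vec n"])
    show "weight_part F \<in> extensional (carrier_vec n)" by (simp add: weight_part_def)
    show "f \<in> extensional (carrier_vec n)" using f(1) by (simp add: PiE_iff)
    fix \<mu> :: "complex vec" assume \<mu>: "\<mu> \<in> carrier_vec n"
    show "weight_part F \<mu> = f \<mu>"
    proof (cases "\<mu> \<in> wt n l ` Zn n")
      case True
      then obtain a where a: "a \<in> Zn n" "\<mu> = wt n l a" by blast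
      show ?thesis unfolding a(2) weight_part_wt[OF a(1)] y(2)[OF a(1)] part_def F_def using a(1) by simp
    next
      case False
      moreover have "f \<mu> \<in> weight_space n V \<mu>" using f(1) \<mu> by (auto simp: PiE_iff)
      ultimately show ?thesis using \<mu> outside[OF \<mu> False] by (simp add: weight_part_def)
    qed
  qed
  then have "T F = v" using weight_part_sum[OF F] f(3) by simp
  then show ?thesis using F by blast
qed

lemma T_coords: "coords fsc (FS n d) V T"
proof (rule coords.intro[OF FS_subspace], unfold_locales)
  show "bij_betw T (FS n d) (carrier V)"
    unfolding bij_betw_def using T_inj T_closed T_surj by blast
  show "T 0 = \<zero>\<^bsub>V\<^esub>" by (simp add: T_def)
qed (simp_all only: T_add T_fsc)

lemma T_single:
  assumes a: "a \<in> Zn n" and y: "y \<in> Cd d" shows "T (single a y) = tau a (T0 y)"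
proof -
  have s: "single a y \<in> FS n d" by (rule single_closed[OF a y])
  have "T (single a y) = (\<Oplus>\<^bsub>V\<^esub>b\<in>{a}. part (single a y) b)"
    by (rule T_superset[OF s]) (use a in \<open>auto simp: single_def\<close>)
  then show ?thesis using part_closed[OF s, of a] by (simp add: part_def)
qed

definition D where "D x F = coords.Tinv (FS n d) T (act V x (T F))"

lemma D_conc_rep: "conc_rep fsc (FS n d) (s_alg n) D"
  unfolding D_def[abs_def] by (rule conc_rep_of_lie_module[OF T_coords lie_module_axioms])

lemma act_T: "\<lbrakk>x \<in> carrier (s_alg n); F \<in> FS n d\<rbrakk> \<Longrightarrow> act V x (T F) = T (D x F)"
  unfolding D_def by (rule coords.T_Tinv[OF T_coords, symmetric], rule act_closed[OF _ T_closed])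

lemma D_eqI: "\<lbrakk>F \<in> FS n d; G \<in> FS n d; act V x (T F) = T G\<rbrakk> \<Longrightarrow> D x F = G"
  unfolding D_def by (simp only: coords.Tinv_T[OF T_coords])

text \<open>Additivity reduces both conditions to monomials. There \<open>tau_step\<close> says that
  e_k raises the exponent, and \<open>tau_weight\<close> says that e^a y has weight l + a.\<close>

lemma laurent: "laurent_rep m d D (\<lambda>i. l $ i)"
proof (rule laurent_rep.intro[OF D_conc_rep], unfold_locales)
  interpret D: conc_rep fsc "FS n d" "s_alg n" D by (rule D_conc_rep)
  fix k F assume k: "k < n" and F: "F \<in> FS n d"
  show "D (e_vec n k) F = shift k F"
  proof (rule FS_additive_ext[of n d "D (e_vec n k)" "shift k", OF _ _ _ F])
    show "D (e_vec n k) (single a y) = shift k (single a y)" if a: "a \<in> Zn n" and y: "y \<in> Cd d" for a y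
    proof (rule D_eqI)
      have a': "a(k := a k + 1) \<in> Zn n" by (rule Zn_upd[OF a k])
      show "single a y \<in> FS n d" by (rule single_closed[OF a y])
      show "shift k (single a y) \<in> FS n d" unfolding shift_single by (rule single_closed[OF a' y])
      show "e k (T (single a y)) = T (shift k (single a y))"
        unfolding shift_single T_single[OF a y] T_single[OF a' y] tau_step[OF k T0_closed[OF y]] ..
    qed
  qed (simp_all only: D.rho_add_right[OF e_vec_closed] shift_add)
  let ?h = "(mat_unit n k k, 0\<^sub>v n)"
  have h: "?h \<in> carrier (s_alg n)" by simp
  have hc: "?h \<in> cartan n" by (auto simp: cartan_def diagonal_mat_def kd_def)
  have we: "weight_eval n (wt n l a) ?h = l $ k + of_int (a k)" for a
  proof -
    have "weight_eval n (wt n l a) ?h = (\<Sum>i<n. kd i k * wt n l a $ i)"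
      unfolding weight_eval_def by (rule sum.cong) (auto simp: kd_def)
    then show ?thesis using sum_kd[of "{..<n}" k "\<lambda>i. wt n l a $ i"] k by simp
  qed
  show "D ?h F = (\<lambda>a. csc (l $ k + of_int (a k)) (F a))"
  proof (rule FS_additive_ext[of n d "D ?h" "\<lambda>F a. csc (l $ k + of_int (a k)) (F a)", OF _ _ _ F])
    show "D ?h (single a y) = (\<lambda>b. csc (l $ k + of_int (b k)) (single a y b))" if a: "a \<in> Zn n" and y: "y \<in> Cd d" for a y
    proof -
      have s: "single a y \<in> FS n d" by (rule single_closed[OF a y])
      have "tau a (T0 y) \<in> weight_space n V (wt n l a)"
        unfolding tau_weight[OF a T0_closed[OF y]] by (rule T0_weight[OF y])
      then have "act V ?h (T (single a y)) = weight_eval n (wt n l a) ?h \<odot>\<^bsub>V\<^esub> T (single a y)"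
        using hc unfolding T_single[OF a y] weight_space_def by blast
      also have "\<dots> = T (fsc (l $ k + of_int (a k)) (single a y))" unfolding T_fsc[OF s] we ..
      finally have "D ?h (single a y) = fsc (l $ k + of_int (a k)) (single a y)" by (rule D_eqI[OF s FS.S_sc[OF s]])
      also have "\<dots> = (\<lambda>b. csc (l $ k + of_int (b k)) (single a y b))"
        by (rule ext) (auto simp: single_def fsc_def csc.sc_zero_right)
      finally show ?thesis .
    qed
    show "D ?h (F + G) = D ?h F + D ?h G" if "F \<in> FS n d" "G \<in> FS n d" for F G
      by (rule D.rho_add_right[OF h that])
  qed (simp add: fun_eq_iff csc_def algebra_simps)
qed

lemma act_T_std:
  "\<lbrakk>x \<in> carrier (s_alg n); F \<in> FS n d\<rbrakk> \<Longrightarrow>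
    act V x (T F) = T (std_act m (\<lambda>i. l $ i) (laurent_rep.rho m D) x F)"
  by (simp only: act_T laurent_rep.D_eq_std[OF laurent])

end

lemma (in laurent_lie_module) standard_form:
  "\<exists>d \<rho> T. std_rep d m \<rho> \<and> coords fsc (FS n d) V T \<and>
    (\<forall>x\<in>carrier (s_alg n). \<forall>F\<in>FS n d. act V x (T F) = T (std_act m (\<lambda>i. l $ i) \<rho> x F))"
proof -
  obtain d T0 where T0: "coords csc (Cd d) (V\<lparr>carrier := weight_space n V l\<rparr>) T0"
    using coords_exist by blast
  have c: "laurent_lie_module_coords m V l d T0"
    by (rule laurent_lie_module_coords.intro[OF laurent_lie_module_axioms laurent_lie_module_coords_axioms.intro[OF T0]])
  show ?thesis
    using laurent_rep.std[OF laurent_lie_module_coords.laurent[OF c]] laurent_lie_module_coords.T_coords[OF c]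
      laurent_lie_module_coords.act_T_std[OF c] by blast
qed

lemma model_exists:
  fixes M :: "(loc_elem, 'a) module"
  assumes l: "l \<in> carrier_vec (Suc m)" and M: "M \<in> Ob (C_cat (Suc m) l)"
  shows "\<exists>d \<rho> T. laurent_model d m \<rho> l M T"
proof -
  let ?V = "as_s_module (Suc m) M"
  have lm: "left_module (U_loc (Suc m)) M" and hc: "harish_chandra (Suc m) ?V"
    and sup: "carrier M = {\<zero>\<^bsub>M\<^esub>} \<or> weight_support (Suc m) ?V = weight_coset (Suc m) l"
    using M by (auto simp: C_cat_def)
  interpret V: lie_module "s_alg (Suc m)" ?V using hc by (simp add: harish_chandra_def)
  interpret V: laurent_lie_module m ?V l
  proof (unfold_locales)
    show "l \<in> carrier_vec (Suc m)" by (rule l)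
    show "weight_module (Suc m) ?V" using hc by (simp add: harish_chandra_def)
    show "vectorspace.fin_dim class_ring (?V\<lparr>carrier := weight_space (Suc m) ?V l\<rparr>)"
      using hc l by (simp only: harish_chandra_def)
    show "bij_betw (act ?V (e_vec (Suc m) k)) (carrier ?V) (carrier ?V)" if "k < Suc m" for k
      using loc_smult_bij[OF lm that] by simp
    fix \<mu> assume \<mu>: "\<mu> \<in> carrier_vec (Suc m)" "\<mu> \<notin> wt (Suc m) l ` Zn (Suc m)"
    show "weight_space (Suc m) ?V \<mu> = {\<zero>\<^bsub>?V\<^esub>}"
      using sup
    proof
      \<comment> \<open>The support of the zero module is empty rather than a coset, but its weight
        spaces off the coset vanish all the same.\<close>
      assume "carrier M = {\<zero>\<^bsub>M\<^esub>}"
      then have c: "carrier ?V = {\<zero>\<^bsub>?V\<^esub>}" by simp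
      have "u = \<zero>\<^bsub>?V\<^esub>" if "u \<in> carrier ?V" for u using that unfolding c by simp
      then have "u = v" if "u \<in> carrier ?V" "v \<in> carrier ?V" for u v using that by metis
      then have "act ?V h \<zero>\<^bsub>?V\<^esub> = weight_eval (Suc m) \<mu> h \<odot>\<^bsub>?V\<^esub> \<zero>\<^bsub>?V\<^esub>" if "h \<in> cartan (Suc m)" for h
        using that V.act_closed[of h "\<zero>\<^bsub>?V\<^esub>"] V.smult_closed[of "weight_eval (Suc m) \<mu> h" "\<zero>\<^bsub>?V\<^esub>"] V.M.zero_closed
        by (auto simp: cartan_def)
      then show ?thesis unfolding weight_space_def c by blast
    next
      assume "weight_support (Suc m) ?V = weight_coset (Suc m) l"
      then show ?thesis using \<mu> unfolding weight_coset_eq[OF l] weight_support_def by blast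
    qed
  qed
  obtain d \<rho> T where d: "std_rep d m \<rho>" "coords fsc (FS (Suc m) d) ?V T"
    "\<And>x F. \<lbrakk>x \<in> carrier (s_alg (Suc m)); F \<in> FS (Suc m) d\<rbrakk> \<Longrightarrow> act ?V x (T F) = T (std_act m (\<lambda>i. l $ i) \<rho> x F)"
    using V.standard_form by blast
  have "laurent_model d m \<rho> l M T"
    by (rule laurent_model.intro[OF d(1,2)], rule laurent_model_axioms.intro[OF lm l], drule (1) d(3), simp only: as_s_module_simps)
  then show ?thesis by blast
qed

section \<open>The equivalence\<close>

lemma concrete_categoryI:
  assumes Ident: "\<And>A. A \<in> Ob C \<Longrightarrow> Ident C A = (\<lambda>v\<in>U A. v)"
    and Comp: "\<And>A B D f g. Comp C A B D g f = compose (U A) g f"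
    and Mor: "\<And>A B. \<lbrakk>A \<in> Ob C; B \<in> Ob C\<rbrakk> \<Longrightarrow> Mor C A B \<subseteq> U A \<rightarrow>\<^sub>E U B"
    and id: "\<And>A. A \<in> Ob C \<Longrightarrow> (\<lambda>v\<in>U A. v) \<in> Mor C A A"
    and comp: "\<And>A B D f g. \<lbrakk>A \<in> Ob C; B \<in> Ob C; D \<in> Ob C; f \<in> Mor C A B; g \<in> Mor C B D\<rbrakk> \<Longrightarrow>
      compose (U A) g f \<in> Mor C A D"
  shows "category C"
proof
  have M: "f x \<in> U B" "f \<in> extensional (U A)" if "A \<in> Ob C" "B \<in> Ob C" "f \<in> Mor C A B" "x \<in> U A" for A B f x
    using Mor[OF that(1,2)] that(3,4) by (auto simp: PiE_iff)
  have E: "f \<in> extensional (U A)" if "A \<in> Ob C" "B \<in> Ob C" "f \<in> Mor C A B" for A B f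
    using Mor[OF that(1,2)] that(3) by (auto simp: PiE_iff)
  fix A B assume A: "A \<in> Ob C" and B: "B \<in> Ob C"
  show "Ident C A \<in> Mor C A A" using id[OF A] Ident[OF A] by simp
  fix f assume f: "f \<in> Mor C A B"
  show "Comp C A A B f (Ident C A) = f"
    unfolding Comp Ident[OF A] by (rule extensionalityI[of _ "U A"]) (auto simp: compose_def E[OF A B f])
  show "Comp C A B B (Ident C B) f = f"
    unfolding Comp Ident[OF B] by (rule extensionalityI[of _ "U A"]) (auto simp: compose_def E[OF A B f] M[OF A B f])
  fix D assume D: "D \<in> Ob C"
  fix g assume g: "g \<in> Mor C B D"
  show "Comp C A B D g f \<in> Mor C A D" unfolding Comp by (rule comp[OF A B D f g])
  fix E h
  show "Comp C A D E h (Comp C A B D g f) = Comp C A B E (Comp C B D E h g) f"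
    unfolding Comp by (rule extensionalityI[of _ "U A"]) (auto simp: compose_def M[OF A B f])
qed

lemma is_iso_concreteI:
  assumes Ident: "Ident C A = (\<lambda>v\<in>U A. v)" "Ident C B = (\<lambda>v\<in>U B. v)"
    and Comp: "\<And>A B D f g. Comp C A B D g f = compose (U A) g f"
    and f: "f \<in> Mor C A B" and g: "g \<in> Mor C B A"
    and gf: "\<And>v. v \<in> U A \<Longrightarrow> g (f v) = v" and fg: "\<And>w. w \<in> U B \<Longrightarrow> f (g w) = w"
  shows "is_iso C A B f"
  unfolding is_iso_def
proof (intro conjI bexI[of _ g])
  show "Comp C A B A g f = Ident C A" "Comp C B A B f g = Ident C B"
    unfolding Comp Ident compose_def by (rule restrict_ext, simp add: gf fg)+
qed (rule f, rule g)

lemma C_cat_simps [simp]: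
  "Mor (C_cat n l) = left_module_hom (U_loc n)" "Ident (C_cat n l) M = (\<lambda>v\<in>carrier M. v)"
  "Comp (C_cat n l) M N P g f = compose (carrier M) g f"
  by (simp_all add: C_cat_def)

lemma A_cat_simps [simp]:
  "Ob (A_cat m) = {V. lie_module (s_alg m) V \<and> vectorspace.fin_dim class_ring V}"
  "Mor (A_cat m) = lie_module_hom (s_alg m)" "Ident (A_cat m) V = (\<lambda>v\<in>carrier V. v)"
  "Comp (A_cat m) V W Z g f = compose (carrier V) g f"
  by (simp_all add: A_cat_def)

lemma category_C: "category (C_cat n l)"
proof (rule concrete_categoryI[of _ carrier])
  fix M N P f g assume M: "M \<in> Ob (C_cat n l)"
  then interpret M: left_module "U_loc n" M by (simp add: C_cat_def)
  show "(\<lambda>v\<in>carrier M. v) \<in> Mor (C_cat n l) M M"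
    by (simp add: left_module_hom_def M.smult_closed)
  assume "f \<in> Mor (C_cat n l) M N" "g \<in> Mor (C_cat n l) N P"
  then have f: "f \<in> carrier M \<rightarrow>\<^sub>E carrier N" "\<And>x y. \<lbrakk>x \<in> carrier M; y \<in> carrier M\<rbrakk> \<Longrightarrow> f (x \<oplus>\<^bsub>M\<^esub> y) = f x \<oplus>\<^bsub>N\<^esub> f y"
      "\<And>a x. \<lbrakk>a \<in> carrier (U_loc n); x \<in> carrier M\<rbrakk> \<Longrightarrow> f (a \<odot>\<^bsub>M\<^esub> x) = a \<odot>\<^bsub>N\<^esub> f x"
    and g: "g \<in> carrier N \<rightarrow>\<^sub>E carrier P" "\<And>x y. \<lbrakk>x \<in> carrier N; y \<in> carrier N\<rbrakk> \<Longrightarrow> g (x \<oplus>\<^bsub>N\<^esub> y) = g x \<oplus>\<^bsub>P\<^esub> g y"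
      "\<And>a x. \<lbrakk>a \<in> carrier (U_loc n); x \<in> carrier N\<rbrakk> \<Longrightarrow> g (a \<odot>\<^bsub>N\<^esub> x) = a \<odot>\<^bsub>P\<^esub> g x"
    by (auto simp: left_module_hom_def)
  have fc: "f x \<in> carrier N" if "x \<in> carrier M" for x using f(1) that by (auto simp: PiE_iff)
  have gc: "g x \<in> carrier P" if "x \<in> carrier N" for x using g(1) that by (auto simp: PiE_iff)
  show "compose (carrier M) g f \<in> Mor (C_cat n l) M P"
    by (simp add: left_module_hom_def compose_eq compose_def fc gc f g M.smult_closed)
qed (auto simp: left_module_hom_def)

lemma category_A: "category (A_cat m)"
proof (rule concrete_categoryI[of _ carrier])
  fix M N P f g assume M: "M \<in> Ob (A_cat m)"
  then interpret M: lie_module "s_alg m" M by simp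
  have sm: "c \<odot>\<^bsub>M\<^esub> v \<in> carrier M" if "v \<in> carrier M" for c v using M.smult_closed[of c v] that by simp
  show "(\<lambda>v\<in>carrier M. v) \<in> Mor (A_cat m) M M"
    by (simp add: lie_module_hom_def sm M.act_closed del: s_alg_simps)
  assume "f \<in> Mor (A_cat m) M N" "g \<in> Mor (A_cat m) N P"
  then have f: "f \<in> carrier M \<rightarrow>\<^sub>E carrier N" "\<And>x y. \<lbrakk>x \<in> carrier M; y \<in> carrier M\<rbrakk> \<Longrightarrow> f (x \<oplus>\<^bsub>M\<^esub> y) = f x \<oplus>\<^bsub>N\<^esub> f y"
      "\<And>a x. x \<in> carrier M \<Longrightarrow> f (a \<odot>\<^bsub>M\<^esub> x) = a \<odot>\<^bsub>N\<^esub> f x"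
      "\<And>a x. \<lbrakk>a \<in> carrier (s_alg m); x \<in> carrier M\<rbrakk> \<Longrightarrow> f (act M a x) = act N a (f x)"
    and g: "g \<in> carrier N \<rightarrow>\<^sub>E carrier P" "\<And>x y. \<lbrakk>x \<in> carrier N; y \<in> carrier N\<rbrakk> \<Longrightarrow> g (x \<oplus>\<^bsub>N\<^esub> y) = g x \<oplus>\<^bsub>P\<^esub> g y"
      "\<And>a x. x \<in> carrier N \<Longrightarrow> g (a \<odot>\<^bsub>N\<^esub> x) = a \<odot>\<^bsub>P\<^esub> g x"
      "\<And>a x. \<lbrakk>a \<in> carrier (s_alg m); x \<in> carrier N\<rbrakk> \<Longrightarrow> g (act N a x) = act P a (g x)"
    by (auto simp only: lie_module_hom_def A_cat_simps mem_Collect_eq)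
  have fc: "f x \<in> carrier N" if "x \<in> carrier M" for x using f(1) that by (auto simp: PiE_iff)
  have gc: "g x \<in> carrier P" if "x \<in> carrier N" for x using g(1) that by (auto simp: PiE_iff)
  show "compose (carrier M) g f \<in> Mor (A_cat m) M P"
    by (simp add: lie_module_hom_def compose_eq compose_def fc gc f g sm M.act_closed del: s_alg_simps)
qed (auto simp: lie_module_hom_def)

section \<open>The intermediate category of matrix representations\<close>

type_synonym matrix_rep = "nat \<times> (s_elem \<Rightarrow> (nat \<Rightarrow> complex) \<Rightarrow> nat \<Rightarrow> complex)"

text \<open>An object is a dimension together with operators on sequences, so its underlying space
  is fixed by the dimension. From here a Laurent module can be built by a formula, and no type
  variable for carriers is involved.\<close>

definition B_cat :: "nat \<Rightarrow> (matrix_rep, (nat \<Rightarrow> complex) \<Rightarrow> nat \<Rightarrow> complex) cat" where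
  "B_cat m = \<lparr>Ob = {X. std_rep (fst X) m (snd X)},
     Mor = (\<lambda>X Y. concrete_hom csc (Cd (fst X)) csc (Cd (fst Y)) (s_alg m) (snd X) (snd Y)),
     Ident = (\<lambda>X. \<lambda>v\<in>Cd (fst X). v),
     Comp = (\<lambda>X Y Z g f. compose (Cd (fst X)) g f)\<rparr>"

lemma B_cat_simps [simp]:
  "Ob (B_cat m) = {X. std_rep (fst X) m (snd X)}"
  "Mor (B_cat m) X Y = concrete_hom csc (Cd (fst X)) csc (Cd (fst Y)) (s_alg m) (snd X) (snd Y)"
  "Ident (B_cat m) X = (\<lambda>v\<in>Cd (fst X). v)"
  "Comp (B_cat m) X Y Z g f = compose (Cd (fst X)) g f"
  by (simp_all add: B_cat_def)

lemma concrete_hom_id: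
  assumes "conc_rep sc S L \<rho>" shows "(\<lambda>v\<in>S. v) \<in> concrete_hom sc S sc S L \<rho> \<rho>"
proof -
  interpret conc_rep sc S L \<rho> by fact
  show ?thesis by (rule concrete_homI) (simp_all add: S_add S_sc rho_closed)
qed

section \<open>Finite dimensional modules and matrix representations\<close>

locale lie_coords = coords sc S V T + conc_rep sc S L \<rho>
  for sc :: "complex \<Rightarrow> 'w::ab_group_add \<Rightarrow> 'w" and S and V :: "('g, 'v) lie_rep" and T
    and L :: "(complex, 'g, 'z) lie_algebra_scheme" and \<rho> +
  assumes act_T: "\<lbrakk>x \<in> carrier L; v \<in> S\<rbrakk> \<Longrightarrow> act V x (T v) = T (\<rho> x v)"

locale two_lie_coords = X: lie_coords sc S V T L \<rho> + Y: lie_coords sc' S' V' T' L \<rho>'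
  for sc :: "complex \<Rightarrow> 'w::ab_group_add \<Rightarrow> 'w" and S and V :: "('g, 'v) lie_rep" and T
    and L :: "(complex, 'g, 'z) lie_algebra_scheme" and \<rho>
    and sc' :: "complex \<Rightarrow> 'x::ab_group_add \<Rightarrow> 'x" and S' and V' :: "('g, 'u) lie_rep" and T' and \<rho>'
begin

definition to_coords where "to_coords f = (\<lambda>y\<in>S. Y.Tinv (f (T y)))"
definition of_coords where "of_coords P = (\<lambda>v\<in>carrier V. T' (P (X.Tinv v)))"

lemma to_coords_hom:
  assumes "f \<in> lie_module_hom L V V'"
  shows "to_coords f \<in> concrete_hom sc S sc' S' L \<rho> \<rho>'"
proof -
  have f: "f \<in> carrier V \<rightarrow>\<^sub>E carrier V'" "\<And>x y. \<lbrakk>x \<in> carrier V; y \<in> carrier V\<rbrakk> \<Longrightarrow> f (x \<oplus>\<^bsub>V\<^esub> y) = f x \<oplus>\<^bsub>V'\<^esub> f y"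
      "\<And>a x. x \<in> carrier V \<Longrightarrow> f (a \<odot>\<^bsub>V\<^esub> x) = a \<odot>\<^bsub>V'\<^esub> f x"
      "\<And>a x. \<lbrakk>a \<in> carrier L; x \<in> carrier V\<rbrakk> \<Longrightarrow> f (act V a x) = act V' a (f x)"
    using assms by (auto simp only: lie_module_hom_def mem_Collect_eq)
  have fc: "f (T y) \<in> carrier V'" if "y \<in> S" for y using f(1) X.T_closed[OF that] by (auto simp: PiE_iff)
  show ?thesis
  proof (rule concrete_homI)
    show "to_coords f \<in> S \<rightarrow>\<^sub>E S'" using Y.Tinv_closed[OF fc] by (auto simp: to_coords_def)
    fix x assume x: "x \<in> S"
    show "to_coords f (sc c x) = sc' c (to_coords f x)" for c
      using x X.S_sc[OF x] Y.Tinv_sc[OF fc[OF x]] f(3)[OF X.T_closed[OF x]] by (simp add: to_coords_def X.T_sc)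
    show "to_coords f (x + y) = to_coords f x + to_coords f y" if y: "y \<in> S" for y
      using x y X.S_add[OF x y] Y.Tinv_add[OF fc[OF x] fc[OF y]] f(2)[OF X.T_closed[OF x] X.T_closed[OF y]]
      by (simp add: to_coords_def X.T_add)
    fix g assume g: "g \<in> carrier L"
    have "f (T (\<rho> g x)) = T' (\<rho>' g (Y.Tinv (f (T x))))"
      unfolding X.act_T[OF g x, symmetric] f(4)[OF g X.T_closed[OF x]] Y.act_T[OF g Y.Tinv_closed[OF fc[OF x]], symmetric]
        Y.T_Tinv[OF fc[OF x]] ..
    then show "to_coords f (\<rho> g x) = \<rho>' g (to_coords f x)"
      using x X.rho_closed[OF g x] Y.Tinv_T[OF Y.rho_closed[OF g Y.Tinv_closed[OF fc[OF x]]]] by (simp add: to_coords_def)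
  qed
qed

lemma of_coords_hom:
  assumes P: "P \<in> concrete_hom sc S sc' S' L \<rho> \<rho>'"
  shows "of_coords P \<in> lie_module_hom L V V'"
proof -
  note PD = concrete_homD[OF P]
  have o: "of_coords P (T x) = T' (P x)" if "x \<in> S" for x
    using that by (simp add: of_coords_def X.T_closed X.Tinv_T)
  have 1: "of_coords P \<in> carrier V \<rightarrow>\<^sub>E carrier V'"
    using Y.T_closed[OF PD(1)[OF X.Tinv_closed]] by (auto simp: of_coords_def)
  have "of_coords P (u \<oplus>\<^bsub>V\<^esub> v) = of_coords P u \<oplus>\<^bsub>V'\<^esub> of_coords P v" if uv: "u \<in> carrier V" "v \<in> carrier V" for u v
  proof -
    obtain x y where xy: "x \<in> S" "u = T x" "y \<in> S" "v = T y" using X.TE uv by metis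
    show ?thesis
      unfolding xy(2,4) X.T_add[OF xy(1,3), symmetric] o[OF xy(1)] o[OF xy(3)] o[OF X.S_add[OF xy(1,3)]]
        PD(2)[OF xy(1,3)] Y.T_add[OF PD(1)[OF xy(1)] PD(1)[OF xy(3)]] ..
  qed
  moreover have "of_coords P (c \<odot>\<^bsub>V\<^esub> u) = c \<odot>\<^bsub>V'\<^esub> of_coords P u" if u: "u \<in> carrier V" for c u
  proof -
    obtain x where x: "x \<in> S" "u = T x" using X.TE u by metis
    show ?thesis
      unfolding x(2) X.T_sc[OF x(1), symmetric] o[OF x(1)] o[OF X.S_sc[OF x(1)]] PD(3)[OF x(1)] Y.T_sc[OF PD(1)[OF x(1)]] ..
  qed
  moreover have "of_coords P (act V g u) = act V' g (of_coords P u)" if g: "g \<in> carrier L" and u: "u \<in> carrier V" for g u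
  proof -
    obtain x where x: "x \<in> S" "u = T x" using X.TE u by metis
    show ?thesis
      unfolding x(2) X.act_T[OF g x(1)] o[OF x(1)] o[OF X.rho_closed[OF g x(1)]] PD(4)[OF g x(1)] Y.act_T[OF g PD(1)[OF x(1)]] ..
  qed
  ultimately show ?thesis using 1 unfolding lie_module_hom_def by blast
qed

lemma to_coords_bij: "bij_betw to_coords (lie_module_hom L V V') (concrete_hom sc S sc' S' L \<rho> \<rho>')"
proof (rule bij_betw_byWitness[of _ of_coords])
  show "\<forall>f\<in>lie_module_hom L V V'. of_coords (to_coords f) = f"
  proof
    fix f assume "f \<in> lie_module_hom L V V'"
    then have f: "f \<in> carrier V \<rightarrow>\<^sub>E carrier V'" by (simp add: lie_module_hom_def)
    show "of_coords (to_coords f) = f"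
    proof (rule extensionalityI[of _ "carrier V"])
      show "f \<in> extensional (carrier V)" using f by (simp add: PiE_iff)
      fix v assume v: "v \<in> carrier V"
      then have "f v \<in> carrier V'" using f by (auto simp: PiE_iff)
      then show "of_coords (to_coords f) v = f v"
        using v by (simp add: of_coords_def to_coords_def X.Tinv_closed X.T_Tinv Y.T_Tinv)
    qed (simp add: of_coords_def)
  qed
  show "\<forall>P\<in>concrete_hom sc S sc' S' L \<rho> \<rho>'. to_coords (of_coords P) = P"
  proof
    fix P assume P: "P \<in> concrete_hom sc S sc' S' L \<rho> \<rho>'"
    show "to_coords (of_coords P) = P"
    proof (rule extensionalityI[of _ S])
      show "P \<in> extensional S" using concrete_homD(5)[OF P] by (simp add: PiE_iff)
      fix y assume y: "y \<in> S"
      then show "to_coords (of_coords P) y = P y"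
        by (simp add: of_coords_def to_coords_def X.T_closed X.Tinv_T Y.Tinv_T[OF concrete_homD(1)[OF P y]])
    qed (simp add: to_coords_def)
  qed
qed (use to_coords_hom of_coords_hom in blast)+

end

text \<open>Coordinates are fixed once and for all for each module: composites are preserved only if
  the middle module is read in the same coordinates on both sides.\<close>

definition chosen_coords :: "(s_elem, 'b) lie_rep \<Rightarrow> nat \<times> ((nat \<Rightarrow> complex) \<Rightarrow> 'b)" where
  "chosen_coords V = (SOME c. coords csc (Cd (fst c)) V (snd c))"

abbreviation cdim where "cdim V \<equiv> fst (chosen_coords V)"
abbreviation cmap where "cmap V \<equiv> snd (chosen_coords V)"

definition coord_rep :: "(s_elem, 'b) lie_rep \<Rightarrow> matrix_rep" where
  "coord_rep V = (cdim V, \<lambda>x y. coords.Tinv (Cd (cdim V)) (cmap V) (act V x (cmap V y)))"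

definition coord_hom :: "(s_elem, 'b) lie_rep \<Rightarrow> (s_elem, 'b) lie_rep \<Rightarrow> ('b \<Rightarrow> 'b) \<Rightarrow> (nat \<Rightarrow> complex) \<Rightarrow> nat \<Rightarrow> complex" where
  "coord_hom V W f = (\<lambda>y\<in>Cd (cdim V). coords.Tinv (Cd (cdim W)) (cmap W) (f (cmap V y)))"

lemma coord_rep_coords:
  assumes "V \<in> Ob (A_cat m)"
  shows "lie_coords csc (Cd (cdim V)) V (cmap V) (s_alg m) (snd (coord_rep V))"
proof -
  interpret V: lie_module "s_alg m" V using assms by simp
  have "\<exists>d T. coords csc (Cd d) V T" using fin_dim_coords[OF V.vectorspace_axioms] assms by simp
  then have "\<exists>c. coords csc (Cd (fst c)) V (snd c)" by auto
  then have c: "coords csc (Cd (cdim V)) V (cmap V)" unfolding chosen_coords_def by (rule someI_ex)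
  show ?thesis
  proof (rule lie_coords.intro[OF c])
    show "conc_rep csc (Cd (cdim V)) (s_alg m) (snd (coord_rep V))"
      unfolding coord_rep_def snd_conv by (rule conc_rep_of_lie_module[OF c V.lie_module_axioms])
    show "lie_coords_axioms (Cd (cdim V)) V (cmap V) (s_alg m) (snd (coord_rep V))"
    proof
      fix x y assume x: "x \<in> carrier (s_alg m)" and y: "y \<in> Cd (cdim V)"
      show "act V x (cmap V y) = cmap V (snd (coord_rep V) x y)"
        unfolding coord_rep_def snd_conv
        by (rule coords.T_Tinv[OF c, symmetric], rule V.act_closed[OF x coords.T_closed[OF c y]])
    qed
  qed
qed

lemma fst_coord_rep [simp]: "fst (coord_rep V) = cdim V"
  by (simp add: coord_rep_def)

lemma coord_rep_Ob: "V \<in> Ob (A_cat m) \<Longrightarrow> coord_rep V \<in> Ob (B_cat m)"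
  using coord_rep_coords[of V m] by (simp add: std_rep_def lie_coords_def)

lemma functor_AB:
  "is_functor (A_cat m :: ((s_elem, 'b) lie_rep, _) cat) (B_cat m) coord_rep coord_hom"
  unfolding is_functor_def
proof (intro conjI ballI)
  fix V :: "(s_elem, 'b) lie_rep" assume V: "V \<in> Ob (A_cat m)"
  show "coord_rep V \<in> Ob (B_cat m)" by (rule coord_rep_Ob[OF V])
  interpret X: lie_coords csc "Cd (cdim V)" V "cmap V" "s_alg m" "snd (coord_rep V)" by (rule coord_rep_coords[OF V])
  show "coord_hom V V (Ident (A_cat m) V) = Ident (B_cat m) (coord_rep V)"
    by (simp add: coord_hom_def X.T_closed X.Tinv_T cong: restrict_cong)
  fix W :: "(s_elem, 'b) lie_rep" and f assume W: "W \<in> Ob (A_cat m)" and f: "f \<in> Mor (A_cat m) V W"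
  interpret Y: lie_coords csc "Cd (cdim W)" W "cmap W" "s_alg m" "snd (coord_rep W)" by (rule coord_rep_coords[OF W])
  interpret XY: two_lie_coords csc "Cd (cdim V)" V "cmap V" "s_alg m" "snd (coord_rep V)" csc "Cd (cdim W)" W "cmap W" "snd (coord_rep W)" ..
  have th: "coord_hom V W = XY.to_coords" by (rule ext) (simp add: coord_hom_def XY.to_coords_def)
  show "coord_hom V W f \<in> Mor (B_cat m) (coord_rep V) (coord_rep W)"
    using XY.to_coords_hom[of f] f unfolding th by simp
  fix Z :: "(s_elem, 'b) lie_rep" and g assume Z: "Z \<in> Ob (A_cat m)" and g: "g \<in> Mor (A_cat m) W Z"
  have fc: "f (cmap V y) \<in> carrier W" if "y \<in> Cd (cdim V)" for y
    using f X.T_closed[OF that] by (auto simp: lie_module_hom_def PiE_iff)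
  show "coord_hom V Z (Comp (A_cat m) V W Z g f) =
      Comp (B_cat m) (coord_rep V) (coord_rep W) (coord_rep Z) (coord_hom W Z g) (coord_hom V W f)"
    by (simp add: coord_hom_def compose_def X.T_closed fc Y.Tinv_closed Y.T_Tinv cong: restrict_cong)
qed

text \<open>For essential surjectivity, C^d is copied along \<open>j\<close> into the type of
  carriers. The copy then has two coordinate systems, \<open>j\<close> and the chosen one, and its
  identity map, read from one to the other, is the required isomorphism.\<close>

lemma ffes_AB:
  assumes inj: "\<And>d. \<exists>j :: (nat \<Rightarrow> complex) \<Rightarrow> 'b. inj_on j (Cd d)"
  shows "fully_faithful_essentially_surjective (A_cat m :: ((s_elem, 'b) lie_rep, _) cat) (B_cat m) coord_rep coord_hom"
  unfolding fully_faithful_essentially_surjective_def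
proof (intro conjI ballI)
  fix V W :: "(s_elem, 'b) lie_rep" assume V: "V \<in> Ob (A_cat m)" and W: "W \<in> Ob (A_cat m)"
  interpret XY: two_lie_coords csc "Cd (cdim V)" V "cmap V" "s_alg m" "snd (coord_rep V)" csc "Cd (cdim W)" W "cmap W" "snd (coord_rep W)"
    by (rule two_lie_coords.intro[OF coord_rep_coords[OF V] coord_rep_coords[OF W]])
  have th: "coord_hom V W = XY.to_coords" by (rule ext) (simp add: coord_hom_def XY.to_coords_def)
  show "bij_betw (coord_hom V W) (Mor (A_cat m) V W) (Mor (B_cat m) (coord_rep V) (coord_rep W))"
    using XY.to_coords_bij unfolding th by simp
next
  fix X assume X: "X \<in> Ob (B_cat m)"
  obtain d \<rho> where Xd: "X = (d, \<rho>)" by (cases X)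
  have R: "conc_rep csc (Cd d) (s_alg m) \<rho>" using X unfolding Xd by (simp add: std_rep_def)
  obtain j :: "(nat \<Rightarrow> complex) \<Rightarrow> 'b" where j: "inj_on j (Cd d)" using inj by blast
  define V where "V = transport_rep csc (Cd d) \<rho> j"
  note tc = transport_rep_coords[OF Cd_subspace j, where \<rho> = \<rho>, folded V_def]
  have V: "V \<in> Ob (A_cat m)"
    unfolding A_cat_simps mem_Collect_eq
    by (rule conjI[OF lie_module_of_coords[OF tc(1) R _ s_alg_lie_ops] coords_fin_dim[OF tc(1)]]) (rule tc(2))
  interpret VV: lie_module "s_alg m" V using V by simp
  have lc: "lie_coords csc (Cd d) V j (s_alg m) \<rho>"
    by (rule lie_coords.intro[OF tc(1) R], rule lie_coords_axioms.intro, rule tc(2))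
  interpret P: two_lie_coords csc "Cd d" V j "s_alg m" \<rho> csc "Cd (cdim V)" V "cmap V" "snd (coord_rep V)"
    by (rule two_lie_coords.intro[OF lc coord_rep_coords[OF V]])
  interpret Q: two_lie_coords csc "Cd (cdim V)" V "cmap V" "s_alg m" "snd (coord_rep V)" csc "Cd d" V j \<rho>
    by (rule two_lie_coords.intro[OF coord_rep_coords[OF V] lc])
  have sm: "c \<odot>\<^bsub>V\<^esub> v \<in> carrier V" if "v \<in> carrier V" for c v using VV.smult_closed[of c v] that by simp
  have id: "(\<lambda>v\<in>carrier V. v) \<in> lie_module_hom (s_alg m) V V"
    by (simp add: lie_module_hom_def sm VV.act_closed del: s_alg_simps)
  have "is_iso (B_cat m) X (coord_rep V) (P.to_coords (\<lambda>v\<in>carrier V. v))"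
  proof (rule is_iso_concreteI[of _ _ "\<lambda>X. Cd (fst X)" _ _ "Q.to_coords (\<lambda>v\<in>carrier V. v)"])
    show "P.to_coords (\<lambda>v\<in>carrier V. v) \<in> Mor (B_cat m) X (coord_rep V)"
      using P.to_coords_hom[OF id] by (simp add: Xd)
    show "Q.to_coords (\<lambda>v\<in>carrier V. v) \<in> Mor (B_cat m) (coord_rep V) X"
      using Q.to_coords_hom[OF id] by (simp add: Xd)
    show "Q.to_coords (\<lambda>v\<in>carrier V. v) (P.to_coords (\<lambda>v\<in>carrier V. v) v) = v" if "v \<in> Cd (fst X)" for v
      using that by (simp add: Xd P.to_coords_def Q.to_coords_def P.X.T_closed P.Y.Tinv_closed P.Y.T_closed P.Y.T_Tinv P.X.Tinv_T)
    show "P.to_coords (\<lambda>v\<in>carrier V. v) (Q.to_coords (\<lambda>v\<in>carrier V. v) v) = v" if "v \<in> Cd (fst (coord_rep V))" for v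
      using that by (simp add: Xd P.to_coords_def Q.to_coords_def P.X.T_closed P.X.Tinv_closed P.Y.T_closed P.X.T_Tinv P.Y.Tinv_T)
  qed simp_all
  then show "\<exists>V\<in>Ob (A_cat m :: ((s_elem, 'b) lie_rep, _) cat). \<exists>f. is_iso (B_cat m) X (coord_rep V) f" using V by blast
qed (rule functor_AB)

section \<open>Matrix representations and Harish-Chandra modules\<close>

text \<open>\<open>j d\<close> embeds the Laurent polynomials over C^d into the type of the
  carriers; a separate embedding for each dimension is enough, as carriers of different objects may
  overlap.\<close>

definition laurent_module ::
  "nat \<Rightarrow> complex vec \<Rightarrow> (nat \<Rightarrow> ((nat \<Rightarrow> int) \<Rightarrow> nat \<Rightarrow> complex) \<Rightarrow> 'a) \<Rightarrow> matrix_rep \<Rightarrow> (loc_elem, 'a) module" where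
  "laurent_module m l j X = loc_module (Suc m)
     (transport_rep fsc (FS (Suc m) (fst X)) (std_act m (\<lambda>i. l $ i) (snd X)) (j (fst X)))"

definition laurent_hom ::
  "nat \<Rightarrow> complex vec \<Rightarrow> (nat \<Rightarrow> ((nat \<Rightarrow> int) \<Rightarrow> nat \<Rightarrow> complex) \<Rightarrow> 'a) \<Rightarrow> matrix_rep \<Rightarrow> matrix_rep \<Rightarrow>
     ((nat \<Rightarrow> complex) \<Rightarrow> nat \<Rightarrow> complex) \<Rightarrow> 'a \<Rightarrow> 'a" where
  "laurent_hom m l j X Y P = (\<lambda>u\<in>carrier (laurent_module m l j X).
     j (fst Y) (push P (inv_into (FS (Suc m) (fst X)) (j (fst X)) u)))"

text \<open>In the copied standard module e_k is a shift conjugated by the coordinates, hence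
  bijective. This is the condition under which the Lie algebra action extends to the
  localization.\<close>

lemma laurent_module_model:
  fixes j :: "nat \<Rightarrow> ((nat \<Rightarrow> int) \<Rightarrow> nat \<Rightarrow> complex) \<Rightarrow> 'a"
  assumes l: "l \<in> carrier_vec (Suc m)" and j: "inj_on (j (fst X)) (FS (Suc m) (fst X))" and X: "X \<in> Ob (B_cat m)"
  shows "laurent_model (fst X) m (snd X) l (laurent_module m l j X) (j (fst X))"
proof -
  let ?n = "Suc m" and ?d = "fst X" and ?\<rho> = "snd X" and ?j = "j (fst X)"
  interpret R: std_rep ?d m ?\<rho> "\<lambda>i. l $ i" using X by simp
  define V where "V = transport_rep fsc (FS ?n ?d) (std_act m (\<lambda>i. l $ i) ?\<rho>) ?j"
  note tc = transport_rep_coords[OF FS_subspace j, where \<rho> = "std_act m (\<lambda>i. l $ i) ?\<rho>", folded V_def]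
  interpret C: coords fsc "FS ?n ?d" V ?j by (rule tc(1))
  have lm: "lie_module (s_alg ?n) V"
    by (rule lie_module_of_coords[OF tc(1) R.std_conc_rep _ s_alg_lie_ops]) (rule tc(2))
  have bij: "bij_betw (act V (e_vec ?n k)) (carrier V) (carrier V)" if k: "k < ?n" for k
  proof -
    have "bij_betw (?j \<circ> shift k) (FS ?n ?d) (carrier V)"
      by (rule bij_betw_trans[OF shift_bij[OF k] C.T_bij])
    then have "bij_betw (\<lambda>F. act V (e_vec ?n k) (?j F)) (FS ?n ?d) (carrier V)"
      by (rule bij_betw_cong[THEN iffD1, rotated]) (simp add: tc(2) R.std_act_e[OF k])
    moreover have "bij_betw C.Tinv (carrier V) (FS ?n ?d)"
      unfolding C.Tinv_def by (rule bij_betw_inv_into[OF C.T_bij])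
    ultimately have "bij_betw ((\<lambda>F. act V (e_vec ?n k) (?j F)) \<circ> C.Tinv) (carrier V) (carrier V)"
      by (rule bij_betw_trans[rotated])
    then show ?thesis
      by (rule bij_betw_cong[THEN iffD1, rotated]) (simp add: C.T_Tinv)
  qed
  define N where "N = loc_module ?n V"
  have ln: "left_module (U_loc ?n) N"
      "\<And>x v. \<lbrakk>x \<in> carrier (s_alg ?n); v \<in> carrier V\<rbrakk> \<Longrightarrow> loc_gen ?n x \<odot>\<^bsub>N\<^esub> v = act V x v"
      "\<And>c v. v \<in> carrier V \<Longrightarrow> loc_scalar ?n c \<odot>\<^bsub>N\<^esub> v = c \<odot>\<^bsub>V\<^esub> v"
    unfolding N_def using bij loc_module[OF lm] by blast+
  have Ns: "carrier N = carrier V" "zero N = zero V" "add N = add V" by (simp_all add: N_def)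
  have "coords fsc (FS ?n ?d) (as_s_module ?n N) ?j"
  proof (rule coords.intro[OF FS_subspace], rule coords_axioms.intro)
    show "bij_betw ?j (FS ?n ?d) (carrier (as_s_module ?n N))" using C.T_bij by (simp add: Ns)
    show "?j (F + G) = ?j F \<oplus>\<^bsub>as_s_module ?n N\<^esub> ?j G" if "F \<in> FS ?n ?d" "G \<in> FS ?n ?d" for F G
      unfolding as_s_module_simps Ns by (rule C.T_add[OF that])
    show "?j (fsc c F) = c \<odot>\<^bsub>as_s_module ?n N\<^esub> ?j F" if "F \<in> FS ?n ?d" for c F
      unfolding as_s_module_simps ln(3)[OF C.T_closed[OF that]] by (rule C.T_sc[OF that])
    show "?j 0 = \<zero>\<^bsub>as_s_module ?n N\<^esub>" unfolding as_s_module_simps Ns by (rule C.T_zero)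
  qed
  moreover have "loc_gen ?n x \<odot>\<^bsub>N\<^esub> ?j F = ?j (std_act m (\<lambda>i. l $ i) ?\<rho> x F)"
    if "x \<in> carrier (s_alg ?n)" "F \<in> FS ?n ?d" for x F
    unfolding ln(2)[OF that(1) C.T_closed[OF that(2)]] by (rule tc(2)[OF that(2)])
  ultimately have "laurent_model ?d m ?\<rho> l N ?j"
    by (intro laurent_model.intro[OF R.std_rep_axioms] laurent_model_axioms.intro ln(1) l)
  moreover have "N = laurent_module m l j X" unfolding N_def V_def laurent_module_def ..
  ultimately show ?thesis by simp
qed

locale laurent_functor =
  fixes m and l :: "complex vec" and j :: "nat \<Rightarrow> ((nat \<Rightarrow> int) \<Rightarrow> nat \<Rightarrow> complex) \<Rightarrow> 'a"
  assumes l: "l \<in> carrier_vec (Suc m)" and j: "inj_on (j d) (FS (Suc m) d)"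
begin

abbreviation n where "n \<equiv> Suc m"
abbreviation Lo where "Lo \<equiv> laurent_module m l j"
abbreviation Lm where "Lm \<equiv> laurent_hom m l j"

lemma model: "X \<in> Ob (B_cat m) \<Longrightarrow> laurent_model (fst X) m (snd X) l (Lo X) (j (fst X))"
  by (rule laurent_module_model[OF l]) (rule j)

lemma functor_BC: "is_functor (B_cat m) (C_cat n l) Lo Lm"
  unfolding is_functor_def
proof (intro conjI ballI)
  fix X assume X: "X \<in> Ob (B_cat m)"
  interpret X: laurent_model "fst X" m "snd X" l "Lo X" "j (fst X)" by (rule model[OF X])
  show "Lo X \<in> Ob (C_cat n l)" by (rule X.model_Ob)
  have Xc: "X.C.Tinv u \<in> FS n (fst X)" "j (fst X) (X.C.Tinv u) = u" if "u \<in> carrier (Lo X)" for u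
    using X.C.Tinv_closed[of u] X.C.T_Tinv[of u] that by simp_all
  have "push (\<lambda>v\<in>Cd (fst X). v) F = F" if F: "F \<in> FS n (fst X)" for F
    by (rule ext) (simp add: push_def FS_closed[OF F])
  then show "Lm X X (Ident (B_cat m) X) = Ident (C_cat n l) (Lo X)"
    unfolding laurent_hom_def X.C.Tinv_def[symmetric] B_cat_simps C_cat_simps
    by (intro restrict_ext) (simp only: Xc)
  fix Y P assume Y: "Y \<in> Ob (B_cat m)" and P: "P \<in> Mor (B_cat m) X Y"
  interpret XY: two_laurent_models "fst X" m "snd X" l "Lo X" "j (fst X)" "fst Y" "snd Y" "Lo Y" "j (fst Y)"
    by (rule two_laurent_models.intro[OF model[OF X] model[OF Y]])
  have th: "Lm X Y = XY.hom_of"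
    by (rule ext) (simp add: laurent_hom_def XY.hom_of_def X.C.Tinv_def)
  show "Lm X Y P \<in> Mor (C_cat n l) (Lo X) (Lo Y)"
    unfolding th C_cat_simps by (rule XY.hom_of_closed) (use P in simp)
  fix Z Q assume Z: "Z \<in> Ob (B_cat m)" and Q: "Q \<in> Mor (B_cat m) Y Z"
  have P': "P \<in> concrete_hom csc (Cd (fst X)) csc (Cd (fst Y)) (s_alg m) (snd X) (snd Y)" using P by simp
  interpret P: std_hom "fst X" m "snd X" "fst Y" "snd Y" "\<lambda>i. l $ i" P
    using X Y P' by (intro std_hom.intro std_hom_axioms.intro) simp_all
  have pc: "push (compose (Cd (fst X)) Q P) F = push Q (push P F)" if F: "F \<in> FS n (fst X)" for F
    by (rule ext) (simp add: push_def compose_def FS_closed[OF F])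
  have Yc: "j (fst Y) G \<in> carrier (Lo Y)" "XY.N.C.Tinv (j (fst Y) G) = G" if "G \<in> FS n (fst Y)" for G
    using XY.N.C.T_closed[OF that] XY.N.C.Tinv_T[OF that] by simp_all
  show "Lm X Z (Comp (B_cat m) X Y Z Q P) = Comp (C_cat n l) (Lo X) (Lo Y) (Lo Z) (Lm Y Z Q) (Lm X Y P)"
    unfolding laurent_hom_def X.C.Tinv_def[symmetric] XY.N.C.Tinv_def[symmetric] B_cat_simps C_cat_simps compose_def[of "carrier (Lo X)"]
    by (rule restrict_ext) (simp add: pc Xc Yc P.push_closed)
qed

text \<open>Every object has Laurent coordinates over some (d, \<rho>) by
  \<open>model_exists\<close>. The module built from the same pair is another model of it, and the
  identity of C^d induces mutually inverse homomorphisms between the two.\<close>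

lemma ffes_BC: "fully_faithful_essentially_surjective (B_cat m) (C_cat n l) Lo Lm"
  unfolding fully_faithful_essentially_surjective_def
proof (intro conjI ballI)
  fix X Y assume X: "X \<in> Ob (B_cat m)" and Y: "Y \<in> Ob (B_cat m)"
  interpret XY: two_laurent_models "fst X" m "snd X" l "Lo X" "j (fst X)" "fst Y" "snd Y" "Lo Y" "j (fst Y)"
    by (rule two_laurent_models.intro[OF model[OF X] model[OF Y]])
  have th: "Lm X Y = XY.hom_of"
    by (rule ext) (simp add: laurent_hom_def XY.hom_of_def XY.M.C.Tinv_def)
  show "bij_betw (Lm X Y) (Mor (B_cat m) X Y) (Mor (C_cat n l) (Lo X) (Lo Y))"
    using XY.hom_of_bij unfolding th by simp
next
  fix M :: "(loc_elem, 'a) module" assume M: "M \<in> Ob (C_cat n l)"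
  obtain d \<rho> T where T: "laurent_model d m \<rho> l M T" using model_exists[OF l M] by blast
  have R: "std_rep d m \<rho>" using T by (simp add: laurent_model_def)
  define X where "X = (d, \<rho>)"
  have X: "X \<in> Ob (B_cat m)" using R by (simp add: X_def)
  have N: "laurent_model d m \<rho> l (Lo X) (j d)" using model[OF X] by (simp add: X_def)
  interpret P: two_laurent_models d m \<rho> l M T d \<rho> "Lo X" "j d" by (rule two_laurent_models.intro[OF T N])
  interpret Q: two_laurent_models d m \<rho> l "Lo X" "j d" d \<rho> M T by (rule two_laurent_models.intro[OF N T])
  let ?id = "\<lambda>v\<in>Cd d. v"
  have id: "?id \<in> concrete_hom csc (Cd d) csc (Cd d) (s_alg m) \<rho> \<rho>"
    by (rule concrete_hom_id) (use R in \<open>simp add: std_rep_def\<close>)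
  have pid: "push ?id F = F" if F: "F \<in> FS n d" for F
    by (rule ext) (simp add: push_def FS_closed[OF F])
  have "is_iso (C_cat n l) M (Lo X) (P.hom_of ?id)"
  proof (rule is_iso_concreteI[of _ _ carrier _ _ "Q.hom_of ?id"])
    show "P.hom_of ?id \<in> Mor (C_cat n l) M (Lo X)" using P.hom_of_closed[OF id] by simp
    show "Q.hom_of ?id \<in> Mor (C_cat n l) (Lo X) M" using Q.hom_of_closed[OF id] by simp
    show "Q.hom_of ?id (P.hom_of ?id v) = v" if v: "v \<in> carrier M" for v
    proof -
      obtain F where F: "F \<in> FS n d" "v = T F" using P.M_TE[OF v] by blast
      show ?thesis unfolding F(2) P.hom_of_T[OF F(1)] pid[OF F(1)] Q.hom_of_T[OF F(1)] ..
    qed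
    show "P.hom_of ?id (Q.hom_of ?id v) = v" if v: "v \<in> carrier (Lo X)" for v
    proof -
      obtain F where F: "F \<in> FS n d" "v = j d F" using Q.M_TE[OF v] by blast
      show ?thesis unfolding F(2) Q.hom_of_T[OF F(1)] pid[OF F(1)] P.hom_of_T[OF F(1)] ..
    qed
  qed simp_all
  then show "\<exists>X\<in>Ob (B_cat m). \<exists>f. is_iso (C_cat n l) M (Lo X) f" using X by blast
qed (rule functor_BC)

end

section \<open>Fitting the spaces into the prescribed types\<close>

text \<open>A function is determined by its graph over the finite set where it differs from
  \<open>z\<close>. The points of the graph are coded as elements of the infinite type, and an
  infinite set has as many finite subsets as elements.\<close>

lemma finite_functions_lepoll:
  assumes "countable I" "infinite (UNIV :: 'a set)" "\<And>F. F \<in> S \<Longrightarrow> finite {i. F i \<noteq> (z :: 'v)}"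
    "\<And>F i. F \<in> S \<Longrightarrow> F i \<noteq> z \<Longrightarrow> i \<in> I" "\<And>F i. F \<in> S \<Longrightarrow> F i \<in> B" "B \<lesssim> (UNIV :: 'a set)"
  shows "S \<lesssim> (UNIV :: 'a set)"
proof -
  have fp: "Fpow (UNIV :: 'a set) \<lesssim> (UNIV :: 'a set)"
    using card_of_Fpow_infinite[OF assms(2)] by (intro eqpoll_imp_lepoll) (simp only: eqpoll_iff_card_of_ordIso)
  obtain f :: "nat \<Rightarrow> 'a" where f: "inj f" using assms(2) infinite_countable_subset[of "UNIV :: 'a set"] by auto
  obtain g where g: "inj_on g I" "g ` I \<subseteq> (UNIV :: nat set)" using assms(1) by (auto simp: countable_def)
  obtain h where h: "inj_on h B" "h ` B \<subseteq> (UNIV :: 'a set)" using assms(6) by (auto simp: lepoll_def)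
  have "(UNIV :: 'a set) \<times> (UNIV :: 'a set) \<lesssim> (UNIV :: 'a set)"
    using card_of_Times_same_infinite[OF assms(2)] by (intro eqpoll_imp_lepoll) (simp only: eqpoll_iff_card_of_ordIso)
  then obtain p :: "'a \<times> 'a \<Rightarrow> 'a" where p: "inj p" by (auto simp: lepoll_def)
  define q where "q = (\<lambda>(i, y). p (f (g i), h y))"
  have q: "inj_on q (I \<times> B)"
  proof (rule inj_onI, clarify)
    fix i y i' y' assume i: "i \<in> I" "i' \<in> I" and y: "y \<in> B" "y' \<in> B" and eq: "q (i, y) = q (i', y')"
    have "(f (g i), h y) = (f (g i'), h y')" by (rule injD[OF p]) (use eq in \<open>simp add: q_def\<close>)
    then have "f (g i) = f (g i')" and hy: "h y = h y'" by auto
    then have "g i = g i'" using injD[OF f] by blast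
    then show "i = i' \<and> y = y'" using inj_onD[OF g(1) _ i] inj_onD[OF h(1) hy y] by blast
  qed
  define G where "G F = q ` ((\<lambda>i. (i, F i)) ` {i. F i \<noteq> z})" for F
  have "inj_on G S"
  proof (rule inj_onI)
    fix F F' assume F: "F \<in> S" and F': "F' \<in> S" and eq: "G F = G F'"
    have sub: "(\<lambda>i. (i, H i)) ` {i. H i \<noteq> z} \<subseteq> I \<times> B" if "H \<in> S" for H
      using assms(4,5)[OF that] by auto
    have e: "(\<lambda>i. (i, F i)) ` {i. F i \<noteq> z} = (\<lambda>i. (i, F' i)) ` {i. F' i \<noteq> z}"
      using eq unfolding G_def inj_on_image_eq_iff[OF q sub[OF F] sub[OF F']] .
    show "F = F'"
    proof
      fix i
      have "F i \<noteq> z \<Longrightarrow> F i = F' i" "F' i \<noteq> z \<Longrightarrow> F i = F' i" using e by (auto simp: set_eq_iff image_iff)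
      then show "F i = F' i" by metis
    qed
  qed
  moreover have "G ` S \<subseteq> Fpow UNIV" using assms(3) by (auto simp: G_def Fpow_def)
  ultimately have "S \<lesssim> Fpow (UNIV :: 'a set)" by (auto simp: lepoll_def)
  then show ?thesis using fp by (rule lepoll_trans)
qed

lemma infinite_of_complex_lepoll:
  assumes "(UNIV :: complex set) \<lesssim> (UNIV :: 'a set)" shows "infinite (UNIV :: 'a set)"
proof -
  have "infinite (UNIV :: complex set)" by (rule infinite_UNIV_char_0)
  then show ?thesis using assms lepoll_trans unfolding infinite_le_lepoll by blast
qed

lemma Cd_lepoll:
  assumes "(UNIV :: complex set) \<lesssim> (UNIV :: 'a set)"
  shows "Cd d \<lesssim> (UNIV :: 'a set)"
proof (rule finite_functions_lepoll[of "UNIV :: nat set" _ 0 UNIV])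
  show "infinite (UNIV :: 'a set)" by (rule infinite_of_complex_lepoll) (rule assms)
  show "finite {i. F i \<noteq> 0}" if "F \<in> Cd d" for F
    by (rule finite_subset[of _ "{..<d}"]) (use that in \<open>auto simp: Cd_def not_le[symmetric]\<close>)
qed (use assms in auto)

lemma Zn_countable: "countable (Zn n)"
proof -
  have "Zn n \<subseteq> (\<lambda>xs i. if i < n then xs ! i else 0) ` UNIV"
  proof
    fix a assume a: "a \<in> Zn n"
    have "a = (\<lambda>i. if i < n then map a [0..<n] ! i else 0)"
      using a by (auto simp: Zn_def fun_eq_iff)
    then show "a \<in> (\<lambda>xs i. if i < n then xs ! i else 0) ` UNIV" by blast
  qed
  then show ?thesis by (rule countable_subset) simp
qed

lemma FS_lepoll:
  assumes c: "(UNIV :: complex set) \<lesssim> (UNIV :: 'a set)"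
  shows "FS n d \<lesssim> (UNIV :: 'a set)"
proof (rule finite_functions_lepoll[OF Zn_countable[of n], of _ 0 "Cd d"])
  show "infinite (UNIV :: 'a set)" by (rule infinite_of_complex_lepoll) (rule assms)
  show "Cd d \<lesssim> (UNIV :: 'a set)" by (rule Cd_lepoll[OF c])
qed (use FS_finite FS_Zn FS_closed in auto)

theorem proposition11:
  fixes n :: nat and l :: "complex vec"
  assumes "n \<ge> 2" and "l \<in> carrier_vec n"
    and "(UNIV :: complex set) \<lesssim> (UNIV :: 'a set)"
    and "(UNIV :: complex set) \<lesssim> (UNIV :: 'b set)"
  shows "equivalent_categories
    (C_cat n l :: ((loc_elem, 'a) module, 'a \<Rightarrow> 'a) cat)
    (A_cat (n - 1) :: ((s_elem, 'b) lie_rep, 'b \<Rightarrow> 'b) cat)"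
proof -
  obtain m where n: "n = Suc m" using assms(1) by (cases n) auto
  have "\<exists>j :: ((nat \<Rightarrow> int) \<Rightarrow> nat \<Rightarrow> complex) \<Rightarrow> 'a. inj_on j (FS n d)" for d
    using FS_lepoll[OF assms(3), of n d] by (auto simp: lepoll_def)
  then obtain j :: "nat \<Rightarrow> ((nat \<Rightarrow> int) \<Rightarrow> nat \<Rightarrow> complex) \<Rightarrow> 'a" where j: "\<And>d. inj_on (j d) (FS n d)" by metis
  interpret laurent_functor m l j
    by unfold_locales (use assms(2) j n in auto)
  have "\<exists>j :: (nat \<Rightarrow> complex) \<Rightarrow> 'b. inj_on j (Cd d)" for d
    using Cd_lepoll[OF assms(4), of d] by (auto simp: lepoll_def)
  \<comment> \<open>The composite functor runs from \<open>A_cat\<close> through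
    \<open>B_cat\<close> to \<open>C_cat\<close>; \<open>ffes_imp_equivalent\<close> turns it
    around, which gives the order of the two categories in the claim.\<close>
  from ffes_comp[OF category_C ffes_AB[OF this] ffes_BC]
  have "equivalent_categories (C_cat (Suc m) l :: ((loc_elem, 'a) module, 'a \<Rightarrow> 'a) cat)
      (A_cat m :: ((s_elem, 'b) lie_rep, 'b \<Rightarrow> 'b) cat)"
    by (rule ffes_imp_equivalent[OF category_A category_C])
  then show ?thesis by (simp add: n)
qed

end
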